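(* Let $n\ge2$, $m\in\mathbb{N}$, $\lambda>0$, let $\Omega\subset\mathbb{R}^n$ be a bounded $C^{1,\alpha}$ domain, and let $G\in\mathcal{G}(\delta,g_0)$ be an $\mathcal{N}$-function with $1<\delta\le g_0$. Suppose $\mathbf{u}:\Omega\to\mathbb{R}^m$ is a minimizer of $\mathcal{J}_G$ in $\Omega$ with boundary data $\mathbf{\Phi}\in C^{1,\alpha}(\Omega,\mathbb{R}^m)$. Then $\mathbf{u}$ is locally Lipschitz continuous in $\Omega$.
   Context: $\mathcal{N}$-function: a continuous $G:[0,+\infty)\to[0,+\infty)$ that is convex, satisfies $G(t)=0$ iff $t=0$, $\lim_{t\to0}G(t)/t=0$ and $\lim_{t\to+\infty}G(t)/t=+\infty$. Class $\mathcal{G}(\delta,g_0)$, $0<\delta\le g_0$: all $\mathcal{N}$-functions $G$ with $G'=g$ for some $g\in C^0([0,+\infty))\cap C^1((0,+\infty))$ such that $\delta\le \frac{g'(s)s}{g(s)}\le g_0$ for all $s>0$. $W^{1,G}(\Omega;\mathbb{R}^m)$ is the Orlicz-Sobolev space of functions which, together with their first weak derivatives, lie in the Orlicz space $L_G$. Functional: $$\mathcal{J}_G(\mathbf{v};\Omega)=\int_\Omega\Big(\sum_{i=1}^mG(|\nabla v_i|)+\lambda\chi_{\{|\mathbf{v}|>0\}}\Big)dx,\qquad |\mathbf{v}|=\sqrt{v_1^2+\cdots+v_m^2}.$$ Minimizer with boundary data $\mathbf{\Phi}=(\Phi_1,\dots,\Phi_m)$, where $0\le\Phi_i\in W^{1,G}(\Omega)$: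 a function $\mathbf{u}\in\mathcal{K}$ with $\mathcal{J}_G(\mathbf{u};\Omega)\le\mathcal{J}_G(\mathbf{v};\Omega)$ for all $\mathbf{v}\in\mathcal{K}$, where $\mathcal{K}=\{\mathbf{v}\in W^{1,G}(\Omega;\mathbb{R}^m):\mathbf{v}=\mathbf{\Phi}\text{ on }\partial\Omega,\ v_i\ge0\text{ for all }i\}$. *)

theory Defs
  imports "HOL-Analysis.Analysis"
begin

section \<open>N-functions\<close>

text \<open>Functions on the half-line are total functions on the reals of which only the values
  on \<open>{0..}\<close> are used.\<close>

definition N_function :: "(real \<Rightarrow> real) \<Rightarrow> bool" where
  "N_function G \<longleftrightarrow>
     (\<forall>t\<ge>0. 0 \<le> G t) \<and> continuous_on {0..} G \<and> convex_on {0..} G \<and>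
     (\<forall>t\<ge>0. G t = 0 \<longleftrightarrow> t = 0) \<and>
     ((\<lambda>t. G t / t) \<longlongrightarrow> 0) (at_right 0) \<and>
     filterlim (\<lambda>t. G t / t) at_top at_top"

text \<open>At \<open>t = 0\<close> the equation \<open>G' = g\<close> is a one-sided derivative. Division by zero is harmless
  in the last line: for \<open>\<delta> > 0\<close> the lower bound forces \<open>g s \<noteq> 0\<close>.\<close>

definition N_class :: "real \<Rightarrow> real \<Rightarrow> (real \<Rightarrow> real) set" where
  "N_class \<delta> g\<^sub>0 = {G. N_function G \<and>
     (\<exists>g. continuous_on {0..} g \<and>
          (\<forall>s>0. g field_differentiable (at s)) \<and> continuous_on {0<..} (deriv g) \<and>
          (\<forall>t\<ge>0. (G has_real_derivative g t) (at t within {0..})) \<and>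
          (\<forall>s>0. \<delta> \<le> deriv g s * s / g s \<and> deriv g s * s / g s \<le> g\<^sub>0))}"


section \<open>Weak gradients\<close>

definition gradient :: "(real ^ 'n \<Rightarrow> real) \<Rightarrow> real ^ 'n \<Rightarrow> real ^ 'n" where
  "gradient f x = (\<chi> i. frechet_derivative f (at x) (axis i 1))"

primrec Ck :: "nat \<Rightarrow> (real ^ 'n \<Rightarrow> real) \<Rightarrow> bool" where
  "Ck 0 f \<longleftrightarrow> continuous_on UNIV f"
| "Ck (Suc k) f \<longleftrightarrow> (\<forall>x. f differentiable (at x)) \<and> (\<forall>i. Ck k (\<lambda>x. gradient f x $ i))"

definition test_functions :: "(real ^ 'n) set \<Rightarrow> (real ^ 'n \<Rightarrow> real) set" where
  "test_functions \<Omega> =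
     {\<phi>. (\<forall>k. Ck k \<phi>) \<and> compact (closure {x. \<phi> x \<noteq> 0}) \<and> closure {x. \<phi> x \<noteq> 0} \<subseteq> \<Omega>}"

definition locally_integrable ::
    "(real ^ 'n) set \<Rightarrow> (real ^ 'n \<Rightarrow> 'b::euclidean_space) \<Rightarrow> bool" where
  "locally_integrable \<Omega> f \<longleftrightarrow> (\<forall>K. compact K \<and> K \<subseteq> \<Omega> \<longrightarrow> integrable (lebesgue_on K) f)"

definition has_weak_gradient ::
    "(real ^ 'n) set \<Rightarrow> (real ^ 'n \<Rightarrow> real) \<Rightarrow> (real ^ 'n \<Rightarrow> real ^ 'n) \<Rightarrow> bool" where
  "has_weak_gradient \<Omega> f F \<longleftrightarrow>
     locally_integrable \<Omega> f \<and> locally_integrable \<Omega> F \<and>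
     (\<forall>\<phi>\<in>test_functions \<Omega>. \<forall>i.
        (LINT x|lebesgue_on \<Omega>. f x * gradient \<phi> x $ i) = - (LINT x|lebesgue_on \<Omega>. F x $ i * \<phi> x))"

text \<open>The weak gradient on an open set is unique up to null sets; everything below depends only
  on its almost-everywhere class.\<close>

definition weak_gradient :: "(real ^ 'n) set \<Rightarrow> (real ^ 'n \<Rightarrow> real) \<Rightarrow> real ^ 'n \<Rightarrow> real ^ 'n" where
  "weak_gradient \<Omega> f = (SOME F. has_weak_gradient \<Omega> f F)"


section \<open>Orlicz and Orlicz-Sobolev spaces\<close>

text \<open>Elements of the spaces are represented by functions, not by almost-everywhere classes;
  their values outside \<open>\<Omega>\<close> are irrelevant.\<close>

definition modular ::
    "(real \<Rightarrow> real) \<Rightarrow> (real ^ 'n) set \<Rightarrow> (real ^ 'n \<Rightarrow> 'b::euclidean_space) \<Rightarrow> ennreal" where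
  "modular G \<Omega> f = (\<integral>\<^sup>+x. ennreal (G (norm (f x))) \<partial>lebesgue_on \<Omega>)"

definition orlicz ::
    "(real \<Rightarrow> real) \<Rightarrow> (real ^ 'n) set \<Rightarrow> (real ^ 'n \<Rightarrow> 'b::euclidean_space) set" where
  "orlicz G \<Omega> =
     {f \<in> borel_measurable (lebesgue_on \<Omega>). \<exists>k>0. modular G \<Omega> (\<lambda>x. f x /\<^sub>R k) < \<infinity>}"

definition luxemburg_norm ::
    "(real \<Rightarrow> real) \<Rightarrow> (real ^ 'n) set \<Rightarrow> (real ^ 'n \<Rightarrow> 'b::euclidean_space) \<Rightarrow> real" where
  "luxemburg_norm G \<Omega> f = Inf {k. 0 < k \<and> modular G \<Omega> (\<lambda>x. f x /\<^sub>R k) \<le> 1}"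

definition sobolev_orlicz ::
    "(real \<Rightarrow> real) \<Rightarrow> (real ^ 'n) set \<Rightarrow> (real ^ 'n \<Rightarrow> real) set" where
  "sobolev_orlicz G \<Omega> = {f \<in> orlicz G \<Omega>. \<exists>F\<in>orlicz G \<Omega>. has_weak_gradient \<Omega> f F}"

definition sobolev_orlicz_norm ::
    "(real \<Rightarrow> real) \<Rightarrow> (real ^ 'n) set \<Rightarrow> (real ^ 'n \<Rightarrow> real) \<Rightarrow> real" where
  "sobolev_orlicz_norm G \<Omega> f = luxemburg_norm G \<Omega> f + luxemburg_norm G \<Omega> (weak_gradient \<Omega> f)"

text \<open>The closure of the test functions in the Orlicz-Sobolev norm.\<close>

definition sobolev_orlicz_0 ::
    "(real \<Rightarrow> real) \<Rightarrow> (real ^ 'n) set \<Rightarrow> (real ^ 'n \<Rightarrow> real) set" where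
  "sobolev_orlicz_0 G \<Omega> = {f \<in> sobolev_orlicz G \<Omega>.
     \<exists>\<phi>. (\<forall>k. \<phi> k \<in> test_functions \<Omega>) \<and>
         (\<lambda>k::nat. sobolev_orlicz_norm G \<Omega> (\<lambda>x. f x - \<phi> k x)) \<longlonglongrightarrow> 0}"


section \<open>Functions and domains of class \<open>C\<^sup>1\<^sup>,\<^sup>\<alpha>\<close>\<close>

text \<open>Finiteness of the full Hoelder norm on \<open>S\<close>: bounds are uniform on the open set \<open>S\<close>.\<close>

definition C1_holder ::
    "real \<Rightarrow> 'a::euclidean_space set \<Rightarrow> ('a \<Rightarrow> 'b::euclidean_space) \<Rightarrow> bool" where
  "C1_holder \<alpha> S f \<longleftrightarrow>
     (\<forall>x\<in>S. f differentiable (at x)) \<and>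
     (\<exists>C. (\<forall>x\<in>S. norm (f x) \<le> C) \<and>
          (\<forall>x\<in>S. onorm (frechet_derivative f (at x)) \<le> C) \<and>
          (\<forall>x\<in>S. \<forall>y\<in>S.
             onorm (\<lambda>h. frechet_derivative f (at x) h - frechet_derivative f (at y) h)
               \<le> C * dist x y powr \<alpha>))"

text \<open>Near each boundary point the domain is the strict epigraph, in some unit direction \<open>e\<close>, of a
  \<open>C\<^sup>1\<^sup>,\<^sup>\<alpha>\<close> function of the orthogonal variables. A function on the hyperplane orthogonal to \<open>e\<close> is
  encoded as a function on the whole space that is constant along \<open>e\<close>. Asking for global bounds on
  it is no restriction, since only its values on a ball matter and it can be cut off.\<close>

definition C1_holder_domain :: "real \<Rightarrow> 'a::euclidean_space set \<Rightarrow> bool" where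
  "C1_holder_domain \<alpha> \<Omega> \<longleftrightarrow>
     open \<Omega> \<and> connected \<Omega> \<and> \<Omega> \<noteq> {} \<and>
     (\<forall>x\<^sub>0\<in>frontier \<Omega>. \<exists>r>0. \<exists>e \<gamma>. norm e = 1 \<and>
        C1_holder \<alpha> UNIV \<gamma> \<and> (\<forall>x t. \<gamma> (x + t *\<^sub>R e) = \<gamma> x) \<and>
        \<Omega> \<inter> ball x\<^sub>0 r = {x \<in> ball x\<^sub>0 r. x \<bullet> e > (\<gamma> x :: real)})"


section \<open>The minimization problem\<close>

definition J_functional ::
    "(real \<Rightarrow> real) \<Rightarrow> real \<Rightarrow> (real ^ 'n) set \<Rightarrow> (real ^ 'n \<Rightarrow> real ^ 'm) \<Rightarrow> ennreal" where
  "J_functional G lam \<Omega> v =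
     (\<integral>\<^sup>+x. ennreal ((\<Sum>i\<in>UNIV. G (norm (weak_gradient \<Omega> (\<lambda>y. v y $ i) x)))
                   + lam * indicator {y. norm (v y) > 0} x) \<partial>lebesgue_on \<Omega>)"

text \<open>The condition \<open>v = \<Phi>\<close> on the boundary means \<open>v - \<Phi> \<in> W\<^sub>0\<^sup>1\<^sup>,\<^sup>G\<close>, componentwise.\<close>

definition admissible ::
    "(real \<Rightarrow> real) \<Rightarrow> (real ^ 'n) set \<Rightarrow> (real ^ 'n \<Rightarrow> real ^ 'm) \<Rightarrow> (real ^ 'n \<Rightarrow> real ^ 'm) set" where
  "admissible G \<Omega> \<Phi> = {v. \<forall>i.
     (\<lambda>x. v x $ i) \<in> sobolev_orlicz G \<Omega> \<and>
     (\<lambda>x. v x $ i - \<Phi> x $ i) \<in> sobolev_orlicz_0 G \<Omega> \<and>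
     (AE x in lebesgue_on \<Omega>. 0 \<le> v x $ i)}"

definition is_minimizer ::
    "(real \<Rightarrow> real) \<Rightarrow> real \<Rightarrow> (real ^ 'n) set \<Rightarrow>
     (real ^ 'n \<Rightarrow> real ^ 'm) \<Rightarrow> (real ^ 'n \<Rightarrow> real ^ 'm) \<Rightarrow> bool" where
  "is_minimizer G lam \<Omega> \<Phi> u \<longleftrightarrow>
     u \<in> admissible G \<Omega> \<Phi> \<and>
     (\<forall>v\<in>admissible G \<Omega> \<Phi>. J_functional G lam \<Omega> u \<le> J_functional G lam \<Omega> v)"

definition locally_lipschitz_on ::
    "'a::euclidean_space set \<Rightarrow> ('a \<Rightarrow> 'b::euclidean_space) \<Rightarrow> bool" where
  "locally_lipschitz_on \<Omega> f \<longleftrightarrow> (\<forall>K. compact K \<and> K \<subseteq> \<Omega> \<longrightarrow> (\<exists>L. L-lipschitz_on K f))"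

end

theory Submission
  imports Defs "HOL-Analysis.Analysis"
begin

text \<open>With the other components frozen, each component \<open>v\<close> of the minimizer minimizes a scalar functional
  \<open>\<integral> G(|\<nabla>v|) + Q \<chi>{v > 0}\<close> with a measurable weight \<open>0 \<le> Q \<le> \<lambda>\<close>. No Euler-Lagrange equation and no interior
  regularity theory is needed for it: a Lipschitz bound is obtained at the boundary and carried inwards by comparison
  with translates.

  At a boundary point \<open>x0\<close>, explicit sub- and supersolutions modelled on the distance to a \<open>C\<^sup>1\<^sup>,\<^sup>\<alpha>\<close> hypersurface
  touching the domain at \<open>x0\<close> yield \<open>|v x - b| \<le> L0 |x - x0|\<close>.

  Let \<open>G L > 2 \<lambda>\<close>, \<open>L \<ge> 9 L0\<close> and let \<open>\<psi>\<close> be the positive part of \<open>v (x + \<sigma>) - v x - L |\<sigma>|\<close>, which by the boundary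
  estimate vanishes within distance \<open>4 |\<sigma>|\<close> of the boundary. Testing minimality with \<open>v + \<psi>\<close> and, on the translated side, with
  \<open>v - \<psi> (x - \<sigma>) / 2\<close>, whose gradients average where \<open>\<psi> > 0\<close>, convexity of \<open>G\<close> bounds the integral of
  \<open>G(|\<nabla>v (x + \<sigma>)|)\<close> over the contact set \<open>Z = {\<psi> > 0, v = 0}\<close> by \<open>2 \<lambda> |Z|\<close>, and strict convexity gives \<open>\<psi> = 0\<close> as soon as
  \<open>Z\<close> is a null set. The bound says that the mean slope of \<open>v\<close> on \<open>Z + \<sigma>\<close> is at most \<open>L\<close>; hence for a unit
  vector \<open>\<tau>\<close> the integral over \<open>{v = 0}\<close> of the positive part of \<open>v (x + t \<tau>) - t L\<close> is nonincreasing in \<open>t\<close>. It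
  is \<open>0\<close> at \<open>t = 0\<close>, so \<open>Z\<close> is null.\<close>

text \<open>The measure term jumps with the positivity set, so minimality is exploited through
  values at competitors only. Raising \<open>v\<close> costs at most \<lambda> times the measure of
  the contact set \<open>Z\<close>; lowering it costs nothing, because no new positive points arise.
  Lowering by half of \<psi> produces the midpoint of two gradients, and there convexity has a
  surplus: on \<open>Z\<close> one of the gradients is zero, and
  \<open>G (t / 2) \<le> G t / 4\<close> improves on the \<open>G t / 2\<close> of mere convexity. A
  quarter of the energy on \<open>Z\<close> against half of \<lambda>|Z| is the origin of the
  constant 2\<lambda>. At the boundary an explicit barrier \<open>w\<close> replaces the translate:
  the half-step inequality follows from the sign of div A(\<nabla>w), and G(|\<nabla>w|) >
  2\<lambda> makes the contact set of the lower barrier null at once. A translate has no such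
  pointwise lower bound; the monotone integral along \<tau> takes its place. The factor 9 is 4 + 5:
  a point and its translate lie within 4|\<sigma>| and 5|\<sigma>| of a common boundary
  point.\<close>

notation scaleR (infixr "*R" 75)

abbreviation L1 :: "('a::euclidean_space \<Rightarrow> 'b::{banach, second_countable_topology}) \<Rightarrow> bool" where
  "L1 \<equiv> integrable lborel"

abbreviation Borel :: "('a::topological_space \<Rightarrow> 'b::topological_space) set" where
  "Borel \<equiv> borel_measurable borel"

section \<open>Gradients and compactly supported C1 functions\<close>

lemma GDERIV_gradient_eq:
  fixes f :: "real ^ 'n \<Rightarrow> real"
  assumes "GDERIV f x :> D"
  shows "gradient f x = D"
proof -
  have "frechet_derivative f (at x) = (\<lambda>h. inner h D)"
    using assms frechet_derivative_at unfolding gderiv_def by metis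
  then show ?thesis
    by (simp add: gradient_def vec_eq_iff inner_axis' )
qed

lemma linear_axis_expansion:
  fixes H :: "real ^ 'n \<Rightarrow> 'b::real_vector"
  assumes "linear H"
  shows "H h = (\<Sum>j\<in>UNIV. h $ j *R H (axis j 1))"
proof -
  have "H h = H (\<Sum>j\<in>UNIV. h $ j *R axis j 1)"
    using basis_expansion[of h] by (simp add: scalar_mult_eq_scaleR)
  then show ?thesis by (simp add: linear_sum[OF assms] linear_scale[OF assms])
qed

lemma differentiable_GDERIV:
  fixes f :: "real ^ 'n \<Rightarrow> real"
  assumes "f differentiable (at x)"
  shows "GDERIV f x :> gradient f x"
proof -
  define f' where "f' = frechet_derivative f (at x)"
  have d: "(f has_derivative f') (at x)"
    using assms frechet_derivative_works f'_def by blast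
  then have l: "linear f'" by (rule has_derivative_linear)
  have "f' h = inner h (gradient f x)" for h
    using linear_axis_expansion[OF l, of h] by (simp add: inner_vec_def gradient_def f'_def)
  then have "f' = (\<lambda>h. inner h (gradient f x))" by auto
  with d show ?thesis by (simp add: gderiv_def)
qed

text \<open>Test functions of class C1 instead of smooth ones: the class is stable under
  multiplication by C1 functions, which product and chain rules for weak gradients require. The
  gradient is an explicit argument, so that it can be given by a formula.\<close>

definition C1c :: "(real ^ 'n) set \<Rightarrow> (real ^ 'n \<Rightarrow> real) \<Rightarrow> (real ^ 'n \<Rightarrow> real ^ 'n) \<Rightarrow> bool" where
  "C1c \<Omega> \<phi> \<phi>' \<longleftrightarrow> (\<forall>x. GDERIV \<phi> x :> \<phi>' x) \<and> continuous_on UNIV \<phi>' \<and>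
     (\<exists>K. compact K \<and> K \<subseteq> \<Omega> \<and> (\<forall>x. x \<notin> K \<longrightarrow> \<phi> x = 0 \<and> \<phi>' x = 0))"

lemma GDERIV_continuous_on:
  assumes "\<And>x. x \<in> S \<Longrightarrow> GDERIV f x :> f' x"
  shows "continuous_on S f"
  using assms unfolding gderiv_def
  by (meson continuous_at_imp_continuous_on has_derivative_continuous)

lemma C1c_cont: "C1c \<Omega> \<phi> \<phi>' \<Longrightarrow> continuous_on UNIV \<phi>"
  unfolding C1c_def by (metis GDERIV_continuous_on)

lemma integrable_continuous_compact_support:
  fixes f :: "'a::euclidean_space \<Rightarrow> 'b::{banach, second_countable_topology}"
  assumes "continuous_on UNIV f" "compact K" "\<And>x. x \<notin> K \<Longrightarrow> f x = 0"
  shows "L1 f"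
proof -
  have "L1 (\<lambda>x. indicator K x *R f x)"
    by (rule borel_integrable_compact) (use assms in \<open>auto intro: continuous_on_subset\<close>)
  moreover have "(\<lambda>x. indicator K x *R f x) = f"
    using assms(3) by (auto simp: indicator_def)
  ultimately show ?thesis by simp
qed

lemma continuous_compact_support_bounded:
  fixes f :: "'a::euclidean_space \<Rightarrow> 'b::real_normed_vector"
  assumes "continuous_on UNIV f" "compact K" "\<And>x. x \<notin> K \<Longrightarrow> f x = 0"
  obtains B where "B > 0" "\<And>x. norm (f x) \<le> B"
proof -
  have "compact (f ` K)"
    using assms by (meson compact_continuous_image continuous_on_subset subset_UNIV)
  then obtain B where "B > 0" "\<forall>y\<in>f ` K. norm y \<le> B"
    using compact_imp_bounded bounded_pos by blast
  then have "norm (f x) \<le> B" for x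
    using assms(3)[of x] by (cases "x \<in> K") auto
  with \<open>B > 0\<close> that show thesis by blast
qed

lemma C1c_integrable:
  assumes "C1c \<Omega> \<phi> \<phi>'"
  shows "L1 \<phi>" "L1 \<phi>'"
proof -
  obtain K where K: "compact K" "\<forall>x. x \<notin> K \<longrightarrow> \<phi> x = 0 \<and> \<phi>' x = 0"
    using assms unfolding C1c_def by blast
  show "L1 \<phi>"
    using integrable_continuous_compact_support[OF C1c_cont[OF assms] K(1)] K(2) by blast
  have "continuous_on UNIV \<phi>'" using assms C1c_def by blast
  then show "L1 \<phi>'"
    using integrable_continuous_compact_support[OF _ K(1)] K(2) by blast
qed

lemma C1c_bounded:
  assumes "C1c \<Omega> \<phi> \<phi>'"
  obtains B where "B > 0" "\<And>x. norm (\<phi> x) \<le> B" "\<And>x. norm (\<phi>' x) \<le> B"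
proof -
  obtain K where K: "compact K" "\<And>x. x \<notin> K \<Longrightarrow> \<phi> x = 0" "\<And>x. x \<notin> K \<Longrightarrow> \<phi>' x = 0"
    using assms unfolding C1c_def by blast
  have "continuous_on UNIV \<phi>'" using assms C1c_def by blast
  obtain B1 where "B1 > 0" "\<And>x. norm (\<phi> x) \<le> B1"
    using continuous_compact_support_bounded[OF C1c_cont[OF assms] K(1,2)] by blast
  moreover obtain B2 where "B2 > 0" "\<And>x. norm (\<phi>' x) \<le> B2"
    using continuous_compact_support_bounded[OF \<open>continuous_on UNIV \<phi>'\<close> K(1,3)] by blast
  ultimately show thesis
    using that[of "max B1 B2"] by (meson le_max_iff_disj less_max_iff_disj)
qed

lemma C1c_diff_bound:
  assumes "C1c \<Omega> \<phi> \<phi>'" and B: "\<And>x. norm (\<phi>' x) \<le> B"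
  shows "\<bar>\<phi> x - \<phi> y\<bar> \<le> B * norm (x - y)"
proof -
  have "norm (\<phi> x - \<phi> y) \<le> B * norm (x - y)"
  proof (rule differentiable_bound[of UNIV _ "\<lambda>x h. inner h (\<phi>' x)"])
    show "(\<phi> has_derivative (\<lambda>h. inner h (\<phi>' x))) (at x within UNIV)" for x
      using assms by (simp add: C1c_def gderiv_def)
    show "onorm (\<lambda>h. inner h (\<phi>' x)) \<le> B" for x
      by (rule onorm_le) (metis B Cauchy_Schwarz_ineq2 mult.commute mult_right_mono norm_ge_zero
          order_trans real_norm_def)
  qed auto
  then show ?thesis by simp
qed

lemma lborel_integral_translation:
  fixes f :: "'a::euclidean_space \<Rightarrow> 'b::{banach, second_countable_topology}"
  shows "(LBINT x. f (x + a)) = (LBINT x. f x)"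
proof (cases "f \<in> Borel")
  case [measurable]: True
  have "(LBINT x. f x) = (\<integral>x. f x \<partial>(distr lborel borel ((+) a)))"
    by (simp add: lborel_distr_plus)
  also have "\<dots> = (LBINT x. f (a + x))"
    by (rule integral_distr) auto
  finally show ?thesis by (simp add: add.commute)
next
  \<comment> \<open>Both integrals take the default value 0 of non-integrable functions, since
    measurability is translation invariant.\<close>
  case False
  have "\<not> L1 f" using False borel_measurable_integrable by auto
  moreover have "\<not> L1 (\<lambda>x. f (x + a))"
  proof
    assume "L1 (\<lambda>x. f (x + a))"
    then have "(\<lambda>x. f (x + a)) \<in> Borel" by auto
    then have "(\<lambda>x. f (x + a)) \<circ> (\<lambda>x. x - a) \<in> Borel"
      by (intro measurable_comp[where N=borel]) auto
    with False show False by (simp add: comp_def)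
  qed
  ultimately show ?thesis by (simp add: not_integrable_integral_eq)
qed

lemma lborel_integrable_translation:
  fixes f :: "'a::euclidean_space \<Rightarrow> 'b::{banach, second_countable_topology}"
  assumes "L1 f"
  shows "L1 (\<lambda>x. f (x + a))"
proof -
  have "integrable (distr lborel borel ((+) a)) f" using assms by (simp add: lborel_distr_plus)
  then have "L1 (\<lambda>x. f (a + x))"
    by (subst (asm) integrable_distr_eq) (use borel_measurable_integrable[OF assms] in auto)
  then show ?thesis by (simp add: add.commute)
qed

lemma nn_integral_lborel_translation:
  fixes f :: "'a::euclidean_space \<Rightarrow> ennreal"
  assumes [measurable]: "f \<in> Borel"
  shows "(\<integral>\<^sup>+x. f (x + a) \<partial>lborel) = (\<integral>\<^sup>+x. f x \<partial>lborel)"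
proof -
  have "(\<integral>\<^sup>+x. f x \<partial>lborel) = (\<integral>\<^sup>+x. f x \<partial>(distr lborel borel ((+) a)))"
    by (simp add: lborel_distr_plus)
  also have "\<dots> = (\<integral>\<^sup>+x. f (a + x) \<partial>lborel)"
    by (rule nn_integral_distr) measurable
  finally show ?thesis by (simp add: add.commute)
qed

text \<open>Directional difference quotients have integral zero by translation invariance, and they
  converge boundedly, on one fixed compact set, to the directional derivative.\<close>

lemma C1c_integral_gradient:
  fixes \<phi> :: "real ^ 'n \<Rightarrow> real"
  assumes "C1c \<Omega> \<phi> \<phi>'"
  shows "(LBINT x. \<phi>' x) = 0"
proof -
  obtain K where K: "compact K" "\<And>x. x \<notin> K \<Longrightarrow> \<phi> x = 0" "\<And>x. x \<notin> K \<Longrightarrow> \<phi>' x = 0"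
    using assms unfolding C1c_def by blast
  obtain B where B: "B > 0" "\<And>x. norm (\<phi>' x) \<le> B" using C1c_bounded[OF assms] by metis
  have "inner h (LBINT x. \<phi>' x) = 0" if h: "norm h = 1" for h
  proof -
    define t :: "nat \<Rightarrow> real" where "t k = 1 / real (Suc k)" for k
    have t0: "t \<longlonglongrightarrow> 0" unfolding t_def by (rule LIMSEQ_Suc[OF lim_1_over_n])
    have tp: "t k > 0" "t k \<le> 1" for k by (auto simp: t_def field_simps)
    define d where "d k x = (\<phi> (x + t k *R h) - \<phi> x) / t k" for k x
    \<comment> \<open>The closed 1-neighbourhood of \<open>K\<close> contains the supports of all
      difference quotients, because the steps \<open>t k\<close> are at most 1.\<close>
    define K' where "K' = (\<Union>x\<in>K. \<Union>y\<in>cball 0 1. {x + y})"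
    have cK': "compact K'" unfolding K'_def
      by (rule compact_sums'[OF K(1) compact_cball])
    have int: "L1 (\<lambda>x. \<phi> (x + a))" for a
      using lborel_integrable_translation C1c_integrable[OF assms] by blast
    have zero: "(LBINT x. d k x) = 0" for k
      unfolding d_def
      using int[of "t k *R h"] C1c_integrable(1)[OF assms]
      by (simp add: lborel_integral_translation)
    have lim: "(\<lambda>k. d k x) \<longlonglongrightarrow> inner h (\<phi>' x)" for x
    proof -
      have "((\<lambda>s. \<phi> (x + s *R h)) has_derivative (\<lambda>s. inner (s *R h) (\<phi>' (x + 0 *R h)))) (at 0)"
        by (rule has_derivative_compose[of "\<lambda>s. x + s *R h" _ _ _ \<phi>])
          (use assms in \<open>auto intro!: derivative_eq_intros simp: C1c_def gderiv_def\<close>)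
      then have "((\<lambda>s. \<phi> (x + s *R h)) has_field_derivative inner h (\<phi>' x)) (at 0)"
        by (simp add: has_field_derivative_def mult_commute_abs)
      then have "(\<lambda>s. (\<phi> (x + s *R h) - \<phi> x) / s) \<midarrow>0\<rightarrow> inner h (\<phi>' x)"
        by (simp add: DERIV_def)
      then show ?thesis unfolding d_def
        by (rule filterlim_compose)
          (use t0 tp in \<open>auto simp: filterlim_at less_imp_neq[symmetric] intro!: always_eventually\<close>)
    qed
    have "(\<lambda>k. LBINT x. d k x) \<longlonglongrightarrow> (LBINT x. inner h (\<phi>' x))"
    proof (rule integral_dominated_convergence[where w="\<lambda>x. indicator K' x *R B"])
      show "L1 (\<lambda>x. indicator K' x *R B)"
        by (rule borel_integrable_compact) (use cK' in auto)
      show "AE x in lborel. norm (d k x) \<le> indicator K' x *R B" for k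
      proof (rule AE_I2)
        fix x
        have "x \<in> K \<Longrightarrow> x \<in> K'" unfolding K'_def by force
        moreover have "x \<in> K'" if "x + t k *R h \<in> K"
        proof -
          have "x = (x + t k *R h) + (- t k *R h)" by simp
          moreover have "- t k *R h \<in> cball 0 1" using tp[of k] h by simp
          ultimately show ?thesis unfolding K'_def using that by blast
        qed
        ultimately have "x \<in> K'" if "d k x \<noteq> 0"
          using that K(2)[of x] K(2)[of "x + t k *R h"] unfolding d_def by fastforce
        moreover have "norm (d k x) \<le> B"
          using C1c_diff_bound[OF assms B(2), of "x + t k *R h" x] tp[of k] h
          unfolding d_def by (simp add: field_simps)
        ultimately show "norm (d k x) \<le> indicator K' x *R B"
          by (cases "d k x = 0") (use B in \<open>auto simp: indicator_def\<close>)
      qed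
    qed (use lim int C1c_integrable[OF assms] C1c_cont[OF assms] in \<open>auto simp: d_def intro!: borel_measurable_integrable\<close>)
    then have "(LBINT x. inner h (\<phi>' x)) = 0"
      using zero LIMSEQ_const_iff by (simp add: LIMSEQ_const_iff)
    then show ?thesis by (simp add: C1c_integrable[OF assms])
  qed
  then have "inner b (LBINT x. \<phi>' x) = 0" if "b \<in> Basis" for b
    using that by simp
  then show ?thesis by (metis euclidean_all_zero_iff inner_commute)
qed

section \<open>Smooth bump functions and mollifying kernels\<close>

definition exp_inv :: "nat \<Rightarrow> real \<Rightarrow> real" where
  "exp_inv j t = (if t > 0 then exp (- 1 / t) / t ^ j else 0)"

lemma exp_inv_tendsto_0: "((exp_inv j) \<longlongrightarrow> 0) (at 0)"
proof -
  have "((\<lambda>t. (inverse t) ^ j / exp (inverse t)) \<longlongrightarrow> 0) (at_right (0::real))"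
    by (rule filterlim_compose[OF tendsto_power_div_exp_0 filterlim_inverse_at_top_right])
  moreover have "eventually (\<lambda>t. (inverse t) ^ j / exp (inverse t) = exp_inv j t) (at_right (0::real))"
    unfolding eventually_at_right_field
    by (intro exI[of _ 1]) (auto simp: exp_inv_def exp_minus field_simps power_inverse)
  ultimately have r: "(exp_inv j \<longlongrightarrow> 0) (at_right 0)"
    by (rule Lim_transform_eventually)
  have "eventually (\<lambda>t. 0 = exp_inv j t) (at_left (0::real))"
    unfolding eventually_at_left_field
    by (intro exI[of _ "-1"]) (auto simp: exp_inv_def)
  then have "(exp_inv j \<longlongrightarrow> 0) (at_left 0)"
    by (rule Lim_transform_eventually[rotated]) simp
  with r show ?thesis by (simp add: filterlim_split_at)
qed

text \<open>Allowing powers of \<open>t\<close> in the denominator makes the family closed under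
  differentiation up to linear combinations. At \<open>t = 0\<close> the difference quotient is
  again a member of the family and tends to 0.\<close>

lemma exp_inv_deriv:
  "(exp_inv j has_real_derivative (exp_inv (j + 2) t - real j * exp_inv (j + 1) t)) (at t)"
proof -
  consider "t > 0" | "t < 0" | "t = 0" by linarith
  then show ?thesis
  proof cases
    case 1
    have "((\<lambda>t. exp (- 1 / t) / t ^ j) has_real_derivative
        (exp (- 1 / t) * (1 / t^2) * t ^ j - exp (- 1 / t) * (real j * t ^ (j - 1))) / (t ^ j * t ^ j)) (at t)"
      using 1 by (auto intro!: derivative_eq_intros simp: power2_eq_square)
    moreover have "(exp (- 1 / t) * (1 / t^2) * t ^ j - exp (- 1 / t) * (real j * t ^ (j - 1))) / (t ^ j * t ^ j)
        = exp_inv (j + 2) t - real j * exp_inv (j + 1) t"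
      using 1 by (cases j) (auto simp: exp_inv_def field_simps power2_eq_square)
    ultimately have "((\<lambda>t. exp (- 1 / t) / t ^ j) has_real_derivative
        exp_inv (j + 2) t - real j * exp_inv (j + 1) t) (at t)" by simp
    then show ?thesis
      by (rule has_field_derivative_transform_within_open[where S="{0<..}"])
        (use 1 in \<open>auto simp: exp_inv_def\<close>)
  next
    case 2
    have "((\<lambda>t. 0) has_real_derivative 0) (at t)" by simp
    then have "(exp_inv j has_real_derivative 0) (at t)"
      by (rule has_field_derivative_transform_within_open[where S="{..<0}"])
        (use 2 in \<open>auto simp: exp_inv_def\<close>)
    then show ?thesis using 2 by (simp add: exp_inv_def)
  next
    case 3
    have "((\<lambda>h. (exp_inv j (0 + h) - exp_inv j 0) / h) \<longlongrightarrow> 0) (at 0)"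
      by (rule Lim_transform_eventually[OF exp_inv_tendsto_0[of "Suc j"]])
        (auto simp: exp_inv_def eventually_at_filter)
    then show ?thesis by (simp add: DERIV_def 3 exp_inv_def)
  qed
qed

text \<open>An algebra that contains the coordinates and the bump and is closed under partial
  derivatives; smoothness of every order follows by induction without formulas for higher
  derivatives. The parameter \<open>e\<close> is the square of the radius.\<close>

inductive bump_alg :: "real \<Rightarrow> (real ^ 'n \<Rightarrow> real) \<Rightarrow> bool" for e where
  "bump_alg e (\<lambda>x. c)"
| "bump_alg e (\<lambda>x. x $ i)"
| "bump_alg e (\<lambda>x. exp_inv j (e - inner x x))"
| "bump_alg e f \<Longrightarrow> bump_alg e g \<Longrightarrow> bump_alg e (\<lambda>x. f x + g x)"
| "bump_alg e f \<Longrightarrow> bump_alg e g \<Longrightarrow> bump_alg e (\<lambda>x. f x * g x)"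

lemma bump_alg_GDERIV:
  fixes f :: "real ^ 'n \<Rightarrow> real"
  assumes "bump_alg e f"
  shows "\<exists>D. (\<forall>x. GDERIV f x :> D x) \<and> (\<forall>i. bump_alg e (\<lambda>x. D x $ i))"
  using assms
proof induction
  case (1 c)
  show ?case by (rule exI[of _ "\<lambda>x. 0"]) (auto simp: GDERIV_const intro: bump_alg.intros)
next
  case (2 i)
  have "GDERIV (\<lambda>x. x $ i) x :> axis i 1" for x :: "real ^ 'n"
    unfolding gderiv_def
    by (simp add: inner_axis bounded_linear_imp_has_derivative bounded_linear_vec_nth)
  then show ?case
    by (intro exI[of _ "\<lambda>x. axis i 1"]) (auto intro: bump_alg.intros)
next
  case (3 j)
  let ?D = "\<lambda>x::real^'n. (exp_inv (j + 2) (e - inner x x) - real j * exp_inv (j + 1) (e - inner x x)) *R (- 2 *R x)"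
  have "GDERIV (\<lambda>x. e - inner x x) x :> - 2 *R x" for x :: "real ^ 'n"
    unfolding gderiv_def by (auto intro!: derivative_eq_intros simp: inner_commute algebra_simps)
  then have "GDERIV (\<lambda>x. exp_inv j (e - inner x x)) x :> ?D x" for x
    using GDERIV_DERIV_compose[OF _ exp_inv_deriv] by blast
  moreover have "bump_alg e (\<lambda>x. ?D x $ i)" for i
  proof -
    have "(\<lambda>x. ?D x $ i) = (\<lambda>x. (exp_inv (j + 2) (e - inner x x) + (- real j) * exp_inv (j + 1) (e - inner x x)) * ((- 2) * x $ i))"
      by auto
    then show ?thesis by (simp only:) (intro bump_alg.intros)
  qed
  ultimately show ?case by (intro exI[of _ ?D] conjI allI)
next
  case (4 f g)
  then obtain D E where "\<forall>x. GDERIV f x :> D x" "\<forall>i. bump_alg e (\<lambda>x. D x $ i)"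
    "\<forall>x. GDERIV g x :> E x" "\<forall>i. bump_alg e (\<lambda>x. E x $ i)" by blast
  then show ?case
    by (intro exI[of _ "\<lambda>x. D x + E x"]) (auto intro: bump_alg.intros GDERIV_add)
next
  case (5 f g)
  then obtain D E where DE: "\<forall>x. GDERIV f x :> D x" "\<forall>i. bump_alg e (\<lambda>x. D x $ i)"
    "\<forall>x. GDERIV g x :> E x" "\<forall>i. bump_alg e (\<lambda>x. E x $ i)" by blast
  then have "GDERIV (\<lambda>x. f x * g x) x :> f x *R E x + g x *R D x" for x
    by (intro GDERIV_mult) auto
  then show ?case
    using DE 5 by (intro exI[of _ "\<lambda>x. f x *R E x + g x *R D x"]) (auto intro!: bump_alg.intros)
qed

lemma bump_alg_Ck: "bump_alg e f \<Longrightarrow> Ck k f"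
proof (induction k arbitrary: f)
  case 0
  then show ?case
    using bump_alg_GDERIV[of e f] GDERIV_continuous_on[of UNIV f] by auto
next
  case (Suc k)
  then obtain D where D: "\<forall>x. GDERIV f x :> D x" "\<forall>i. bump_alg e (\<lambda>x. D x $ i)"
    using bump_alg_GDERIV by blast
  then have "gradient f = D" using GDERIV_gradient_eq by blast
  moreover have "f differentiable (at x)" for x
    using D(1) unfolding gderiv_def differentiable_def by blast
  ultimately show ?case using D(2) Suc.IH by simp
qed

text \<open>A mollifier at scale \<open>e\<close>. It is not tied to rescalings of one profile: the
  estimates below rely on smoothness, sign, support radius and mass alone.\<close>

definition kernel :: "real \<Rightarrow> (real ^ 'n \<Rightarrow> real) \<Rightarrow> bool" where
  "kernel e k \<longleftrightarrow> (\<forall>j. Ck j k) \<and> (\<forall>x. 0 \<le> k x) \<and> (\<forall>x. e \<le> norm x \<longrightarrow> k x = 0) \<and>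
     (LBINT x. k x) = 1"

lemma ex_kernel:
  assumes "e > 0"
  shows "\<exists>k :: real ^ 'n \<Rightarrow> real. kernel e k"
proof -
  define b :: "real ^ 'n \<Rightarrow> real" where "b x = exp_inv 0 (e\<^sup>2 - inner x x)" for x
  have ba: "bump_alg (e\<^sup>2) b" unfolding b_def by (rule bump_alg.intros)
  have cont: "continuous_on UNIV b" using bump_alg_Ck[OF ba, of 0] by simp
  have pos: "b x > 0" if "norm x < e" for x
  proof -
    have "norm x ^ 2 < e ^ 2" using that assms by (intro power_strict_mono) auto
    then show ?thesis by (simp add: b_def exp_inv_def power2_norm_eq_inner)
  qed
  have zero: "b x = 0" if "e \<le> norm x" for x
  proof -
    have "e ^ 2 \<le> norm x ^ 2" using that assms by (intro power_mono) auto
    then show ?thesis by (simp add: b_def exp_inv_def power2_norm_eq_inner)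
  qed
  have nn: "0 \<le> b x" for x by (simp add: b_def exp_inv_def)
  have int: "L1 b"
    by (rule integrable_continuous_compact_support[OF cont compact_cball[of 0 e]]) (simp add: zero)
  have "(LBINT x. b x) \<noteq> 0"
  proof
    assume "(LBINT x. b x) = 0"
    then have "AE x in lborel. b x = 0" using integral_nonneg_eq_0_iff_AE[OF int] nn by simp
    then have "AE x in lborel. x \<notin> ball (0 :: real ^ 'n) e"
      by eventually_elim (use pos in force)
    then have "ball (0 :: real ^ 'n) e \<in> null_sets lborel"
      by (subst AE_iff_null_sets) auto
    then have "negligible (ball (0 :: real ^ 'n) e)"
      by (simp add: negligible_iff_null_sets null_sets_completionI)
    then show False using assms open_not_negligible[of "ball (0 :: real ^ 'n) e"] by auto
  qed
  moreover have "(LBINT x. b x) \<ge> 0" using nn by (simp add: integral_nonneg_AE)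
  ultimately have c: "(LBINT x. b x) > 0" by simp
  define k where "k x = (1 / (LBINT x. b x)) * b x" for x
  have "bump_alg (e\<^sup>2) k" unfolding k_def by (intro bump_alg.intros ba)
  moreover have "(LBINT x. k x) = 1" using c by (simp add: k_def)
  moreover have "k x \<ge> 0" "e \<le> norm x \<Longrightarrow> k x = 0" for x
    using nn c zero by (auto simp: k_def)
  ultimately have "kernel e k"
    unfolding kernel_def using bump_alg_Ck by blast
  then show ?thesis by blast
qed

lemma GDERIV_zero_open:
  assumes "GDERIV f x :> D" "open S" "x \<in> S" "\<And>y. y \<in> S \<Longrightarrow> f y = 0"
  shows "D = 0"
proof -
  have "((\<lambda>y. 0) has_derivative (\<lambda>h. inner h D)) (at x)"
    using assms(1) unfolding gderiv_def
    by (rule has_derivative_transform_within_open[OF _ assms(2,3)]) (simp add: assms(4))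
  moreover have "((\<lambda>y. 0) has_derivative (\<lambda>h. 0)) (at x)" by simp
  ultimately have "(\<lambda>h. inner h D) = (\<lambda>h. 0)" by (rule has_derivative_unique)
  then have "inner D D = 0" by metis
  then show ?thesis by simp
qed

lemma Ck1_GDERIV:
  fixes f :: "real ^ 'n \<Rightarrow> real"
  assumes "Ck 1 f"
  shows "GDERIV f x :> gradient f x" "continuous_on UNIV (gradient f)"
proof -
  show "GDERIV f x :> gradient f x"
    using assms by (simp add: differentiable_GDERIV)
  have "continuous_on UNIV (\<lambda>x. \<chi> i. gradient f x $ i)"
    using assms by (intro continuous_on_vec_lambda) simp
  then show "continuous_on UNIV (gradient f)" by simp
qed

lemma smooth_C1c:
  assumes "\<And>j. Ck j \<phi>" "compact K" "K \<subseteq> \<Omega>" "\<And>x. x \<notin> K \<Longrightarrow> \<phi> x = 0"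
  shows "C1c \<Omega> \<phi> (gradient \<phi>)"
proof -
  note d = Ck1_GDERIV[OF assms(1)]
  have 3: "gradient \<phi> x = 0" if "x \<notin> K" for x
    by (rule GDERIV_zero_open[OF d(1), of "- K"])
      (use that assms in \<open>auto simp: compact_imp_closed open_Compl\<close>)
  show ?thesis unfolding C1c_def using d 3 assms by blast
qed

lemma test_functions_C1c:
  assumes "\<phi> \<in> test_functions \<Omega>"
  shows "C1c \<Omega> \<phi> (gradient \<phi>)"
proof (rule smooth_C1c)
  show "\<phi> x = 0" if "x \<notin> closure {x. \<phi> x \<noteq> 0}" for x
    using that closure_subset[of "{x. \<phi> x \<noteq> 0}"] by blast
qed (use assms in \<open>auto simp: test_functions_def\<close>)

lemma test_functionsI:
  assumes "\<And>j. Ck j \<phi>" "compact K" "K \<subseteq> \<Omega>" "\<And>x. x \<notin> K \<Longrightarrow> \<phi> x = 0"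
  shows "\<phi> \<in> test_functions \<Omega>"
proof -
  have "closure {x. \<phi> x \<noteq> 0} \<subseteq> K"
    by (rule closure_minimal) (use assms in \<open>auto simp: compact_imp_closed\<close>)
  then show ?thesis
    using assms unfolding test_functions_def
    by (auto simp: compact_closure intro: bounded_subset[OF compact_imp_bounded])
qed

section \<open>Convolution and translations in L1\<close>

definition conv :: "(real ^ 'n \<Rightarrow> real) \<Rightarrow> (real ^ 'n \<Rightarrow> 'b::euclidean_space) \<Rightarrow> real ^ 'n \<Rightarrow> 'b" where
  "conv k f x = (LBINT y. k (x - y) *R f y)"

lemma integrable_bilinear_bounded:
  fixes p :: "'b::{real_normed_vector, second_countable_topology} \<Rightarrow> 'c::{banach, second_countable_topology} \<Rightarrow> 'd::{banach, second_countable_topology}"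
  assumes p: "bounded_bilinear p" and f: "integrable M f" and g[measurable]: "g \<in> borel_measurable M" and B: "\<And>x. norm (g x) \<le> B"
  shows "integrable M (\<lambda>x. p (g x) (f x))"
proof -
  interpret bounded_bilinear p by (rule p)
  obtain K where K: "K \<ge> 0" "\<And>a b. norm (p a b) \<le> norm a * norm b * K" using nonneg_bounded by blast
  have fm: "f \<in> borel_measurable M" using f by auto
  show ?thesis
  proof (rule Bochner_Integration.integrable_bound[of M "\<lambda>x. B * norm (f x) * K"])
    show "(\<lambda>x. p (g x) (f x)) \<in> borel_measurable M"
      by (rule borel_measurable_continuous_Pair[OF g fm continuous_on[OF continuous_on_fst[OF continuous_on_id] continuous_on_snd[OF continuous_on_id]]])
    show "AE x in M. norm (p (g x) (f x)) \<le> norm (B * norm (f x) * K)"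
    proof (rule AE_I2)
      fix x
      have "norm (p (g x) (f x)) \<le> B * norm (f x) * K"
        by (rule order_trans[OF K(2)]) (intro mult_right_mono B K norm_ge_zero)
      then show "norm (p (g x) (f x)) \<le> norm (B * norm (f x) * K)" by simp
    qed
  qed (use f in simp)
qed

lemmas integrable_bounded_scaleR = integrable_bilinear_bounded[OF bounded_bilinear_scaleR]
lemmas integrable_scaleR_bounded = integrable_bilinear_bounded[OF bounded_bilinear.flip[OF bounded_bilinear_scaleR]]

text \<open>The part with \<open>u n - v\<close> is bounded by \<open>B * K\<close> times the L1
  distance, and the rest is a dominated limit. A general bilinear map covers scalar multiples in
  both orders and inner products.\<close>

lemma L1_bilinear_tendsto:
  fixes p :: "'b::{real_normed_vector, second_countable_topology} \<Rightarrow> 'c::{banach, second_countable_topology} \<Rightarrow> 'd::{banach, second_countable_topology}"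
  assumes p: "bounded_bilinear p" and u: "\<And>n. integrable M (u n)" "integrable M v" "(\<lambda>n. \<integral>x. norm (u n x - v x) \<partial>M) \<longlonglongrightarrow> 0"
    and b: "\<And>n. b n \<in> borel_measurable M" "\<And>n x. norm (b n x) \<le> B" "AE x in M. (\<lambda>n. b n x) \<longlonglongrightarrow> c x" "c \<in> borel_measurable M"
  shows "(\<lambda>n. \<integral>x. p (b n x) (u n x) \<partial>M) \<longlonglongrightarrow> (\<integral>x. p (c x) (v x) \<partial>M)"
proof -
  interpret bounded_bilinear p by (rule p)
  obtain K where K: "K \<ge> 0" "\<And>a b. norm (p a b) \<le> norm a * norm b * K" using nonneg_bounded by blast
  have Kb: "norm (p (b n x) y) \<le> B * K * norm y" for n x y
    using order_trans[OF K(2) mult_right_mono[OF mult_right_mono[OF b(2) norm_ge_zero] K(1)]] by (simp add: ac_simps)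
  note ip = integrable_bilinear_bounded[OF p _ b(1,2)]
  have vm: "v \<in> borel_measurable M" using u(2) by auto
  have "(\<lambda>n. \<integral>x. p (b n x) (u n x - v x) \<partial>M) \<longlonglongrightarrow> 0"
  proof (rule Lim_null_comparison)
    show "(\<lambda>n. B * K * (\<integral>x. norm (u n x - v x) \<partial>M)) \<longlonglongrightarrow> 0" using tendsto_mult_right_zero[OF u(3)] by simp
    have "norm (\<integral>x. p (b n x) (u n x - v x) \<partial>M) \<le> (\<integral>x. B * K * norm (u n x - v x) \<partial>M)" for n
      by (rule order_trans[OF integral_norm_bound integral_mono]) (use u Kb in \<open>auto intro!: ip\<close>)
    then show "\<forall>\<^sub>F n in sequentially. norm (\<integral>x. p (b n x) (u n x - v x) \<partial>M) \<le> B * K * (\<integral>x. norm (u n x - v x) \<partial>M)" by simp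
  qed
  moreover have "(\<lambda>n. \<integral>x. p (b n x) (v x) \<partial>M) \<longlonglongrightarrow> (\<integral>x. p (c x) (v x) \<partial>M)"
  proof (rule integral_dominated_convergence[where w="\<lambda>x. B * K * norm (v x)"])
    show "(\<lambda>x. p (c x) (v x)) \<in> borel_measurable M"
      by (rule borel_measurable_continuous_Pair[OF b(4) vm continuous_on[OF continuous_on_fst[OF continuous_on_id] continuous_on_snd[OF continuous_on_id]]])
    show "AE x in M. (\<lambda>n. p (b n x) (v x)) \<longlonglongrightarrow> p (c x) (v x)"
      using b(3) by eventually_elim (intro tendsto tendsto_const)
  qed (use u(2) Kb ip in \<open>auto intro!: borel_measurable_integrable\<close>)
  moreover have "(\<integral>x. p (b n x) (u n x) \<partial>M) = (\<integral>x. p (b n x) (u n x - v x) \<partial>M) + (\<integral>x. p (b n x) (v x) \<partial>M)" for n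
    using ip[OF u(1)] ip[OF u(2)] by (simp add: diff_right)
  ultimately show ?thesis using tendsto_add by fastforce
qed

lemma dominated_L1_tendsto:
  fixes f :: "nat \<Rightarrow> 'a \<Rightarrow> 'b::{banach, second_countable_topology}"
  assumes [measurable]: "\<And>n. f n \<in> borel_measurable M" "g \<in> borel_measurable M" and w: "integrable M w"
    and l: "AE x in M. (\<lambda>n. f n x) \<longlonglongrightarrow> g x" and b: "\<And>n. AE x in M. norm (f n x - g x) \<le> w x"
  shows "(\<lambda>n. \<integral>x. norm (f n x - g x) \<partial>M) \<longlonglongrightarrow> 0"
proof -
  have "(\<lambda>n. \<integral>x. norm (f n x - g x) \<partial>M) \<longlonglongrightarrow> (\<integral>x. 0 \<partial>M)"
  proof (rule integral_dominated_convergence[OF _ _ w])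
    show "AE x in M. (\<lambda>n. norm (f n x - g x)) \<longlonglongrightarrow> 0"
      using l by eventually_elim (intro tendsto_norm_zero LIM_zero)
  qed (use b in auto)
  then show ?thesis by simp
qed

lemma C1c_measurable:
  assumes "C1c \<Omega> \<phi> \<phi>'"
  shows "\<phi> \<in> Borel" "\<phi>' \<in> Borel"
  using C1c_integrable[OF assms] borel_measurable_integrable by auto

lemma uniformly_continuous_compact_support:
  fixes f :: "'a::euclidean_space \<Rightarrow> 'b::real_normed_vector"
  assumes c: "continuous_on UNIV f" and K: "compact K" "\<And>x. x \<notin> K \<Longrightarrow> f x = 0" and "e > 0"
  shows "\<exists>d>0. \<forall>x y. norm (x - y) < d \<longrightarrow> norm (f x - f y) < e"
proof -
  define K' where "K' = (\<Union>x\<in>K. \<Union>y\<in>cball 0 1. {x + y})"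
  have cK': "compact K'" unfolding K'_def
    by (rule compact_sums'[OF K(1) compact_cball])
  have sub: "K \<subseteq> K'" unfolding K'_def by force
  have "uniformly_continuous_on K' f"
    using c cK' compact_uniformly_continuous continuous_on_subset by blast
  then obtain d where d: "d > 0" "\<And>x y. x \<in> K' \<Longrightarrow> y \<in> K' \<Longrightarrow> dist x y < d \<Longrightarrow> dist (f x) (f y) < e"
    using \<open>e > 0\<close> unfolding uniformly_continuous_on_def by metis
  have "norm (f x - f y) < e" if xy: "norm (x - y) < min d 1" for x y
  proof (cases "x \<in> K \<or> y \<in> K")
    case True
    then have "x \<in> K' \<and> y \<in> K'"
    proof
      assume "x \<in> K"
      moreover have "y = x + (y - x)" "y - x \<in> cball 0 1" using xy by (auto simp: norm_minus_commute)
      ultimately show ?thesis using sub unfolding K'_def by blast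
    next
      assume "y \<in> K"
      moreover have "x = y + (x - y)" "x - y \<in> cball 0 1" using xy by auto
      ultimately show ?thesis using sub unfolding K'_def by blast
    qed
    then show ?thesis using d(2)[of x y] xy by (simp add: dist_norm)
  next
    case False
    then show ?thesis using K(2) \<open>e > 0\<close> by simp
  qed
  then show ?thesis using d(1) by (intro exI[of _ "min d 1"]) auto
qed

text \<open>The first-order expansion of the kernel has an error uniform in the base point, since
  \<open>k'\<close> is uniformly continuous; integrating it against \<open>f\<close> gives
  differentiability of the convolution.\<close>

lemma conv_GDERIV:
  fixes f :: "real ^ 'n \<Rightarrow> real"
  assumes k: "C1c UNIV k k'" and f: "L1 f"
  shows "GDERIV (conv k f) x :> (LBINT y. f y *R k' (x - y))"
proof -
  obtain B where B: "B > 0" "\<And>x. norm (k x) \<le> B" "\<And>x. norm (k' x) \<le> B" using C1c_bounded[OF k] by metis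
  note [measurable] = C1c_measurable[OF k] borel_measurable_integrable[OF f]
  obtain K where K: "compact K" "\<And>x. x \<notin> K \<Longrightarrow> k x = 0" "\<And>x. x \<notin> K \<Longrightarrow> k' x = 0"
    using k unfolding C1c_def by blast
  have ck': "continuous_on UNIV k'" using k C1c_def by blast
  have int1: "L1 (\<lambda>y. k (x - y) * f y)" for x
    using integrable_bounded_scaleR[OF f, of "\<lambda>y. k (x - y)" B] B by simp
  have int2: "L1 (\<lambda>y. f y *R k' (x - y))" for x
    by (rule integrable_scaleR_bounded[OF f, of _ B]) (use B in auto)
  define D where "D = (LBINT y. f y *R k' (x - y))"
  define I where "I = (LBINT y. \<bar>f y\<bar>)"
  have I: "I \<ge> 0" by (simp add: I_def)
  have "(conv k f has_derivative (\<lambda>h. inner h D)) (at x)"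
    unfolding has_derivative_at_alt
  proof (intro conjI allI impI)
    show "bounded_linear (\<lambda>h. inner h D)" by (rule bounded_linear_inner_left)
    fix e :: real assume "e > 0"
    \<comment> \<open>The \<open>+ 1\<close> avoids division by zero when \<open>f\<close> is
      null.\<close>
    define e' where "e' = e / (I + 1)"
    have "e' > 0" using \<open>e > 0\<close> I by (simp add: e'_def)
    then obtain d where d: "d > 0" "\<And>x y. norm (x - y) < d \<Longrightarrow> norm (k' x - k' y) < e'"
      using uniformly_continuous_compact_support[OF ck' K(1,3)] by metis
    have pt: "\<bar>k (z + h) - k z - inner h (k' z)\<bar> \<le> e' * norm h" if "norm h < d" for z h
    proof -
      have "norm (k (z + h) - k z - inner (z + h - z) (k' z)) \<le> norm (z + h - z) * e'"
      proof (rule differentiable_bound_linearization[where S="closed_segment z (z+h)" and f'="\<lambda>x h. inner h (k' x)"])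
        show "z + t *R (z + h - z) \<in> closed_segment z (z + h)" if "t \<in> {0..1}" for t
          using that by (auto simp: closed_segment_def algebra_simps intro!: exI[of _ t])
        show "(k has_derivative (\<lambda>h. inner h (k' y))) (at y within closed_segment z (z + h))" for y
          using k unfolding C1c_def gderiv_def by (meson has_derivative_at_withinI)
        fix y assume "y \<in> closed_segment z (z + h)"
        then have "norm (y - z) \<le> norm h"
          using segment_bound1[of y z "z + h"] by (simp add: norm_minus_commute)
        then have "norm (k' y - k' z) < e'" using d(2) that by auto
        then have "norm (inner v (k' y) - inner v (k' z)) \<le> e' * norm v" for v
          by (smt (verit, best) Cauchy_Schwarz_ineq2 inner_diff_right mult.commute mult_right_mono norm_ge_zero real_norm_def)
        then show "onorm ((\<lambda>v. inner v (k' y)) - (\<lambda>v. inner v (k' z))) \<le> e'"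
          unfolding fun_diff_def by (rule onorm_le)
      qed auto
      then show ?thesis by (simp add: mult.commute)
    qed
    show "\<exists>d>0. \<forall>y. norm (y - x) < d \<longrightarrow> norm (conv k f y - conv k f x - inner (y - x) D) \<le> e * norm (y - x)"
    proof (intro exI[of _ d] conjI allI impI)
      fix y assume y: "norm (y - x) < d"
      define h where "h = y - x"
      have "conv k f y - conv k f x - inner h D =
          (LBINT z. f z * (k ((x - z) + h) - k (x - z) - inner h (k' (x - z))))"
      proof -
        have "inner h D = (LBINT z. f z * inner h (k' (x - z)))"
          unfolding D_def using int2[of x]
          by (subst integral_inner_right[symmetric]) (auto simp: )
        moreover have "L1 (\<lambda>z. f z * inner h (k' (x - z)))"
        proof -
          have "L1 (\<lambda>z. inner h (f z *R k' (x - z)))"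
            by (rule integrable_inner_right) (rule int2)
          then show ?thesis by (simp only: inner_scaleR_right)
        qed
        moreover have yz: "x - z + h = y - z" for z by (simp add: h_def)
        ultimately show ?thesis
          unfolding conv_def yz using int1[of x] int1[of y]
          by (simp add: right_diff_distrib mult.commute)
      qed
      also have "norm \<dots> \<le> (LBINT z. \<bar>f z\<bar> * (e' * norm h))"
      proof (rule order_trans[OF integral_norm_bound integral_mono])
        have "L1 (\<lambda>z. \<bar>f z\<bar>)" using f by simp
        then show "L1 (\<lambda>z. \<bar>f z\<bar> * (e' * norm h))" by (rule integrable_mult_left)
        have "L1 (\<lambda>z. k (y - z) * f z - k (x - z) * f z - inner h (f z *R k' (x - z)))"
          by (intro Bochner_Integration.integrable_diff integrable_inner_right int1 int2)
        then show "L1 (\<lambda>z. norm (f z * (k ((x - z) + h) - k (x - z) - inner h (k' (x - z)))))"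
          by (intro integrable_norm) (simp add: h_def algebra_simps)
        show "norm (f z * (k ((x - z) + h) - k (x - z) - inner h (k' (x - z)))) \<le> \<bar>f z\<bar> * (e' * norm h)" for z
          using pt[of h "x - z"] y unfolding h_def by (simp add: abs_mult mult_left_mono)
      qed
      also have "\<dots> = I * (e' * norm h)" by (simp add: I_def)
      also have "\<dots> \<le> e * norm h"
        using I \<open>e > 0\<close> unfolding e'_def by (simp add: field_simps mult_right_mono)
      finally show "norm (conv k f y - conv k f x - inner (y - x) D) \<le> e * norm (y - x)"
        by (simp add: h_def)
    qed (use d in auto)
  qed
  then show ?thesis by (simp add: gderiv_def D_def)
qed

text \<open>The kernel is general in the induction, because a partial derivative of the convolution
  is the convolution with the partial derivative of the kernel.\<close>

lemma Ck_conv: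
  fixes f :: "real ^ 'n \<Rightarrow> real"
  assumes f: "L1 f" and "\<And>j. Ck j \<phi>" "compact K" "\<And>x. x \<notin> K \<Longrightarrow> \<phi> x = 0"
  shows "Ck j (conv \<phi> f)"
  using assms(2-)
proof (induction j arbitrary: \<phi>)
  case 0
  then have "C1c UNIV \<phi> (gradient \<phi>)" by (intro smooth_C1c) auto
  from GDERIV_continuous_on[OF conv_GDERIV[OF this f], of UNIV] show ?case by simp
next
  case (Suc j)
  have c: "C1c UNIV \<phi> (gradient \<phi>)" using Suc.prems by (intro smooth_C1c) auto
  note d = conv_GDERIV[OF this f]
  obtain B where B: "B > 0" "\<And>x. norm (\<phi> x) \<le> B" "\<And>x. norm (gradient \<phi> x) \<le> B" using C1c_bounded[OF c] by metis
  note [measurable] = C1c_measurable[OF c] borel_measurable_integrable[OF f]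
  have int2: "L1 (\<lambda>y. f y *R gradient \<phi> (x - y))" for x
    by (rule integrable_scaleR_bounded[OF f, of _ B]) (use B in auto)
  have "gradient (conv \<phi> f) x $ i = conv (\<lambda>x. gradient \<phi> x $ i) f x" for x i
    unfolding GDERIV_gradient_eq[OF d[of x]] conv_def
    using integral_bounded_linear[OF bounded_linear_vec_nth int2[of x], of i, symmetric]
    by (simp add: mult.commute)
  moreover have "Ck j (conv (\<lambda>x. gradient \<phi> x $ i) f)" for i
  proof (rule Suc.IH)
    show "Ck l (\<lambda>x. gradient \<phi> x $ i)" for l using Suc.prems(1)[of "Suc l"] by simp
    show "gradient \<phi> x $ i = 0" if "x \<notin> K" for x
      using GDERIV_zero_open[of \<phi> x "gradient \<phi> x" "- K"] c that Suc.prems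
      by (auto simp: C1c_def compact_imp_closed open_Compl)
  qed (use Suc.prems in auto)
  moreover have "conv \<phi> f differentiable (at x)" for x
    using d unfolding gderiv_def differentiable_def by blast
  ultimately show ?case by simp
qed

text \<open>The functions with this property are closed under L1 limits and sums, so indicators of
  sets of finite measure suffice. These are approximated from outside by open sets, and a point of
  an open set stays in it under small shifts.\<close>

lemma L1_translation_tendsto:
  fixes f :: "'a::euclidean_space \<Rightarrow> 'b::{banach, second_countable_topology}"
  assumes f: "L1 f" and h: "h \<longlonglongrightarrow> 0"
  shows "(\<lambda>n. LBINT x. norm (f (x - h n) - f x)) \<longlonglongrightarrow> 0"
proof -
  define T :: "('a \<Rightarrow> 'b) \<Rightarrow> nat \<Rightarrow> real" where "T f n = (LBINT x. norm (f (x - h n) - f x))" for f n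
  have sh: "L1 (\<lambda>x. g (x - a))" if "L1 g" for g :: "'a \<Rightarrow> 'c::{banach, second_countable_topology}" and a
    using lborel_integrable_translation[OF that, of "- a"] by simp
  have approx: "T f \<longlonglongrightarrow> 0"
    if f: "L1 f" and g: "\<And>e. 0 < e \<Longrightarrow> \<exists>g. L1 g \<and> (LBINT x. norm (g x - f x)) < e \<and> T g \<longlonglongrightarrow> 0" for f
  proof (rule LIMSEQ_I)
    fix e :: real assume e: "0 < e"
    then obtain g where g: "L1 g" "(LBINT x. norm (g x - f x)) < e / 4" "T g \<longlonglongrightarrow> 0" using g[of "e / 4"] by auto
    have le: "T f n \<le> 2 * (LBINT x. norm (g x - f x)) + T g n" for n
    proof -
      have "T f n \<le> (LBINT x. norm (g (x - h n) - f (x - h n)) + norm (g (x - h n) - g x) + norm (g x - f x))"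
        unfolding T_def
      proof (rule integral_mono)
        show "norm (f (x - h n) - f x) \<le> norm (g (x - h n) - f (x - h n)) + norm (g (x - h n) - g x) + norm (g x - f x)" for x
          by norm
      qed (use sh[OF f] sh[OF g(1)] f g(1) in auto)
      then show ?thesis
        using lborel_integral_translation[of "\<lambda>x. norm (g x - f x)" "- h n"] sh[OF f] sh[OF g(1)] f g(1) by (simp add: T_def)
    qed
    have "0 < e / 2" using e by simp
    from order_tendstoD(2)[OF g(3) this] obtain N where N: "\<And>n. N \<le> n \<Longrightarrow> T g n < e / 2"
      unfolding eventually_sequentially by blast
    have "norm (T f n - 0) < e" if "N \<le> n" for n
    proof -
      have "0 \<le> T f n" unfolding T_def by simp
      then show ?thesis using le[of n] N[OF that] g(2) by simp
    qed
    then show "\<exists>N. \<forall>n\<ge>N. norm (T f n - 0) < e" by blast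
  qed
  have op: "T (\<lambda>x. indicator U x *R c) \<longlonglongrightarrow> 0" if U: "open U" "emeasure lborel U < \<infinity>" for U c
  proof -
    have [measurable]: "U \<in> sets borel" using U by simp
    have i: "L1 (indicat_real U)" using U by (intro integrable_real_indicator) auto
    have ib: "L1 (\<lambda>x. (1 - indicat_real U (x - h n)) * indicator U x)" for n
      using integrable_bounded_scaleR[OF i, of "\<lambda>x. 1 - indicator U (x - h n)" 1] by (simp add: indicator_def)
    have "(\<lambda>n. LBINT x. (1 - indicat_real U (x - h n)) * indicator U x) \<longlonglongrightarrow> (\<integral>x. 0 \<partial>(lborel :: 'a measure))"
    proof (rule integral_dominated_convergence[OF _ _ i])
      show "AE x in lborel. (\<lambda>n. (1 - indicat_real U (x - h n)) * indicator U x) \<longlonglongrightarrow> 0"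
      proof (rule AE_I2)
        fix x
        show "(\<lambda>n. (1 - indicat_real U (x - h n)) * indicator U x) \<longlonglongrightarrow> 0"
        proof (cases "x \<in> U")
          case True
          have "(\<lambda>n. x - h n) \<longlonglongrightarrow> x" using tendsto_diff[OF tendsto_const h] by simp
          from topological_tendstoD[OF this U(1) True]
          have "\<forall>\<^sub>F n in sequentially. (1 - indicat_real U (x - h n)) * indicator U x = 0" by eventually_elim simp
          then show ?thesis by (rule tendsto_eventually)
        qed simp
      qed
    qed (auto simp: indicator_def)
    moreover have "T (\<lambda>x. indicator U x *R c) n = 2 * norm c * (LBINT x. (1 - indicat_real U (x - h n)) * indicator U x)" for n
    proof -
      \<comment> \<open>For values \<open>a\<close>, \<open>b\<close> in {0, 1} one has |a - b| = a
        - b + 2(1 - a)b. The difference integrates to zero by translation invariance, so only points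
        of \<open>U\<close> whose shift leaves \<open>U\<close> contribute.\<close>
      have "norm (indicator U (x - h n) *R c - indicator U x *R c) =
          norm c * (indicator U (x - h n) - indicator U x + 2 * ((1 - indicator U (x - h n)) * indicator U x))" for x
        by (simp add: indicator_def)
      then show ?thesis
        using ib i sh[OF i] lborel_integral_translation[of "indicat_real U" "- h n"] by (simp add: T_def)
    qed
    then have "T (\<lambda>x. indicator U x *R c) = (\<lambda>n. 2 * norm c * (LBINT x. (1 - indicat_real U (x - h n)) * indicator U x))" by (rule ext)
    ultimately show ?thesis using tendsto_mult_right_zero[of _ sequentially "2 * norm c"] by simp
  qed
  have "T f \<longlonglongrightarrow> 0" using f
  proof (induction rule: integrable_induct)
    case (base A c)
    have A[measurable]: "A \<in> sets borel" and fin: "emeasure lborel A < \<infinity>" using base by auto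
    show ?case
    proof (rule approx)
      show "L1 (\<lambda>x. indicator A x *R c)" using fin by simp
      fix e :: real assume "0 < e"
      define d where "d = e / (norm c + 1)"
      have c: "0 < norm c + 1" by (simp add: add_nonneg_pos)
      have d: "0 < d" "norm c * d < e" using \<open>0 < e\<close> c by (auto simp: d_def field_simps)
      have "A \<in> sets lebesgue" by simp
      then obtain U where U: "open U" "A \<subseteq> U" "emeasure lebesgue (U - A) < ennreal d"
        using sets_lebesgue_outer_open d by metis
      have [measurable]: "U \<in> sets borel" using U(1) by simp
      have UA: "emeasure lborel (U - A) < ennreal d" using U(3) by simp
      then have fUA: "emeasure lborel (U - A) < \<infinity>" using order_less_trans ennreal_less_top by (metis infinity_ennreal_def)
      have "emeasure lborel U = emeasure lborel A + emeasure lborel (U - A)"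
        using plus_emeasure[of A lborel "U - A"] U(2) by (simp add: Un_absorb1)
      then have fU: "emeasure lborel U < \<infinity>" using fin fUA by simp
      have "(LBINT x. norm (indicator U x *R c - indicator A x *R c)) = (LBINT x. indicator (U - A) x * norm c)"
        using U(2) by (intro Bochner_Integration.integral_cong) (auto simp: indicator_def)
      also have "\<dots> = measure lborel (U - A) * norm c" using fUA by simp
      also have "\<dots> \<le> d * norm c"
      proof (intro mult_right_mono norm_ge_zero)
        show "measure lborel (U - A) \<le> d"
          using UA d(1) fUA by (simp add: emeasure_eq_ennreal_measure less_top ennreal_less_iff)
      qed
      finally have "(LBINT x. norm (indicator U x *R c - indicator A x *R c)) < e" using d(2) by (simp add: mult.commute)
      then show "\<exists>g. L1 g \<and> (LBINT x. norm (g x - indicator A x *R c)) < e \<and> T g \<longlonglongrightarrow> 0"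
        using op[OF U(1) fU] fU by (intro exI[of _ "\<lambda>x. indicator U x *R c"]) simp
    qed
  next
    case (add f g)
    have a: "T (\<lambda>x. f x + g x) n \<le> T f n + T g n" for n
    proof -
      have "T (\<lambda>x. f x + g x) n \<le> (LBINT x. norm (f (x - h n) - f x) + norm (g (x - h n) - g x))"
        unfolding T_def using sh[OF add.hyps(1)] sh[OF add.hyps(2)] add.hyps by (intro integral_mono) (auto intro: norm_triangle_ineq simp: add_diff_add)
      then show ?thesis using sh[OF add.hyps(1)] sh[OF add.hyps(2)] add.hyps by (simp add: T_def)
    qed
    have b: "0 \<le> T (\<lambda>x. f x + g x) n" for n unfolding T_def by simp
    have c: "(\<lambda>n. T f n + T g n) \<longlonglongrightarrow> 0" using tendsto_add[OF add.IH] by simp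
    show ?case by (rule tendsto_sandwich[OF _ _ tendsto_const c]) (use a b in simp_all)
  next
    case (lim f s)
    have l: "(\<lambda>i. LBINT x. norm (s i x - f x)) \<longlonglongrightarrow> 0"
    proof (rule dominated_L1_tendsto[where w="\<lambda>x. 3 * norm (f x)"])
      show "AE x in lborel. norm (s i x - f x) \<le> 3 * norm (f x)" for i
      proof (rule AE_I2)
        fix x show "norm (s i x - f x) \<le> 3 * norm (f x)"
          using lim(3)[of x i] norm_triangle_ineq4[of "s i x" "f x"] by simp
      qed
    qed (use lim(1,2,4) in auto)
    show ?case
    proof (rule approx[OF lim(4)])
      fix e :: real assume "0 < e"
      from eventually_happens'[OF sequentially_bot order_tendstoD(2)[OF l this]] obtain i
        where "(LBINT x. norm (s i x - f x)) < e" by (elim exE) (rule that)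
      then show "\<exists>g. L1 g \<and> (LBINT x. norm (g x - f x)) < e \<and> T g \<longlonglongrightarrow> 0"
        by (intro exI[of _ "s i"] conjI lim(1) lim.IH)
    qed
  qed
  then show ?thesis unfolding T_def .
qed

lemma L1_translation_continuous:
  fixes f :: "'a::euclidean_space \<Rightarrow> 'b::{banach, second_countable_topology}"
  assumes f: "L1 f" and "e > 0"
  shows "\<exists>d>0. \<forall>h. norm h < d \<longrightarrow> (LBINT x. norm (f (x - h) - f x)) < e"
proof -
  have "continuous (at 0) (\<lambda>h. LBINT x. norm (f (x - h) - f x))"
    unfolding continuous_at_sequentially using L1_translation_tendsto[OF f] by (auto simp: comp_def)
  then show ?thesis
    unfolding continuous_at_eps_delta using \<open>e > 0\<close> by (fastforce simp: dist_norm)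
qed

section \<open>Young functions and their modulars\<close>

text \<open>Convexity and monotonicity are encoded together by a nonnegative subgradient at every
  point, the form in which Jensen's inequality consumes them. The last clause is the doubling
  condition, under which modular and norm convergence coincide.\<close>

definition young :: "(real \<Rightarrow> real) \<Rightarrow> bool" where
  "young \<Gamma> \<longleftrightarrow> continuous_on {0..} \<Gamma> \<and> \<Gamma> 0 = 0 \<and>
     (\<forall>m\<ge>0. \<exists>s\<ge>0. \<forall>t\<ge>0. \<Gamma> m + s * (t - m) \<le> \<Gamma> t) \<and>
     (\<exists>C>0. \<forall>t\<ge>0. \<Gamma> (2 * t) \<le> C * \<Gamma> t)"

text \<open>With the identity as Young function, every modular estimate is also an L1
  estimate.\<close>

lemma young_id: "young (\<lambda>t. t)"
proof -
  have "\<exists>s\<ge>0. \<forall>t\<ge>0. m + s * (t - m) \<le> t" for m :: real by (rule exI[of _ 1]) auto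
  moreover have "\<exists>C>0. \<forall>t\<ge>0. 2 * t \<le> C * (t::real)" by (rule exI[of _ "2"]) auto
  ultimately show ?thesis unfolding young_def by (auto intro: continuous_intros)
qed

lemma young_subgradient:
  assumes "young \<Gamma>" "0 \<le> m"
  obtains s where "s \<ge> 0" "\<And>t. t \<ge> 0 \<Longrightarrow> \<Gamma> m + s * (t - m) \<le> \<Gamma> t"
  using assms unfolding young_def by blast

lemma young_mono:
  assumes "young \<Gamma>" "0 \<le> s" "s \<le> t"
  shows "\<Gamma> s \<le> \<Gamma> t"
proof -
  obtain c where "c \<ge> 0" "\<And>t. t \<ge> 0 \<Longrightarrow> \<Gamma> s + c * (t - s) \<le> \<Gamma> t"
    using young_subgradient[OF assms(1,2)] by metis
  then have "\<Gamma> s + c * (t - s) \<le> \<Gamma> t" "0 \<le> c * (t - s)" using assms by auto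
  then show ?thesis by linarith
qed

lemma young_nonneg:
  assumes "young \<Gamma>" "0 \<le> t"
  shows "0 \<le> \<Gamma> t"
  using young_mono[OF assms(1), of 0 t] assms unfolding young_def by simp

lemma young_scale:
  assumes y: "young \<Gamma>" and "0 \<le> t" "0 \<le> c" "c \<le> 1"
  shows "\<Gamma> (c * t) \<le> c * \<Gamma> t"
proof -
  have "0 \<le> c * t" using assms by simp
  then obtain s where s: "s \<ge> 0" "\<And>r. r \<ge> 0 \<Longrightarrow> \<Gamma> (c * t) + s * (r - c * t) \<le> \<Gamma> r"
    using young_subgradient[OF y] by metis
  have 1: "c * (\<Gamma> (c * t) + s * (t - c * t)) \<le> c * \<Gamma> t"
    using s(2) assms by (intro mult_left_mono) auto
  have "(1 - c) * (\<Gamma> (c * t) + s * (0 - c * t)) \<le> (1 - c) * \<Gamma> 0"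
    using s(2)[of 0] assms by (intro mult_left_mono) auto
  then have 2: "(1 - c) * (\<Gamma> (c * t) + s * (0 - c * t)) \<le> 0" using y by (simp add: young_def)
  have "\<Gamma> (c * t) = c * (\<Gamma> (c * t) + s * (t - c * t)) + (1 - c) * (\<Gamma> (c * t) + s * (0 - c * t))"
    by (simp add: algebra_simps)
  with 1 2 show ?thesis by linarith
qed

lemma young_add:
  assumes y: "young \<Gamma>"
  obtains C where "C > 0" "\<And>a b. 0 \<le> a \<Longrightarrow> 0 \<le> b \<Longrightarrow> \<Gamma> (a + b) \<le> C * (\<Gamma> a + \<Gamma> b)"
proof -
  obtain C where C: "C > 0" "\<forall>t\<ge>0. \<Gamma> (2 * t) \<le> C * \<Gamma> t"
    using y unfolding young_def by blast
  have "\<Gamma> (a + b) \<le> C * (\<Gamma> a + \<Gamma> b)" if "0 \<le> a" "0 \<le> b" for a b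
  proof -
    have "\<Gamma> (a + b) \<le> \<Gamma> (2 * max a b)" using that by (intro young_mono[OF y]) auto
    also have "\<dots> \<le> C * \<Gamma> (max a b)" using C(2) that by auto
    also have "\<dots> \<le> C * (\<Gamma> a + \<Gamma> b)"
      using C(1) young_nonneg[OF y that(1)] young_nonneg[OF y that(2)]
      by (intro mult_left_mono) (auto simp: max_def)
    finally show ?thesis .
  qed
  with C(1) that show thesis by blast
qed

lemma young_continuous_abs: "young \<Gamma> \<Longrightarrow> continuous_on UNIV (\<lambda>t. \<Gamma> \<bar>t\<bar>)"
  unfolding young_def
  by (rule continuous_on_compose2[of "{0..}" \<Gamma>]) (auto intro: continuous_intros)

lemma young_measurable:
  fixes f :: "'a \<Rightarrow> 'b::euclidean_space"
  assumes "young \<Gamma>" and [measurable]: "f \<in> borel_measurable M"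
  shows "(\<lambda>x. \<Gamma> (norm (f x))) \<in> borel_measurable M"
proof -
  have [measurable]: "(\<lambda>t. \<Gamma> \<bar>t\<bar>) \<in> Borel"
    using young_continuous_abs[OF assms(1)] by (rule borel_measurable_continuous_onI)
  have "(\<lambda>x. (\<lambda>t. \<Gamma> \<bar>t\<bar>) (norm (f x))) \<in> borel_measurable M" by measurable
  then show ?thesis by simp
qed

text \<open>Taken over the whole space, so that translations act on it; functions extended by zero
  contribute nothing outside \<Omega>, because \<open>\<Gamma> 0 = 0\<close>.\<close>

definition mdl :: "(real \<Rightarrow> real) \<Rightarrow> (real ^ 'n \<Rightarrow> 'b::euclidean_space) \<Rightarrow> ennreal" where
  "mdl \<Gamma> f = (\<integral>\<^sup>+x. ennreal (\<Gamma> (norm (f x))) \<partial>lborel)"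

lemma mdl_mono:
  assumes "young \<Gamma>" "AE x in lborel. norm (f x) \<le> norm (g x)"
  shows "mdl \<Gamma> f \<le> mdl \<Gamma> g"
  unfolding mdl_def
  by (rule nn_integral_mono_AE)
    (use assms(2) in eventually_elim, auto intro!: ennreal_leI young_mono[OF assms(1)])

lemma mdl_cong:
  assumes "AE x in lborel. norm (f x) = norm (g x)"
  shows "mdl \<Gamma> f = mdl \<Gamma> g"
  unfolding mdl_def by (rule nn_integral_cong_AE) (use assms in eventually_elim, auto)

lemma mdl_add:
  assumes y: "young \<Gamma>"
  shows "\<exists>C>0. \<forall>f\<in>Borel. \<forall>g\<in>Borel.
    mdl \<Gamma> (\<lambda>x. f x + g x :: 'b::euclidean_space) \<le> ennreal C * (mdl \<Gamma> f + mdl \<Gamma> (g :: real ^ 'n \<Rightarrow> 'b))"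
proof -
  obtain C where C: "C > 0" "\<And>a b. 0 \<le> a \<Longrightarrow> 0 \<le> b \<Longrightarrow> \<Gamma> (a + b) \<le> C * (\<Gamma> a + \<Gamma> b)"
    using young_add[OF y] by metis
  have "mdl \<Gamma> (\<lambda>x. f x + g x) \<le> ennreal C * (mdl \<Gamma> f + mdl \<Gamma> g)"
    if [measurable]: "f \<in> Borel" "g \<in> Borel" for f g :: "real ^ 'n \<Rightarrow> 'b"
  proof -
    note [measurable] = young_measurable[OF y that(1)] young_measurable[OF y that(2)]
    have "mdl \<Gamma> (\<lambda>x. f x + g x) \<le> (\<integral>\<^sup>+x. ennreal C * (ennreal (\<Gamma> (norm (f x))) + ennreal (\<Gamma> (norm (g x)))) \<partial>lborel)"
      unfolding mdl_def
    proof (rule nn_integral_mono)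
      fix x
      have "\<Gamma> (norm (f x + g x)) \<le> \<Gamma> (norm (f x) + norm (g x))"
        by (intro young_mono[OF y]) (auto intro: norm_triangle_ineq)
      also have "\<dots> \<le> C * (\<Gamma> (norm (f x)) + \<Gamma> (norm (g x)))" by (rule C(2)) auto
      finally show "ennreal (\<Gamma> (norm (f x + g x))) \<le> ennreal C * (ennreal (\<Gamma> (norm (f x))) + ennreal (\<Gamma> (norm (g x))))"
        using C(1) young_nonneg[OF y]
        by (simp add: ennreal_mult'[symmetric] ennreal_plus[symmetric] ennreal_leI del: ennreal_plus)
    qed
    also have "\<dots> = ennreal C * (mdl \<Gamma> f + mdl \<Gamma> g)"
      unfolding mdl_def by (subst nn_integral_cmult, measurable) (simp add: nn_integral_add)
    finally show ?thesis .
  qed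
  with C(1) show ?thesis by blast
qed

lemma mdl_translation:
  fixes f :: "real ^ 'n \<Rightarrow> 'b::euclidean_space"
  assumes "young \<Gamma>" "f \<in> Borel"
  shows "mdl \<Gamma> (\<lambda>x. f (x + a)) = mdl \<Gamma> f"
  unfolding mdl_def
  using nn_integral_lborel_translation[of "\<lambda>x. ennreal (\<Gamma> (norm (f x)))" a] young_measurable[OF assms]
  by simp

text \<open>Reduced to L1 continuity of \<open>f\<close> and of \<open>K\<close>, its
  \<Gamma>-energy density. Where the difference is at most 1, convexity bounds \<Gamma> linearly.
  Elsewhere doubling leads to \<open>K (x - h) + K x\<close>; the part of \<open>K\<close> above a
  high level \<open>N\<close> is small in L1.\<close>

lemma mdl_translation_continuous:
  fixes f :: "real ^ 'n \<Rightarrow> 'b::euclidean_space"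
  assumes y: "young \<Gamma>" and f: "L1 f" and fin: "mdl \<Gamma> f < \<infinity>" and e: "0 < e"
  shows "\<exists>d>0. \<forall>h. norm h < d \<longrightarrow> mdl \<Gamma> (\<lambda>x. f (x - h) - f x) \<le> ennreal e"
proof -
  obtain C where C: "C > 0" "\<And>a b. 0 \<le> a \<Longrightarrow> 0 \<le> b \<Longrightarrow> \<Gamma> (a + b) \<le> C * (\<Gamma> a + \<Gamma> b)"
    using young_add[OF y] by metis
  define K where "K x = \<Gamma> (norm (f x))" for x
  have [measurable]: "f \<in> Borel" using f by auto
  have [measurable]: "K \<in> Borel" unfolding K_def by (rule young_measurable[OF y]) measurable
  have K0: "0 \<le> K x" for x unfolding K_def by (rule young_nonneg[OF y norm_ge_zero])
  have iK: "L1 K"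
    by (rule integrableI_nonneg) (use fin K0 in \<open>auto simp: mdl_def K_def[symmetric]\<close>)
  have "(\<lambda>N. LBINT x. max 0 (K x - real N)) \<longlonglongrightarrow> (\<integral>x. 0 \<partial>(lborel :: (real ^ 'n) measure))"
  proof (rule integral_dominated_convergence[OF _ _ iK])
    show "AE x in lborel. (\<lambda>N. max 0 (K x - real N)) \<longlonglongrightarrow> 0"
    proof (rule AE_I2)
      fix x
      obtain N0 :: nat where N0: "K x \<le> real N0" using real_arch_simple by blast
      have "\<forall>\<^sub>F N in sequentially. max 0 (K x - real N) = 0"
        using eventually_ge_at_top[of N0] by eventually_elim (use N0 in auto)
      then show "(\<lambda>N. max 0 (K x - real N)) \<longlonglongrightarrow> 0" by (rule tendsto_eventually)
    qed
  qed (use K0 in auto)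
  moreover have "0 < e / (6 * C)" using e C(1) by simp
  ultimately have "\<forall>\<^sub>F N in sequentially. (LBINT x. max 0 (K x - real N)) < e / (6 * C)"
    using order_tendstoD(2) by fastforce
  then obtain N :: nat where N: "(LBINT x. max 0 (K x - real N)) < e / (6 * C)"
    using eventually_happens'[OF sequentially_bot] by blast
  \<comment> \<open>The first summand is the linear bound on [0, 1]. The second absorbs the part of
    \<open>K\<close> below \<open>N\<close>, which counts only where the difference
    \<open>k x\<close> exceeds 1. Each of the three error terms is then at most a third of
    \<open>e\<close>.\<close>
  define c where "c = \<Gamma> 1 + 2 * C * real N"
  have c: "0 \<le> c" using young_nonneg[OF y, of 1] C(1) by (simp add: c_def)
  have "0 < e / (3 * (c + 1))" "0 < e / (3 * C)" using e c C(1) by auto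
  from L1_translation_continuous[OF f this(1)] L1_translation_continuous[OF iK this(2)]
  obtain d1 d2 where d: "0 < d1" "\<forall>h. norm h < d1 \<longrightarrow> (LBINT x. norm (f (x - h) - f x)) < e / (3 * (c + 1))"
    "0 < d2" "\<forall>h. norm h < d2 \<longrightarrow> (LBINT x. norm (K (x - h) - K x)) < e / (3 * C)" by (elim exE conjE) (rule that)
  have "mdl \<Gamma> (\<lambda>x. f (x - h) - f x) \<le> ennreal e" if h: "norm h < min d1 d2" for h
  proof -
    define k where "k x = norm (f (x - h) - f x)" for x
    define k' where "k' x = norm (K (x - h) - K x)" for x
    have "L1 (\<lambda>x. max 0 (K x - real N))"
      by (rule Bochner_Integration.integrable_bound[OF iK]) (use K0 in \<open>auto simp: max_def\<close>)
    then have i: "L1 k" "L1 k'" "L1 (\<lambda>x. max 0 (K x - real N))"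
      using f iK lborel_integrable_translation[OF f, of "- h"] lborel_integrable_translation[OF iK, of "- h"] by (auto simp: k_def[abs_def] k'_def[abs_def])
    define R where "R x = c * k x + 2 * C * max 0 (K x - real N) + C * k' x" for x
    have R: "\<Gamma> (k x) \<le> R x" for x
    proof (cases "k x \<le> 1")
      case True
      have "\<Gamma> (k x) \<le> k x * \<Gamma> 1" using young_scale[OF y, of 1 "k x"] True by (simp add: k_def)
      also have "\<dots> \<le> c * k x" using C(1) by (simp add: c_def k_def algebra_simps)
      finally show ?thesis using C(1) by (simp add: R_def k'_def add_nonneg_nonneg add_increasing2)
    next
      case False
      have "\<Gamma> (k x) \<le> \<Gamma> (norm (f (x - h)) + norm (f x))"
        unfolding k_def by (intro young_mono[OF y] norm_triangle_ineq4) simp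
      also have "\<dots> \<le> C * (K (x - h) + K x)" unfolding K_def by (rule C(2)) auto
      also have "\<dots> \<le> C * (2 * real N + 2 * max 0 (K x - real N) + k' x)"
      proof (rule mult_left_mono)
        have "a + b \<le> 2 * n + 2 * m + c" if "b - n \<le> m" "a - b \<le> c" for a b c m n :: real using that by linarith
        then show "K (x - h) + K x \<le> 2 * real N + 2 * max 0 (K x - real N) + k' x" by this (simp_all add: k'_def)
      qed (use C(1) in simp)
      also have "\<dots> \<le> R x"
      proof -
        have "2 * C * real N * 1 \<le> 2 * C * real N * k x" using False C(1) by (intro mult_left_mono) auto
        moreover have "0 \<le> \<Gamma> 1 * k x" using young_nonneg[OF y, of 1] by (simp add: k_def)
        ultimately show ?thesis by (simp add: R_def c_def algebra_simps)
      qed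
      finally show ?thesis .
    qed
    have R0: "0 \<le> R x" for x using order_trans[OF young_nonneg[OF y] R] by (simp add: k_def)
    have "mdl \<Gamma> (\<lambda>x. f (x - h) - f x) \<le> (\<integral>\<^sup>+x. ennreal (R x) \<partial>lborel)"
      unfolding mdl_def k_def[symmetric] by (intro nn_integral_mono ennreal_leI R)
    also have "\<dots> = ennreal (LBINT x. R x)"
      by (rule nn_integral_eq_integral) (use i R0 in \<open>auto simp: R_def\<close>)
    also have "\<dots> \<le> ennreal e"
    proof (rule ennreal_leI)
      have "(LBINT x. R x) = c * (LBINT x. k x) + 2 * C * (LBINT x. max 0 (K x - real N)) + C * (LBINT x. k' x)"
        using i by (simp add: R_def)
      also have "\<dots> \<le> c * (e / (3 * (c + 1))) + 2 * C * (e / (6 * C)) + C * (e / (3 * C))"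
        using d(2,4) h N C(1) c unfolding k_def k'_def by (intro add_mono mult_left_mono) (auto intro: less_imp_le)
      also have "\<dots> \<le> e" using c C(1) e by (simp add: field_simps)
      finally show "(LBINT x. R x) \<le> e" .
    qed
    finally show ?thesis .
  qed
  with d(1,3) show ?thesis by (intro exI[of _ "min d1 d2"]) auto
qed

section \<open>Convergence of mollifications in modular\<close>

lemma lborel_reflection:
  "distr lborel borel (\<lambda>x. t - x) = (lborel :: 'a::euclidean_space measure)"
  using lborel_affine[of "-1" t] by (simp add: density_1)

lemma lborel_integral_reflection:
  fixes f :: "'a::euclidean_space \<Rightarrow> 'b::{banach, second_countable_topology}"
  assumes [measurable]: "f \<in> Borel"
  shows "(LBINT x. f (t - x)) = (LBINT x. f x)"
proof -
  have "(LBINT x. f x) = (\<integral>x. f x \<partial>(distr lborel borel (\<lambda>x. t - x)))"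
    by (simp add: lborel_reflection)
  also have "\<dots> = (LBINT x. f (t - x))"
    by (rule integral_distr) measurable
  finally show ?thesis ..
qed

lemma lborel_integrable_reflection:
  fixes f :: "'a::euclidean_space \<Rightarrow> 'b::{banach, second_countable_topology}"
  assumes "L1 f"
  shows "L1 (\<lambda>x. f (t - x))"
proof -
  have "integrable (distr lborel borel (\<lambda>x. t - x)) f" using assms by (simp add: lborel_reflection)
  then show ?thesis
    by (subst (asm) integrable_distr_eq) (use borel_measurable_integrable[OF assms] in auto)
qed

lemma kernel_C1c:
  assumes "kernel e k"
  shows "C1c UNIV k (gradient k)"
  by (rule smooth_C1c[of _ "cball 0 e"]) (use assms in \<open>auto simp: kernel_def\<close>)

lemma conv_integrable:
  fixes f :: "real ^ 'n \<Rightarrow> 'b::euclidean_space"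
  assumes k: "C1c UNIV k k'" and f: "L1 f"
  shows "L1 (\<lambda>y. k (x - y) *R f y)"
proof -
  note [measurable] = C1c_measurable[OF k] borel_measurable_integrable[OF f]
  obtain B where B: "B > 0" "\<And>x. norm (k x) \<le> B" using C1c_bounded[OF k] by metis
  show ?thesis
    by (rule integrable_bounded_scaleR[OF f, of _ B]) (use B in auto)
qed

lemma conv_alt:
  fixes f :: "real ^ 'n \<Rightarrow> 'b::euclidean_space"
  assumes k: "C1c UNIV k k'" and f: "L1 f"
  shows "conv k f x = (LBINT z. k z *R f (x - z))" "L1 (\<lambda>z. k z *R f (x - z))"
proof -
  note [measurable] = C1c_measurable[OF k] borel_measurable_integrable[OF f]
  show "conv k f x = (LBINT z. k z *R f (x - z))"
    unfolding conv_def using lborel_integral_reflection[of "\<lambda>y. k (x - y) *R f y" x] by simp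
  show "L1 (\<lambda>z. k z *R f (x - z))"
    using lborel_integrable_reflection[OF conv_integrable[OF k f, of x], of x] by simp
qed

lemma conv_diff:
  fixes f :: "real ^ 'n \<Rightarrow> 'b::euclidean_space"
  assumes k: "kernel e k" and f: "L1 f"
  shows "conv k f x - f x = (LBINT z. k z *R (f (x - z) - f x))" "L1 (\<lambda>z. k z *R (f (x - z) - f x))"
proof -
  note kc = kernel_C1c[OF k]
  have ik: "L1 k" using C1c_integrable[OF kc] by simp
  have i: "L1 (\<lambda>z. k z *R f (x - z))" by (rule conv_alt(2)[OF kc f])
  show "conv k f x - f x = (LBINT z. k z *R (f (x - z) - f x))"
    unfolding conv_alt(1)[OF kc f] scaleR_diff_right using i ik k by (simp add: kernel_def)
  show "L1 (\<lambda>z. k z *R (f (x - z) - f x))" unfolding scaleR_diff_right using i ik by simp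
qed

lemma conv_measurable:
  fixes f :: "real ^ 'n \<Rightarrow> 'b::euclidean_space"
  assumes k: "C1c UNIV k k'" and f: "L1 f"
  shows "conv k f \<in> Borel"
proof -
  note [measurable] = C1c_measurable[OF k] borel_measurable_integrable[OF f]
  have "conv k f \<in> borel_measurable lborel"
    unfolding conv_def by measurable
  then show ?thesis by simp
qed

text \<open>The kernel is a probability density, so Jensen's inequality bounds the modular of the
  mollification error by an average of modulars of translation differences over shifts of length
  below \<open>e\<close>.\<close>

lemma conv_diff_mdl:
  fixes f :: "real ^ 'n \<Rightarrow> 'b::euclidean_space"
  assumes y: "young \<Gamma>" and k: "kernel e k" and f: "L1 f"
    and d: "\<And>h. norm h < e \<Longrightarrow> mdl \<Gamma> (\<lambda>x. f (x - h) - f x) \<le> d"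
  shows "mdl \<Gamma> (\<lambda>x. conv k f x - f x) \<le> d"
proof -
  note kc = kernel_C1c[OF k]
  note [measurable] = C1c_measurable[OF kc] borel_measurable_integrable[OF f]
  have k0: "0 \<le> k x" "e \<le> norm x \<Longrightarrow> k x = 0" "(LBINT x. k x) = 1" for x
    using k by (auto simp: kernel_def)
  have ik: "L1 k" using C1c_integrable[OF kc] by simp
  define n where "n x z = norm (f (x - z) - f x)" for x z
  have [measurable]: "(\<lambda>(x, z). n x z) \<in> borel_measurable (borel \<Otimes>\<^sub>M borel)" unfolding n_def by measurable
  have \<Gamma>m[measurable]: "(\<lambda>(x, z). ennreal (\<Gamma> (n x z))) \<in> borel_measurable (borel \<Otimes>\<^sub>M borel)"
    using young_measurable[OF y, of "\<lambda>(x, z). f (x - z) - f x" "borel \<Otimes>\<^sub>M borel"]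
    unfolding n_def by (simp add: case_prod_beta')
  have nk: "(\<integral>\<^sup>+z. ennreal (k z) \<partial>lborel) = 1"
    using nn_integral_eq_integral[OF ik] k0 by simp
  have jensen: "ennreal (\<Gamma> (norm (conv k f x - f x))) \<le> (\<integral>\<^sup>+z. ennreal (k z) * ennreal (\<Gamma> (n x z)) \<partial>lborel)" for x
  proof -
    note eq = conv_diff(1)[OF k f] and i3 = conv_diff(2)[OF k f, of x]
    have i4: "L1 (\<lambda>z. k z * n x z)"
      using integrable_norm[OF i3] k0(1) by (simp add: n_def)
    define m where "m = (LBINT z. k z * n x z)"
    have m0: "m \<ge> 0" unfolding m_def using k0(1) by (intro integral_nonneg_AE) (auto simp: n_def)
    have "norm (conv k f x - f x) \<le> m"
      unfolding eq m_def using integral_norm_bound[of lborel "\<lambda>z. k z *R (f (x - z) - f x)"] k0(1)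
      by (simp add: n_def)
    then have "\<Gamma> (norm (conv k f x - f x)) \<le> \<Gamma> m" by (intro young_mono[OF y]) auto
    moreover have "ennreal (\<Gamma> m) \<le> (\<integral>\<^sup>+z. ennreal (k z) * ennreal (\<Gamma> (n x z)) \<partial>lborel)"
    proof (cases "(\<integral>\<^sup>+z. ennreal (k z) * ennreal (\<Gamma> (n x z)) \<partial>lborel) = \<infinity>")
      case False
      have "L1 (\<lambda>z. k z * \<Gamma> (n x z))"
      proof (rule integrableI_nonneg)
        show "(\<integral>\<^sup>+z. ennreal (k z * \<Gamma> (n x z)) \<partial>lborel) < \<infinity>"
          using False k0 by (simp add: ennreal_mult' less_top)
        show "(\<lambda>z. k z * \<Gamma> (n x z)) \<in> borel_measurable lborel"
          using young_measurable[OF y, of "\<lambda>z. f (x - z) - f x" lborel] unfolding n_def by measurable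
      qed (use k0 young_nonneg[OF y] in \<open>auto simp: n_def\<close>)
      note i5 = this
      obtain s where s: "s \<ge> 0" "\<And>t. t \<ge> 0 \<Longrightarrow> \<Gamma> m + s * (t - m) \<le> \<Gamma> t"
        using young_subgradient[OF y m0] by metis
      \<comment> \<open>Jensen by integrating the supporting line at the mean \<open>m\<close>
        against \<open>k\<close>: the linear term averages to zero.\<close>
      have "(LBINT z. k z * \<Gamma> m + s * (k z * n x z) - s * m * k z) \<le> (LBINT z. k z * \<Gamma> (n x z))"
      proof (rule integral_mono)
        show "L1 (\<lambda>z. k z * \<Gamma> m + s * (k z * n x z) - s * m * k z)"
          using ik i4 by simp
        show "k z * \<Gamma> m + s * (k z * n x z) - s * m * k z \<le> k z * \<Gamma> (n x z)" for z
          using mult_left_mono[OF s(2)[of "n x z"] k0(1)[of z]] by (simp add: n_def algebra_simps)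
      qed (rule i5)
      moreover have "(LBINT z. k z * \<Gamma> m + s * (k z * n x z) - s * m * k z) = \<Gamma> m"
        using ik i4 k0(3) by (simp add: m_def)
      ultimately have "ennreal (\<Gamma> m) \<le> ennreal (LBINT z. k z * \<Gamma> (n x z))" by (simp add: ennreal_leI)
      also have "\<dots> = (\<integral>\<^sup>+z. ennreal (k z * \<Gamma> (n x z)) \<partial>lborel)"
        by (rule nn_integral_eq_integral[symmetric, OF i5]) (use k0 young_nonneg[OF y] in \<open>auto simp: n_def\<close>)
      finally show ?thesis using k0 by (simp add: ennreal_mult')
    qed simp
    ultimately show ?thesis using ennreal_leI order_trans by blast
  qed
  have "mdl \<Gamma> (\<lambda>x. conv k f x - f x) \<le> (\<integral>\<^sup>+x. \<integral>\<^sup>+z. ennreal (k z) * ennreal (\<Gamma> (n x z)) \<partial>lborel \<partial>lborel)"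
    unfolding mdl_def by (intro nn_integral_mono jensen)
  also have "\<dots> = (\<integral>\<^sup>+z. \<integral>\<^sup>+x. ennreal (k z) * ennreal (\<Gamma> (n x z)) \<partial>lborel \<partial>lborel)"
    by (rule lborel_pair.Fubini'[symmetric]) measurable
  also have "\<dots> = (\<integral>\<^sup>+z. ennreal (k z) * mdl \<Gamma> (\<lambda>x. f (x - z) - f x) \<partial>lborel)"
  proof (rule nn_integral_cong)
    fix z :: "real ^ 'n"
    have "(\<lambda>x. \<Gamma> (n x z)) \<in> Borel"
      unfolding n_def by (rule young_measurable[OF y]) measurable
    then have [measurable]: "(\<lambda>x. ennreal (\<Gamma> (n x z))) \<in> Borel" by measurable
    show "(\<integral>\<^sup>+x. ennreal (k z) * ennreal (\<Gamma> (n x z)) \<partial>lborel) = ennreal (k z) * mdl \<Gamma> (\<lambda>x. f (x - z) - f x)"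
      using nn_integral_cmult[of "\<lambda>x. ennreal (\<Gamma> (n x z))" lborel "ennreal (k z)"]
      by (simp add: mdl_def n_def[symmetric])
  qed
  also have "\<dots> \<le> (\<integral>\<^sup>+z. ennreal (k z) * d \<partial>lborel)"
  proof (rule nn_integral_mono)
    fix z show "ennreal (k z) * mdl \<Gamma> (\<lambda>x. f (x - z) - f x) \<le> ennreal (k z) * d"
      by (cases "norm z < e") (use d k0 in \<open>auto intro: mult_left_mono\<close>)
  qed
  also have "\<dots> = d" by (subst nn_integral_multc) (auto simp: nk)
  finally show ?thesis .
qed

lemma conv_mdl_tendsto:
  fixes f :: "real ^ 'n \<Rightarrow> 'b::euclidean_space"
  assumes y: "young \<Gamma>" and f: "L1 f" and fin: "mdl \<Gamma> f < \<infinity>" and k: "\<And>n. kernel (r n) (k n)" "r \<longlonglongrightarrow> 0"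
  shows "(\<lambda>n. mdl \<Gamma> (\<lambda>x. conv (k n) f x - f x)) \<longlonglongrightarrow> 0"
proof (rule order_tendstoI)
  fix a :: ennreal assume "0 < a"
  then obtain b where b: "0 < b" "b < a" using dense by blast
  then obtain e where e: "b = ennreal e" "0 < e" by (cases b) auto
  obtain d where d: "d > 0" "\<And>h. norm h < d \<Longrightarrow> mdl \<Gamma> (\<lambda>x. f (x - h) - f x) \<le> ennreal e"
    using mdl_translation_continuous[OF y f fin e(2)] by blast
  show "\<forall>\<^sub>F n in sequentially. mdl \<Gamma> (\<lambda>x. conv (k n) f x - f x) < a"
    using order_tendstoD(2)[OF k(2) d(1)]
  proof eventually_elim
    case (elim n)
    have "mdl \<Gamma> (\<lambda>x. conv (k n) f x - f x) \<le> b"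
      unfolding e by (rule conv_diff_mdl[OF y k(1) f]) (use d(2) elim in auto)
    then show ?case using b(2) by simp
  qed
qed simp

text \<open>The factor \<open>a\<close> is C1 on \<open>U\<close> only. The product is controlled on
  the open cover consisting of \<open>U\<close> and the complement of the support \<open>K\<close>,
  where it is zero.\<close>

lemma C1c_mult_local:
  fixes a :: "real ^ 'n \<Rightarrow> real"
  assumes U: "open U" and \<zeta>: "C1c U \<zeta> \<zeta>'" and a: "\<And>x. x \<in> U \<Longrightarrow> GDERIV a x :> a' x" "continuous_on U a'"
  shows "C1c U (\<lambda>x. \<zeta> x * a x) (\<lambda>x. \<zeta> x *R a' x + a x *R \<zeta>' x)"
proof -
  obtain K where K: "compact K" "K \<subseteq> U" "\<And>x. x \<notin> K \<Longrightarrow> \<zeta> x = 0" "\<And>x. x \<notin> K \<Longrightarrow> \<zeta>' x = 0"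
    using \<zeta> unfolding C1c_def by blast
  have \<zeta>d: "GDERIV \<zeta> x :> \<zeta>' x" for x using \<zeta> by (simp add: C1c_def)
  have \<zeta>c: "continuous_on UNIV \<zeta>'" using \<zeta> by (simp add: C1c_def)
  have oK: "open (- K)" using K(1) by (simp add: compact_imp_closed open_Compl)
  have "GDERIV (\<lambda>x. \<zeta> x * a x) x :> \<zeta> x *R a' x + a x *R \<zeta>' x" for x
  proof (cases "x \<in> U")
    case True
    then show ?thesis using GDERIV_mult[OF \<zeta>d a(1)[OF True]] by simp
  next
    case False
    then have "x \<in> - K" using K(2) by blast
    have "((\<lambda>y. 0) has_derivative (\<lambda>h. inner h (0 :: real ^ 'n))) (at x)" by simp
    then have "((\<lambda>x. \<zeta> x * a x) has_derivative (\<lambda>h. inner h 0)) (at x)"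
      by (rule has_derivative_transform_within_open[OF _ oK \<open>x \<in> - K\<close>]) (simp add: K(3))
    moreover have "\<zeta> x *R a' x + a x *R \<zeta>' x = 0" using \<open>x \<in> - K\<close> K by simp
    ultimately show ?thesis by (simp add: gderiv_def)
  qed
  moreover have "continuous_on UNIV (\<lambda>x. \<zeta> x *R a' x + a x *R \<zeta>' x)"
  proof -
    have "continuous_on U (\<lambda>x. \<zeta> x *R a' x + a x *R \<zeta>' x)"
      using continuous_on_subset[OF C1c_cont[OF \<zeta>]] continuous_on_subset[OF \<zeta>c] a(2) GDERIV_continuous_on[OF a(1)]
      by (intro continuous_intros) auto
    moreover have "continuous_on (- K) (\<lambda>x. \<zeta> x *R a' x + a x *R \<zeta>' x)"
      using continuous_on_const[of "- K" "0 :: real ^ 'n"]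
      by (rule continuous_on_eq) (simp add: K)
    ultimately have "continuous_on (U \<union> - K) (\<lambda>x. \<zeta> x *R a' x + a x *R \<zeta>' x)"
      by (rule continuous_on_open_Un[OF U oK])
    moreover have "U \<union> - K = UNIV" using K(2) by blast
    ultimately show ?thesis by simp
  qed
  ultimately show ?thesis unfolding C1c_def using K by (intro conjI exI[of _ K]) auto
qed

lemma C1c_mono: "C1c U \<phi> \<phi>' \<Longrightarrow> U \<subseteq> V \<Longrightarrow> C1c V \<phi> \<phi>'"
  unfolding C1c_def by blast

section \<open>Weak gradients of functions extended by zero\<close>

text \<open>Function and gradient live on the whole space and vanish off \<Omega>, but the identity
  is tested only inside \<Omega>. Hence nothing is claimed across the frontier, while translation,
  cutoff and whole-space integrals remain available.\<close>

definition wgrad :: "(real ^ 'n) set \<Rightarrow> (real ^ 'n \<Rightarrow> real) \<Rightarrow> (real ^ 'n \<Rightarrow> real ^ 'n) \<Rightarrow> bool" where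
  "wgrad \<Omega> f F \<longleftrightarrow> L1 f \<and> L1 F \<and> (\<forall>x. x \<notin> \<Omega> \<longrightarrow> f x = 0 \<and> F x = 0) \<and>
     (\<forall>\<phi> \<phi>'. C1c \<Omega> \<phi> \<phi>' \<longrightarrow> (LBINT x. f x *R \<phi>' x) = - (LBINT x. \<phi> x *R F x))"

lemma wgradD:
  assumes "wgrad \<Omega> f F"
  shows "L1 f" "L1 F" "x \<notin> \<Omega> \<Longrightarrow> f x = 0" "x \<notin> \<Omega> \<Longrightarrow> F x = 0"
    "C1c \<Omega> \<phi> \<phi>' \<Longrightarrow> (LBINT x. f x *R \<phi>' x) = - (LBINT x. \<phi> x *R F x)"
    "f \<in> Borel" "F \<in> Borel"
  using assms unfolding wgrad_def by auto

lemma C1c_test_integrable: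
  fixes F :: "real ^ 'n \<Rightarrow> real ^ 'n"
  assumes "C1c \<Omega> \<phi> \<phi>'" "L1 f" "L1 F"
  shows "L1 (\<lambda>x. f x *R \<phi>' x)" "L1 (\<lambda>x. \<phi> x *R F x)"
proof -
  obtain B where B: "B > 0" "\<And>x. norm (\<phi> x) \<le> B" "\<And>x. norm (\<phi>' x) \<le> B" using C1c_bounded[OF assms(1)] by metis
  note [measurable] = C1c_measurable[OF assms(1)]
  show "L1 (\<lambda>x. f x *R \<phi>' x)"
    by (rule integrable_scaleR_bounded[OF assms(2), of _ B]) (use B in auto)
  show "L1 (\<lambda>x. \<phi> x *R F x)"
    by (rule integrable_bounded_scaleR[OF assms(3), of _ B]) (use B in auto)
qed

lemma wgrad_add:
  assumes "wgrad \<Omega> f F" "wgrad \<Omega> g G"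
  shows "wgrad \<Omega> (\<lambda>x. f x + g x) (\<lambda>x. F x + G x)"
  unfolding wgrad_def
proof (intro conjI allI impI)
  fix \<phi> \<phi>' assume c: "C1c \<Omega> \<phi> \<phi>'"
  note i = C1c_test_integrable[OF c wgradD(1,2)[OF assms(1)]] C1c_test_integrable[OF c wgradD(1,2)[OF assms(2)]]
  show "(LBINT x. (f x + g x) *R \<phi>' x) = - (LBINT x. \<phi> x *R (F x + G x))"
    using i wgradD(5)[OF assms(1) c] wgradD(5)[OF assms(2) c]
    by (simp add: scaleR_add_left scaleR_add_right)
qed (use wgradD[OF assms(1)] wgradD[OF assms(2)] in auto)

lemma wgrad_scale:
  assumes "wgrad \<Omega> f F"
  shows "wgrad \<Omega> (\<lambda>x. c * f x) (\<lambda>x. c *R F x)"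
  unfolding wgrad_def
proof (intro conjI allI impI)
  fix \<phi> \<phi>' assume c: "C1c \<Omega> \<phi> \<phi>'"
  note i = C1c_test_integrable[OF c wgradD(1,2)[OF assms(1)]]
  have "(LBINT x. (c * f x) *R \<phi>' x) = (LBINT x. c *R (f x *R \<phi>' x))" by simp
  also have "\<dots> = c *R (LBINT x. f x *R \<phi>' x)" by (rule integral_scaleR_right)
  also have "\<dots> = - (c *R (LBINT x. \<phi> x *R F x))" using wgradD(5)[OF assms c] by simp
  also have "\<dots> = - (LBINT x. c *R (\<phi> x *R F x))" by (simp only: integral_scaleR_right)
  finally show "(LBINT x. (c * f x) *R \<phi>' x) = - (LBINT x. \<phi> x *R (c *R F x))"
    by (simp add: mult.commute)
qed (use wgradD[OF assms(1)] in auto)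

lemma wgrad_diff:
  assumes "wgrad \<Omega> f F" "wgrad \<Omega> g G"
  shows "wgrad \<Omega> (\<lambda>x. f x - g x) (\<lambda>x. F x - G x)"
  using wgrad_add[OF assms(1) wgrad_scale[OF assms(2), of "-1"]] by simp

lemma wgrad_cong_AE:
  assumes w: "wgrad \<Omega> f F" and "AE x in lborel. f x = g x" "AE x in lborel. F x = G x"
    and [measurable]: "g \<in> Borel" "G \<in> Borel"
    and z: "\<And>x. x \<notin> \<Omega> \<Longrightarrow> g x = 0 \<and> G x = 0"
  shows "wgrad \<Omega> g G"
  unfolding wgrad_def
proof (intro conjI allI impI)
  note [measurable] = wgradD(6,7)[OF w]
  show "L1 g"
    using wgradD(1)[OF w] by (rule integrable_cong_AE_imp) (use assms in auto)
  show "L1 G"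
    using wgradD(2)[OF w] by (rule integrable_cong_AE_imp) (use assms in auto)
  fix \<phi> \<phi>' assume c: "C1c \<Omega> \<phi> \<phi>'"
  note [measurable] = C1c_measurable[OF c]
  have "(LBINT x. f x *R \<phi>' x) = (LBINT x. g x *R \<phi>' x)"
    by (rule integral_cong_AE) (use assms(2) in auto)
  moreover have "(LBINT x. \<phi> x *R F x) = (LBINT x. \<phi> x *R G x)"
    by (rule integral_cong_AE) (use assms(3) in auto)
  ultimately show "(LBINT x. g x *R \<phi>' x) = - (LBINT x. \<phi> x *R G x)"
    using wgradD(5)[OF w c] by simp
qed (use z in auto)

lemma wgrad_restrict:
  assumes w: "wgrad \<Omega> f F" and U: "open U" "U \<subseteq> \<Omega>"
  shows "wgrad U (\<lambda>x. indicator U x * f x) (\<lambda>x. indicator U x *R F x)"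
  unfolding wgrad_def
proof (intro conjI allI impI)
  have [measurable]: "U \<in> sets borel" using U by simp
  show "L1 (\<lambda>x. indicator U x * f x)"
    using integrable_mult_indicator[OF _ wgradD(1)[OF w], of U] by simp
  show "L1 (\<lambda>x. indicator U x *R F x)"
    using integrable_mult_indicator[OF _ wgradD(2)[OF w], of U] by simp
  fix \<phi> \<phi>' assume c: "C1c U \<phi> \<phi>'"
  have z: "\<phi> x = 0 \<and> \<phi>' x = 0" if "x \<notin> U" for x using c that unfolding C1c_def by blast
  have "(LBINT x. (indicator U x * f x) *R \<phi>' x) = (LBINT x. f x *R \<phi>' x)"
    by (rule Bochner_Integration.integral_cong) (use z in \<open>auto simp: indicator_def\<close>)
  moreover have "(LBINT x. \<phi> x *R (indicator U x *R F x)) = (LBINT x. \<phi> x *R F x)"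
    by (rule Bochner_Integration.integral_cong) (use z in \<open>auto simp: indicator_def\<close>)
  ultimately show "(LBINT x. (indicator U x * f x) *R \<phi>' x) = - (LBINT x. \<phi> x *R (indicator U x *R F x))"
    using wgradD(5)[OF w C1c_mono[OF c U(2)]] by simp
qed auto

lemma GDERIV_translate:
  assumes "GDERIV f (x + a) :> D"
  shows "GDERIV (\<lambda>x. f (x + a)) x :> D"
proof -
  have "((\<lambda>x. f (x + a)) has_derivative (\<lambda>h. inner h D)) (at x)"
    by (rule has_derivative_compose[of "\<lambda>x. x + a" "\<lambda>h. h" x UNIV f "\<lambda>h. inner h D"])
      (use assms in \<open>auto simp: gderiv_def intro!: derivative_eq_intros\<close>)
  then show ?thesis by (simp add: gderiv_def)
qed

lemma wgrad_translate:
  assumes w: "wgrad \<Omega> f F"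
  shows "wgrad ((\<lambda>x. x - a) ` \<Omega>) (\<lambda>x. f (x + a)) (\<lambda>x. F (x + a))"
  unfolding wgrad_def
proof (intro conjI allI impI)
  show "L1 (\<lambda>x. f (x + a))" "L1 (\<lambda>x. F (x + a))"
    using lborel_integrable_translation wgradD[OF w] by auto
  show "f (x + a) = 0" "F (x + a) = 0" if "x \<notin> (\<lambda>x. x - a) ` \<Omega>" for x
  proof -
    have "x + a \<notin> \<Omega>" using that by (metis add_diff_cancel_right' image_eqI)
    then show "f (x + a) = 0" "F (x + a) = 0" using wgradD[OF w] by auto
  qed
  fix \<phi> \<phi>' assume c: "C1c ((\<lambda>x. x - a) ` \<Omega>) \<phi> \<phi>'"
  have c2: "C1c \<Omega> (\<lambda>x. \<phi> (x + (- a))) (\<lambda>x. \<phi>' (x + (- a)))"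
  proof -
    obtain K where K: "compact K" "K \<subseteq> (\<lambda>x. x - a) ` \<Omega>" "\<forall>x. x \<notin> K \<longrightarrow> \<phi> x = 0 \<and> \<phi>' x = 0"
      using c unfolding C1c_def by blast
    have "compact ((+) a ` K)" using compact_translation[OF K(1)] .
    moreover have "(+) a ` K \<subseteq> \<Omega>" using K(2) by auto
    moreover have "\<phi> (x + (- a)) = 0 \<and> \<phi>' (x + (- a)) = 0" if "x \<notin> (+) a ` K" for x
    proof -
      have "x + - a \<notin> K"
      proof
        assume "x + - a \<in> K"
        then have "a + (x + - a) \<in> (+) a ` K" by blast
        with that show False by simp
      qed
      then show ?thesis using K(3) by blast
    qed
    moreover have "continuous_on UNIV (\<lambda>x. \<phi>' (x + (- a)))"
    proof (rule continuous_on_compose2[of UNIV \<phi>'])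
      show "continuous_on UNIV \<phi>'" using c by (simp add: C1c_def)
      show "continuous_on UNIV (\<lambda>x. x + - a)" by (intro continuous_intros)
    qed simp
    moreover have "GDERIV (\<lambda>x. \<phi> (x + - a)) x :> \<phi>' (x + - a)" for x
      by (rule GDERIV_translate) (use c in \<open>auto simp: C1c_def\<close>)
    ultimately show ?thesis unfolding C1c_def by blast
  qed
  have "(LBINT x. f (x + a) *R \<phi>' x) = (LBINT x. f x *R \<phi>' (x + - a))"
    using lborel_integral_translation[of "\<lambda>x. f x *R \<phi>' (x + - a)" a] by simp
  also have "\<dots> = - (LBINT x. \<phi> (x + - a) *R F x)" by (rule wgradD(5)[OF w c2])
  also have "\<dots> = - (LBINT x. \<phi> x *R F (x + a))"
    using lborel_integral_translation[of "\<lambda>x. \<phi> (x + - a) *R F x" a] by simp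
  finally show "(LBINT x. f (x + a) *R \<phi>' x) = - (LBINT x. \<phi> x *R F (x + a))" .
qed

lemma C1c_wgrad:
  assumes "C1c \<Omega> \<phi> \<phi>'"
  shows "wgrad \<Omega> \<phi> \<phi>'"
  unfolding wgrad_def
proof (intro conjI allI impI)
  fix \<psi> \<psi>' assume c: "C1c \<Omega> \<psi> \<psi>'"
  have "C1c UNIV (\<lambda>x. \<phi> x * \<psi> x) (\<lambda>x. \<phi> x *R \<psi>' x + \<psi> x *R \<phi>' x)"
    by (rule C1c_mult_local[OF open_UNIV C1c_mono[OF assms subset_UNIV]]) (use c in \<open>auto simp: C1c_def\<close>)
  from C1c_integral_gradient[OF this]
  have "(LBINT x. \<phi> x *R \<psi>' x + \<psi> x *R \<phi>' x) = 0" .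
  moreover have "L1 (\<lambda>x. \<phi> x *R \<psi>' x)" "L1 (\<lambda>x. \<psi> x *R \<phi>' x)"
    using C1c_test_integrable[OF c C1c_integrable[OF assms]] by auto
  ultimately show "(LBINT x. \<phi> x *R \<psi>' x) = - (LBINT x. \<psi> x *R \<phi>' x)"
    by (simp add: eq_neg_iff_add_eq_0)
qed (use C1c_integrable[OF assms] assms in \<open>auto simp: C1c_def\<close>)

text \<open>A test function on \<open>U\<close> times \<open>f\<close> is C1 with compact support in
  \<open>U\<close>, so the integral of its gradient is zero; boundedness on the bounded set
  \<open>U\<close> supplies integrability.\<close>

lemma C1_bounded_wgrad:
  fixes f :: "real ^ 'n \<Rightarrow> real"
  assumes U: "open U" "bounded U" and d: "\<And>x. x \<in> U \<Longrightarrow> GDERIV f x :> f' x" "continuous_on U f'"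
    and b: "\<And>x. x \<in> U \<Longrightarrow> \<bar>f x\<bar> \<le> B" "\<And>x. x \<in> U \<Longrightarrow> norm (f' x) \<le> B"
  shows "wgrad U (\<lambda>x. indicator U x * f x) (\<lambda>x. indicator U x *R f' x)"
  unfolding wgrad_def
proof (intro conjI allI impI)
  have [measurable]: "U \<in> sets borel" using U by simp
  have fin: "emeasure lborel U < \<infinity>" using emeasure_bounded_finite[OF U(2)] .
  have iU: "L1 (\<lambda>x. indicator U x *R B)" using fin by simp
  have m1: "(\<lambda>x. indicator U x *R f x) \<in> Borel"
    using borel_measurable_continuous_on_indicator[OF _ GDERIV_continuous_on[OF d(1)], of U] by simp
  have m2: "(\<lambda>x. indicator U x *R f' x) \<in> Borel"
    using borel_measurable_continuous_on_indicator[OF _ d(2)] by simp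
  show i1: "L1 (\<lambda>x. indicator U x * f x)"
    using iU
  proof (rule Bochner_Integration.integrable_bound)
    show "AE x in lborel. norm (indicator U x * f x) \<le> norm (indicator U x *R B)"
      by (rule AE_I2) (use b(1) order_trans[OF _ abs_ge_self] in \<open>auto simp: indicator_def\<close>)
  qed (use m1 in simp)
  show i2: "L1 (\<lambda>x. indicator U x *R f' x)"
    using iU
  proof (rule Bochner_Integration.integrable_bound)
    show "AE x in lborel. norm (indicator U x *R f' x) \<le> norm (indicator U x *R B)"
      by (rule AE_I2) (use b(2) order_trans[OF _ abs_ge_self] in \<open>auto simp: indicator_def\<close>)
  qed (use m2 in simp)
  fix \<psi> \<psi>' assume c: "C1c U \<psi> \<psi>'"
  have z: "\<psi> x = 0 \<and> \<psi>' x = 0" if "x \<notin> U" for x using c that unfolding C1c_def by blast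
  have "C1c U (\<lambda>x. \<psi> x * f x) (\<lambda>x. \<psi> x *R f' x + f x *R \<psi>' x)"
    by (rule C1c_mult_local[OF U(1) c d])
  from C1c_integral_gradient[OF this]
  have "(LBINT x. \<psi> x *R f' x + f x *R \<psi>' x) = 0" .
  moreover have "(\<lambda>x. \<psi> x *R f' x + f x *R \<psi>' x) = (\<lambda>x. \<psi> x *R (indicator U x *R f' x) + (indicator U x * f x) *R \<psi>' x)"
    using z by (auto simp: indicator_def fun_eq_iff)
  ultimately have "(LBINT x. \<psi> x *R (indicator U x *R f' x) + (indicator U x * f x) *R \<psi>' x) = 0" by simp
  then show "(LBINT x. (indicator U x * f x) *R \<psi>' x) = - (LBINT x. \<psi> x *R (indicator U x *R f' x))"
    using C1c_test_integrable[OF c i1 i2]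
    by (subst (asm) Bochner_Integration.integral_add) (auto simp: eq_neg_iff_add_eq_0 add.commute)
qed auto

lemma conv_diff_bound:
  fixes f :: "real ^ 'n \<Rightarrow> 'b::euclidean_space"
  assumes k: "kernel e k" and f: "L1 f"
    and d: "\<And>h. norm h < e \<Longrightarrow> norm (f (x - h) - f x) \<le> d"
  shows "norm (conv k f x - f x) \<le> d"
proof -
  have k0: "0 \<le> k x" "e \<le> norm x \<Longrightarrow> k x = 0" "(LBINT x. k x) = 1" for x
    using k by (auto simp: kernel_def)
  have "norm (conv k f x - f x) \<le> (LBINT z. norm (k z *R (f (x - z) - f x)))"
    unfolding conv_diff(1)[OF k f] by (rule integral_norm_bound)
  also have "\<dots> \<le> (LBINT z. d * k z)"
  proof (rule integral_mono)
    show "norm (k z *R (f (x - z) - f x)) \<le> d * k z" for z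
      using mult_left_mono[OF d[of z] k0(1)[of z]] k0(1,2)[of z]
      by (cases "norm z < e") (auto simp: mult.commute)
  qed (use integrable_norm[OF conv_diff(2)[OF k f]] C1c_integrable[OF kernel_C1c[OF k]] in auto)
  also have "\<dots> = d" using k0(3) by simp
  finally show ?thesis .
qed

lemma GDERIV_reflect:
  assumes "GDERIV k (x - y) :> D"
  shows "GDERIV (\<lambda>y. c * k (x - y)) y :> (- c) *R D"
proof -
  have "((\<lambda>y. k (x - y)) has_derivative (\<lambda>h. inner (- h) D)) (at y)"
    by (rule has_derivative_compose[of "\<lambda>y. x - y" "\<lambda>h. - h" y UNIV k "\<lambda>h. inner h D"])
      (use assms in \<open>auto simp: gderiv_def intro!: derivative_eq_intros\<close>)
  from has_derivative_mult_right[OF this, of c] show ?thesis by (simp add: gderiv_def)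
qed

lemma Ck_reflect:
  assumes "\<And>j. Ck j k"
  shows "Ck j (\<lambda>y. c * k (x - y))"
  using assms
proof (induction j arbitrary: k c)
  case 0
  have "continuous_on UNIV k" using 0[of 0] by simp
  then have "continuous_on UNIV (\<lambda>y. k (x - y))"
    by (rule continuous_on_compose2) (auto intro: continuous_intros)
  then show ?case by (simp add: continuous_on_mult_left)
next
  case (Suc j)
  note g = GDERIV_reflect[OF Ck1_GDERIV(1)[OF Suc.prems], of c x]
  have "gradient (\<lambda>y. c * k (x - y)) y $ i = (- c) * (gradient k (x - y) $ i)" for y i
    unfolding GDERIV_gradient_eq[OF g] by simp
  moreover have "Ck j (\<lambda>y. (- c) * (gradient k (x - y) $ i))" for i
    using Suc.IH[of "\<lambda>z. gradient k z $ i" "- c"] Suc.prems[of "Suc _"] by simp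
  moreover have "(\<lambda>y. c * k (x - y)) differentiable (at y)" for y
    using g unfolding gderiv_def differentiable_def by blast
  ultimately show ?case by simp
qed

lemma kernel_reflect_test:
  assumes k: "kernel e k" and "cball x e \<subseteq> \<Omega>"
  shows "(\<lambda>y. k (x - y)) \<in> test_functions \<Omega>"
proof (rule test_functionsI[of _ "cball x e"])
  show "Ck j (\<lambda>y. k (x - y))" for j
    using Ck_reflect[of k j 1 x] k by (simp add: kernel_def)
  show "k (x - y) = 0" if "y \<notin> cball x e" for y
    using that k by (simp add: kernel_def dist_norm)
qed (use assms in auto)

text \<open>The reflected kernel centred at \<open>x\<close> is itself a test function as soon as
  the ball of radius \<open>e\<close> lies in \<Omega>.\<close>

lemma conv_wgrad:
  assumes w: "wgrad \<Omega> f F" and k: "kernel e k" and x: "cball x e \<subseteq> \<Omega>"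
  shows "GDERIV (conv k f) x :> conv k F x"
proof -
  have "gradient (\<lambda>y. k (x - y)) y = - gradient k (x - y)" for y
    using GDERIV_gradient_eq[OF GDERIV_reflect[of k x y "gradient k (x - y)" 1]] kernel_C1c[OF k] by (simp add: C1c_def)
  with wgradD(5)[OF w test_functions_C1c[OF kernel_reflect_test[OF k x]]]
  have "(LBINT y. f y *R (- gradient k (x - y))) = - (LBINT y. k (x - y) *R F y)" by simp
  then have "(LBINT y. f y *R gradient k (x - y)) = conv k F x"
    by (simp add: conv_def)
  with conv_GDERIV[OF kernel_C1c[OF k] wgradD(1)[OF w]] show ?thesis by metis
qed

lemma compact_cball_nbhd:
  fixes K :: "'a::euclidean_space set"
  assumes "compact K" "K \<subseteq> U" "open U"
  obtains d where "d > 0" "\<And>x. x \<in> K \<Longrightarrow> cball x d \<subseteq> U"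
proof -
  obtain d where d: "d > 0" "\<And>x y. x \<in> K \<Longrightarrow> y \<in> - U \<Longrightarrow> d \<le> dist x y"
  proof -
    have "closed (- U)" "K \<inter> - U = {}" using assms by auto
    from separate_compact_closed[OF assms(1) this] that show ?thesis by blast
  qed
  have "cball x (d / 2) \<subseteq> U" if "x \<in> K" for x
  proof
    fix z assume "z \<in> cball x (d / 2)"
    then show "z \<in> U" using d(2)[OF that, of z] d(1) by (cases "z \<in> U") auto
  qed
  with d(1) that[of "d / 2"] show thesis by simp
qed

lemma conv_test_function:
  fixes f :: "real ^ 'n \<Rightarrow> real"
  assumes k: "kernel r k" and f: "L1 f" and K: "compact K" "\<And>x. x \<notin> K \<Longrightarrow> f x = 0" "\<And>x. x \<in> K \<Longrightarrow> cball x r \<subseteq> \<Omega>"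
  shows "conv k f \<in> test_functions \<Omega>"
proof (rule test_functionsI)
  define K' where "K' = {x + y |x y. x \<in> K \<and> y \<in> cball 0 r}"
  show "Ck j (conv k f)" for j
    by (rule Ck_conv[OF f, of k "cball 0 r"]) (use k in \<open>auto simp: kernel_def\<close>)
  show "compact K'" unfolding K'_def by (rule compact_sums[OF K(1) compact_cball])
  show "K' \<subseteq> \<Omega>"
  proof
    fix z assume "z \<in> K'"
    then obtain x y where "z = x + y" "x \<in> K" "y \<in> cball 0 r" unfolding K'_def by blast
    then show "z \<in> \<Omega>" using K(3)[of x] by (auto simp: dist_norm subset_iff)
  qed
  show "conv k f x = 0" if "x \<notin> K'" for x
  proof -
    have z: "k (x - y) *R f y = 0" for y
    proof (cases "y \<in> K")
      case True
      then have "x - y \<notin> cball 0 r" using that unfolding K'_def by force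
      then show ?thesis using k by (simp add: kernel_def)
    qed (simp add: K)
    show ?thesis unfolding conv_def z by simp
  qed
qed

text \<open>Mollifying at scale \<open>e = d / 3\<close> the indicator of the
  \<open>2 * e\<close>-neighbourhood of \<open>K\<close> gives the value 1 within distance
  \<open>e\<close> of \<open>K\<close> and 0 beyond \<open>3 * e = d\<close>.\<close>

lemma cutoff:
  fixes K :: "(real ^ 'n) set"
  assumes "compact K" "K \<subseteq> U" "open U"
  obtains \<zeta> \<zeta>' where "C1c U \<zeta> \<zeta>'" "\<And>x. x \<in> K \<Longrightarrow> \<zeta> x = 1" "\<And>x. x \<in> K \<Longrightarrow> \<zeta>' x = 0"
proof -
  obtain d where d: "d > 0" "\<And>x. x \<in> K \<Longrightarrow> cball x d \<subseteq> U"
    by (rule compact_cball_nbhd[OF assms], rule that)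
  define e where "e = d / 3"
  have e: "e > 0" using d by (simp add: e_def)
  obtain k :: "real ^ 'n \<Rightarrow> real" where k: "kernel e k" using ex_kernel[OF e] by blast
  define K2 where "K2 = {x + y |x y. x \<in> K \<and> y \<in> cball 0 (2 * e)}"
  have cK2: "compact K2" unfolding K2_def by (rule compact_sums[OF assms(1) compact_cball])
  then have [measurable]: "K2 \<in> sets borel" by (simp add: borel_compact)
  have K2: "z \<in> K2" if "x \<in> K" "norm (z - x) \<le> 2 * e" for x z
  proof -
    have "z = x + (z - x) \<and> z - x \<in> cball 0 (2 * e)" using that by simp
    then show ?thesis using \<open>x \<in> K\<close> unfolding K2_def by blast
  qed
  define f :: "real ^ 'n \<Rightarrow> real" where "f = indicator K2"
  have f: "L1 f"
    unfolding f_def using emeasure_compact_finite[OF cK2] by simp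
  have C: "C1c U (conv k f) (gradient (conv k f))"
  proof (rule test_functions_C1c, rule conv_test_function[OF k f cK2])
    fix x assume "x \<in> K2"
    then obtain a b where a: "x = a + b" "a \<in> K" "norm b \<le> 2 * e" unfolding K2_def by auto
    have "cball x e \<subseteq> cball a d" using a by (simp add: cball_subset_cball_iff dist_norm e_def)
    with d(2)[OF a(2)] show "cball x e \<subseteq> U" by blast
  qed (simp add: f_def)
  have one: "conv k f y = 1" if "x \<in> K" "y \<in> ball x e" for x y
  proof -
    have y: "norm (y - x) < e" using that(2) by (simp add: dist_norm norm_minus_commute)
    have "norm (conv k f y - f y) \<le> 0"
    proof (rule conv_diff_bound[OF k f])
      fix h :: "real ^ 'n" assume "norm h < e"
      then have "norm (y - x) \<le> 2 * e" "norm (y - h - x) \<le> 2 * e"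
        using y e norm_triangle_ineq4[of "y - x" h] by (auto simp: algebra_simps)
      then show "norm (f (y - h) - f y) \<le> 0" using K2[OF that(1)] by (simp add: f_def)
    qed
    moreover have "y \<in> K2" using K2[OF that(1)] y e by simp
    ultimately show ?thesis by (simp add: f_def)
  qed
  have "conv k f x = 1" if "x \<in> K" for x using one[OF that, of x] e by simp
  moreover have "gradient (conv k f) x = 0" if "x \<in> K" for x
  proof (rule GDERIV_zero_open[of "\<lambda>y. conv k f y - 1" x _ "ball x e"])
    show "GDERIV (\<lambda>y. conv k f y - 1) x :> gradient (conv k f) x"
      using GDERIV_diff[of "conv k f" x "gradient (conv k f) x" "\<lambda>y. 1" 0] C
      by (simp add: C1c_def GDERIV_const)
  qed (use one[OF that] e in auto)
  ultimately show thesis using that C by blast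
qed

text \<open>Multiplying a test function on \<Omega> by \<zeta> confines its support to a compact
  part of \<open>U\<close>, and this changes nothing where \<open>f\<close> or \<open>F\<close> is
  nonzero. Since \<open>S\<close> is merely closed, \<open>U\<close> may reach the frontier of
  \<Omega>.\<close>

lemma wgrad_extend:
  assumes w: "wgrad U f F" and U: "open U" "U \<subseteq> \<Omega>"
    and \<zeta>: "\<And>x. GDERIV \<zeta> x :> \<zeta>' x" "continuous_on UNIV \<zeta>'"
    and S: "closed S" "S \<inter> \<Omega> \<subseteq> U" "\<And>x. x \<notin> S \<Longrightarrow> \<zeta> x = 0 \<and> \<zeta>' x = 0"
    and one: "\<And>x. f x \<noteq> 0 \<or> F x \<noteq> 0 \<Longrightarrow> \<zeta> x = 1 \<and> \<zeta>' x = 0"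
  shows "wgrad \<Omega> f F"
  unfolding wgrad_def
proof (intro conjI allI impI)
  show "f x = 0" "F x = 0" if "x \<notin> \<Omega>" for x using wgradD(3,4)[OF w, of x] that U(2) by blast+
  fix \<phi> \<phi>' assume c: "C1c \<Omega> \<phi> \<phi>'"
  obtain K where K: "compact K" "K \<subseteq> \<Omega>" "\<And>x. x \<notin> K \<Longrightarrow> \<phi> x = 0" "\<And>x. x \<notin> K \<Longrightarrow> \<phi>' x = 0"
    using c unfolding C1c_def by blast
  have "C1c UNIV (\<lambda>x. \<phi> x * \<zeta> x) (\<lambda>x. \<phi> x *R \<zeta>' x + \<zeta> x *R \<phi>' x)"
    by (rule C1c_mult_local[OF open_UNIV C1c_mono[OF c subset_UNIV]]) (use \<zeta> in auto)
  then have c2: "C1c U (\<lambda>x. \<phi> x * \<zeta> x) (\<lambda>x. \<phi> x *R \<zeta>' x + \<zeta> x *R \<phi>' x)"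
    unfolding C1c_def using K S
    by (intro conjI exI[of _ "K \<inter> S"]) (auto intro: compact_Int_closed)
  have "(LBINT x. f x *R \<phi>' x) = (LBINT x. f x *R (\<phi> x *R \<zeta>' x + \<zeta> x *R \<phi>' x))"
    by (rule Bochner_Integration.integral_cong[OF refl]) (use one in force)
  also have "\<dots> = - (LBINT x. (\<phi> x * \<zeta> x) *R F x)" by (rule wgradD(5)[OF w c2])
  also have "(LBINT x. (\<phi> x * \<zeta> x) *R F x) = (LBINT x. \<phi> x *R F x)"
    by (rule Bochner_Integration.integral_cong[OF refl]) (use one in force)
  finally show "(LBINT x. f x *R \<phi>' x) = - (LBINT x. \<phi> x *R F x)" .
qed (use wgradD[OF w] in auto)

text \<open>When \<open>f\<close> and \<open>F\<close> have compact support, a C1 function on a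
  neighbourhood becomes a test function after multiplication by a cutoff that is 1 on that
  support.\<close>

lemma wgrad_test_local:
  assumes w: "wgrad \<Omega> f F" and U: "open U" "U \<subseteq> \<Omega>" and K: "compact K" "K \<subseteq> U"
    and z: "\<And>x. x \<notin> K \<Longrightarrow> f x = 0 \<and> F x = 0"
    and a: "\<And>x. x \<in> U \<Longrightarrow> GDERIV a x :> a' x" "continuous_on U a'"
  shows "(LBINT x. f x *R a' x) = - (LBINT x. a x *R F x)"
proof -
  obtain \<zeta> \<zeta>' where \<zeta>: "C1c U \<zeta> \<zeta>'" "\<And>x. x \<in> K \<Longrightarrow> \<zeta> x = 1" "\<And>x. x \<in> K \<Longrightarrow> \<zeta>' x = 0"
    using cutoff[OF K U(1)] by blast
  have "C1c \<Omega> (\<lambda>x. \<zeta> x * a x) (\<lambda>x. \<zeta> x *R a' x + a x *R \<zeta>' x)"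
    using C1c_mono[OF C1c_mult_local[OF U(1) \<zeta>(1) a] U(2)] .
  from wgradD(5)[OF w this]
  have "(LBINT x. f x *R (\<zeta> x *R a' x + a x *R \<zeta>' x)) = - (LBINT x. (\<zeta> x * a x) *R F x)" .
  moreover have "(LBINT x. f x *R (\<zeta> x *R a' x + a x *R \<zeta>' x)) = (LBINT x. f x *R a' x)"
    by (rule Bochner_Integration.integral_cong[OF refl]) (use \<zeta> z in force)
  moreover have "(LBINT x. (\<zeta> x * a x) *R F x) = (LBINT x. a x *R F x)"
    by (rule Bochner_Integration.integral_cong[OF refl]) (use \<zeta> z in force)
  ultimately show ?thesis by simp
qed

lemma mdl_id: "L1 f \<Longrightarrow> mdl (\<lambda>t. t) f = ennreal (LBINT x. norm (f x))"
  unfolding mdl_def by (intro nn_integral_eq_integral) auto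

lemma conv_integrable_lborel:
  fixes f :: "real ^ 'n \<Rightarrow> 'b::euclidean_space"
  assumes k: "kernel e k" and f: "L1 f"
  shows "L1 (conv k f)"
proof -
  note kc = kernel_C1c[OF k]
  note [measurable] = borel_measurable_integrable[OF f] conv_measurable[OF kc f]
  have "mdl (\<lambda>t. t) (\<lambda>x. f (x - h) - f x) \<le> ennreal (2 * (LBINT x. norm (f x)))" for h
  proof -
    have i: "L1 (\<lambda>x. f (x - h))" using lborel_integrable_translation[OF f, of "-h"] by simp
    have "(LBINT x. norm (f (x - h) - f x)) \<le> (LBINT x. norm (f (x - h)) + norm (f x))"
      using i f by (intro integral_mono) (auto intro: norm_triangle_ineq4)
    also have "\<dots> = 2 * (LBINT x. norm (f x))"
      using i f lborel_integral_translation[of "\<lambda>x. norm (f x)" "-h"] by simp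
    finally show ?thesis
      using i f by (subst mdl_id) (auto intro: ennreal_leI)
  qed
  from conv_diff_mdl[OF young_id k f this]
  have "mdl (\<lambda>t. t) (\<lambda>x. conv k f x - f x) < \<infinity>" by (rule order_le_less_trans) simp
  then have "L1 (\<lambda>x. conv k f x - f x)"
    unfolding mdl_def by (intro integrableI_bounded) auto
  then have "L1 (\<lambda>x. (conv k f x - f x) + f x)"
    using f by (rule Bochner_Integration.integrable_add)
  then show ?thesis by simp
qed

lemma conv_L1_tendsto:
  fixes f :: "real ^ 'n \<Rightarrow> 'b::euclidean_space"
  assumes k: "\<And>n. kernel (r n) (k n)" and r: "r \<longlonglongrightarrow> 0" and f: "L1 f"
  shows "(\<lambda>n. LBINT x. norm (conv (k n) f x - f x)) \<longlonglongrightarrow> 0"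
proof -
  have "mdl (\<lambda>t. t) f < \<infinity>" using mdl_id[OF f] by simp
  from conv_mdl_tendsto[OF young_id f this k r]
  have "(\<lambda>n. mdl (\<lambda>t. t) (\<lambda>x. conv (k n) f x - f x)) \<longlonglongrightarrow> 0" .
  moreover have "L1 (\<lambda>x. conv (k n) f x - f x)" for n using conv_integrable_lborel[OF k f] f by auto
  ultimately show ?thesis by (simp add: mdl_id ennreal_tendsto_0_iff)
qed

text \<open>Almost everywhere convergence is obtained by passing to a subsequence of an
  L1-convergent sequence, so Lebesgue points are avoided.\<close>

lemma mollify_seq:
  fixes f :: "real ^ 'n \<Rightarrow> 'b::euclidean_space"
  assumes f: "L1 f"
  shows "\<exists>r k. (\<forall>n. r n > 0) \<and> r \<longlonglongrightarrow> 0 \<and> (\<forall>n. kernel (r n) (k n)) \<and>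
    (AE x in lborel. (\<lambda>n. conv (k n) f x) \<longlonglongrightarrow> f x)"
proof -
  define r where "r n = 1 / real (Suc n)" for n
  have r0: "r \<longlonglongrightarrow> 0" unfolding r_def by (rule LIMSEQ_Suc[OF lim_1_over_n])
  have "\<forall>n. \<exists>k :: real ^ 'n \<Rightarrow> real. kernel (r n) k" by (intro allI ex_kernel) (simp add: r_def)
  then obtain k :: "nat \<Rightarrow> real ^ 'n \<Rightarrow> real" where k: "\<And>n. kernel (r n) (k n)" by metis
  have "L1 (\<lambda>x. conv (k n) f x - f x)" for n
    using conv_integrable_lborel[OF k f] f by auto
  from tendsto_L1_AE_subseq[OF this conv_L1_tendsto[OF k r0 f]]
  obtain s where s: "strict_mono s" "AE x in lborel. (\<lambda>n. conv (k (s n)) f x - f x) \<longlonglongrightarrow> 0" by blast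
  have "AE x in lborel. (\<lambda>n. conv (k (s n)) f x) \<longlonglongrightarrow> f x"
    using s(2) by eventually_elim (simp add: LIM_zero_iff)
  moreover have "(\<lambda>n. r (s n)) \<longlonglongrightarrow> 0" using LIMSEQ_subseq_LIMSEQ[OF r0 s(1)] by (simp add: comp_def)
  ultimately show ?thesis using k
    by (intro exI[of _ "\<lambda>n. r (s n)"] exI[of _ "\<lambda>n. k (s n)"]) (auto simp: r_def)
qed

lemma wgrad_limit:
  assumes w: "\<And>n. wgrad \<Omega> (f n) (F n)" and i: "L1 g" "L1 G"
    and z: "\<And>x. x \<notin> \<Omega> \<Longrightarrow> g x = 0 \<and> G x = 0"
    and l: "(\<lambda>n. LBINT x. norm (f n x - g x)) \<longlonglongrightarrow> 0" "(\<lambda>n. LBINT x. norm (F n x - G x)) \<longlonglongrightarrow> 0"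
  shows "wgrad \<Omega> g G"
  unfolding wgrad_def
proof (intro conjI allI impI)
  fix \<phi> \<phi>' assume c: "C1c \<Omega> \<phi> \<phi>'"
  obtain B where B: "B > 0" "\<And>x. norm (\<phi> x) \<le> B" "\<And>x. norm (\<phi>' x) \<le> B" using C1c_bounded[OF c] by metis
  note m = C1c_measurable[OF c]
  have "(\<lambda>n. LBINT x. f n x *R \<phi>' x) \<longlonglongrightarrow> (LBINT x. g x *R \<phi>' x)"
    by (rule L1_bilinear_tendsto[OF bounded_bilinear.flip[OF bounded_bilinear_scaleR] wgradD(1)[OF w] i(1) l(1)]) (use B m in auto)
  moreover have "(\<lambda>n. LBINT x. \<phi> x *R F n x) \<longlonglongrightarrow> (LBINT x. \<phi> x *R G x)"
    by (rule L1_bilinear_tendsto[OF bounded_bilinear_scaleR wgradD(2)[OF w] i(2) l(2)]) (use B m in auto)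
  then have "(\<lambda>n. LBINT x. f n x *R \<phi>' x) \<longlonglongrightarrow> - (LBINT x. \<phi> x *R G x)"
    unfolding wgradD(5)[OF w c] by (rule tendsto_minus)
  ultimately show "(LBINT x. g x *R \<phi>' x) = - (LBINT x. \<phi> x *R G x)"
    by (rule LIMSEQ_unique)
qed (use i z in auto)

section \<open>Chain rule, truncation and uniqueness of weak gradients\<close>

lemma conv_Ck:
  fixes f :: "real ^ 'n \<Rightarrow> real"
  assumes "kernel e k" "L1 f"
  shows "Ck j (conv k f)"
  by (rule Ck_conv[OF assms(2), of k "cball 0 e"]) (use assms in \<open>auto simp: kernel_def\<close>)

lemma lipschitz_from_deriv:
  fixes H :: "real \<Rightarrow> real"
  assumes "\<And>t. (H has_real_derivative H' t) (at t)" "\<And>t. \<bar>H' t\<bar> \<le> C"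
  shows "\<bar>H s - H t\<bar> \<le> C * \<bar>s - t\<bar>"
  using field_differentiable_bound[of UNIV H H' C s t] assms by auto

text \<open>The classical chain rule holds for the mollifications \<open>fn\<close> on the support
  of a test function. In the limit \<open>H (fn n x)\<close> converges in L1 by the Lipschitz bound,
  and \<open>H' (fn n x)\<close> is bounded and converges almost everywhere against the
  L1-convergent \<open>Fn\<close>.\<close>

lemma wgrad_chain:
  fixes H :: "real \<Rightarrow> real"
  assumes \<Omega>: "open \<Omega>" and w: "wgrad \<Omega> f F"
    and H: "\<And>t. (H has_real_derivative H' t) (at t)" "continuous_on UNIV H'" "\<And>t. \<bar>H' t\<bar> \<le> C" "H 0 = 0"
  shows "wgrad \<Omega> (\<lambda>x. H (f x)) (\<lambda>x. H' (f x) *R F x)"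
proof -
  note lip = lipschitz_from_deriv[OF H(1,3)]
  have Hb: "\<bar>H t\<bar> \<le> C * \<bar>t\<bar>" for t using lip[of t 0] H(4) by simp
  have C0: "C \<ge> 0" using H(3)[of 0] by linarith
  have cH: "continuous_on UNIV H" using H(1) by (meson DERIV_isCont continuous_at_imp_continuous_on)
  have [measurable]: "H \<in> Borel" "H' \<in> Borel"
    using cH H(2) by (auto intro: borel_measurable_continuous_onI)
  note [measurable] = wgradD(6,7)[OF w]
  have iH: "L1 (\<lambda>x. H (g x))" if "L1 g" for g :: "real ^ 'n \<Rightarrow> real"
  proof (rule Bochner_Integration.integrable_bound[of lborel "\<lambda>x. C * \<bar>g x\<bar>"])
    have [measurable]: "g \<in> borel_measurable lborel" using that by auto
    show "(\<lambda>x. H (g x)) \<in> borel_measurable lborel" by measurable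
  qed (use that Hb C0 in auto)
  have iH': "L1 (\<lambda>x. H' (g x) *R G x)" if "L1 G" "g \<in> borel_measurable lborel"
    for g :: "real ^ 'n \<Rightarrow> real" and G :: "real ^ 'n \<Rightarrow> real ^ 'n"
  proof (rule integrable_bounded_scaleR[OF that(1), of _ C])
    note [measurable] = that(2)
    show "(\<lambda>x. H' (g x)) \<in> borel_measurable lborel" by measurable
  qed (use H(3) in simp)
  obtain r k where rk: "\<And>n. r n > 0" "r \<longlonglongrightarrow> 0" "\<And>n. kernel (r n) (k n)"
    "AE x in lborel. (\<lambda>n. conv (k n) f x) \<longlonglongrightarrow> f x"
    using mollify_seq[OF wgradD(1)[OF w]] by blast
  define fn where "fn n = conv (k n) f" for n
  define Fn where "Fn n = conv (k n) F" for n
  have ifn: "L1 (fn n)" "L1 (Fn n)" for n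
    unfolding fn_def Fn_def using conv_integrable_lborel[OF rk(3)] wgradD(1,2)[OF w] by auto
  have mfn[measurable]: "fn n \<in> borel_measurable lborel" for n using ifn by auto
  have Lf: "(\<lambda>n. LBINT x. norm (fn n x - f x)) \<longlonglongrightarrow> 0"
    unfolding fn_def by (rule conv_L1_tendsto[OF rk(3,2) wgradD(1)[OF w]])
  have LF: "(\<lambda>n. LBINT x. norm (Fn n x - F x)) \<longlonglongrightarrow> 0"
    unfolding Fn_def by (rule conv_L1_tendsto[OF rk(3,2) wgradD(2)[OF w]])
  show ?thesis
    unfolding wgrad_def
  proof (intro conjI allI impI)
    show "L1 (\<lambda>x. H (f x))" by (rule iH[OF wgradD(1)[OF w]])
    show "L1 (\<lambda>x. H' (f x) *R F x)" by (rule iH'[OF wgradD(2)[OF w]]) simp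
    fix \<phi> \<phi>' assume c: "C1c \<Omega> \<phi> \<phi>'"
    obtain B where B: "B > 0" "\<And>x. norm (\<phi> x) \<le> B" "\<And>x. norm (\<phi>' x) \<le> B" using C1c_bounded[OF c] by metis
    note [measurable] = C1c_measurable[OF c]
    obtain K where K: "compact K" "K \<subseteq> \<Omega>" "\<And>x. x \<notin> K \<Longrightarrow> \<phi> x = 0" "\<And>x. x \<notin> K \<Longrightarrow> \<phi>' x = 0"
      using c unfolding C1c_def by blast
    obtain d where d: "d > 0" "\<And>x. x \<in> K \<Longrightarrow> cball x d \<subseteq> \<Omega>"
      by (rule compact_cball_nbhd[OF K(1,2) \<Omega>], rule that)
    obtain N where N: "\<And>n. n \<ge> N \<Longrightarrow> r n < d"
      using order_tendstoD(2)[OF rk(2) d(1)] unfolding eventually_sequentially by blast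
    \<comment> \<open>Once the radius is below the distance of the support to the frontier, the
      gradient of the mollification is the mollified weak gradient there.\<close>
    have eq: "(LBINT x. H (fn n x) *R \<phi>' x) = - (LBINT x. \<phi> x *R (H' (fn n x) *R Fn n x))" if "n \<ge> N" for n
    proof -
      have Ck1: "Ck 1 (fn n)" unfolding fn_def by (rule conv_Ck[OF rk(3) wgradD(1)[OF w]])
      note g = Ck1_GDERIV[OF Ck1]
      have gF: "gradient (fn n) x = Fn n x" if "x \<in> K" for x
      proof -
        have "cball x (r n) \<subseteq> \<Omega>" using d(2)[OF that] N[OF \<open>n \<ge> N\<close>] by (meson less_imp_le order_trans subset_cball)
        from conv_wgrad[OF w rk(3) this] show ?thesis
          unfolding fn_def Fn_def by (rule GDERIV_gradient_eq)
      qed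
      have cf: "continuous_on UNIV (fn n)" using g(1) GDERIV_continuous_on by metis
      have "C1c UNIV (\<lambda>x. \<phi> x * H (fn n x)) (\<lambda>x. \<phi> x *R (H' (fn n x) *R gradient (fn n) x) + H (fn n x) *R \<phi>' x)"
      proof (rule C1c_mult_local[OF open_UNIV C1c_mono[OF c subset_UNIV]])
        show "GDERIV (\<lambda>x. H (fn n x)) x :> H' (fn n x) *R gradient (fn n) x" for x
          using GDERIV_DERIV_compose[OF g(1) H(1)] by simp
        show "continuous_on UNIV (\<lambda>x. H' (fn n x) *R gradient (fn n) x)"
          by (intro continuous_on_scaleR g(2) continuous_on_compose2[OF H(2) cf]) auto
      qed
      from C1c_integral_gradient[OF this]
      have "0 = (LBINT x. \<phi> x *R (H' (fn n x) *R gradient (fn n) x) + H (fn n x) *R \<phi>' x)" by simp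
      also have "\<dots> = (LBINT x. \<phi> x *R (H' (fn n x) *R Fn n x) + H (fn n x) *R \<phi>' x)"
      proof (rule Bochner_Integration.integral_cong[OF refl])
        fix x show "\<phi> x *R (H' (fn n x) *R gradient (fn n) x) + H (fn n x) *R \<phi>' x = \<phi> x *R (H' (fn n x) *R Fn n x) + H (fn n x) *R \<phi>' x"
          by (cases "x \<in> K") (simp_all add: gF K)
      qed
      also have "\<dots> = (LBINT x. \<phi> x *R (H' (fn n x) *R Fn n x)) + (LBINT x. H (fn n x) *R \<phi>' x)"
        by (rule Bochner_Integration.integral_add)
          (rule C1c_test_integrable[OF c iH[OF ifn(1)] iH'[OF ifn(2) mfn]])+
      finally show ?thesis by (simp add: eq_neg_iff_add_eq_0 add.commute)
    qed
    have l1: "(\<lambda>n. LBINT x. H (fn n x) *R \<phi>' x) \<longlonglongrightarrow> (LBINT x. H (f x) *R \<phi>' x)"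
    proof (rule L1_bilinear_tendsto[OF bounded_bilinear.flip[OF bounded_bilinear_scaleR] iH[OF ifn(1)] iH[OF wgradD(1)[OF w]]])
      show "(\<lambda>n. LBINT x. norm (H (fn n x) - H (f x))) \<longlonglongrightarrow> 0"
      proof (rule Lim_null_comparison)
        show "(\<lambda>n. C * (LBINT x. norm (fn n x - f x))) \<longlonglongrightarrow> 0"
          using tendsto_mult_right_zero[OF Lf] by simp
        show "\<forall>\<^sub>F n in sequentially. norm (LBINT x. norm (H (fn n x) - H (f x))) \<le> C * (LBINT x. norm (fn n x - f x))"
        proof (rule always_eventually, rule allI)
          fix n
          have "(LBINT x. norm (H (fn n x) - H (f x))) \<le> (LBINT x. C * norm (fn n x - f x))"
            using iH[OF ifn(1)] iH[OF wgradD(1)[OF w]] ifn wgradD(1)[OF w] lip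
            by (intro integral_mono) auto
          then show "norm (LBINT x. norm (H (fn n x) - H (f x))) \<le> C * (LBINT x. norm (fn n x - f x))"
            by simp
        qed
      qed
    qed (use B in auto)
    have "(\<lambda>n. LBINT x. (\<phi> x * H' (fn n x)) *R Fn n x) \<longlonglongrightarrow> (LBINT x. (\<phi> x * H' (f x)) *R F x)"
    proof (rule L1_bilinear_tendsto[OF bounded_bilinear_scaleR ifn(2) wgradD(2)[OF w] LF])
      show "norm (\<phi> x * H' (fn n x)) \<le> B * C" for n x
        using B(1) B(2)[of x] H(3)[of "fn n x"] by (auto simp: abs_mult intro!: mult_mono)
      show "AE x in lborel. (\<lambda>n. \<phi> x * H' (fn n x)) \<longlonglongrightarrow> \<phi> x * H' (f x)"
        using rk(4)
      proof eventually_elim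
        case (elim x)
        have "isCont H' (f x)" using H(2) by (simp add: continuous_on_eq_continuous_at)
        from isCont_tendsto_compose[OF this elim] show ?case
          unfolding fn_def by (intro tendsto_intros)
      qed
    qed measurable
    then have "(\<lambda>n. LBINT x. \<phi> x *R (H' (fn n x) *R Fn n x)) \<longlonglongrightarrow> (LBINT x. \<phi> x *R (H' (f x) *R F x))" by simp
    then have "(\<lambda>n. - (LBINT x. \<phi> x *R (H' (fn n x) *R Fn n x))) \<longlonglongrightarrow> - (LBINT x. \<phi> x *R (H' (f x) *R F x))"
      by (rule tendsto_minus)
    then have "(\<lambda>n. LBINT x. H (fn n x) *R \<phi>' x) \<longlonglongrightarrow> - (LBINT x. \<phi> x *R (H' (f x) *R F x))"
    proof (rule Lim_transform_eventually)
      show "\<forall>\<^sub>F n in sequentially. - (LBINT x. \<phi> x *R (H' (fn n x) *R Fn n x)) = (LBINT x. H (fn n x) *R \<phi>' x)"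
        using eventually_ge_at_top[of N] by eventually_elim (simp only: eq)
    qed
    with l1 show "(LBINT x. H (f x) *R \<phi>' x) = - (LBINT x. \<phi> x *R (H' (f x) *R F x))"
      by (rule LIMSEQ_unique)
  qed (use wgradD[OF w] H(4) in auto)
qed

lemma deriv_max_square: "((\<lambda>t. (max 0 t)\<^sup>2) has_real_derivative 2 * max 0 t) (at (t::real))"
proof -
  consider "t > 0" | "t < 0" | "t = 0" by linarith
  then show ?thesis
  proof cases
    case 1
    have "((\<lambda>t. t\<^sup>2) has_real_derivative 2 * t) (at t)" by (auto intro!: derivative_eq_intros)
    then have "((\<lambda>t. (max 0 t)\<^sup>2) has_real_derivative 2 * t) (at t)"
      by (rule has_field_derivative_transform_within_open[where S="{0<..}"]) (use 1 in auto)
    with 1 show ?thesis by simp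
  next
    case 2
    have "((\<lambda>t. 0) has_real_derivative 0) (at t)" by simp
    then have "((\<lambda>t. (max 0 t)\<^sup>2) has_real_derivative 0) (at t)"
      by (rule has_field_derivative_transform_within_open[where S="{..<0}"]) (use 2 in auto)
    with 2 show ?thesis by simp
  next
    case 3
    have "((\<lambda>h. ((max 0 (0 + h))\<^sup>2 - (max 0 0)\<^sup>2) / h) \<longlongrightarrow> 0) (at (0::real))"
    proof (rule Lim_null_comparison)
      show "((\<lambda>h::real. \<bar>h\<bar>) \<longlongrightarrow> 0) (at 0)" by (rule tendsto_rabs_zero) simp
      show "\<forall>\<^sub>F h in at 0. norm (((max 0 (0 + h))\<^sup>2 - (max 0 0)\<^sup>2) / h) \<le> \<bar>h :: real\<bar>"
        by (rule always_eventually) (auto simp: max_def power2_eq_square)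
    qed
    then show ?thesis by (simp add: DERIV_def 3)
  qed
qed

text \<open>The C1 functions \<open>H n\<close> approximate the positive part, with derivatives
  bounded by 1 that tend to the indicator of the open half-line. Since they vanish at 0 for every
  \<open>n\<close>, the limit gradient is zero on the zero set.\<close>

lemma wgrad_pos:
  assumes \<Omega>: "open \<Omega>" and w: "wgrad \<Omega> f F"
  shows "wgrad \<Omega> (\<lambda>x. max 0 (f x)) (\<lambda>x. indicator {x. f x > 0} x *R F x)"
proof -
  define e where "e n = 1 / real (Suc n)" for n
  have e0: "e \<longlonglongrightarrow> 0" unfolding e_def by (rule LIMSEQ_Suc[OF lim_1_over_n])
  have ep: "e n > 0" for n by (simp add: e_def)
  define H where "H n t = sqrt ((max 0 t)\<^sup>2 + (e n)\<^sup>2) - e n" for n and t :: real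
  define H' where "H' n t = max 0 t / sqrt ((max 0 t)\<^sup>2 + (e n)\<^sup>2)" for n and t :: real
  have pos: "(max 0 t)\<^sup>2 + (e n)\<^sup>2 > 0" for n t using ep[of n] by (simp add: add_nonneg_pos)
  have dH: "(H n has_real_derivative H' n t) (at t)" for n t
  proof -
    have "((\<lambda>t. (max 0 t)\<^sup>2 + (e n)\<^sup>2) has_real_derivative 2 * max 0 t) (at t)"
      using DERIV_add[OF deriv_max_square[of t] DERIV_const[of "(e n)\<^sup>2"]] by simp
    from DERIV_diff[OF DERIV_chain2[OF DERIV_real_sqrt[OF pos[of t n]] this] DERIV_const[of "e n"]]
    show ?thesis unfolding H_def H'_def by (simp add: field_simps)
  qed
  have cH': "continuous_on UNIV (H' n)" for n
    unfolding H'_def using pos[of _ n] by (intro continuous_intros) (auto simp: less_imp_neq[symmetric])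
  have bH': "\<bar>H' n t\<bar> \<le> 1" for n t
  proof -
    have "max 0 t \<le> sqrt ((max 0 t)\<^sup>2 + (e n)\<^sup>2)" by (rule real_le_rsqrt) simp
    then show ?thesis using pos[of t n] by (auto simp: H'_def divide_le_eq)
  qed
  have H0: "H n 0 = 0" for n using ep[of n] by (simp add: H_def)
  have lim: "(\<lambda>n. H n t) \<longlonglongrightarrow> max 0 t" for t
  proof -
    have "(\<lambda>n. H n t) \<longlonglongrightarrow> sqrt ((max 0 t)\<^sup>2 + 0\<^sup>2) - 0"
      unfolding H_def by (intro tendsto_intros e0)
    then show ?thesis by simp
  qed
  have lim': "(\<lambda>n. H' n t) \<longlonglongrightarrow> indicator {0<..} t" for t
  proof (cases "t > 0")
    case True
    then have "(\<lambda>n. H' n t) \<longlonglongrightarrow> max 0 t / sqrt ((max 0 t)\<^sup>2 + 0\<^sup>2)"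
      unfolding H'_def by (intro tendsto_intros e0) auto
    then show ?thesis using True by simp
  qed (simp add: H'_def)
  note wn = wgrad_chain[OF \<Omega> w dH cH' bH' H0]
  note [measurable] = wgradD(6,7)[OF w]
  have ip: "L1 (\<lambda>x. max 0 (f x))"
    by (rule Bochner_Integration.integrable_bound[OF wgradD(1)[OF w]]) auto
  have iF: "L1 (\<lambda>x. indicator {x. f x > 0} x *R F x)"
    by (rule integrable_bounded_scaleR[OF wgradD(2)[OF w], of _ 1]) (auto simp: indicator_def)
  have Hb: "\<bar>H n t\<bar> \<le> \<bar>t\<bar>" for n t using lipschitz_from_deriv[OF dH bH', of n t 0] H0 by simp
  show ?thesis
  proof (rule wgrad_limit[OF wn ip iF])
    show "(\<lambda>n. LBINT x. norm (H n (f x) - max 0 (f x))) \<longlonglongrightarrow> 0"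
    proof (rule dominated_L1_tendsto[where w="\<lambda>x. 2 * \<bar>f x\<bar>"])
      show "AE x in lborel. norm (H n (f x) - max 0 (f x)) \<le> 2 * \<bar>f x\<bar>" for n
      proof (rule AE_I2)
        fix x show "norm (H n (f x) - max 0 (f x)) \<le> 2 * \<bar>f x\<bar>" using Hb[of n "f x"] by (auto simp: max_def)
      qed
    qed (use lim wgradD(1)[OF w] wgradD(6)[OF wn] in auto)
    show "(\<lambda>n. LBINT x. norm (H' n (f x) *R F x - indicator {x. f x > 0} x *R F x)) \<longlonglongrightarrow> 0"
    proof (rule dominated_L1_tendsto[where w="\<lambda>x. 2 * norm (F x)"])
      show "AE x in lborel. (\<lambda>n. H' n (f x) *R F x) \<longlonglongrightarrow> indicator {x. f x > 0} x *R F x"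
      proof (rule AE_I2)
        fix x
        have "(\<lambda>n. H' n (f x) *R F x) \<longlonglongrightarrow> indicator {0<..} (f x) *R F x" by (intro tendsto_intros lim')
        then show "(\<lambda>n. H' n (f x) *R F x) \<longlonglongrightarrow> indicator {x. f x > 0} x *R F x" by (simp add: indicator_def)
      qed
      show "AE x in lborel. norm (H' n (f x) *R F x - indicator {x. f x > 0} x *R F x) \<le> 2 * norm (F x)" for n
      proof (rule AE_I2)
        fix x
        have "norm (H' n (f x) *R F x - indicator {x. f x > 0} x *R F x) = \<bar>H' n (f x) - indicator {x. f x > 0} x\<bar> * norm (F x)"
          by (simp add: scaleR_diff_left[symmetric])
        also have "\<dots> \<le> 2 * norm (F x)"
          using bH'[of n "f x"] by (intro mult_right_mono) (auto simp: indicator_def)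
        finally show "norm (H' n (f x) *R F x - indicator {x. f x > 0} x *R F x) \<le> 2 * norm (F x)" .
      qed
    qed (use wgradD(2)[OF w] wgradD(7)[OF wn] iF in auto)
  qed (use wgradD[OF w] in auto)
qed

lemma cball_subset_infdist:
  fixes \<Omega> :: "'a::euclidean_space set"
  assumes "r < infdist x (- \<Omega>)"
  shows "cball x r \<subseteq> \<Omega>"
proof
  fix y assume y: "y \<in> cball x r"
  show "y \<in> \<Omega>"
  proof (rule ccontr)
    assume "y \<notin> \<Omega>"
    then have "infdist x (- \<Omega>) \<le> dist x y" by (intro infdist_le) auto
    then show False using y assms by simp
  qed
qed

lemma infdist_compl_pos:
  fixes \<Omega> :: "'a::euclidean_space set"
  assumes "open \<Omega>" "bounded \<Omega>" "x \<in> \<Omega>"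
  shows "infdist x (- \<Omega>) > 0"
proof -
  have n: "- \<Omega> \<noteq> {}"
  proof
    assume "- \<Omega> = {}"
    then have "\<Omega> = UNIV" by blast
    with assms(2) not_bounded_UNIV show False by simp
  qed
  have "closed (- \<Omega>)" using assms(1) by (simp add: closed_Compl)
  from in_closed_iff_infdist_zero[OF this n, of x] have "infdist x (- \<Omega>) \<noteq> 0" using assms(3) by simp
  with infdist_nonneg[of x "- \<Omega>"] show ?thesis by linarith
qed

text \<open>A reflected kernel of small radius centred at \<open>x\<close> is a test function, so
  the mollifications of \<open>h\<close> at \<open>x\<close> are eventually zero; almost everywhere
  they converge to \<open>h x\<close>.\<close>

lemma fundamental_lemma:
  fixes h :: "real ^ 'n \<Rightarrow> 'b::euclidean_space"
  assumes \<Omega>: "open \<Omega>" "bounded \<Omega>" and h: "L1 h" "\<And>x. x \<notin> \<Omega> \<Longrightarrow> h x = 0"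
    and t: "\<And>\<phi>. \<phi> \<in> test_functions \<Omega> \<Longrightarrow> (LBINT x. \<phi> x *R h x) = 0"
  shows "AE x in lborel. h x = 0"
proof -
  obtain r k where rk: "\<And>n. r n > 0" "r \<longlonglongrightarrow> 0" "\<And>n. kernel (r n) (k n)"
    "AE x in lborel. (\<lambda>n. conv (k n) h x) \<longlonglongrightarrow> h x"
    using mollify_seq[OF h(1)] by blast
  show ?thesis
    using rk(4)
  proof eventually_elim
    case (elim x)
    show ?case
    proof (cases "x \<in> \<Omega>")
      case True
      have "\<forall>\<^sub>F n in sequentially. conv (k n) h x = 0"
        using order_tendstoD(2)[OF rk(2) infdist_compl_pos[OF \<Omega> True]]
      proof eventually_elim
        case (elim n)
        from t[OF kernel_reflect_test[OF rk(3) cball_subset_infdist[OF this]]] show ?case by (simp add: conv_def)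
      qed
      from LIMSEQ_unique[OF elim tendsto_eventually[OF this]] show ?thesis .
    qed (use h in auto)
  qed
qed

lemma wgrad_unique:
  assumes "open \<Omega>" "bounded \<Omega>" and w: "wgrad \<Omega> f F" "wgrad \<Omega> f F'"
  shows "AE x in lborel. F x = F' x"
proof -
  have "AE x in lborel. F x - F' x = 0"
  proof (rule fundamental_lemma[OF assms(1,2)])
    show "L1 (\<lambda>x. F x - F' x)" using wgradD(2)[OF w(1)] wgradD(2)[OF w(2)] by auto
    show "F x - F' x = 0" if "x \<notin> \<Omega>" for x using wgradD(4)[OF w(1) that] wgradD(4)[OF w(2) that] by simp
    fix \<phi> assume "\<phi> \<in> test_functions \<Omega>"
    then have c: "C1c \<Omega> \<phi> (gradient \<phi>)" by (rule test_functions_C1c)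
    show "(LBINT x. \<phi> x *R (F x - F' x)) = 0"
      using wgradD(5)[OF w(1) c] wgradD(5)[OF w(2) c]
        C1c_test_integrable(2)[OF c wgradD(1,2)[OF w(1)]] C1c_test_integrable(2)[OF c wgradD(1,2)[OF w(2)]]
      by (simp add: scaleR_diff_right)
  qed
  then show ?thesis by eventually_elim simp
qed

text \<open>Both the positive and the negative part have gradients that vanish on the zero set by
  construction; uniqueness transfers this to their difference.\<close>

lemma wgrad_zero_level:
  assumes "open \<Omega>" "bounded \<Omega>" and w: "wgrad \<Omega> f F"
  shows "AE x in lborel. f x = 0 \<longrightarrow> F x = 0"
proof -
  have n: "wgrad \<Omega> (\<lambda>x. - f x) (\<lambda>x. - F x)" using wgrad_scale[OF w, of "-1"] by simp
  have "wgrad \<Omega> (\<lambda>x. max 0 (f x) - max 0 (- f x))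
      (\<lambda>x. indicator {x. f x > 0} x *R F x - indicator {x. - f x > 0} x *R (- F x))"
    by (rule wgrad_diff[OF wgrad_pos[OF assms(1) w] wgrad_pos[OF assms(1) n]])
  moreover have "(\<lambda>x. max 0 (f x) - max 0 (- f x)) = f" by (auto simp: max_def)
  ultimately have "wgrad \<Omega> f (\<lambda>x. indicator {x. f x > 0} x *R F x - indicator {x. - f x > 0} x *R (- F x))" by simp
  from wgrad_unique[OF assms(1,2) w this] show ?thesis
    by eventually_elim auto
qed

lemma conv_tendsto:
  fixes f :: "real ^ 'n \<Rightarrow> 'b::euclidean_space"
  assumes k: "\<And>n. kernel (r n) (k n)" "r \<longlonglongrightarrow> 0" and f: "L1 f" and c: "isCont f x"
  shows "(\<lambda>n. conv (k n) f x) \<longlonglongrightarrow> f x"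
proof (rule tendstoI)
  fix e :: real assume "0 < e"
  then obtain d where d: "0 < d" "\<And>y. dist y x < d \<Longrightarrow> dist (f y) (f x) < e / 2"
    using c unfolding continuous_at_eps_delta by (metis half_gt_zero)
  show "\<forall>\<^sub>F n in sequentially. dist (conv (k n) f x) (f x) < e"
    using order_tendstoD(2)[OF k(2) d(1)]
  proof eventually_elim
    case (elim n)
    have "norm (conv (k n) f x - f x) \<le> e / 2"
      by (rule conv_diff_bound[OF k(1) f]) (use d(2) elim in \<open>force simp: dist_norm intro: less_imp_le\<close>)
    then show ?case using \<open>0 < e\<close> by (simp add: dist_norm)
  qed
qed

text \<open>The factor 3 comes from reusing the estimate of the mollification error; a uniform bound
  is all that dominated convergence asks for.\<close>

lemma conv_bound:
  fixes f :: "real ^ 'n \<Rightarrow> 'b::euclidean_space"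
  assumes k: "kernel r k" and f: "L1 f" and B: "\<And>x. norm (f x) \<le> B"
  shows "norm (conv k f x) \<le> 3 * B"
proof -
  have "norm (f (x - h) - f x) \<le> 2 * B" for h
    using norm_triangle_ineq4[of "f (x - h)" "f x"] B[of x] B[of "x - h"] by linarith
  then have "norm (conv k f x - f x) \<le> 2 * B" by (rule conv_diff_bound[OF k f])
  then show ?thesis using norm_triangle_sub[of "conv k f x" "f x"] B[of x] by linarith
qed

text \<open>Passes from smooth test functions to C1 ones: mollifications of a C1 test function are
  smooth, eventually supported in \<Omega>, and converge boundedly at every point together with
  their gradients.\<close>

lemma wgradI_test:
  assumes \<Omega>: "open \<Omega>" and i: "L1 f" "L1 F"
    and z: "\<And>x. x \<notin> \<Omega> \<Longrightarrow> f x = 0 \<and> F x = 0"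
    and t: "\<And>\<phi>. \<phi> \<in> test_functions \<Omega> \<Longrightarrow> (LBINT x. f x *R gradient \<phi> x) = - (LBINT x. \<phi> x *R F x)"
  shows "wgrad \<Omega> f F"
  unfolding wgrad_def
proof (intro conjI allI impI)
  fix \<phi> \<phi>' assume c: "C1c \<Omega> \<phi> \<phi>'"
  note ic = C1c_integrable[OF c]
  note [measurable] = C1c_measurable[OF c]
  obtain B where B: "B > 0" "\<And>x. norm (\<phi> x) \<le> B" "\<And>x. norm (\<phi>' x) \<le> B" using C1c_bounded[OF c] by metis
  obtain K where K: "compact K" "K \<subseteq> \<Omega>" "\<And>x. x \<notin> K \<Longrightarrow> \<phi> x = 0"
    using c unfolding C1c_def by blast
  have cont: "isCont \<phi> x" "isCont \<phi>' x" for x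
    using c C1c_cont[OF c] by (auto simp: C1c_def continuous_on_eq_continuous_at)
  obtain d where d: "d > 0" "\<And>x. x \<in> K \<Longrightarrow> cball x d \<subseteq> \<Omega>"
    by (rule compact_cball_nbhd[OF K(1,2) \<Omega>], rule that)
  obtain r k where rk: "\<And>n. r n > 0" "r \<longlonglongrightarrow> 0" "\<And>n. kernel (r n) (k n)"
    "AE x in lborel. (\<lambda>n. conv (k n) \<phi> x) \<longlonglongrightarrow> \<phi> x"
    using mollify_seq[OF ic(1)] by blast
  have m: "conv (k n) \<phi> \<in> borel_measurable lborel" "conv (k n) \<phi>' \<in> borel_measurable lborel" for n
    using conv_integrable_lborel[OF rk(3) ic(1)] conv_integrable_lborel[OF rk(3) ic(2)] by auto
  have grad: "gradient (conv (k n) \<phi>) x = conv (k n) \<phi>' x" for n x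
    by (rule GDERIV_gradient_eq, rule conv_wgrad[OF C1c_wgrad[OF C1c_mono[OF c subset_UNIV]] rk(3)]) simp
  have l1: "(\<lambda>n. LBINT x. f x *R conv (k n) \<phi>' x) \<longlonglongrightarrow> (LBINT x. f x *R \<phi>' x)"
    by (rule L1_bilinear_tendsto[OF bounded_bilinear.flip[OF bounded_bilinear_scaleR] i(1) i(1) _ m(2) conv_bound[OF rk(3) ic(2) B(3)]])
      (use conv_tendsto[OF rk(3,2) ic(2) cont(2)] in auto)
  have l2: "(\<lambda>n. - (LBINT x. conv (k n) \<phi> x *R F x)) \<longlonglongrightarrow> - (LBINT x. \<phi> x *R F x)"
    by (rule tendsto_minus, rule L1_bilinear_tendsto[OF bounded_bilinear_scaleR i(2) i(2) _ m(1) conv_bound[OF rk(3) ic(1) B(2)]])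
      (use conv_tendsto[OF rk(3,2) ic(1) cont(1)] in auto)
  have ev: "\<forall>\<^sub>F n in sequentially. - (LBINT x. conv (k n) \<phi> x *R F x) = (LBINT x. f x *R conv (k n) \<phi>' x)"
    using order_tendstoD(2)[OF rk(2) d(1)]
  proof eventually_elim
    case (elim n)
    have "conv (k n) \<phi> \<in> test_functions \<Omega>"
    proof (rule conv_test_function[OF rk(3) ic(1) K(1,3)])
      show "cball x (r n) \<subseteq> \<Omega>" if "x \<in> K" for x using d(2)[OF that] elim by force
    qed
    from t[OF this] show ?case by (simp add: grad)
  qed
  show "(LBINT x. f x *R \<phi>' x) = - (LBINT x. \<phi> x *R F x)"
    by (rule LIMSEQ_unique[OF l1 Lim_transform_eventually[OF l2 ev]])
qed (use i z in auto)

section \<open>Borel representatives of Orlicz and Sobolev functions\<close>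

lemma AE_lebesgue_on_iff:
  assumes "\<Omega> \<in> sets borel"
  shows "(AE x in lebesgue_on \<Omega>. P x) \<longleftrightarrow> (AE x\<in>\<Omega> in lborel. P x)"
  using assms by (subst AE_restrict_space_iff) (auto simp: AE_completion_iff)

lemma lebesgue_measurable_rep:
  fixes f :: "'a::euclidean_space \<Rightarrow> 'b::euclidean_space"
  assumes \<Omega>: "\<Omega> \<in> sets borel" and f: "f \<in> borel_measurable (lebesgue_on \<Omega>)"
  shows "\<exists>g. g \<in> Borel \<and> (AE x\<in>\<Omega> in lborel. f x = g x) \<and> (\<forall>x. x \<notin> \<Omega> \<longrightarrow> g x = 0)"
proof -
  have f': "(\<lambda>x. indicator \<Omega> x *R f x) \<in> borel_measurable lebesgue"
    using f \<Omega> by (subst (asm) borel_measurable_restrict_space_iff) auto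
  have "\<exists>g. g \<in> borel_measurable lborel \<and> (AE x in lborel. (indicator \<Omega> x *R f x) \<bullet> b = g x)" for b
    using completion_ex_borel_measurable_real[of "\<lambda>x. (indicator \<Omega> x *R f x) \<bullet> b" lborel] f'
      borel_measurable_inner[OF f' borel_measurable_const[of b]] by blast
  then obtain g where g: "\<And>b. g b \<in> borel_measurable lborel" "\<And>b. AE x in lborel. (indicator \<Omega> x *R f x) \<bullet> b = g b x"
    by metis
  define h where "h x = indicator \<Omega> x *R (\<Sum>b\<in>Basis. g b x *R b)" for x
  have [measurable]: "g b \<in> Borel" for b using g(1) by simp
  have [measurable]: "\<Omega> \<in> sets borel" by (rule \<Omega>)
  have "AE x in lborel. \<forall>b\<in>Basis. (indicator \<Omega> x *R f x) \<bullet> b = g b x"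
    using g(2) by (intro AE_finite_allI) auto
  then have "AE x\<in>\<Omega> in lborel. f x = h x"
  proof eventually_elim
    case (elim x)
    have "(\<Sum>b\<in>Basis. g b x *R b) = (\<Sum>b\<in>Basis. ((indicator \<Omega> x *R f x) \<bullet> b) *R b)"
      by (rule sum.cong[OF refl]) (simp only: elim)
    also have "\<dots> = indicator \<Omega> x *R f x" by (rule euclidean_representation)
    finally show ?case by (auto simp: h_def)
  qed
  moreover have "h \<in> Borel" unfolding h_def by measurable
  moreover have "\<forall>x. x \<notin> \<Omega> \<longrightarrow> h x = 0" by (simp add: h_def)
  ultimately show ?thesis by blast
qed

lemma lebesgue_on_integral_rep:
  fixes f g :: "'a::euclidean_space \<Rightarrow> 'b::euclidean_space"
  assumes \<Omega>: "\<Omega> \<in> sets borel" and g: "g \<in> Borel" and e: "AE x\<in>\<Omega> in lborel. f x = g x"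
    and z: "\<And>x. x \<notin> \<Omega> \<Longrightarrow> g x = 0" and f: "f \<in> borel_measurable (lebesgue_on \<Omega>)"
  shows "integral\<^sup>L (lebesgue_on \<Omega>) f = integral\<^sup>L lborel g" "integrable (lebesgue_on \<Omega>) f \<longleftrightarrow> L1 g"
proof -
  have ae: "AE x in lebesgue_on \<Omega>. f x = g x" using e AE_lebesgue_on_iff[OF \<Omega>] by blast
  have gl: "g \<in> borel_measurable lborel" using g by simp
  have g2: "g \<in> borel_measurable lebesgue" using gl by (rule measurable_completion)
  have gm: "g \<in> borel_measurable (lebesgue_on \<Omega>)" using g2 by (rule measurable_restrict_space1)
  have sl: "\<Omega> \<inter> space lebesgue \<in> sets lebesgue" using \<Omega> by simp
  have ig: "(\<lambda>x. indicator \<Omega> x *R g x) = g" using z by (auto simp: indicator_def)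
  have "integral\<^sup>L (lebesgue_on \<Omega>) f = integral\<^sup>L (lebesgue_on \<Omega>) g"
    by (rule integral_cong_AE[OF f gm ae])
  also have "\<dots> = integral\<^sup>L lebesgue g" using integral_restrict_space[OF sl, of g] ig by simp
  also have "\<dots> = integral\<^sup>L lborel g" by (rule integral_completion[OF gl])
  finally show "integral\<^sup>L (lebesgue_on \<Omega>) f = integral\<^sup>L lborel g" .
  have "integrable (lebesgue_on \<Omega>) f \<longleftrightarrow> integrable (lebesgue_on \<Omega>) g"
    by (rule integrable_cong_AE[OF f gm ae])
  also have "\<dots> \<longleftrightarrow> integrable lebesgue g" using integrable_restrict_space[OF sl, of g] ig by simp
  also have "\<dots> \<longleftrightarrow> L1 g" by (rule integrable_completion[OF gl])
  finally show "integrable (lebesgue_on \<Omega>) f \<longleftrightarrow> L1 g" .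
qed

lemma lebesgue_on_nn_integral_rep:
  assumes \<Omega>: "\<Omega> \<in> sets borel" and e: "AE x\<in>\<Omega> in lborel. f x = g x" and z: "\<And>x. x \<notin> \<Omega> \<Longrightarrow> g x = 0"
  shows "(\<integral>\<^sup>+x. f x \<partial>lebesgue_on \<Omega>) = (\<integral>\<^sup>+x. g x \<partial>lborel)"
proof -
  have "(\<integral>\<^sup>+x. f x \<partial>lebesgue_on \<Omega>) = (\<integral>\<^sup>+x. g x \<partial>lebesgue_on \<Omega>)"
    by (rule nn_integral_cong_AE) (use e AE_lebesgue_on_iff[OF \<Omega>] in blast)
  also have "\<dots> = (\<integral>\<^sup>+x. g x * indicator \<Omega> x \<partial>lebesgue)"
    by (rule nn_integral_restrict_space) (use \<Omega> in simp)
  also have "\<dots> = (\<integral>\<^sup>+x. g x \<partial>lebesgue)"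
    by (rule nn_integral_cong) (use z in \<open>auto simp: indicator_def\<close>)
  finally show ?thesis by (simp add: nn_integral_completion)
qed

lemma lebesgue_on_AE_measurable:
  fixes f g :: "'a::euclidean_space \<Rightarrow> 'b::euclidean_space"
  assumes \<Omega>: "\<Omega> \<in> sets borel" and g: "g \<in> Borel" and e: "AE x\<in>\<Omega> in lborel. f x = g x"
    and z: "\<And>x. x \<notin> \<Omega> \<Longrightarrow> g x = 0"
  shows "f \<in> borel_measurable (lebesgue_on \<Omega>)"
proof -
  have gl: "g \<in> borel_measurable lborel" using g by simp
  have g2: "g \<in> borel_measurable lebesgue" using gl by (rule measurable_completion)
  have "AE x in lborel. indicator \<Omega> x *R f x = g x" using e by eventually_elim (use z in \<open>auto simp: indicator_def\<close>)
  then have "AE x in lebesgue. g x = indicator \<Omega> x *R f x" by (subst AE_completion_iff) (auto elim: eventually_mono)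
  then have "(\<lambda>x. indicator \<Omega> x *R f x) \<in> borel_measurable lebesgue"
    by (rule borel_measurable_AE[OF g2])
  then show ?thesis
    using \<Omega> by (subst borel_measurable_restrict_space_iff) auto
qed

lemma modular_eq_mdl:
  assumes "young G" "\<Omega> \<in> sets borel" "AE x\<in>\<Omega> in lborel. f x = g x" "\<And>x. x \<notin> \<Omega> \<Longrightarrow> g x = 0"
  shows "modular G \<Omega> f = mdl G g"
  unfolding modular_def mdl_def
  by (rule lebesgue_on_nn_integral_rep[OF assms(2)])
    (use assms in \<open>auto simp: young_def elim: eventually_mono\<close>)

lemma young_pow2:
  assumes "young \<Gamma>"
  shows "\<exists>C>0. \<forall>t\<ge>0. \<Gamma> (2 ^ j * t) \<le> C * \<Gamma> t"
proof (induction j)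
  case 0
  then show ?case by (intro exI[of _ 1]) auto
next
  case (Suc j)
  then obtain C where C: "C > 0" "\<forall>t\<ge>0. \<Gamma> (2 ^ j * t) \<le> C * \<Gamma> t" by blast
  obtain D where D: "D > 0" "\<forall>t\<ge>0. \<Gamma> (2 * t) \<le> D * \<Gamma> t"
    using assms unfolding young_def by blast
  have "\<Gamma> (2 ^ Suc j * t) \<le> (D * C) * \<Gamma> t" if "t \<ge> 0" for t
  proof -
    have "\<Gamma> (2 ^ Suc j * t) = \<Gamma> (2 * (2 ^ j * t))" by (simp add: mult.assoc)
    also have "\<dots> \<le> D * \<Gamma> (2 ^ j * t)" using D(2) that by simp
    also have "\<dots> \<le> D * (C * \<Gamma> t)" using C(2) D(1) that by (intro mult_left_mono) auto
    finally show ?thesis by (simp add: mult.assoc)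
  qed
  then show ?case using C(1) D(1) by (intro exI[of _ "D * C"]) auto
qed

lemma young_mult:
  assumes y: "young \<Gamma>"
  shows "\<exists>C>0. \<forall>t\<ge>0. \<Gamma> (\<bar>c\<bar> * t) \<le> C * \<Gamma> t"
proof -
  obtain j where j: "\<bar>c\<bar> < 2 ^ j" using real_arch_pow[of 2 "\<bar>c\<bar>"] by auto
  obtain C where C: "C > 0" "\<forall>t\<ge>0. \<Gamma> (2 ^ j * t) \<le> C * \<Gamma> t" using young_pow2[OF y, of j] by blast
  have "\<Gamma> (\<bar>c\<bar> * t) \<le> C * \<Gamma> t" if "t \<ge> 0" for t
  proof -
    have "\<Gamma> (\<bar>c\<bar> * t) \<le> \<Gamma> (2 ^ j * t)" using j that by (intro young_mono[OF y]) (auto intro: mult_right_mono)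
    also have "\<dots> \<le> C * \<Gamma> t" using C(2) that by blast
    finally show ?thesis .
  qed
  with C(1) show ?thesis by blast
qed

lemma mdl_scaleR:
  assumes y: "young \<Gamma>"
  shows "\<exists>C>0. \<forall>f\<in>Borel. mdl \<Gamma> (\<lambda>x. c *R f x :: 'b::euclidean_space) \<le> ennreal C * mdl \<Gamma> (f :: real ^ 'n \<Rightarrow> 'b)"
proof -
  obtain C where C: "C > 0" "\<forall>t\<ge>0. \<Gamma> (\<bar>c\<bar> * t) \<le> C * \<Gamma> t" using young_mult[OF y, of c] by blast
  have "mdl \<Gamma> (\<lambda>x. c *R f x) \<le> ennreal C * mdl \<Gamma> f" if "f \<in> Borel" for f :: "real ^ 'n \<Rightarrow> 'b"
  proof -
    note [measurable] = young_measurable[OF y that]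
    have "mdl \<Gamma> (\<lambda>x. c *R f x) \<le> (\<integral>\<^sup>+x. ennreal C * ennreal (\<Gamma> (norm (f x))) \<partial>lborel)"
      unfolding mdl_def using C young_nonneg[OF y]
      by (intro nn_integral_mono) (auto simp: ennreal_mult'[symmetric] intro!: ennreal_leI)
    then show ?thesis by (simp add: mdl_def nn_integral_cmult)
  qed
  with C(1) show ?thesis by blast
qed

lemma mdl_scaleR_finite:
  fixes f :: "real ^ 'n \<Rightarrow> 'b::euclidean_space"
  assumes y: "young \<Gamma>" and f: "f \<in> Borel" "mdl \<Gamma> f < \<infinity>"
  shows "mdl \<Gamma> (\<lambda>x. c *R f x) < \<infinity>"
proof -
  obtain C where "C > 0" "mdl \<Gamma> (\<lambda>x. c *R f x) \<le> ennreal C * mdl \<Gamma> f"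
    using mdl_scaleR[OF y, where 'b='b and 'n='n, of c] f by blast
  moreover have "ennreal C * mdl \<Gamma> f < \<infinity>" using f(2) by (simp add: ennreal_mult_less_top)
  ultimately show ?thesis by (meson order_le_less_trans)
qed

lemma mdl_add_finite:
  fixes f g :: "real ^ 'n \<Rightarrow> 'b::euclidean_space"
  assumes y: "young \<Gamma>" and f: "f \<in> Borel" "mdl \<Gamma> f < \<infinity>" and g: "g \<in> Borel" "mdl \<Gamma> g < \<infinity>"
  shows "mdl \<Gamma> (\<lambda>x. f x + g x) < \<infinity>"
proof -
  obtain C where "C > 0" "mdl \<Gamma> (\<lambda>x. f x + g x) \<le> ennreal C * (mdl \<Gamma> f + mdl \<Gamma> g)"
    using mdl_add[OF y, where 'b='b and 'n='n] f g by blast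
  moreover have "ennreal C * (mdl \<Gamma> f + mdl \<Gamma> g) < \<infinity>" using f(2) g(2) by (simp add: ennreal_mult_less_top)
  ultimately show ?thesis by (meson order_le_less_trans)
qed

lemma mdl_scale_le:
  fixes f :: "real ^ 'n \<Rightarrow> 'b::euclidean_space"
  assumes y: "young \<Gamma>" and f: "f \<in> Borel" and c: "0 \<le> c" "c \<le> 1"
  shows "mdl \<Gamma> (\<lambda>x. c *R f x) \<le> ennreal c * mdl \<Gamma> f"
proof -
  note [measurable] = young_measurable[OF y f]
  have "mdl \<Gamma> (\<lambda>x. c *R f x) \<le> (\<integral>\<^sup>+x. ennreal c * ennreal (\<Gamma> (norm (f x))) \<partial>lborel)"
    unfolding mdl_def using c young_nonneg[OF y] young_scale[OF y _ c]
    by (intro nn_integral_mono) (auto simp: ennreal_mult'[symmetric] intro!: ennreal_leI)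
  then show ?thesis by (simp add: mdl_def nn_integral_cmult)
qed

text \<open>Superlinear growth and the finite measure of \<Omega> put Orlicz functions into L1,
  where \<open>wgrad\<close> is defined.\<close>

lemma mdl_finite_integrable:
  fixes f :: "real ^ 'n \<Rightarrow> 'b::euclidean_space"
  assumes y: "young \<Gamma>" and sl: "\<And>t. t \<ge> 0 \<Longrightarrow> t \<le> \<Gamma> t + C" and \<Omega>: "\<Omega> \<in> sets borel" "bounded \<Omega>"
    and f: "f \<in> Borel" "mdl \<Gamma> f < \<infinity>" and z: "\<And>x. x \<notin> \<Omega> \<Longrightarrow> f x = 0"
  shows "L1 f"
proof (rule integrableI_bounded)
  show "f \<in> borel_measurable lborel" using f by simp
  note [measurable] = young_measurable[OF y f(1)] \<Omega>(1)
  have "(\<integral>\<^sup>+x. ennreal (norm (f x)) \<partial>lborel) \<le> (\<integral>\<^sup>+x. ennreal (\<Gamma> (norm (f x))) + ennreal \<bar>C\<bar> * indicator \<Omega> x \<partial>lborel)"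
  proof (rule nn_integral_mono)
    fix x
    show "ennreal (norm (f x)) \<le> ennreal (\<Gamma> (norm (f x))) + ennreal \<bar>C\<bar> * indicator \<Omega> x"
    proof (cases "x \<in> \<Omega>")
      case True
      have "norm (f x) \<le> \<Gamma> (norm (f x)) + \<bar>C\<bar>" using sl[of "norm (f x)"] by simp
      then have "ennreal (norm (f x)) \<le> ennreal (\<Gamma> (norm (f x)) + \<bar>C\<bar>)" by (rule ennreal_leI)
      then show ?thesis using True young_nonneg[OF y, of "norm (f x)"] by (simp add: ennreal_plus)
    qed (simp add: z)
  qed
  also have "\<dots> = mdl \<Gamma> f + ennreal \<bar>C\<bar> * emeasure lborel \<Omega>"
    by (subst nn_integral_add) (auto simp: mdl_def nn_integral_cmult_indicator)
  also have "\<dots> < \<infinity>" using f(2) emeasure_bounded_finite[OF \<Omega>(2)] by (simp add: ennreal_mult_less_top)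
  finally show "(\<integral>\<^sup>+x. ennreal (norm (f x)) \<partial>lborel) < \<infinity>" .
qed

text \<open>Membership gives a finite modular at one scale \<open>k\<close> only; doubling moves it
  to scale 1.\<close>

lemma orlicz_rep:
  fixes f :: "real ^ 'n \<Rightarrow> 'b::euclidean_space"
  assumes y: "young G" and \<Omega>: "\<Omega> \<in> sets borel" and f: "f \<in> orlicz G \<Omega>"
  shows "\<exists>g. g \<in> Borel \<and> (AE x\<in>\<Omega> in lborel. f x = g x) \<and> (\<forall>x. x \<notin> \<Omega> \<longrightarrow> g x = 0) \<and>
    mdl G g < \<infinity>"
proof -
  have fm: "f \<in> borel_measurable (lebesgue_on \<Omega>)" using f by (simp add: orlicz_def)
  obtain g where g: "g \<in> Borel" "AE x\<in>\<Omega> in lborel. f x = g x" "\<forall>x. x \<notin> \<Omega> \<longrightarrow> g x = 0"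
    using lebesgue_measurable_rep[OF \<Omega> fm] by (elim exE conjE) (rule that)
  obtain k where k: "k > 0" "modular G \<Omega> (\<lambda>x. f x /\<^sub>R k) < \<infinity>" using f by (auto simp: orlicz_def)
  have "modular G \<Omega> (\<lambda>x. f x /\<^sub>R k) = mdl G (\<lambda>x. g x /\<^sub>R k)"
    by (rule modular_eq_mdl[OF y \<Omega>]) (use g in \<open>auto elim: eventually_mono\<close>)
  then have "mdl G (\<lambda>x. g x /\<^sub>R k) < \<infinity>" using k by simp
  from mdl_scaleR_finite[OF y _ this, of k] g(1) k(1) have "mdl G g < \<infinity>" by simp
  with g show ?thesis by blast
qed

lemma orliczI:
  fixes f :: "real ^ 'n \<Rightarrow> 'b::euclidean_space"
  assumes y: "young G" and \<Omega>: "\<Omega> \<in> sets borel" and g: "g \<in> Borel" "AE x\<in>\<Omega> in lborel. f x = g x"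
    "\<And>x. x \<notin> \<Omega> \<Longrightarrow> g x = 0" "mdl G g < \<infinity>"
  shows "f \<in> orlicz G \<Omega>"
proof -
  have "modular G \<Omega> (\<lambda>x. f x /\<^sub>R 1) < \<infinity>"
    using modular_eq_mdl[OF y \<Omega> g(2,3)] g(4) by simp
  moreover have "f \<in> borel_measurable (lebesgue_on \<Omega>)"
    by (rule lebesgue_on_AE_measurable[OF \<Omega> g(1,2,3)])
  ultimately show ?thesis unfolding orlicz_def using zero_less_one by blast
qed

lemma integral_vec_nth:
  fixes V :: "'a \<Rightarrow> real ^ 'n"
  assumes "integrable M V"
  shows "(\<integral>x. V x \<partial>M) $ i = (\<integral>x. V x $ i \<partial>M)"
  using integral_bounded_linear[OF bounded_linear_vec_nth assms, of i] by simp

lemma measurable_vec_nth[measurable]: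
  fixes f :: "'a \<Rightarrow> real ^ 'n"
  assumes [measurable]: "f \<in> borel_measurable M"
  shows "(\<lambda>x. f x $ i) \<in> borel_measurable M"
proof -
  have "(\<lambda>x. inner (f x) (axis i 1)) \<in> borel_measurable M" by measurable
  then show ?thesis by (simp add: inner_axis)
qed

lemma weak_gradient_test_integrals:
  fixes f :: "real ^ 'n \<Rightarrow> real" and F :: "real ^ 'n \<Rightarrow> real ^ 'n"
  assumes \<Omega>: "\<Omega> \<in> sets borel" "D \<subseteq> \<Omega>" and c: "C1c D \<phi> \<phi>'"
    and g: "g \<in> Borel" "AE x\<in>D in lborel. f x = g x"
    and H: "H \<in> Borel" "AE x\<in>D in lborel. F x = H x"
  shows "(LINT x|lebesgue_on \<Omega>. f x * \<phi>' x $ i) = (LBINT x. g x * \<phi>' x $ i)"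
    "(LINT x|lebesgue_on \<Omega>. F x $ i * \<phi> x) = (LBINT x. H x $ i * \<phi> x)"
proof -
  note [measurable] = C1c_measurable[OF c] g(1) H(1)
  have z: "\<phi> x = 0" "\<phi>' x = 0" if "x \<notin> D" for x using c that unfolding C1c_def by blast+
  have z': "x \<notin> D" if "x \<notin> \<Omega>" for x using that \<Omega>(2) by blast
  have m1: "(\<lambda>x. g x * \<phi>' x $ i) \<in> Borel" by measurable
  have a1: "AE x\<in>\<Omega> in lborel. f x * \<phi>' x $ i = g x * \<phi>' x $ i"
    using g(2) by eventually_elim (use z in force)
  show "(LINT x|lebesgue_on \<Omega>. f x * \<phi>' x $ i) = (LBINT x. g x * \<phi>' x $ i)"
    by (rule lebesgue_on_integral_rep(1)[OF \<Omega>(1) m1 a1 _ lebesgue_on_AE_measurable[OF \<Omega>(1) m1 a1]]) (simp_all add: z z')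
  have m2: "(\<lambda>x. H x $ i * \<phi> x) \<in> Borel" by measurable
  have a2: "AE x\<in>\<Omega> in lborel. F x $ i * \<phi> x = H x $ i * \<phi> x"
    using H(2) by eventually_elim (use z in force)
  show "(LINT x|lebesgue_on \<Omega>. F x $ i * \<phi> x) = (LBINT x. H x $ i * \<phi> x)"
    by (rule lebesgue_on_integral_rep(1)[OF \<Omega>(1) m2 a2 _ lebesgue_on_AE_measurable[OF \<Omega>(1) m2 a2]]) (simp_all add: z z')
qed

lemma wgrad_has_weak_gradient:
  fixes \<Omega> :: "(real ^ 'n) set"
  assumes \<Omega>: "open \<Omega>" and w: "wgrad \<Omega> g F" and f: "AE x\<in>\<Omega> in lborel. f x = g x"
  shows "has_weak_gradient \<Omega> f F"
proof -
  have \<Omega>b: "\<Omega> \<in> sets borel" using \<Omega> by simp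
  have li: "integrable (lebesgue_on K) f'"
    if K: "compact K" "K \<subseteq> \<Omega>" and h: "L1 h" "AE x\<in>\<Omega> in lborel. f' x = h x"
    for K and f' h :: "real ^ 'n \<Rightarrow> 'b::euclidean_space"
  proof -
    have Kb: "K \<in> sets borel" using K(1) by (simp add: borel_compact)
    have m: "(\<lambda>x. indicator K x *R h x) \<in> Borel"
      using Kb borel_measurable_integrable[OF h(1)] by measurable
    have a: "AE x\<in>K in lborel. f' x = indicator K x *R h x"
      using h(2) by eventually_elim (use K(2) in auto)
    have "L1 (\<lambda>x. indicator K x *R h x)"
      using integrable_mult_indicator[OF _ h(1), of K] Kb by simp
    then show ?thesis
      using lebesgue_on_integral_rep(2)[OF Kb m a _ lebesgue_on_AE_measurable[OF Kb m a]] by simp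
  qed
  show ?thesis
    unfolding has_weak_gradient_def locally_integrable_def
  proof (intro conjI allI impI ballI)
    show "integrable (lebesgue_on K) f" if "compact K \<and> K \<subseteq> \<Omega>" for K
      by (rule li[OF _ _ wgradD(1)[OF w] f]) (use that in auto)
    show "integrable (lebesgue_on K) F" if "compact K \<and> K \<subseteq> \<Omega>" for K
      by (rule li[OF _ _ wgradD(2)[OF w]]) (use that in auto)
    fix \<phi> i assume "\<phi> \<in> test_functions \<Omega>"
    then have c: "C1c \<Omega> \<phi> (gradient \<phi>)" by (rule test_functions_C1c)
    have "(LINT x|lebesgue_on \<Omega>. f x * gradient \<phi> x $ i) = (LBINT x. g x * gradient \<phi> x $ i)"
      by (rule weak_gradient_test_integrals(1)[where F=F, OF \<Omega>b order_refl c wgradD(6)[OF w] f wgradD(7)[OF w]]) (rule AE_I2, simp)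
    also have "\<dots> = (LBINT x. g x *R gradient \<phi> x) $ i"
      using integral_vec_nth[OF C1c_test_integrable(1)[OF c wgradD(1,2)[OF w]], of i] by simp
    also have "\<dots> = - (LBINT x. \<phi> x *R F x) $ i" unfolding wgradD(5)[OF w c] by simp
    also have "(LBINT x. \<phi> x *R F x) $ i = (LBINT x. F x $ i * \<phi> x)"
      using integral_vec_nth[OF C1c_test_integrable(2)[OF c wgradD(1,2)[OF w]], of i] by (simp add: mult.commute)
    also have "\<dots> = (LINT x|lebesgue_on \<Omega>. F x $ i * \<phi> x)"
      by (rule weak_gradient_test_integrals(2)[where F=F, OF \<Omega>b order_refl c wgradD(6)[OF w] f wgradD(7)[OF w], symmetric]) (rule AE_I2, simp)
    finally show "(LINT x|lebesgue_on \<Omega>. f x * gradient \<phi> x $ i) = - (LINT x|lebesgue_on \<Omega>. F x $ i * \<phi> x)" .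
  qed
qed

text \<open>The subset \<open>D\<close> serves two cases: for Orlicz functions it is \<Omega>
  itself, whereas a merely locally integrable gradient has integrable representatives only on sets
  well inside \<Omega>.\<close>

lemma has_weak_gradient_wgrad:
  assumes \<Omega>: "open \<Omega>" and D: "open D" "D \<subseteq> \<Omega>" and hw: "has_weak_gradient \<Omega> f F"
    and g: "L1 g" "AE x\<in>D in lborel. f x = g x" "\<forall>x. x \<notin> D \<longrightarrow> g x = 0"
    and H: "L1 H" "AE x\<in>D in lborel. F x = H x" "\<forall>x. x \<notin> D \<longrightarrow> H x = 0"
  shows "wgrad D g H"
proof (rule wgradI_test[OF D(1) g(1) H(1)])
  have \<Omega>b: "\<Omega> \<in> sets borel" using \<Omega> by simp
  have gm: "g \<in> Borel" and Hm: "H \<in> Borel"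
    using borel_measurable_integrable[OF g(1)] borel_measurable_integrable[OF H(1)] by auto
  fix \<phi> assume t: "\<phi> \<in> test_functions D"
  then have t\<Omega>: "\<phi> \<in> test_functions \<Omega>" using D(2) unfolding test_functions_def by blast
  have c: "C1c D \<phi> (gradient \<phi>)" using t by (rule test_functions_C1c)
  note ti = weak_gradient_test_integrals[OF \<Omega>b D(2) c gm g(2) Hm H(2)]
  show "(LBINT x. g x *R gradient \<phi> x) = - (LBINT x. \<phi> x *R H x)"
  proof (subst vec_eq_iff, rule allI)
    fix i
    have "(LBINT x. g x *R gradient \<phi> x) $ i = (LBINT x. g x * gradient \<phi> x $ i)"
      using integral_vec_nth[OF C1c_test_integrable(1)[OF c g(1) H(1)], of i] by simp
    also have "\<dots> = - (LBINT x. H x $ i * \<phi> x)"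
      unfolding ti[symmetric] using hw t\<Omega> unfolding has_weak_gradient_def by blast
    also have "\<dots> = - (LBINT x. \<phi> x *R H x) $ i"
      using integral_vec_nth[OF C1c_test_integrable(2)[OF c g(1) H(1)], of i] by (simp add: mult.commute)
    finally show "(LBINT x. g x *R gradient \<phi> x) $ i = (- (LBINT x. \<phi> x *R H x)) $ i" by simp
  qed
qed (use g H in auto)

text \<open>Exhausts \<Omega> by the open sets of points at distance more than
  \<open>1 / real (Suc n)\<close> from the complement. Each lies in a compact subset, where local
  integrability is integrability. This is what makes the choice in \<open>weak_gradient\<close>
  harmless.\<close>

lemma has_weak_gradient_unique:
  fixes \<Omega> :: "(real ^ 'n) set"
  assumes \<Omega>: "open \<Omega>" "bounded \<Omega>" and hw: "has_weak_gradient \<Omega> f F1" "has_weak_gradient \<Omega> f F2"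
  shows "AE x\<in>\<Omega> in lborel. F1 x = F2 x"
proof -
  have ci: "continuous_on UNIV (\<lambda>x. infdist x (- \<Omega>))" by (intro continuous_on_infdist continuous_on_id)
  have "AE x in lborel. 1 / real (Suc n) < infdist x (- \<Omega>) \<longrightarrow> F1 x = F2 x" for n
  proof -
    define D where "D = {x. 1 / real (Suc n) < infdist x (- \<Omega>)}"
    define K where "K = {x. 1 / real (Suc n) \<le> infdist x (- \<Omega>)}"
    have oD: "open D" unfolding D_def by (rule open_Collect_less) (use ci in auto)
    have cK: "closed K" unfolding K_def by (rule closed_Collect_le) (use ci in auto)
    have K\<Omega>: "K \<subseteq> \<Omega>"
    proof
      fix x assume "x \<in> K"
      then have "0 < infdist x (- \<Omega>)" unfolding K_def by (smt (verit) divide_pos_pos mem_Collect_eq of_nat_0_less_iff zero_less_Suc)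
      then show "x \<in> \<Omega>" using infdist_zero[of x "- \<Omega>"] by fastforce
    qed
    have DK: "D \<subseteq> K" by (auto simp: D_def K_def)
    have bK: "bounded K" using K\<Omega> \<Omega>(2) bounded_subset by blast
    have compK: "compact K" using cK bK by (simp add: compact_eq_bounded_closed)
    have bD: "bounded D" using DK bK bounded_subset by blast
    have Db: "D \<in> sets borel" using oD by simp
    have Kb: "K \<in> sets borel" using cK by simp
    have rep: "\<exists>h. L1 h \<and> (AE x\<in>D in lborel. F x = h x) \<and> (\<forall>x. x \<notin> D \<longrightarrow> h x = 0)"
      if "locally_integrable \<Omega> F" for F :: "real ^ 'n \<Rightarrow> 'b::euclidean_space"
    proof -
      have iK: "integrable (lebesgue_on K) F" using that compK K\<Omega> unfolding locally_integrable_def by blast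
      obtain h where h: "h \<in> Borel" "AE x\<in>K in lborel. F x = h x" "\<forall>x. x \<notin> K \<longrightarrow> h x = 0"
        using lebesgue_measurable_rep[OF Kb borel_measurable_integrable[OF iK]] by (elim exE conjE) (rule that)
      have "L1 h"
        using lebesgue_on_integral_rep(2)[OF Kb h(1,2) _ borel_measurable_integrable[OF iK]] h(3) iK by blast
      from integrable_mult_indicator[OF _ this, of D] Db
      have "L1 (\<lambda>x. indicator D x *R h x)" by simp
      moreover have "AE x\<in>D in lborel. F x = indicator D x *R h x"
        using h(2) by eventually_elim (use DK in auto)
      ultimately show ?thesis by (intro exI[of _ "\<lambda>x. indicator D x *R h x"]) auto
    qed
    have li: "locally_integrable \<Omega> f" "locally_integrable \<Omega> F1" "locally_integrable \<Omega> F2"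
      using hw by (simp_all add: has_weak_gradient_def)
    obtain g where g: "L1 g" "AE x\<in>D in lborel. f x = g x" "\<forall>x. x \<notin> D \<longrightarrow> g x = 0"
      using rep[OF li(1)] by (elim exE conjE) (rule that)
    obtain h1 where h1: "L1 h1" "AE x\<in>D in lborel. F1 x = h1 x" "\<forall>x. x \<notin> D \<longrightarrow> h1 x = 0"
      using rep[OF li(2)] by (elim exE conjE) (rule that)
    obtain h2 where h2: "L1 h2" "AE x\<in>D in lborel. F2 x = h2 x" "\<forall>x. x \<notin> D \<longrightarrow> h2 x = 0"
      using rep[OF li(3)] by (elim exE conjE) (rule that)
    note w = has_weak_gradient_wgrad[OF \<Omega>(1) oD order_trans[OF DK K\<Omega>] _ g]
    from wgrad_unique[OF oD bD w[OF hw(1) h1] w[OF hw(2) h2]] h1(2) h2(2) show ?thesis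
      by eventually_elim (auto simp: D_def)
  qed
  then have "AE x in lborel. \<forall>n. 1 / real (Suc n) < infdist x (- \<Omega>) \<longrightarrow> F1 x = F2 x"
    unfolding AE_all_countable by (rule allI)
  then show ?thesis
  proof eventually_elim
    case (elim x)
    show ?case
    proof
      assume "x \<in> \<Omega>"
      from infdist_compl_pos[OF \<Omega> this] obtain n where "1 / real (Suc n) < infdist x (- \<Omega>)"
        using reals_Archimedean by (metis inverse_eq_divide)
      with elim show "F1 x = F2 x" by blast
    qed
  qed
qed

section \<open>Zero boundary values and modular convergence\<close>

text \<open>The closure of the test functions with respect to modulars, which are what convexity and
  domination arguments produce; \<open>sobolev_orlicz_0_iff_W0\<close> identifies it with the
  closure in norm.\<close>

definition W0 :: "(real \<Rightarrow> real) \<Rightarrow> (real ^ 'n) set \<Rightarrow> (real ^ 'n \<Rightarrow> real) \<Rightarrow> (real ^ 'n \<Rightarrow> real ^ 'n) \<Rightarrow> bool" where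
  "W0 G \<Omega> \<psi> \<Psi> \<longleftrightarrow> wgrad \<Omega> \<psi> \<Psi> \<and> (\<exists>\<phi>. (\<forall>n::nat. \<phi> n \<in> test_functions \<Omega>) \<and>
     (\<lambda>n. mdl G (\<lambda>x. \<psi> x - \<phi> n x)) \<longlonglongrightarrow> 0 \<and> (\<lambda>n. mdl G (\<lambda>x. \<Psi> x - gradient (\<phi> n) x)) \<longlonglongrightarrow> 0)"

locale young_domain =
  fixes G :: "real \<Rightarrow> real" and \<Omega> :: "(real ^ 'n) set" and C\<^sub>G :: real
  assumes yG: "young G" and superlinear: "\<And>t. t \<ge> 0 \<Longrightarrow> t \<le> G t + C\<^sub>G"
    and open_\<Omega>: "open \<Omega>" and bounded_\<Omega>: "bounded \<Omega>"
begin

lemma borel_\<Omega>[measurable]: "\<Omega> \<in> sets borel" using open_\<Omega> by simp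

lemma meas_G[measurable]: "f \<in> Borel \<Longrightarrow> (\<lambda>x. G (norm (f x))) \<in> Borel"
  for f :: "real ^ 'n \<Rightarrow> 'b::euclidean_space"
  by (rule young_measurable[OF yG])

lemma G_nonneg: "0 \<le> G (norm y)"
  by (rule young_nonneg[OF yG]) simp

lemma integrable_G:
  fixes f :: "real ^ 'n \<Rightarrow> 'b::euclidean_space"
  assumes "f \<in> Borel" "mdl G f < \<infinity>"
  shows "L1 (\<lambda>x. G (norm (f x)))"
  by (rule integrableI_nonneg) (use assms meas_G[OF assms(1)] G_nonneg in \<open>auto simp: mdl_def\<close>)

lemma integrable_ind_G:
  fixes f :: "real ^ 'n \<Rightarrow> 'b::euclidean_space"
  assumes "f \<in> Borel" "mdl G f < \<infinity>" "D \<in> sets borel"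
  shows "L1 (\<lambda>x. indicator D x * G (norm (f x)))"
  using integrable_mult_indicator[OF _ integrable_G[OF assms(1,2)], of D] assms(3) by simp

lemma emeasure_subset_\<Omega>:
  assumes "D \<in> sets borel" "D \<subseteq> \<Omega>"
  shows "emeasure lborel D < \<infinity>"
  using emeasure_mono[OF assms(2), of lborel] emeasure_bounded_finite[OF bounded_\<Omega>] by (simp add: order_le_less_trans)

lemma sobolev_orlicz_rep:
  assumes "f \<in> sobolev_orlicz G \<Omega>"
  shows "\<exists>g F. wgrad \<Omega> g F \<and> (AE x\<in>\<Omega> in lborel. f x = g x) \<and>
    (AE x\<in>\<Omega> in lborel. weak_gradient \<Omega> f x = F x) \<and> mdl G g < \<infinity> \<and> mdl G F < \<infinity>"
proof -
  obtain F0 where f: "f \<in> orlicz G \<Omega>" and F0: "F0 \<in> orlicz G \<Omega>" "has_weak_gradient \<Omega> f F0"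
    using assms unfolding sobolev_orlicz_def by blast
  obtain g where g: "g \<in> Borel" "AE x\<in>\<Omega> in lborel. f x = g x" "\<forall>x. x \<notin> \<Omega> \<longrightarrow> g x = 0" "mdl G g < \<infinity>"
    using orlicz_rep[OF yG borel_\<Omega> f] by (elim exE conjE) (rule that)
  obtain F where F: "F \<in> Borel" "AE x\<in>\<Omega> in lborel. F0 x = F x" "\<forall>x. x \<notin> \<Omega> \<longrightarrow> F x = 0" "mdl G F < \<infinity>"
    using orlicz_rep[OF yG borel_\<Omega> F0(1)] by (elim exE conjE) (rule that)
  have ig: "L1 g"
    by (rule mdl_finite_integrable[OF yG superlinear borel_\<Omega> bounded_\<Omega> g(1,4)]) (use g(3) in auto)
  have iF: "L1 F"
    by (rule mdl_finite_integrable[OF yG superlinear borel_\<Omega> bounded_\<Omega> F(1,4)]) (use F(3) in auto)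
  have w: "wgrad \<Omega> g F" by (rule has_weak_gradient_wgrad[OF open_\<Omega> open_\<Omega> order_refl F0(2) ig g(2,3) iF F(2,3)])
  have "has_weak_gradient \<Omega> f (weak_gradient \<Omega> f)"
    unfolding weak_gradient_def using F0(2) by (rule someI[of "has_weak_gradient \<Omega> f"])
  from has_weak_gradient_unique[OF open_\<Omega> bounded_\<Omega> this F0(2)] F(2)
  have "AE x\<in>\<Omega> in lborel. weak_gradient \<Omega> f x = F x" by eventually_elim auto
  with w g F show ?thesis by blast
qed

lemma sobolev_orliczI:
  assumes w: "wgrad \<Omega> g F" and f: "AE x\<in>\<Omega> in lborel. f x = g x" and fin: "mdl G g < \<infinity>" "mdl G F < \<infinity>"
  shows "f \<in> sobolev_orlicz G \<Omega>" "AE x\<in>\<Omega> in lborel. weak_gradient \<Omega> f x = F x"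
proof -
  have hw: "has_weak_gradient \<Omega> f F" by (rule wgrad_has_weak_gradient[OF open_\<Omega> w f])
  have "f \<in> orlicz G \<Omega>" by (rule orliczI[OF yG borel_\<Omega> wgradD(6)[OF w] f wgradD(3)[OF w] fin(1)])
  moreover have "F \<in> orlicz G \<Omega>"
    by (rule orliczI[OF yG borel_\<Omega> wgradD(7)[OF w] _ wgradD(4)[OF w] fin(2)]) auto
  ultimately show "f \<in> sobolev_orlicz G \<Omega>" unfolding sobolev_orlicz_def using hw by blast
  have "has_weak_gradient \<Omega> f (weak_gradient \<Omega> f)"
    unfolding weak_gradient_def using hw by (rule someI[of "has_weak_gradient \<Omega> f"])
  from has_weak_gradient_unique[OF open_\<Omega> bounded_\<Omega> this hw]
  show "AE x\<in>\<Omega> in lborel. weak_gradient \<Omega> f x = F x" .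
qed

text \<open>Ensures that \<open>Inf\<close> in \<open>luxemburg_norm\<close> is a genuine infimum:
  dividing by \<open>k \<ge> 1\<close> divides the modular at least by \<open>k\<close>.\<close>

lemma luxemburg_set_nonempty:
  fixes h :: "real ^ 'n \<Rightarrow> 'b::euclidean_space"
  assumes h: "h \<in> Borel" "AE x\<in>\<Omega> in lborel. f x = h x" "\<And>x. x \<notin> \<Omega> \<Longrightarrow> h x = 0" "mdl G h < \<infinity>"
  shows "\<exists>k>0. modular G \<Omega> (\<lambda>x. f x /\<^sub>R k) \<le> 1"
proof -
  obtain m where m: "mdl G h = ennreal m" "m \<ge> 0" using h(4) by (metis ennreal_cases infinity_ennreal_def less_irrefl)
  define k where "k = max 1 m"
  have k: "k \<ge> 1" "k \<ge> m" by (auto simp: k_def)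
  have "modular G \<Omega> (\<lambda>x. f x /\<^sub>R k) = mdl G (\<lambda>x. h x /\<^sub>R k)"
    by (rule modular_eq_mdl[OF yG borel_\<Omega>]) (use h in \<open>auto elim: eventually_mono\<close>)
  also have "\<dots> \<le> ennreal (inverse k) * mdl G h"
    by (rule mdl_scale_le[OF yG h(1)]) (use k in \<open>auto simp: field_simps\<close>)
  also have "\<dots> = ennreal (inverse k * m)" using m k by (simp add: ennreal_mult')
  also have "\<dots> \<le> 1" using k m by (simp add: field_simps ennreal_le_1)
  finally show ?thesis using k by (intro exI[of _ k]) auto
qed

lemma luxemburg_small_mdl:
  fixes h :: "real ^ 'n \<Rightarrow> 'b::euclidean_space"
  assumes h: "h \<in> Borel" "AE x\<in>\<Omega> in lborel. f x = h x" "\<And>x. x \<notin> \<Omega> \<Longrightarrow> h x = 0" "mdl G h < \<infinity>"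
  shows "0 \<le> luxemburg_norm G \<Omega> f" "luxemburg_norm G \<Omega> f < e \<Longrightarrow> e \<le> 1 \<Longrightarrow> mdl G h \<le> ennreal e"
proof -
  define S where "S = {k. 0 < k \<and> modular G \<Omega> (\<lambda>x. f x /\<^sub>R k) \<le> 1}"
  have ne: "S \<noteq> {}" using luxemburg_set_nonempty[OF h] by (auto simp: S_def)
  have L: "luxemburg_norm G \<Omega> f = Inf S" by (simp add: luxemburg_norm_def S_def)
  show "0 \<le> luxemburg_norm G \<Omega> f" unfolding L by (rule cInf_greatest[OF ne]) (auto simp: S_def)
  assume "luxemburg_norm G \<Omega> f < e" and e: "e \<le> 1"
  then obtain k where k: "k \<in> S" "k < e" unfolding L using cInf_lessD[OF ne] by blast
  have k0: "0 < k" and m: "modular G \<Omega> (\<lambda>x. f x /\<^sub>R k) \<le> 1" using k by (auto simp: S_def)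
  have "modular G \<Omega> (\<lambda>x. f x /\<^sub>R k) = mdl G (\<lambda>x. h x /\<^sub>R k)"
    by (rule modular_eq_mdl[OF yG borel_\<Omega>]) (use h in \<open>auto elim: eventually_mono\<close>)
  with m have m': "mdl G (\<lambda>x. h x /\<^sub>R k) \<le> 1" by simp
  have "mdl G (\<lambda>x. k *R (h x /\<^sub>R k)) \<le> ennreal k * mdl G (\<lambda>x. h x /\<^sub>R k)"
    by (rule mdl_scale_le[OF yG]) (use k k0 e h in auto)
  also have "\<dots> \<le> ennreal k * 1" by (rule mult_left_mono[OF m']) simp
  also have "\<dots> \<le> ennreal e" using k by (simp add: ennreal_leI)
  finally show "mdl G h \<le> ennreal e" using k0 by simp
qed

text \<open>Small norm implies small modular by convexity. In the converse direction doubling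
  enters: the modular of \<open>h n\<close> divided by \<open>e\<close> is at most a constant,
  depending on \<open>e\<close>, times that of \<open>h n\<close>.\<close>

lemma luxemburg_tendsto_iff:
  fixes h :: "nat \<Rightarrow> real ^ 'n \<Rightarrow> 'b::euclidean_space"
  assumes h: "\<And>n. h n \<in> Borel" "\<And>n. AE x\<in>\<Omega> in lborel. f n x = h n x" "\<And>n x. x \<notin> \<Omega> \<Longrightarrow> h n x = 0"
    "\<And>n. mdl G (h n) < \<infinity>"
  shows "(\<lambda>n. luxemburg_norm G \<Omega> (f n)) \<longlonglongrightarrow> 0 \<longleftrightarrow> (\<lambda>n. mdl G (h n)) \<longlonglongrightarrow> 0"
proof
  note lux = luxemburg_small_mdl[OF h]
  assume l: "(\<lambda>n. luxemburg_norm G \<Omega> (f n)) \<longlonglongrightarrow> 0"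
  \<comment> \<open>The null sequence is added because \<open>luxemburg_small_mdl\<close> asks for a
    number strictly above the norm.\<close>
  have l2: "(\<lambda>n. luxemburg_norm G \<Omega> (f n) + 1 / real (Suc n)) \<longlonglongrightarrow> 0"
    using tendsto_add[OF l LIMSEQ_Suc[OF lim_1_over_n]] by simp
  show "(\<lambda>n. mdl G (h n)) \<longlonglongrightarrow> 0"
  proof (rule tendsto_sandwich[OF _ _ tendsto_const])
    show "(\<lambda>n. ennreal (luxemburg_norm G \<Omega> (f n) + 1 / real (Suc n))) \<longlonglongrightarrow> 0" using tendsto_ennrealI[OF l2] by simp
    have "\<forall>\<^sub>F n in sequentially. luxemburg_norm G \<Omega> (f n) + 1 / real (Suc n) < 1" using order_tendstoD(2)[OF l2] by simp
    then show "\<forall>\<^sub>F n in sequentially. mdl G (h n) \<le> ennreal (luxemburg_norm G \<Omega> (f n) + 1 / real (Suc n))"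
      by eventually_elim (intro lux(2), simp_all)
  qed simp
next
  note lux = luxemburg_small_mdl[OF h]
  assume l: "(\<lambda>n. mdl G (h n)) \<longlonglongrightarrow> 0"
  show "(\<lambda>n. luxemburg_norm G \<Omega> (f n)) \<longlonglongrightarrow> 0"
  proof (rule order_tendstoI)
    show "\<forall>\<^sub>F n in sequentially. a < luxemburg_norm G \<Omega> (f n)" if "a < 0" for a
      using lux(1) that by (intro always_eventually allI) (rule order_less_le_trans)
    fix a :: real assume a: "0 < a"
    define e where "e = a / 2"
    have e: "0 < e" "e < a" using a by (auto simp: e_def)
    obtain C where C: "C > 0" "\<And>h :: real ^ 'n \<Rightarrow> 'b. h \<in> Borel \<Longrightarrow> mdl G (\<lambda>x. inverse e *R h x) \<le> ennreal C * mdl G h"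
      using mdl_scaleR[OF yG, where 'b='b and 'n='n, of "inverse e"] by blast
    have "0 < ennreal (1 / C)" using C(1) by simp
    from order_tendstoD(2)[OF l this] show "\<forall>\<^sub>F n in sequentially. luxemburg_norm G \<Omega> (f n) < a"
    proof eventually_elim
      case (elim n)
      have "modular G \<Omega> (\<lambda>x. f n x /\<^sub>R e) = mdl G (\<lambda>x. h n x /\<^sub>R e)"
        by (rule modular_eq_mdl[OF yG borel_\<Omega>]) (use h(2)[of n] h(3) in \<open>auto elim: eventually_mono\<close>)
      also have "\<dots> \<le> ennreal C * mdl G (h n)" by (rule C(2)[OF h(1)])
      also have "\<dots> \<le> ennreal C * ennreal (1 / C)" by (rule mult_left_mono[OF less_imp_le[OF elim]]) simp
      also have "\<dots> = 1" using C(1) by (simp add: ennreal_mult'[symmetric])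
      finally have "e \<in> {k. 0 < k \<and> modular G \<Omega> (\<lambda>x. f n x /\<^sub>R k) \<le> 1}" using e by simp
      then have "luxemburg_norm G \<Omega> (f n) \<le> e" unfolding luxemburg_norm_def
        by (rule cInf_lower) (auto intro: bdd_belowI[of _ 0])
      then show ?case using e by simp
    qed
  qed
qed

lemma test_function_wgrad:
  assumes "\<phi> \<in> test_functions \<Omega>"
  shows "wgrad \<Omega> \<phi> (gradient \<phi>)"
  by (rule C1c_wgrad[OF test_functions_C1c[OF assms]])

lemma bounded_mdl_finite:
  fixes h :: "real ^ 'n \<Rightarrow> 'b::euclidean_space"
  assumes [measurable]: "h \<in> Borel" and b: "\<And>x. norm (h x) \<le> B" and z: "\<And>x. x \<notin> \<Omega> \<Longrightarrow> h x = 0"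
  shows "mdl G h < \<infinity>"
proof -
  have "mdl G h \<le> (\<integral>\<^sup>+x. ennreal (G B) * indicator \<Omega> x \<partial>lborel)"
    unfolding mdl_def
  proof (rule nn_integral_mono)
    fix x
    show "ennreal (G (norm (h x))) \<le> ennreal (G B) * indicator \<Omega> x"
    proof (cases "x \<in> \<Omega>")
      case True then show ?thesis using b[of x] by (auto intro!: ennreal_leI young_mono[OF yG])
    next
      case False then show ?thesis using yG z by (simp add: young_def)
    qed
  qed
  also have "\<dots> < \<infinity>" using emeasure_bounded_finite[OF bounded_\<Omega>]
    by (simp add: nn_integral_cmult_indicator ennreal_mult_less_top)
  finally show ?thesis .
qed

lemma test_function_mdl:
  assumes "\<phi> \<in> test_functions \<Omega>"
  shows "mdl G \<phi> < \<infinity>" "mdl G (gradient \<phi>) < \<infinity>"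
proof -
  note c = test_functions_C1c[OF assms]
  obtain B where B: "B > 0" "\<And>x. norm (\<phi> x) \<le> B" "\<And>x. norm (gradient \<phi> x) \<le> B" using C1c_bounded[OF c] by metis
  have z: "\<phi> x = 0 \<and> gradient \<phi> x = 0" if "x \<notin> \<Omega>" for x using c that unfolding C1c_def by blast
  show "mdl G \<phi> < \<infinity>" by (rule bounded_mdl_finite[OF _ B(2)]) (use C1c_measurable[OF c] z in auto)
  show "mdl G (gradient \<phi>) < \<infinity>" by (rule bounded_mdl_finite[OF _ B(3)]) (use C1c_measurable[OF c] z in auto)
qed

lemma mdl_diff_finite:
  fixes f g :: "real ^ 'n \<Rightarrow> 'b::euclidean_space"
  assumes f: "f \<in> Borel" "mdl G f < \<infinity>" and g: "g \<in> Borel" "mdl G g < \<infinity>"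
  shows "mdl G (\<lambda>x. f x - g x) < \<infinity>"
proof -
  have "mdl G (\<lambda>x. - g x) < \<infinity>" using g(2) by (simp add: mdl_def)
  from mdl_add_finite[OF yG f _ this] g(1) show ?thesis by simp
qed

lemma sobolev_orlicz_0_iff_W0:
  assumes w: "wgrad \<Omega> g F" and f: "AE x\<in>\<Omega> in lborel. f x = g x" and fin: "mdl G g < \<infinity>" "mdl G F < \<infinity>"
  shows "f \<in> sobolev_orlicz_0 G \<Omega> \<longleftrightarrow> W0 G \<Omega> g F"
proof -
  have "(\<lambda>k. sobolev_orlicz_norm G \<Omega> (\<lambda>x. f x - \<phi> k x)) \<longlonglongrightarrow> 0 \<longleftrightarrow>
      (\<lambda>k. mdl G (\<lambda>x. g x - \<phi> k x)) \<longlonglongrightarrow> 0 \<and> (\<lambda>k. mdl G (\<lambda>x. F x - gradient (\<phi> k) x)) \<longlonglongrightarrow> 0"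
    if \<phi>: "\<And>k::nat. \<phi> k \<in> test_functions \<Omega>" for \<phi>
  proof -
    note t = test_function_wgrad[OF \<phi>] and tm = test_function_mdl[OF \<phi>]
    note wd = wgrad_diff[OF w t]
    have a: "AE x\<in>\<Omega> in lborel. f x - \<phi> k x = g x - \<phi> k x" for k using f by eventually_elim simp
    note f1 = mdl_diff_finite[OF wgradD(6)[OF w] fin(1) wgradD(6)[OF t] tm(1)]
    note f2 = mdl_diff_finite[OF wgradD(7)[OF w] fin(2) wgradD(7)[OF t] tm(2)]
    note s = sobolev_orliczI(2)[OF wd a f1 f2]
    define l where "l k = luxemburg_norm G \<Omega> (\<lambda>x. f x - \<phi> k x)" for k
    define l' where "l' k = luxemburg_norm G \<Omega> (weak_gradient \<Omega> (\<lambda>x. f x - \<phi> k x))" for k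
    have nn: "0 \<le> l k" "0 \<le> l' k" for k
      using luxemburg_small_mdl(1)[OF wgradD(6)[OF wd] a wgradD(3)[OF wd] f1] luxemburg_small_mdl(1)[OF wgradD(7)[OF wd] s wgradD(4)[OF wd] f2]
      by (auto simp: l_def l'_def)
    have "(\<lambda>k. l k + l' k) \<longlonglongrightarrow> 0 \<longleftrightarrow> l \<longlonglongrightarrow> 0 \<and> l' \<longlonglongrightarrow> 0"
    proof
      assume c: "(\<lambda>k. l k + l' k) \<longlonglongrightarrow> 0"
      show "l \<longlonglongrightarrow> 0 \<and> l' \<longlonglongrightarrow> 0"
        by (intro conjI; rule tendsto_sandwich[OF _ _ tendsto_const c]) (use nn in \<open>auto intro!: always_eventually\<close>)
    qed (use tendsto_add[of l 0 sequentially l' 0] in auto)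
    moreover have "l \<longlonglongrightarrow> 0 \<longleftrightarrow> (\<lambda>k. mdl G (\<lambda>x. g x - \<phi> k x)) \<longlonglongrightarrow> 0" unfolding l_def[abs_def]
      by (rule luxemburg_tendsto_iff[OF wgradD(6)[OF wd] a wgradD(3)[OF wd] f1])
    moreover have "l' \<longlonglongrightarrow> 0 \<longleftrightarrow> (\<lambda>k. mdl G (\<lambda>x. F x - gradient (\<phi> k) x)) \<longlonglongrightarrow> 0" unfolding l'_def[abs_def]
      by (rule luxemburg_tendsto_iff[OF wgradD(7)[OF wd] s wgradD(4)[OF wd] f2])
    ultimately show ?thesis by (simp add: sobolev_orlicz_norm_def l_def l'_def)
  qed
  then show ?thesis
    unfolding sobolev_orlicz_0_def W0_def using w sobolev_orliczI(1)[OF w f fin] by auto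
qed

lemma mdl_tendsto_add:
  fixes f g :: "nat \<Rightarrow> real ^ 'n \<Rightarrow> 'b::euclidean_space"
  assumes "\<And>n. f n \<in> Borel" "\<And>n. g n \<in> Borel"
    and l: "(\<lambda>n. mdl G (f n)) \<longlonglongrightarrow> 0" "(\<lambda>n. mdl G (g n)) \<longlonglongrightarrow> 0"
  shows "(\<lambda>n. mdl G (\<lambda>x. f n x + g n x)) \<longlonglongrightarrow> 0"
proof -
  obtain C where C: "C > 0" "\<forall>f\<in>Borel. \<forall>g\<in>Borel.
    mdl G (\<lambda>x. f x + g x :: 'b) \<le> ennreal C * (mdl G f + mdl G (g :: real ^ 'n \<Rightarrow> 'b))"
    using mdl_add[OF yG, where 'b='b and 'n='n] by blast
  have c: "(\<lambda>n. ennreal C * (mdl G (f n) + mdl G (g n))) \<longlonglongrightarrow> 0"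
    using ennreal_tendsto_cmult[OF _ tendsto_add[OF l], of "ennreal C"] by simp
  show ?thesis by (rule tendsto_sandwich[OF _ _ tendsto_const c]) (use C(2) assms in auto)
qed

lemma mdl_tendsto_scaleR:
  fixes f :: "nat \<Rightarrow> real ^ 'n \<Rightarrow> 'b::euclidean_space"
  assumes "\<And>n. f n \<in> Borel" and l: "(\<lambda>n. mdl G (f n)) \<longlonglongrightarrow> 0"
  shows "(\<lambda>n. mdl G (\<lambda>x. c *R f n x)) \<longlonglongrightarrow> 0"
proof -
  obtain C where C: "C > 0" "\<forall>f\<in>Borel. mdl G (\<lambda>x. c *R f x :: 'b) \<le> ennreal C * mdl G (f :: real ^ 'n \<Rightarrow> 'b)"
    using mdl_scaleR[OF yG, where 'b='b and 'n='n, of c] by blast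
  have c: "(\<lambda>n. ennreal C * mdl G (f n)) \<longlonglongrightarrow> 0"
    using ennreal_tendsto_cmult[OF _ l, of "ennreal C"] by simp
  show ?thesis by (rule tendsto_sandwich[OF _ _ tendsto_const c]) (use C(2) assms in auto)
qed

end

context young_domain
begin

lemma wgrad_compact_UNIV:
  assumes w: "wgrad \<Omega> f F" and K: "compact K" "K \<subseteq> \<Omega>" "\<And>x. x \<notin> K \<Longrightarrow> f x = 0 \<and> F x = 0"
  shows "wgrad UNIV f F"
  unfolding wgrad_def
proof (intro conjI allI impI)
  fix \<phi> :: "real ^ 'n \<Rightarrow> real" and \<phi>' assume c: "C1c UNIV \<phi> \<phi>'"
  show "(LBINT x. f x *R \<phi>' x) = - (LBINT x. \<phi> x *R F x)"
    by (rule wgrad_test_local[OF w open_\<Omega> order_refl K])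
      (use c in \<open>auto simp: C1c_def intro: continuous_on_subset\<close>)
qed (use wgradD[OF w] in auto)

text \<open>Mollifications at scales below the distance from \<open>K\<close> to the complement are
  test functions, and they converge in modular.\<close>

lemma compact_support_W0:
  assumes w: "wgrad \<Omega> f F" and K: "compact K" "K \<subseteq> \<Omega>" "\<And>x. x \<notin> K \<Longrightarrow> f x = 0 \<and> F x = 0"
    and fin: "mdl G f < \<infinity>" "mdl G F < \<infinity>"
  shows "W0 G \<Omega> f F"
proof -
  obtain d where d: "d > 0" "\<And>x. x \<in> K \<Longrightarrow> cball x d \<subseteq> \<Omega>"
    by (rule compact_cball_nbhd[OF K(1,2) open_\<Omega>], rule that)
  define r where "r n = d * (1 / real (Suc n))" for n
  have r: "0 < r n" "r n \<le> d" for n using d(1) by (auto simp: r_def field_simps)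
  have r0: "r \<longlonglongrightarrow> 0" using tendsto_mult_right_zero[OF LIMSEQ_Suc[OF lim_1_over_n], of d] by (simp add: r_def[abs_def])
  have "\<forall>n. \<exists>k :: real ^ 'n \<Rightarrow> real. kernel (r n) k" by (intro allI ex_kernel r)
  then obtain k :: "nat \<Rightarrow> real ^ 'n \<Rightarrow> real" where k: "\<And>n. kernel (r n) (k n)" by metis
  have "wgrad UNIV f F" by (rule wgrad_compact_UNIV[OF w K])
  then have grad: "gradient (conv (k n) f) x = conv (k n) F x" for n x
    by (intro GDERIV_gradient_eq conv_wgrad[OF _ k subset_UNIV])
  have "conv (k n) f \<in> test_functions \<Omega>" for n
  proof (rule conv_test_function[OF k wgradD(1)[OF w] K(1)])
    show "cball x (r n) \<subseteq> \<Omega>" if "x \<in> K" for x using d(2)[OF that] r(2)[of n] by (meson order_trans subset_cball)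
  qed (use K(3) in blast)
  moreover have "(\<lambda>n. mdl G (\<lambda>x. f x - conv (k n) f x)) \<longlonglongrightarrow> 0"
    using conv_mdl_tendsto[OF yG wgradD(1)[OF w] fin(1) k r0] by (simp add: mdl_def abs_minus_commute)
  moreover have "(\<lambda>n. mdl G (\<lambda>x. F x - conv (k n) F x)) \<longlonglongrightarrow> 0"
    using conv_mdl_tendsto[OF yG wgradD(2)[OF w] fin(2) k r0] by (simp add: mdl_def norm_minus_commute)
  ultimately show ?thesis
    unfolding W0_def using w by (intro conjI exI[of _ "\<lambda>n. conv (k n) f"]) (auto simp: grad)
qed

text \<open>A diagonal choice: the \<open>n\<close>-th function is replaced by a test function
  within \<open>1 / real (Suc n)\<close> in both modulars.\<close>

lemma W0_limit:
  assumes w: "wgrad \<Omega> \<psi> \<Psi>" and f: "\<And>n::nat. W0 G \<Omega> (f n) (F n)"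
    and l: "(\<lambda>n. mdl G (\<lambda>x. \<psi> x - f n x)) \<longlonglongrightarrow> 0" "(\<lambda>n. mdl G (\<lambda>x. \<Psi> x - F n x)) \<longlonglongrightarrow> 0"
  shows "W0 G \<Omega> \<psi> \<Psi>"
proof -
  have inv: "(\<lambda>n. ennreal (1 / real (Suc n))) \<longlonglongrightarrow> 0"
    using tendsto_ennrealI[OF LIMSEQ_Suc[OF lim_1_over_n]] by simp
  have "\<forall>n. \<exists>\<phi>. \<phi> \<in> test_functions \<Omega> \<and> mdl G (\<lambda>x. f n x - \<phi> x) \<le> ennreal (1 / real (Suc n)) \<and> mdl G (\<lambda>x. F n x - gradient \<phi> x) \<le> ennreal (1 / real (Suc n))"
  proof
    fix n
    obtain \<phi> where \<phi>: "\<And>k::nat. \<phi> k \<in> test_functions \<Omega>" "(\<lambda>k. mdl G (\<lambda>x. f n x - \<phi> k x)) \<longlonglongrightarrow> 0"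
      "(\<lambda>k. mdl G (\<lambda>x. F n x - gradient (\<phi> k) x)) \<longlonglongrightarrow> 0"
      using f[of n] unfolding W0_def by blast
    have p: "0 < ennreal (1 / real (Suc n))" by simp
    obtain k where "mdl G (\<lambda>x. f n x - \<phi> k x) < ennreal (1 / real (Suc n))" "mdl G (\<lambda>x. F n x - gradient (\<phi> k) x) < ennreal (1 / real (Suc n))"
      using eventually_happens'[OF sequentially_bot eventually_conj[OF order_tendstoD(2)[OF \<phi>(2) p] order_tendstoD(2)[OF \<phi>(3) p]]] by blast
    then show "\<exists>\<phi>. \<phi> \<in> test_functions \<Omega> \<and> mdl G (\<lambda>x. f n x - \<phi> x) \<le> ennreal (1 / real (Suc n)) \<and> mdl G (\<lambda>x. F n x - gradient \<phi> x) \<le> ennreal (1 / real (Suc n))"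
      using \<phi>(1)[of k] by (intro exI[of _ "\<phi> k"]) auto
  qed
  from choice[OF this] obtain \<phi> where "\<forall>n. \<phi> n \<in> test_functions \<Omega> \<and> mdl G (\<lambda>x. f n x - \<phi> n x) \<le> ennreal (1 / real (Suc n)) \<and>
    mdl G (\<lambda>x. F n x - gradient (\<phi> n) x) \<le> ennreal (1 / real (Suc n))" by (elim exE) (rule that)
  then have \<phi>: "\<And>n. \<phi> n \<in> test_functions \<Omega>" "\<And>n. mdl G (\<lambda>x. f n x - \<phi> n x) \<le> ennreal (1 / real (Suc n))"
    "\<And>n. mdl G (\<lambda>x. F n x - gradient (\<phi> n) x) \<le> ennreal (1 / real (Suc n))" by auto
  have wf: "wgrad \<Omega> (f n) (F n)" for n using f by (simp add: W0_def)
  note [measurable] = wgradD(6,7)[OF w] wgradD(6,7)[OF wf] C1c_measurable[OF test_functions_C1c[OF \<phi>(1)]]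
  have "(\<lambda>n. mdl G (\<lambda>x. (\<psi> x - f n x) + (f n x - \<phi> n x))) \<longlonglongrightarrow> 0"
    by (rule mdl_tendsto_add[OF _ _ l(1) tendsto_sandwich[OF _ _ tendsto_const inv]]) (measurable, use \<phi>(2) in auto)
  moreover have "(\<lambda>n. mdl G (\<lambda>x. (\<Psi> x - F n x) + (F n x - gradient (\<phi> n) x))) \<longlonglongrightarrow> 0"
    by (rule mdl_tendsto_add[OF _ _ l(2) tendsto_sandwich[OF _ _ tendsto_const inv]]) (measurable, use \<phi>(3) in auto)
  ultimately show ?thesis unfolding W0_def using w \<phi>(1) by auto
qed

lemma W0_add_scale:
  assumes "W0 G \<Omega> f F" "W0 G \<Omega> g H"
  shows "W0 G \<Omega> (\<lambda>x. f x + c * g x) (\<lambda>x. F x + c *R H x)"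
proof -
  have wf: "wgrad \<Omega> f F" and wg: "wgrad \<Omega> g H" using assms by (auto simp: W0_def)
  obtain \<phi> where \<phi>: "\<And>n::nat. \<phi> n \<in> test_functions \<Omega>" "(\<lambda>n. mdl G (\<lambda>x. f x - \<phi> n x)) \<longlonglongrightarrow> 0"
    "(\<lambda>n. mdl G (\<lambda>x. F x - gradient (\<phi> n) x)) \<longlonglongrightarrow> 0"
    using assms(1) unfolding W0_def by blast
  obtain \<xi> where \<xi>: "\<And>n::nat. \<xi> n \<in> test_functions \<Omega>" "(\<lambda>n. mdl G (\<lambda>x. g x - \<xi> n x)) \<longlonglongrightarrow> 0"
    "(\<lambda>n. mdl G (\<lambda>x. H x - gradient (\<xi> n) x)) \<longlonglongrightarrow> 0"
    using assms(2) unfolding W0_def by blast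
  note w1 = test_function_wgrad[OF \<phi>(1)] and w2 = test_function_wgrad[OF \<xi>(1)]
  note [measurable] = wgradD(6,7)[OF wf] wgradD(6,7)[OF wg] wgradD(6,7)[OF w1] wgradD(6,7)[OF w2]
  show ?thesis
  proof (rule W0_limit[OF wgrad_add[OF wf wgrad_scale[OF wg]]])
    fix n
    obtain K1 where K1: "compact K1" "K1 \<subseteq> \<Omega>" "\<And>x. x \<notin> K1 \<Longrightarrow> \<phi> n x = 0 \<and> gradient (\<phi> n) x = 0"
      using test_functions_C1c[OF \<phi>(1)[of n]] unfolding C1c_def by blast
    obtain K2 where K2: "compact K2" "K2 \<subseteq> \<Omega>" "\<And>x. x \<notin> K2 \<Longrightarrow> \<xi> n x = 0 \<and> gradient (\<xi> n) x = 0"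
      using test_functions_C1c[OF \<xi>(1)[of n]] unfolding C1c_def by blast
    show "W0 G \<Omega> (\<lambda>x. \<phi> n x + c * \<xi> n x) (\<lambda>x. gradient (\<phi> n) x + c *R gradient (\<xi> n) x)"
    proof (rule compact_support_W0[OF wgrad_add[OF w1 wgrad_scale[OF w2]] compact_Un[OF K1(1) K2(1)]])
      show "mdl G (\<lambda>x. \<phi> n x + c * \<xi> n x) < \<infinity>"
        using mdl_add_finite[OF yG _ test_function_mdl(1)[OF \<phi>(1)] _ mdl_scaleR_finite[OF yG _ test_function_mdl(1)[OF \<xi>(1)], of n c], of n] by simp
      show "mdl G (\<lambda>x. gradient (\<phi> n) x + c *R gradient (\<xi> n) x) < \<infinity>"
        using mdl_add_finite[OF yG _ test_function_mdl(2)[OF \<phi>(1)] _ mdl_scaleR_finite[OF yG _ test_function_mdl(2)[OF \<xi>(1)], of n c], of n] by simp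
    qed (use K1 K2 in auto)
  next
    have "(\<lambda>n. mdl G (\<lambda>x. (f x - \<phi> n x) + c *R (g x - \<xi> n x))) \<longlonglongrightarrow> 0"
      by (rule mdl_tendsto_add[OF _ _ \<phi>(2) mdl_tendsto_scaleR[OF _ \<xi>(2)]]) measurable
    then show "(\<lambda>n. mdl G (\<lambda>x. f x + c * g x - (\<phi> n x + c * \<xi> n x))) \<longlonglongrightarrow> 0" by (simp add: algebra_simps)
    have "(\<lambda>n. mdl G (\<lambda>x. (F x - gradient (\<phi> n) x) + c *R (H x - gradient (\<xi> n) x))) \<longlonglongrightarrow> 0"
      by (rule mdl_tendsto_add[OF _ _ \<phi>(3) mdl_tendsto_scaleR[OF _ \<xi>(3)]]) measurable
    then show "(\<lambda>n. mdl G (\<lambda>x. F x + c *R H x - (gradient (\<phi> n) x + c *R gradient (\<xi> n) x))) \<longlonglongrightarrow> 0" by (simp add: algebra_simps)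
  qed
qed

end

locale orlicz_domain = young_domain G \<Omega> C\<^sub>G
  for G :: "real \<Rightarrow> real" and \<Omega> :: "(real ^ 'n) set" and C\<^sub>G :: real +
  assumes G_pos: "t > 0 \<Longrightarrow> G t > 0"
begin

text \<open>Since \<open>G t / t\<close> is nondecreasing, \<open>t\<close> is at most
  \<open>a\<close> or at most \<open>(a / G a) * G t\<close>. The first alternative contributes
  \<open>a\<close> times the measure of \<Omega>, the second a multiple of the modular.\<close>

lemma mdl_L1:
  assumes "e > 0"
  shows "\<exists>d>0. \<forall>h :: real ^ 'n \<Rightarrow> 'b::euclidean_space. L1 h \<longrightarrow> (\<forall>x. x \<notin> \<Omega> \<longrightarrow> h x = 0) \<longrightarrow> mdl G h \<le> ennreal d \<longrightarrow>
    (LBINT x. norm (h x)) \<le> e"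
proof -
  define m where "m = measure lborel \<Omega>"
  have em: "emeasure lborel \<Omega> = ennreal m"
    using emeasure_bounded_finite[OF bounded_\<Omega>] by (simp add: m_def emeasure_eq_ennreal_measure less_top)
  have m0: "m \<ge> 0" by (simp add: m_def)
  \<comment> \<open>Makes \<open>a * m\<close> at most half of \<open>e\<close>, also when \<Omega>
    is empty.\<close>
  define a where "a = e / (2 * (m + 1))"
  have a: "a > 0" using \<open>e > 0\<close> m0 by (simp add: a_def)
  define c where "c = a / G a"
  have c: "c > 0" using a G_pos by (simp add: c_def)
  define d where "d = e / (2 * c)"
  have "(LBINT x. norm (h x)) \<le> e"
    if h: "L1 h" "\<forall>x. x \<notin> \<Omega> \<longrightarrow> h x = 0" "mdl G h \<le> ennreal d" for h :: "real ^ 'n \<Rightarrow> 'b"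
  proof -
    have hm[measurable]: "h \<in> Borel" using h(1) by auto
    note [measurable] = young_measurable[OF yG hm]
    have pt: "norm (h x) \<le> a * indicator \<Omega> x + c * G (norm (h x))" for x
    proof (cases "norm (h x) \<le> a")
      case True
      have "0 \<le> c * G (norm (h x))" using c young_nonneg[OF yG] by simp
      then show ?thesis using True h(2) by (cases "x \<in> \<Omega>") auto
    next
      case False
      define t where "t = norm (h x)"
      have t: "t > a" using False by (simp add: t_def)
      have "G a = G (a / t * t)" using t a by simp
      also have "\<dots> \<le> a / t * G t" by (rule young_scale[OF yG]) (use t a in \<open>auto simp: divide_le_eq\<close>)
      finally have "t * G a \<le> a * G t" using t a by (simp add: field_simps)
      then have "t \<le> c * G t" using G_pos[OF a] by (simp add: c_def field_simps)
      moreover have "0 \<le> a * indicator \<Omega> x" using a by simp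
      ultimately show ?thesis unfolding t_def by linarith
    qed
    have "ennreal (LBINT x. norm (h x)) = (\<integral>\<^sup>+x. ennreal (norm (h x)) \<partial>lborel)"
      using nn_integral_eq_integral[of lborel "\<lambda>x. norm (h x)"] h(1) by simp
    also have "\<dots> \<le> (\<integral>\<^sup>+x. ennreal a * indicator \<Omega> x + ennreal c * ennreal (G (norm (h x))) \<partial>lborel)"
    proof (rule nn_integral_mono)
      fix x
      have "ennreal (norm (h x)) \<le> ennreal (a * indicator \<Omega> x + c * G (norm (h x)))" by (rule ennreal_leI[OF pt])
      also have "\<dots> = ennreal a * indicator \<Omega> x + ennreal c * ennreal (G (norm (h x)))"
        using a c young_nonneg[OF yG] by (simp add: ennreal_plus ennreal_mult' ennreal_indicator)
      finally show "ennreal (norm (h x)) \<le> ennreal a * indicator \<Omega> x + ennreal c * ennreal (G (norm (h x)))" .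
    qed
    also have "\<dots> = ennreal a * emeasure lborel \<Omega> + ennreal c * mdl G h"
      by (subst nn_integral_add) (auto simp: mdl_def nn_integral_cmult_indicator nn_integral_cmult)
    also have "\<dots> \<le> ennreal a * ennreal m + ennreal c * ennreal d"
      unfolding em by (intro add_left_mono mult_left_mono h(3)) auto
    also have "\<dots> = ennreal (a * m + c * d)"
      using a c m0 \<open>e > 0\<close> unfolding d_def
      by (simp add: ennreal_mult'[symmetric] ennreal_plus[symmetric] del: ennreal_plus)
    also have "a * m + c * d \<le> e"
    proof -
      have "a * m \<le> e / 2" using \<open>e > 0\<close> m0 by (simp add: a_def field_simps)
      moreover have "c * d = e / 2" using c by (simp add: d_def)
      ultimately show ?thesis by simp
    qed
    finally show ?thesis using \<open>e > 0\<close> by (simp add: ennreal_leI)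
  qed
  moreover have "d > 0" using c \<open>e > 0\<close> by (simp add: d_def)
  ultimately show ?thesis by blast
qed

lemma mdl_tendsto_L1:
  fixes h :: "nat \<Rightarrow> real ^ 'n \<Rightarrow> 'b::euclidean_space"
  assumes "\<And>n. L1 (h n)" "\<And>n x. x \<notin> \<Omega> \<Longrightarrow> h n x = 0" "(\<lambda>n. mdl G (h n)) \<longlonglongrightarrow> 0"
  shows "(\<lambda>n. LBINT x. norm (h n x)) \<longlonglongrightarrow> 0"
proof (rule LIMSEQ_I)
  fix e :: real assume "e > 0"
  obtain d where d: "d > 0" "\<And>h :: real ^ 'n \<Rightarrow> 'b. L1 h \<Longrightarrow> \<forall>x. x \<notin> \<Omega> \<longrightarrow> h x = 0 \<Longrightarrow> mdl G h \<le> ennreal d \<Longrightarrow>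
    (LBINT x. norm (h x)) \<le> e / 2"
    using mdl_L1[where 'b='b, of "e / 2"] \<open>e > 0\<close> by auto
  have "ennreal d > 0" using d(1) by simp
  from order_tendstoD(2)[OF assms(3) this] obtain N where N: "\<And>n. n \<ge> N \<Longrightarrow> mdl G (h n) < ennreal d"
    unfolding eventually_sequentially by blast
  have "norm ((LBINT x. norm (h n x)) - 0) < e" if "n \<ge> N" for n
    using d(2)[OF assms(1), of n] assms(2) N[OF that] \<open>e > 0\<close> by (auto simp: less_imp_le)
  then show "\<exists>N. \<forall>n\<ge>N. norm ((LBINT x. norm (h n x)) - 0) < e" by blast
qed

text \<open>Zero boundary values let the gradient identity pass across the frontier: it holds on the
  whole space for the approximating test functions and survives L1 limits.\<close>

lemma W0_wgrad_UNIV: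
  assumes w0: "W0 G \<Omega> f F"
  shows "wgrad UNIV f F"
proof -
  have w: "wgrad \<Omega> f F" using w0 by (simp add: W0_def)
  obtain \<phi> where \<phi>: "\<And>n::nat. \<phi> n \<in> test_functions \<Omega>" "(\<lambda>n. mdl G (\<lambda>x. f x - \<phi> n x)) \<longlonglongrightarrow> 0"
    "(\<lambda>n. mdl G (\<lambda>x. F x - gradient (\<phi> n) x)) \<longlonglongrightarrow> 0"
    using w0 unfolding W0_def by blast
  note t = test_function_wgrad[OF \<phi>(1)]
  have c: "wgrad UNIV (\<phi> n) (gradient (\<phi> n))" for n
    by (rule C1c_wgrad[OF C1c_mono[OF test_functions_C1c[OF \<phi>(1)] subset_UNIV]])
  have l1: "(\<lambda>n. LBINT x. norm (f x - \<phi> n x)) \<longlonglongrightarrow> 0"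
    by (rule mdl_tendsto_L1[OF _ _ \<phi>(2)]) (use wgradD[OF w] wgradD[OF t] in auto)
  have l2: "(\<lambda>n. LBINT x. norm (F x - gradient (\<phi> n) x)) \<longlonglongrightarrow> 0"
    by (rule mdl_tendsto_L1[OF _ _ \<phi>(3)]) (use wgradD[OF w] wgradD[OF t] in auto)
  show ?thesis
    by (rule wgrad_limit[OF c wgradD(1,2)[OF w]]) (use l1 l2 in \<open>simp_all add: abs_minus_commute norm_minus_commute\<close>)
qed

text \<open>A crude Poincare argument: testing with a coordinate function turns the integral of
  \<open>f\<close> into an integral of the gradient, hence into 0, and \<open>f\<close> is
  nonnegative.\<close>

lemma W0_zero_gradient:
  assumes w0: "W0 G \<Omega> f F" and F: "AE x in lborel. F x = 0" and nn: "\<And>x. 0 \<le> f x"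
  shows "AE x in lborel. f x = 0"
proof -
  have w: "wgrad UNIV f F" by (rule W0_wgrad_UNIV[OF w0])
  have w\<Omega>: "wgrad \<Omega> f F" using w0 by (simp add: W0_def)
  obtain i :: 'n where True by simp
  have K: "compact (closure \<Omega>)" using bounded_\<Omega> by (simp add: compact_closure)
  have "(LBINT x. f x *R (axis i 1 :: real ^ 'n)) = - (LBINT x. (x $ i) *R F x)"
  proof (rule wgrad_test_local[OF w open_UNIV subset_UNIV K subset_UNIV])
    show "f x = 0 \<and> F x = 0" if "x \<notin> closure \<Omega>" for x
      using that closure_subset[of \<Omega>] wgradD(3,4)[OF w\<Omega>, of x] by blast
    show "GDERIV (\<lambda>x. x $ i) x :> (axis i 1 :: real ^ 'n)" for x
      unfolding gderiv_def by (simp add: inner_axis bounded_linear_imp_has_derivative bounded_linear_vec_nth)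
  qed simp
  also have "(LBINT x. (x $ i) *R F x) = 0"
    by (rule integral_eq_zero_AE) (use F in eventually_elim, simp)
  finally have "(LBINT x. f x) *R (axis i 1 :: real ^ 'n) = 0"
    using wgradD(1)[OF w] by simp
  then have "(LBINT x. f x) = 0" by (simp add: axis_eq_0_iff)
  then show ?thesis using integral_nonneg_eq_0_iff_AE[OF wgradD(1)[OF w]] nn by simp
qed

text \<open>Functions with zero boundary values form an order ideal. The minimum of \<psi> and the
  positive part of a test function close to \<open>f\<close> has compact support and lies below
  \<psi>, and these minima approximate \<psi> in modular together with their gradients.\<close>

lemma W0_dominated:
  assumes f: "W0 G \<Omega> f F" "mdl G F < \<infinity>" and w: "wgrad \<Omega> \<psi> \<Psi>" and fin: "mdl G \<psi> < \<infinity>" "mdl G \<Psi> < \<infinity>"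
    and nn: "\<And>x. 0 \<le> \<psi> x" and le: "AE x in lborel. \<psi> x \<le> max 0 (f x)"
  obtains \<eta> H where "\<And>n::nat. wgrad \<Omega> (\<eta> n) (H n)" "\<And>n. \<exists>K. compact K \<and> K \<subseteq> \<Omega> \<and> (\<forall>x. x \<notin> K \<longrightarrow> \<eta> n x = 0)"
    "\<And>n x. 0 \<le> \<eta> n x \<and> \<eta> n x \<le> \<psi> x" "\<And>n x. \<eta> n x = 0 \<Longrightarrow> H n x = 0" "\<And>n. mdl G (\<eta> n) < \<infinity>" "\<And>n. mdl G (H n) < \<infinity>"
    "(\<lambda>n. mdl G (\<lambda>x. \<psi> x - \<eta> n x)) \<longlonglongrightarrow> 0" "(\<lambda>n. mdl G (\<lambda>x. \<Psi> x - H n x)) \<longlonglongrightarrow> 0"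
proof -
  have wf: "wgrad \<Omega> f F" using f by (simp add: W0_def)
  obtain \<phi>0 where \<phi>0: "\<And>n::nat. \<phi>0 n \<in> test_functions \<Omega>" "(\<lambda>n. mdl G (\<lambda>x. f x - \<phi>0 n x)) \<longlonglongrightarrow> 0"
    "(\<lambda>n. mdl G (\<lambda>x. F x - gradient (\<phi>0 n) x)) \<longlonglongrightarrow> 0"
    using f(1) unfolding W0_def by blast
  have "(\<lambda>n. LBINT x. norm (f x - \<phi>0 n x)) \<longlonglongrightarrow> 0"
    by (rule mdl_tendsto_L1[OF _ _ \<phi>0(2)]) (use wgradD[OF wf] wgradD[OF test_function_wgrad[OF \<phi>0(1)]] in auto)
  moreover have "L1 (\<lambda>x. f x - \<phi>0 n x)" for n
    using wgradD(1)[OF wf] wgradD(1)[OF test_function_wgrad[OF \<phi>0(1)]] by auto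
  ultimately obtain s where s: "strict_mono s" "AE x in lborel. (\<lambda>n. f x - \<phi>0 (s n) x) \<longlonglongrightarrow> 0"
    using tendsto_L1_AE_subseq[of lborel "\<lambda>n x. f x - \<phi>0 n x"] by blast
  define \<phi> where "\<phi> n = \<phi>0 (s n)" for n
  have \<phi>: "\<phi> n \<in> test_functions \<Omega>" for n using \<phi>0 by (simp add: \<phi>_def)
  have l1: "(\<lambda>n. mdl G (\<lambda>x. f x - \<phi> n x)) \<longlonglongrightarrow> 0"
    using LIMSEQ_subseq_LIMSEQ[OF \<phi>0(2) s(1)] by (simp add: \<phi>_def comp_def)
  have l2: "(\<lambda>n. mdl G (\<lambda>x. F x - gradient (\<phi> n) x)) \<longlonglongrightarrow> 0"
    using LIMSEQ_subseq_LIMSEQ[OF \<phi>0(3) s(1)] by (simp add: \<phi>_def comp_def)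
  have ae: "AE x in lborel. (\<lambda>n. \<phi> n x) \<longlonglongrightarrow> f x"
    using s(2)
  proof eventually_elim
    case (elim x)
    from tendsto_diff[OF tendsto_const[of "f x"] elim] show ?case by (simp add: \<phi>_def)
  qed
  note w\<phi> = test_function_wgrad[OF \<phi>]
  define p where "p n x = max 0 (\<phi> n x)" for n x
  define P where "P n x = indicator {x. \<phi> n x > 0} x *R gradient (\<phi> n) x" for n x
  have wp: "wgrad \<Omega> (p n) (P n)" for n unfolding p_def P_def by (rule wgrad_pos[OF open_\<Omega> w\<phi>])
  define E where "E n x = indicator {x. \<psi> x - p n x > 0} x *R (\<Psi> x - P n x)" for n x
  have wE: "wgrad \<Omega> (\<lambda>x. max 0 (\<psi> x - p n x)) (E n)" for n
    unfolding E_def by (rule wgrad_pos[OF open_\<Omega> wgrad_diff[OF w wp]])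
  \<comment> \<open>This is the minimum of \<open>\<psi> x\<close> and \<open>p n x\<close>, written
    with a positive part so that \<open>wgrad_pos\<close> delivers its gradient.\<close>
  define \<eta> where "\<eta> n x = \<psi> x - max 0 (\<psi> x - p n x)" for n x
  \<comment> \<open>Resetting the gradient on the zero set alters it on a null set only and makes
    the support statement hold at every point.\<close>
  define H where "H n x = indicator {x. \<eta> n x \<noteq> 0} x *R (\<Psi> x - E n x)" for n x
  note [measurable] = wgradD(6,7)[OF w] wgradD(6,7)[OF wf] wgradD(6,7)[OF w\<phi>] wgradD(6,7)[OF wp] wgradD(6,7)[OF wE]
  have w\<eta>0: "wgrad \<Omega> (\<eta> n) (\<lambda>x. \<Psi> x - E n x)" for n
    unfolding \<eta>_def by (rule wgrad_diff[OF w wE])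
  note [measurable] = wgradD(6,7)[OF w\<eta>0]
  have HE: "AE x in lborel. \<Psi> x - E n x = H n x" for n
    using wgrad_zero_level[OF open_\<Omega> bounded_\<Omega> w\<eta>0[of n]] by eventually_elim (auto simp: H_def)
  have Hm[measurable]: "H n \<in> Borel" for n unfolding H_def by measurable
  have w\<eta>: "wgrad \<Omega> (\<eta> n) (H n)" for n
    by (rule wgrad_cong_AE[OF w\<eta>0 _ HE]) (use wgradD(3)[OF w\<eta>0] in \<open>auto simp: H_def\<close>)
  have \<eta>b: "0 \<le> \<eta> n x" "\<eta> n x \<le> \<psi> x" for n x using nn[of x] by (auto simp: \<eta>_def p_def)
  have \<eta>K: "\<exists>K. compact K \<and> K \<subseteq> \<Omega> \<and> (\<forall>x. x \<notin> K \<longrightarrow> \<eta> n x = 0)" for n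
  proof -
    obtain K where K: "compact K" "K \<subseteq> \<Omega>" "\<And>x. x \<notin> K \<Longrightarrow> \<phi> n x = 0"
      using test_functions_C1c[OF \<phi>[of n]] unfolding C1c_def by blast
    have "\<eta> n x = 0" if "x \<notin> K" for x using K(3)[OF that] nn[of x] by (simp add: \<eta>_def p_def)
    with K show ?thesis by blast
  qed
  have m\<eta>: "mdl G (\<eta> n) < \<infinity>" for n
  proof -
    have "mdl G (\<eta> n) \<le> mdl G \<psi>" by (rule mdl_mono[OF yG]) (use \<eta>b nn in auto)
    then show ?thesis using fin(1) by (rule order_le_less_trans)
  qed
  have L1: "(\<lambda>n. mdl G (\<lambda>x. \<psi> x - \<eta> n x)) \<longlonglongrightarrow> 0"
  proof (rule tendsto_sandwich[OF _ _ tendsto_const l1])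
    show "\<forall>\<^sub>F n in sequentially. mdl G (\<lambda>x. \<psi> x - \<eta> n x) \<le> mdl G (\<lambda>x. f x - \<phi> n x)"
    proof (rule always_eventually, rule allI, rule mdl_mono[OF yG])
      fix n show "AE x in lborel. norm (\<psi> x - \<eta> n x) \<le> norm (f x - \<phi> n x)"
        using le by eventually_elim (auto simp: \<eta>_def p_def max_def split: if_splits)
    qed
  qed simp
  \<comment> \<open>The gradient error is split by replacing the gradient of the test function by
    \<open>F\<close>: \<open>A\<close> tends to zero almost everywhere under a fixed majorant, and
    \<open>B\<close> is bounded by the approximation error of \<open>F\<close>.\<close>
  define A where "A n x = indicator {x. \<psi> x - p n x > 0} x *R (\<Psi> x - indicator {x. \<phi> n x > 0} x *R F x)" for n x
  define B where "B n x = indicator {x. \<psi> x - p n x > 0 \<and> \<phi> n x > 0} x *R (F x - gradient (\<phi> n) x)" for n x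
  have Am[measurable]: "A n \<in> Borel" for n unfolding A_def by measurable
  have Bm[measurable]: "B n \<in> Borel" for n unfolding B_def by measurable
  have EAB: "E n x = A n x + B n x" for n x
    by (auto simp: E_def A_def B_def P_def indicator_def algebra_simps)
  have fp: "mdl G (\<lambda>x. norm (\<Psi> x) + norm (F x)) < \<infinity>"
    by (rule mdl_add_finite[OF yG]) (use fin f in \<open>auto simp: mdl_def\<close>)
  have A0: "(\<lambda>n. mdl G (A n)) \<longlonglongrightarrow> 0"
  proof -
    have "(\<lambda>n. \<integral>\<^sup>+x. ennreal (G (norm (A n x))) \<partial>lborel) \<longlonglongrightarrow> (\<integral>\<^sup>+x. 0 \<partial>(lborel :: (real ^ 'n) measure))"
    proof (rule nn_integral_dominated_convergence[where w="\<lambda>x. ennreal (G (norm (norm (\<Psi> x) + norm (F x))))"])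
      show "(\<lambda>x. ennreal (G (norm (A n x)))) \<in> borel_measurable lborel" for n
        using young_measurable[OF yG Am] by measurable
      show "(\<lambda>x. ennreal (G (norm (norm (\<Psi> x) + norm (F x))))) \<in> borel_measurable lborel"
        using young_measurable[OF yG, of "\<lambda>x. norm (\<Psi> x) + norm (F x)" borel] by measurable
      show "AE x in lborel. ennreal (G (norm (A n x))) \<le> ennreal (G (norm (norm (\<Psi> x) + norm (F x))))" for n
      proof (intro AE_I2 ennreal_leI young_mono[OF yG])
        fix x show "norm (A n x) \<le> norm (norm (\<Psi> x) + norm (F x))"
          using norm_triangle_ineq4[of "\<Psi> x" "F x"] by (auto simp: A_def indicator_def)
      qed auto
      show "(\<integral>\<^sup>+x. ennreal (G (norm (norm (\<Psi> x) + norm (F x)))) \<partial>lborel) < \<infinity>" using fp by (simp add: mdl_def)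
      have wd: "wgrad \<Omega> (\<lambda>x. max 0 (f x) - \<psi> x) (\<lambda>x. indicator {x. f x > 0} x *R F x - \<Psi> x)"
        by (rule wgrad_diff[OF wgrad_pos[OF open_\<Omega> wf] w])
      show "AE x in lborel. (\<lambda>n. ennreal (G (norm (A n x)))) \<longlonglongrightarrow> 0"
        using ae le wgrad_zero_level[OF open_\<Omega> bounded_\<Omega> wd] wgrad_zero_level[OF open_\<Omega> bounded_\<Omega> w]
      proof eventually_elim
        case (elim x)
        have "eventually (\<lambda>n. A n x = 0) sequentially"
        proof -
          \<comment> \<open>Strictly below \<open>f\<close>, the cut is eventually inactive. Where
            \<psi> equals a positive \<open>f\<close>, the two gradients agree almost everywhere.
            Where \<psi> is zero, no cut occurs.\<close>
          consider "\<psi> x < max 0 (f x)" | "\<psi> x = max 0 (f x)" "f x > 0" | "\<psi> x = max 0 (f x)" "f x \<le> 0"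
            using elim(2) by linarith
          then show ?thesis
          proof cases
            case 1
            then have "\<psi> x < f x" using nn[of x] by (auto simp: max_def split: if_splits)
            from order_tendstoD(1)[OF elim(1) this] show ?thesis
              by eventually_elim (auto simp: A_def p_def)
          next
            case 2
            from order_tendstoD(1)[OF elim(1) 2(2)] show ?thesis
              by eventually_elim (use 2 elim(3) in \<open>auto simp: A_def\<close>)
          next
            case 3
            then have "\<psi> x = 0" by simp
            then show ?thesis by (auto simp: A_def p_def)
          qed
        qed
        then have "eventually (\<lambda>n. ennreal (G (norm (A n x))) = 0) sequentially"
          by eventually_elim (use yG in \<open>simp add: young_def\<close>)
        then show ?case by (rule tendsto_eventually)
      qed
    qed simp
    then show ?thesis by (simp add: mdl_def)
  qed
  have B0: "(\<lambda>n. mdl G (B n)) \<longlonglongrightarrow> 0"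
  proof (rule tendsto_sandwich[OF _ _ tendsto_const l2])
    show "\<forall>\<^sub>F n in sequentially. mdl G (B n) \<le> mdl G (\<lambda>x. F x - gradient (\<phi> n) x)"
      by (rule always_eventually, rule allI, rule mdl_mono[OF yG]) (auto simp: B_def indicator_def)
  qed simp
  have "mdl G (\<lambda>x. A n x + B n x) = mdl G (\<lambda>x. \<Psi> x - H n x)" for n
  proof (rule mdl_cong)
    show "AE x in lborel. norm (A n x + B n x) = norm (\<Psi> x - H n x)"
      using HE[of n]
    proof eventually_elim
      case (elim x)
      show ?case unfolding elim[symmetric] EAB[symmetric] by simp
    qed
  qed
  then have L2: "(\<lambda>n. mdl G (\<lambda>x. \<Psi> x - H n x)) \<longlonglongrightarrow> 0" using mdl_tendsto_add[OF Am Bm A0 B0] by simp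
  have mH: "mdl G (H n) < \<infinity>" for n
  proof -
    have mE: "mdl G (P n) < \<infinity>"
    proof -
      have "mdl G (P n) \<le> mdl G (gradient (\<phi> n))" by (rule mdl_mono[OF yG]) (auto simp: P_def indicator_def)
      then show ?thesis using test_function_mdl(2)[OF \<phi>] by (rule order_le_less_trans)
    qed
    have "mdl G (\<lambda>x. norm (\<Psi> x) + norm (P n x)) < \<infinity>"
      by (rule mdl_add_finite[OF yG]) (use fin mE in \<open>auto simp: mdl_def\<close>)
    moreover have "mdl G (H n) \<le> mdl G (\<lambda>x. norm (\<Psi> x) + norm (P n x))"
      by (rule mdl_mono[OF yG]) (auto simp: H_def E_def indicator_def)
    ultimately show ?thesis by (meson order_le_less_trans)
  qed
  show thesis by (rule that[OF w\<eta> \<eta>K _ _ m\<eta> mH L1 L2]) (use \<eta>b in \<open>auto simp: H_def\<close>)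
qed

lemma W0_of_dominated:
  assumes "W0 G \<Omega> f F" "mdl G F < \<infinity>" "wgrad \<Omega> \<psi> \<Psi>" "mdl G \<psi> < \<infinity>" "mdl G \<Psi> < \<infinity>"
    "\<And>x. 0 \<le> \<psi> x" "AE x in lborel. \<psi> x \<le> max 0 (f x)"
  shows "W0 G \<Omega> \<psi> \<Psi>"
proof -
  obtain \<eta> H where h: "\<And>n::nat. wgrad \<Omega> (\<eta> n) (H n)" "\<And>n. \<exists>K. compact K \<and> K \<subseteq> \<Omega> \<and> (\<forall>x. x \<notin> K \<longrightarrow> \<eta> n x = 0)"
    "\<And>n x. 0 \<le> \<eta> n x \<and> \<eta> n x \<le> \<psi> x" "\<And>n x. \<eta> n x = 0 \<Longrightarrow> H n x = 0" "\<And>n. mdl G (\<eta> n) < \<infinity>" "\<And>n. mdl G (H n) < \<infinity>"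
    "(\<lambda>n. mdl G (\<lambda>x. \<psi> x - \<eta> n x)) \<longlonglongrightarrow> 0" "(\<lambda>n. mdl G (\<lambda>x. \<Psi> x - H n x)) \<longlonglongrightarrow> 0"
    by (rule W0_dominated[OF assms], rule that)
  show ?thesis
  proof (rule W0_limit[OF assms(3) _ h(7,8)])
    fix n
    obtain K where "compact K" "K \<subseteq> \<Omega>" "\<forall>x. x \<notin> K \<longrightarrow> \<eta> n x = 0" using h(2) by blast
    then show "W0 G \<Omega> (\<eta> n) (H n)" using h by (intro compact_support_W0[of _ _ K]) auto
  qed
qed

end

section \<open>Growth and convexity of G and g\<close>

locale nfun =
  fixes G g :: "real \<Rightarrow> real" and \<delta> g\<^sub>0 :: real
  assumes \<delta>: "1 < \<delta>" and N: "N_function G" and cont_g: "continuous_on {0..} g"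
    and diff_g: "\<And>s. s > 0 \<Longrightarrow> g field_differentiable (at s)" and cont_dg: "continuous_on {0<..} (deriv g)"
    and deriv_G: "\<And>t. t \<ge> 0 \<Longrightarrow> (G has_real_derivative g t) (at t within {0..})"
    and ell: "\<And>s. s > 0 \<Longrightarrow> \<delta> \<le> deriv g s * s / g s" "\<And>s. s > 0 \<Longrightarrow> deriv g s * s / g s \<le> g\<^sub>0"
begin

lemmas N_facts = N[unfolded N_function_def]

lemma G0: "G 0 = 0"
  using N_facts[THEN conjunct2, THEN conjunct2, THEN conjunct2, THEN conjunct1, rule_format, of 0] by simp

lemma G_pos:
  assumes "t > 0"
  shows "G t > 0"
  using N_facts[THEN conjunct1, rule_format, of t] assms
    N_facts[THEN conjunct2, THEN conjunct2, THEN conjunct2, THEN conjunct1, rule_format, of t] by linarith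

lemma cont_G: "continuous_on {0..} G"
  using N_facts by (elim conjE)

lemma DERIV_G:
  assumes "t > 0"
  shows "(G has_real_derivative g t) (at t)"
proof -
  have "(G has_real_derivative g t) (at t within {0<..})"
    by (rule has_field_derivative_subset[OF deriv_G]) (use assms in auto)
  moreover have "at t within {0<..} = at t" by (rule at_within_open) (use assms in auto)
  ultimately show ?thesis by simp
qed

lemma DERIV_g: "t > 0 \<Longrightarrow> (g has_real_derivative deriv g t) (at t)"
  using diff_g DERIV_deriv_iff_field_differentiable by blast

lemma g0: "g 0 = 0"
proof -
  have "((\<lambda>t. (G t - G 0) / (t - 0)) \<longlongrightarrow> g 0) (at 0 within {0..})"
    using deriv_G[OF order_refl] unfolding has_field_derivative_iff .
  then have "((\<lambda>t. G t / t) \<longlongrightarrow> g 0) (at_right 0)" by (simp add: G0 at_within_Ici_at_right)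
  moreover have "((\<lambda>t. G t / t) \<longlongrightarrow> 0) (at_right 0)" using N_facts by (elim conjE)
  ultimately show ?thesis using tendsto_unique trivial_limit_at_right_real by blast
qed

lemma G_MVT:
  assumes "0 \<le> a" "a < b"
  obtains z where "a < z" "z < b" "G b - G a = (b - a) * g z"
proof -
  have c: "continuous_on {a..b} G" using cont_G by (rule continuous_on_subset) (use assms in auto)
  have "G differentiable (at x)" if "a < x" for x
    using DERIV_G[of x] that assms(1) real_differentiable_def by force
  then obtain l z where z: "a < z" "z < b" "DERIV G z :> l" "G b - G a = (b - a) * l"
    using MVT[OF assms(2) c] by blast
  have "l = g z" using DERIV_unique[OF z(3) DERIV_G] z(1) assms(1) by simp
  with z that show thesis by blast
qed

lemma g_nz: "s > 0 \<Longrightarrow> g s \<noteq> 0"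
  using ell(1)[of s] \<delta> by force

text \<open>By the lower bound with \<open>\<delta> > 1\<close> the function \<open>g\<close> has no
  zero on the open half-line. By the mean value theorem it is positive somewhere below
  \<open>s\<close>, so a negative value at \<open>s\<close> would force a zero.\<close>

lemma g_pos:
  assumes "s > 0"
  shows "g s > 0"
proof (rule ccontr)
  assume "\<not> g s > 0"
  then have neg: "g s < 0" using g_nz[OF assms] by simp
  obtain z where z: "0 < z" "z < s" "G s - G 0 = (s - 0) * g z" using G_MVT[of 0 s] assms by auto
  then have zp: "g z > 0" using G_pos[OF assms] assms by (simp add: G0 zero_less_mult_iff)
  have "continuous_on {z..s} g" using cont_g by (rule continuous_on_subset) (use z in auto)
  then obtain x where "z \<le> x" "x \<le> s" "g x = 0"
    using IVT2'[of g s 0 z] zp neg z(2) by auto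
  then show False using g_nz[of x] z(1) by simp
qed

lemma dg_pos:
  assumes "s > 0"
  shows "deriv g s > 0" "\<delta> * g s \<le> deriv g s * s" "deriv g s * s \<le> g\<^sub>0 * g s"
proof -
  show "\<delta> * g s \<le> deriv g s * s" using ell(1)[OF assms] g_pos[OF assms] by (simp add: field_simps)
  then have "0 < deriv g s * s" using g_pos[OF assms] \<delta> by (smt (verit) mult_pos_pos)
  then show "deriv g s > 0" using assms by (simp add: zero_less_mult_iff)
  show "deriv g s * s \<le> g\<^sub>0 * g s" using ell(2)[OF assms] g_pos[OF assms] by (simp add: field_simps)
qed

lemma g_strict_mono:
  assumes "0 \<le> a" "a < b"
  shows "g a < g b"
proof (cases "a = 0")
  case True then show ?thesis using g0 g_pos assms by simp
next
  case False
  show ?thesis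
  proof (rule DERIV_pos_imp_increasing[OF assms(2)])
    fix x assume "a \<le> x" "x \<le> b"
    then have "x > 0" using False assms by simp
    then show "\<exists>y. DERIV g x :> y \<and> 0 < y" using DERIV_g dg_pos(1) by blast
  qed
qed

lemma g_nonneg: "0 \<le> s \<Longrightarrow> 0 \<le> g s"
  using g_pos[of s] g0 by (cases "s = 0") auto

lemma g_mono: "0 \<le> a \<Longrightarrow> a \<le> b \<Longrightarrow> g a \<le> g b"
  using g_strict_mono[of a b] by (cases "a = b") auto

text \<open>The quotient \<open>g x / x\<close> is nondecreasing, since \<delta> exceeds 1.\<close>

lemma g_double_lower:
  assumes "t > 0"
  shows "2 * g t \<le> g (2 * t)"
proof -
  have "g t / t \<le> g (2 * t) / (2 * t)"
  proof (rule DERIV_nonneg_imp_nondecreasing[of t "2 * t" "\<lambda>x. g x / x"])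
    show "t \<le> 2 * t" using assms by simp
    fix x assume "t \<le> x" "x \<le> 2 * t"
    then have x: "x > 0" using assms by simp
    have "DERIV (\<lambda>x. g x / x) x :> (deriv g x * x - g x * 1) / (x * x)"
      by (rule DERIV_divide[OF DERIV_g[OF x] DERIV_ident]) (use x in simp)
    moreover have "0 \<le> (deriv g x * x - g x * 1) / (x * x)"
    proof -
      have "1 * g x \<le> \<delta> * g x" using \<delta> g_pos[OF x] by (intro mult_right_mono) auto
      then show ?thesis using dg_pos(2)[OF x] by (intro divide_nonneg_nonneg) auto
    qed
    ultimately show "\<exists>y. DERIV (\<lambda>x. g x / x) x :> y \<and> 0 \<le> y" by blast
  qed
  then show ?thesis using assms by (simp add: field_simps)
qed

text \<open>The upper bound on the logarithmic derivative makes
  \<open>g x * x powr (- g\<^sub>0)\<close> nonincreasing.\<close>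

lemma g_double_upper:
  assumes "t > 0"
  shows "g (2 * t) \<le> 2 powr g\<^sub>0 * g t"
proof -
  have "g (2 * t) * (2 * t) powr (- g\<^sub>0) \<le> g t * t powr (- g\<^sub>0)"
  proof (rule DERIV_nonpos_imp_nonincreasing[of t "2 * t" "\<lambda>x. g x * x powr (- g\<^sub>0)"])
    show "t \<le> 2 * t" using assms by simp
    fix x assume "t \<le> x" "x \<le> 2 * t"
    then have x: "x > 0" using assms by simp
    have p: "DERIV (\<lambda>x. x powr (- g\<^sub>0)) x :> - g\<^sub>0 * x powr (- g\<^sub>0 - 1)"
      by (rule has_real_derivative_powr[OF x])
    have "DERIV (\<lambda>x. g x * x powr (- g\<^sub>0)) x :> g x * (- g\<^sub>0 * x powr (- g\<^sub>0 - 1)) + deriv g x * x powr (- g\<^sub>0)"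
      using DERIV_mult'[OF DERIV_g[OF x] p] by simp
    moreover have "g x * (- g\<^sub>0 * x powr (- g\<^sub>0 - 1)) + deriv g x * x powr (- g\<^sub>0) \<le> 0"
    proof -
      have "x powr (- g\<^sub>0) = x powr (- g\<^sub>0 - 1) * x"
        using x powr_add[of x "- g\<^sub>0 - 1" 1] by simp
      then have "g x * (- g\<^sub>0 * x powr (- g\<^sub>0 - 1)) + deriv g x * x powr (- g\<^sub>0) = x powr (- g\<^sub>0 - 1) * (deriv g x * x - g\<^sub>0 * g x)"
        by (simp add: algebra_simps)
      also have "\<dots> \<le> 0" using dg_pos(3)[OF x] by (intro mult_nonneg_nonpos) auto
      finally show ?thesis .
    qed
    ultimately show "\<exists>y. DERIV (\<lambda>x. g x * x powr (- g\<^sub>0)) x :> y \<and> y \<le> 0" by blast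
  qed
  then have "g (2 * t) * 2 powr (- g\<^sub>0) * t powr (- g\<^sub>0) \<le> g t * t powr (- g\<^sub>0)"
    using assms by (simp add: powr_mult mult.assoc)
  then have "g (2 * t) * 2 powr (- g\<^sub>0) \<le> g t" using assms by simp
  then have "2 powr g\<^sub>0 * (g (2 * t) * 2 powr (- g\<^sub>0)) \<le> 2 powr g\<^sub>0 * g t" by (intro mult_left_mono) auto
  moreover have "2 powr g\<^sub>0 * (g (2 * t) * 2 powr (- g\<^sub>0)) = g (2 * t)"
    by (simp add: powr_minus field_simps)
  ultimately show ?thesis by simp
qed

text \<open>Lifts the two doubling inequalities from \<open>g\<close> to \<open>G\<close>: both
  sides vanish at 0 and their derivatives are compared.\<close>

lemma G_diff_mono:
  assumes "t \<ge> 0" "c \<ge> 0" and le: "\<And>x. x > 0 \<Longrightarrow> a * g x \<le> c * g (c * x)"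
  shows "a * G t \<le> G (c * t)"
proof (cases "t = 0 \<or> c = 0")
  case True
  then show ?thesis
  proof
    assume "t = 0" then show ?thesis by (simp add: G0)
  next
    assume c: "c = 0"
    then have "a \<le> 0" using le[of 1] g_pos[of 1] by (simp add: mult_le_0_iff)
    then show ?thesis using c G_pos[of t] G0 assms(1) by (cases "t = 0") (auto simp: mult_le_0_iff)
  qed
next
  case False
  then have t: "t > 0" "c > 0" using assms by auto
  define f where "f x = G (c * x) - a * G x" for x
  have cf: "continuous_on {0..t} f"
    unfolding f_def using t
    by (intro continuous_intros continuous_on_compose2[OF cont_G] continuous_on_subset[OF cont_G]) auto
  have d: "DERIV f x :> c * g (c * x) - a * g x" if "x > 0" for x
  proof -
    have "DERIV (\<lambda>x. c * x) x :> c" by (rule DERIV_cmult_Id)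
    from DERIV_chain2[OF DERIV_G this] that t have "DERIV (\<lambda>x. G (c * x)) x :> g (c * x) * c" by simp
    from DERIV_diff[OF this DERIV_cmult[OF DERIV_G[OF that], of a]] show ?thesis by (simp add: f_def[abs_def] mult.commute)
  qed
  then have "f differentiable (at x)" if "0 < x" for x using that real_differentiable_def by blast
  then obtain l z where z: "0 < z" "z < t" "DERIV f z :> l" "f t - f 0 = (t - 0) * l"
    using MVT[OF t(1) cf] by blast
  have "l = c * g (c * z) - a * g z" using DERIV_unique[OF z(3) d[OF z(1)]] .
  then have "l \<ge> 0" using le[OF z(1)] by simp
  then have "0 \<le> (t - 0) * l" using t by simp
  then have "f t \<ge> f 0" using z(4) by linarith
  then show ?thesis by (simp add: f_def G0)
qed

lemma G_double_lower: "t \<ge> 0 \<Longrightarrow> 4 * G t \<le> G (2 * t)"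
  by (rule G_diff_mono) (use g_double_lower in auto)

text \<open>Plain convexity would give one half. The better factor is the entire gain in
  \<open>energy_comparison\<close>.\<close>

lemma G_half: "t \<ge> 0 \<Longrightarrow> G (t / 2) \<le> G t / 4"
  using G_double_lower[of "t / 2"] by simp

lemma G_double_upper:
  assumes "t \<ge> 0"
  shows "G (2 * t) \<le> 2 * 2 powr g\<^sub>0 * G t"
proof -
  have "(1 / (2 * 2 powr g\<^sub>0)) * G (2 * t) \<le> G (1 / 2 * (2 * t))"
  proof (rule G_diff_mono)
    fix x :: real assume x: "x > 0"
    have "g (2 * (x / 2)) \<le> 2 powr g\<^sub>0 * g (x / 2)" by (rule g_double_upper) (use x in simp)
    then show "(1 / (2 * 2 powr g\<^sub>0)) * g x \<le> 1 / 2 * g (1 / 2 * x)" by (simp add: field_simps)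
  qed (use assms in auto)
  then show ?thesis by (simp add: field_simps)
qed

lemma G_subgradient_strict:
  assumes "0 \<le> m" "0 \<le> t" "t \<noteq> m"
  shows "G m + g m * (t - m) < G t"
proof (cases "m < t")
  case True
  obtain z where z: "m < z" "z < t" "G t - G m = (t - m) * g z" using G_MVT[OF assms(1) True] by blast
  have "(t - m) * g m < (t - m) * g z" using g_strict_mono[OF assms(1) z(1)] True by simp
  then show ?thesis using z(3) by (simp add: mult.commute)
next
  case False
  then have l: "t < m" using assms by simp
  obtain z where z: "t < z" "z < m" "G m - G t = (m - t) * g z" using G_MVT[OF assms(2) l] by blast
  have "(m - t) * g z < (m - t) * g m" using g_strict_mono[of z m] z assms l by simp
  then show ?thesis using z(3) by (simp add: algebra_simps)
qed

lemma young: "young G"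
  unfolding young_def
proof (intro conjI allI impI)
  fix m :: real assume m: "0 \<le> m"
  have "G m + g m * (t - m) \<le> G t" if "t \<ge> 0" for t
    using G_subgradient_strict[OF m that] by (cases "t = m") auto
  then show "\<exists>s\<ge>0. \<forall>t\<ge>0. G m + s * (t - m) \<le> G t" using g_nonneg[OF m] by blast
next
  show "\<exists>C>0. \<forall>t\<ge>0. G (2 * t) \<le> C * G t"
    using G_double_upper by (intro exI[of _ "2 * 2 powr g\<^sub>0"]) auto
qed (simp_all add: cont_G G0)

lemma superlinear: "\<exists>C. \<forall>t\<ge>0. t \<le> G t + C"
proof -
  have "eventually (\<lambda>t. 1 \<le> G t / t) at_top"
  proof -
    have "filterlim (\<lambda>t. G t / t) at_top at_top" using N_facts by (elim conjE)
    then show ?thesis unfolding filterlim_at_top by blast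
  qed
  then obtain T where T: "\<And>t. t \<ge> T \<Longrightarrow> 1 \<le> G t / t" unfolding eventually_at_top_linorder by blast
  have "t \<le> G t + \<bar>T\<bar>" if "t \<ge> 0" for t
  proof (cases "t \<ge> T \<and> t > 0")
    case True
    then have "t \<le> G t" using T[of t] by (simp add: field_simps)
    then show ?thesis by simp
  next
    case False
    then show ?thesis using young_nonneg[OF young that] that by auto
  qed
  then show ?thesis by blast
qed

lemma G_unbounded: "\<exists>\<Lambda>>0. \<forall>t\<ge>\<Lambda>. G t > c"
proof -
  obtain C where C: "\<And>t. t \<ge> 0 \<Longrightarrow> t \<le> G t + C" using superlinear by blast
  have "G t > c" if "t \<ge> \<bar>c\<bar> + \<bar>C\<bar> + 1" for t using C[of t] that by linarith
  then show ?thesis by (intro exI[of _ "\<bar>c\<bar> + \<bar>C\<bar> + 1"]) auto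
qed

text \<open>The gradient of the map sending \<open>p\<close> to \<open>G (norm p)\<close>; at
  \<open>p = 0\<close> division by zero yields the correct value 0.\<close>

definition A :: "'a::euclidean_space \<Rightarrow> 'a" where
  "A p = (g (norm p) / norm p) *R p"

text \<open>Strictness has two sources: different norms are separated by strict monotonicity of
  \<open>g\<close>, and different vectors of equal norm by strictness in the Cauchy-Schwarz
  inequality.\<close>

lemma G_gradient_strict:
  fixes p q :: "'a::euclidean_space"
  assumes "p \<noteq> q"
  shows "G (norm p) + A p \<bullet> (q - p) < G (norm q)"
proof (cases "p = 0")
  case True
  then show ?thesis using assms G_pos[of "norm q"] by (simp add: A_def G0)
next
  case False
  define c where "c = g (norm p) / norm p"
  have c: "c > 0" using g_pos[of "norm p"] False by (simp add: c_def)
  have e: "A p \<bullet> (q - p) = c * (p \<bullet> q - (norm p)\<^sup>2)"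
    by (simp add: A_def c_def inner_diff_right power2_norm_eq_inner right_diff_distrib diff_divide_distrib)
  have cp: "c * norm p = g (norm p)" using False by (simp add: c_def)
  show ?thesis
  proof (cases "norm q = norm p")
    case True
    have "p \<bullet> q \<noteq> (norm p)\<^sup>2"
    proof
      assume h: "p \<bullet> q = (norm p)\<^sup>2"
      have "(p - q) \<bullet> (p - q) = (norm p)\<^sup>2 - 2 * (p \<bullet> q) + (norm q)\<^sup>2"
        by (simp add: inner_diff_left inner_diff_right power2_norm_eq_inner inner_commute)
      also have "\<dots> = 0" unfolding h True by simp
      finally have "p - q = 0" by (simp only: inner_eq_zero_iff)
      then show False using assms by (simp only: right_minus_eq)
    qed
    moreover have "p \<bullet> q \<le> (norm p)\<^sup>2" using norm_cauchy_schwarz[of p q] True by (simp add: power2_eq_square)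
    ultimately have "c * (p \<bullet> q - (norm p)\<^sup>2) < 0" using c by (simp add: mult_pos_neg)
    then show ?thesis using True e by simp
  next
    case False
    have "p \<bullet> q \<le> norm p * norm q" by (rule norm_cauchy_schwarz)
    then have "c * (p \<bullet> q - (norm p)\<^sup>2) \<le> c * (norm p * norm q - (norm p)\<^sup>2)" using c by (intro mult_left_mono) auto
    also have "\<dots> = g (norm p) * (norm q - norm p)"
      unfolding cp[symmetric] by (simp add: power2_eq_square algebra_simps)
    finally show ?thesis using G_subgradient_strict[of "norm p" "norm q"] False e by simp
  qed
qed

lemma G_gradient:
  fixes p q :: "'a::euclidean_space"
  shows "G (norm p) + A p \<bullet> (q - p) \<le> G (norm q)"
  using G_gradient_strict[of p q] by (cases "p = q") auto

lemma G_midpoint_strict: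
  fixes p q :: "'a::euclidean_space"
  assumes "p \<noteq> q"
  shows "G (norm ((1 / 2) *R (p + q))) < (G (norm p) + G (norm q)) / 2"
proof -
  define m where "m = (1 / 2) *R (p + q)"
  have d: "p - m = (1 / 2) *R (p - q)" "q - m = - ((1 / 2) *R (p - q))"
  proof -
    have "p = (1 / 2) *R p + (1 / 2) *R p" "q = (1 / 2) *R q + (1 / 2) *R q"
      by (simp_all add: scaleR_left_distrib[symmetric])
    then show "p - m = (1 / 2) *R (p - q)" "q - m = - ((1 / 2) *R (p - q))"
      unfolding m_def by (simp_all add: algebra_simps)
  qed
  have "m \<noteq> p" using d(1) assms by auto
  then have "G (norm m) + A m \<bullet> (p - m) < G (norm p)" by (rule G_gradient_strict)
  moreover have "G (norm m) + A m \<bullet> (q - m) \<le> G (norm q)" by (rule G_gradient)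
  ultimately show ?thesis unfolding m_def[symmetric] d by simp
qed

lemma G_midpoint:
  fixes p q :: "'a::euclidean_space"
  shows "G (norm ((1 / 2) *R (p + q))) \<le> (G (norm p) + G (norm q)) / 2"
  using G_midpoint_strict[of p q] by (cases "p = q") (auto simp: scaleR_2[symmetric])

end

lemma N_class_nfun:
  assumes "G \<in> N_class \<delta> g\<^sub>0" "1 < \<delta>"
  shows "\<exists>g. nfun G g \<delta> g\<^sub>0"
proof -
  have N: "N_function G" and "\<exists>g. continuous_on {0..} g \<and>
          (\<forall>s>0. g field_differentiable (at s)) \<and> continuous_on {0<..} (deriv g) \<and>
          (\<forall>t\<ge>0. (G has_real_derivative g t) (at t within {0..})) \<and>
          (\<forall>s>0. \<delta> \<le> deriv g s * s / g s \<and> deriv g s * s / g s \<le> g\<^sub>0)"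
    using assms(1) by (simp_all only: N_class_def mem_Collect_eq)
  then obtain g where g: "continuous_on {0..} g" "\<forall>s>0. g field_differentiable (at s)" "continuous_on {0<..} (deriv g)"
          "\<forall>t\<ge>0. (G has_real_derivative g t) (at t within {0..})"
          "\<forall>s>0. \<delta> \<le> deriv g s * s / g s \<and> deriv g s * s / g s \<le> g\<^sub>0"
    by (elim exE conjE) (rule that)
  have "nfun G g \<delta> g\<^sub>0"
    by (rule nfun.intro[OF assms(2) N g(1) _ g(3)]) (use g in simp_all)
  then show ?thesis by (intro exI[of _ g])
qed

section \<open>Energy comparison and the scalar minimization problem\<close>

context nfun
begin

text \<open>Writing I(p) for the energy on \<open>D\<close>, convexity at the midpoint and
  \<open>G_half\<close> on \<open>Z\<close>, where \<open>q\<close> is zero, give I(p) \<le> I(p)/2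
  + I(q)/2 minus a quarter of the energy of \<open>p\<close> on \<open>Z\<close>. Inserting I(q)
  \<le> I(p) + lam |Z| leaves the first claim. If \<open>Z\<close> is null, equality holds
  throughout, and strict convexity forces \<open>p = q\<close>.\<close>

lemma energy_comparison:
  fixes p q :: "'a::euclidean_space \<Rightarrow> 'b::euclidean_space"
  assumes [measurable]: "p \<in> Borel" "q \<in> Borel" "D \<in> sets borel" "Z \<in> sets borel"
    and ZD: "Z \<subseteq> D" and fin: "emeasure lborel Z < \<infinity>"
    and ip: "L1 (\<lambda>x. indicator D x * G (norm (p x)))"
    and iq: "L1 (\<lambda>x. indicator D x * G (norm (q x)))"
    and qZ: "AE x\<in>Z in lborel. q x = 0"
    and h1: "(LBINT x. indicator D x * G (norm (p x))) \<le> (LBINT x. indicator D x * G (norm ((1 / 2) *R (p x + q x))))"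
    and h2: "(LBINT x. indicator D x * G (norm (q x))) \<le> (LBINT x. indicator D x * G (norm (p x))) + lam * measure lborel Z"
  shows "(LBINT x. indicator Z x * G (norm (p x))) \<le> 2 * lam * measure lborel Z"
    and "measure lborel Z = 0 \<Longrightarrow> AE x\<in>D in lborel. p x = q x"
proof -
  have mG[measurable]: "(\<lambda>x. G (norm (f x))) \<in> Borel" if [measurable]: "f \<in> Borel" for f :: "'a \<Rightarrow> 'b"
    by (rule young_measurable[OF young]) measurable
  have nn: "0 \<le> G (norm y)" for y :: 'b by (rule young_nonneg[OF young]) simp
  define m where "m x = (1 / 2) *R (p x + q x)" for x
  have [measurable]: "m \<in> Borel" unfolding m_def by measurable
  have im: "L1 (\<lambda>x. indicator D x * G (norm (m x)))"
  proof (rule Bochner_Integration.integrable_bound[OF Bochner_Integration.integrable_add[OF ip iq]])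
    show "AE x in lborel. norm (indicator D x * G (norm (m x))) \<le> norm (indicator D x * G (norm (p x)) + indicator D x * G (norm (q x)))"
    proof (rule AE_I2)
      fix x
      have "G (norm (m x)) \<le> (G (norm (p x)) + G (norm (q x))) / 2"
        unfolding m_def by (rule G_midpoint)
      also have "\<dots> \<le> G (norm (p x)) + G (norm (q x))" using nn[of "p x"] nn[of "q x"] by simp
      finally have "G (norm (m x)) \<le> G (norm (p x)) + G (norm (q x))" .
      then show "norm (indicator D x * G (norm (m x))) \<le> norm (indicator D x * G (norm (p x)) + indicator D x * G (norm (q x)))"
        using nn by (auto simp: indicator_def)
    qed
  qed measurable
  have iZ: "L1 (\<lambda>x. indicator Z x * G (norm (p x)))"
    by (rule Bochner_Integration.integrable_bound[OF ip]) (use ZD nn in \<open>auto simp: indicator_def\<close>)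
  have "(LBINT x. indicator D x * G (norm (m x))) \<le>
      (LBINT x. 1 / 2 * (indicator D x * G (norm (p x))) + 1 / 2 * (indicator D x * G (norm (q x))) - 1 / 4 * (indicator Z x * G (norm (p x))))"
  proof (rule integral_mono_AE[OF im])
    show "AE x in lborel. indicator D x * G (norm (m x)) \<le> 1 / 2 * (indicator D x * G (norm (p x))) + 1 / 2 * (indicator D x * G (norm (q x))) - 1 / 4 * (indicator Z x * G (norm (p x)))"
      using qZ
    proof eventually_elim
      case (elim x)
      show ?case
      proof (cases "x \<in> Z")
        case True
        then have "norm (m x) = norm (p x) / 2" using elim by (simp add: m_def)
        then have "G (norm (m x)) \<le> G (norm (p x)) / 4" using G_half[OF norm_ge_zero] by (simp only:)
        moreover have "x \<in> D" using True ZD by blast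
        ultimately show ?thesis using True elim G0 by (simp add: field_simps)
      next
        case False
        then show ?thesis using G_midpoint[of "p x" "q x"] unfolding m_def by (auto simp: indicator_def)
      qed
    qed
  qed (use ip iq iZ in auto)
  also have "\<dots> = 1 / 2 * (LBINT x. indicator D x * G (norm (p x))) + 1 / 2 * (LBINT x. indicator D x * G (norm (q x))) - 1 / 4 * (LBINT x. indicator Z x * G (norm (p x)))"
    using ip iq iZ by simp
  finally show "(LBINT x. indicator Z x * G (norm (p x))) \<le> 2 * lam * measure lborel Z"
    using h1 h2 unfolding m_def by linarith
  assume Z0: "measure lborel Z = 0"
  define k where "k x = indicator D x * G (norm (p x)) / 2 + indicator D x * G (norm (q x)) / 2 - indicator D x * G (norm (m x))" for x
  have ik: "L1 k" unfolding k_def using ip iq im by simp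
  have kn: "0 \<le> k x" for x
    using G_midpoint[of "p x" "q x"] unfolding k_def m_def by (auto simp: indicator_def)
  have "(LBINT x. k x) = (LBINT x. indicator D x * G (norm (p x))) / 2 + (LBINT x. indicator D x * G (norm (q x))) / 2 - (LBINT x. indicator D x * G (norm (m x)))"
    unfolding k_def using ip iq im by simp
  then have "(LBINT x. k x) \<le> 0" using h1 h2 Z0 unfolding m_def by simp
  moreover have "(LBINT x. k x) \<ge> 0" using kn by (simp add: integral_nonneg_AE)
  ultimately have "(LBINT x. k x) = 0" by linarith
  then have "AE x in lborel. k x = 0" using integral_nonneg_eq_0_iff_AE[OF ik] kn by simp
  then show "AE x\<in>D in lborel. p x = q x"
  proof eventually_elim
    case (elim x)
    show ?case
    proof (rule impI, rule ccontr)
      assume "x \<in> D" "p x \<noteq> q x"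
      then show False using elim G_midpoint_strict[of "p x" "q x"] unfolding k_def m_def by simp
    qed
  qed
qed

end

text \<open>One component with the others frozen: in the application \<open>Q\<close> is
  \<open>lam\<close> where all other components vanish and 0 elsewhere, and \<open>P\<close> is the
  gradient of the boundary datum. Minimality is expressed by perturbations with zero boundary
  values, integrated over the whole space, where everything vanishes off \<Omega>.\<close>

locale scalar_min = nfun G g \<delta> g\<^sub>0 + orlicz_domain G \<Omega> C\<^sub>G
  for G g :: "real \<Rightarrow> real" and \<delta> g\<^sub>0 C\<^sub>G :: real and \<Omega> :: "(real ^ 'n) set" +
  fixes Q u :: "real ^ 'n \<Rightarrow> real" and U :: "real ^ 'n \<Rightarrow> real ^ 'n" and \<phi> :: "real ^ 'n \<Rightarrow> real"
    and P :: "real ^ 'n \<Rightarrow> real ^ 'n" and lam M :: real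
  assumes Q: "Q \<in> Borel" "\<And>x. 0 \<le> Q x" "\<And>x. Q x \<le> lam"
    and u: "wgrad \<Omega> u U" "mdl G u < \<infinity>" "mdl G U < \<infinity>" "\<And>x. 0 \<le> u x"
    and bc: "W0 G \<Omega> (\<lambda>x. u x - \<phi> x) (\<lambda>x. U x - P x)" "mdl G P < \<infinity>"
      "\<And>x. x \<in> \<Omega> \<Longrightarrow> 0 \<le> \<phi> x" "\<And>x. x \<in> \<Omega> \<Longrightarrow> \<phi> x \<le> M"
    and M: "0 < M"
    and minimal: "\<And>\<psi> \<Psi>. W0 G \<Omega> \<psi> \<Psi> \<Longrightarrow> mdl G \<psi> < \<infinity> \<Longrightarrow> mdl G \<Psi> < \<infinity> \<Longrightarrow> (\<And>x. 0 \<le> u x + \<psi> x) \<Longrightarrow>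
      (LBINT x. G (norm (U x)) + Q x * indicator {x. 0 < u x} x) \<le>
      (LBINT x. G (norm (U x + \<Psi> x)) + Q x * indicator {x. 0 < u x + \<psi> x} x)"
begin

lemma lam0: "0 \<le> lam" using Q(2)[of 0] Q(3)[of 0] by linarith

lemma P_measurable[measurable]: "P \<in> Borel"
proof -
  have "(\<lambda>x. U x - (U x - P x)) \<in> Borel"
    using bc(1) u(1) by (intro borel_measurable_diff wgradD(7)) (auto simp: W0_def)
  then show ?thesis by simp
qed

lemma integrable_Q:
  assumes [measurable]: "D \<in> sets borel" and "D \<subseteq> \<Omega>"
  shows "L1 (\<lambda>x. Q x * indicator D x)"
proof (rule Bochner_Integration.integrable_bound[where f="\<lambda>x. indicator \<Omega> x *R lam"])
  note [measurable] = Q(1)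
  show "L1 (\<lambda>x. indicator \<Omega> x *R lam)" using emeasure_bounded_finite[OF bounded_\<Omega>] by simp
  show "(\<lambda>x. Q x * indicator D x) \<in> borel_measurable lborel" by measurable
  show "AE x in lborel. norm (Q x * indicator D x) \<le> norm (indicator \<Omega> x *R lam)"
    by (rule AE_I2) (use Q(2,3) assms(2) lam0 in \<open>auto simp: indicator_def\<close>)
qed

text \<open>Where \<psi> vanishes, so does \<Psi> almost everywhere, and the energies cancel. The
  comparison is thereby localized to \<open>D\<close>, while the measure terms stay whole.\<close>

lemma minimal_split:
  assumes w0: "W0 G \<Omega> \<psi> \<Psi>" and fin: "mdl G \<psi> < \<infinity>" "mdl G \<Psi> < \<infinity>" and nn: "\<And>x. 0 \<le> u x + \<psi> x"
  defines "D \<equiv> {x. \<psi> x \<noteq> 0}"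
  shows "(LBINT x. indicator D x * G (norm (U x))) + (LBINT x. Q x * indicator {x. 0 < u x} x) \<le>
      (LBINT x. indicator D x * G (norm (U x + \<Psi> x))) + (LBINT x. Q x * indicator {x. 0 < u x + \<psi> x} x)"
    "L1 (\<lambda>x. Q x * indicator {x. 0 < u x} x)" "L1 (\<lambda>x. Q x * indicator {x. 0 < u x + \<psi> x} x)"
proof -
  have w: "wgrad \<Omega> \<psi> \<Psi>" using w0 by (simp add: W0_def)
  note [measurable] = wgradD(6,7)[OF w] wgradD(6,7)[OF u(1)] Q(1)
  have [measurable]: "D \<in> sets borel" unfolding D_def by measurable
  show iQ: "L1 (\<lambda>x. Q x * indicator {x. 0 < u x} x)"
    by (rule integrable_Q) (measurable, use wgradD(3)[OF u(1)] in force)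
  show iQ2: "L1 (\<lambda>x. Q x * indicator {x. 0 < u x + \<psi> x} x)"
    by (rule integrable_Q) (measurable, use wgradD(3)[OF u(1)] wgradD(3)[OF w] in force)
  have fU: "mdl G (\<lambda>x. U x + \<Psi> x) < \<infinity>" by (rule mdl_add_finite[OF yG _ u(3) _ fin(2)]) measurable
  have i1: "L1 (\<lambda>x. G (norm (U x + \<Psi> x)))" by (rule integrable_G[OF _ fU]) measurable
  have i2: "L1 (\<lambda>x. G (norm (U x)))" by (rule integrable_G[OF _ u(3)]) measurable
  have i3: "L1 (\<lambda>x. indicator D x * G (norm (U x + \<Psi> x)))" by (rule integrable_ind_G[OF _ fU]) measurable
  have i4: "L1 (\<lambda>x. indicator D x * G (norm (U x)))" by (rule integrable_ind_G[OF _ u(3)]) measurable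
  have "(LBINT x. G (norm (U x + \<Psi> x)) - G (norm (U x))) =
      (LBINT x. indicator D x * G (norm (U x + \<Psi> x)) - indicator D x * G (norm (U x)))"
  proof (rule integral_cong_AE)
    show "AE x in lborel. G (norm (U x + \<Psi> x)) - G (norm (U x)) = indicator D x * G (norm (U x + \<Psi> x)) - indicator D x * G (norm (U x))"
      using wgrad_zero_level[OF open_\<Omega> bounded_\<Omega> w] by eventually_elim (auto simp: D_def indicator_def)
  qed (use i1 i2 i3 i4 in \<open>auto intro!: borel_measurable_diff\<close>)
  moreover have "(LBINT x. G (norm (U x)) + Q x * indicator {x. 0 < u x} x) \<le>
      (LBINT x. G (norm (U x + \<Psi> x)) + Q x * indicator {x. 0 < u x + \<psi> x} x)"
    by (rule minimal[OF w0 fin nn])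
  ultimately show "(LBINT x. indicator D x * G (norm (U x))) + (LBINT x. Q x * indicator {x. 0 < u x} x) \<le>
      (LBINT x. indicator D x * G (norm (U x + \<Psi> x))) + (LBINT x. Q x * indicator {x. 0 < u x + \<psi> x} x)"
    using i1 i2 i3 i4 iQ iQ2 by simp
qed

text \<open>Adding \<psi> creates positive points only on \<open>Z\<close>, at cost at most
  \<open>lam\<close> times its measure. The remaining input \<open>h\<close> says that moving
  halfway from the gradient of \<open>u + \<psi>\<close> back to that of \<open>u\<close> does not
  lower the energy; it comes either from the equation of a barrier or from minimality of a
  translate.\<close>

lemma compare_max:
  assumes w0: "W0 G \<Omega> \<psi> \<Psi>" and fin: "mdl G \<psi> < \<infinity>" "mdl G \<Psi> < \<infinity>" and nn: "\<And>x. 0 \<le> \<psi> x"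
  defines "D \<equiv> {x. \<psi> x \<noteq> 0}"
  defines "Z \<equiv> {x. \<psi> x \<noteq> 0 \<and> u x = 0}"
  assumes h: "(LBINT x. indicator D x * G (norm (U x + \<Psi> x))) \<le> (LBINT x. indicator D x * G (norm ((1 / 2) *R ((U x + \<Psi> x) + U x))))"
  shows "(LBINT x. indicator Z x * G (norm (U x + \<Psi> x))) \<le> 2 * lam * measure lborel Z"
    and "measure lborel Z = 0 \<Longrightarrow> AE x in lborel. \<psi> x = 0"
proof -
  have w: "wgrad \<Omega> \<psi> \<Psi>" using w0 by (simp add: W0_def)
  note [measurable] = wgradD(6,7)[OF w] wgradD(6,7)[OF u(1)] Q(1)
  have D[measurable]: "D \<in> sets borel" unfolding D_def by measurable
  have Z[measurable]: "Z \<in> sets borel" unfolding Z_def by measurable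
  have D\<Omega>: "D \<subseteq> \<Omega>" using wgradD(3)[OF w] unfolding D_def by blast
  have ZD: "Z \<subseteq> D" unfolding Z_def D_def by blast
  have fU: "mdl G (\<lambda>x. U x + \<Psi> x) < \<infinity>" by (rule mdl_add_finite[OF yG _ u(3) _ fin(2)]) measurable
  have nn': "0 \<le> u x + \<psi> x" for x using nn[of x] u(4)[of x] by simp
  note e1 = minimal_split(1)[OF w0 fin nn', folded D_def] and iQ = minimal_split(2)[OF w0 fin nn'] and iQ2 = minimal_split(3)[OF w0 fin nn']
  have fZ: "emeasure lborel Z < \<infinity>" using emeasure_subset_\<Omega>[OF Z] ZD D\<Omega> by blast
  have "(LBINT x. Q x * indicator {x. 0 < u x + \<psi> x} x) \<le> (LBINT x. Q x * indicator {x. 0 < u x} x + lam * indicator Z x)"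
  proof (rule integral_mono[OF iQ2])
    show "L1 (\<lambda>x. Q x * indicator {x. 0 < u x} x + lam * indicator Z x)" using iQ fZ by simp
    show "Q x * indicator {x. 0 < u x + \<psi> x} x \<le> Q x * indicator {x. 0 < u x} x + lam * indicator Z x" for x
    proof (cases "0 < u x")
      case True
      then have "0 < u x + \<psi> x" using nn[of x] by (simp add: add_pos_nonneg)
      then show ?thesis using True lam0 by (simp add: indicator_def)
    next
      case False
      then have "u x = 0" using u(4)[of x] by simp
      then show ?thesis using Q(2,3)[of x] lam0 by (auto simp: Z_def indicator_def)
    qed
  qed
  also have "\<dots> = (LBINT x. Q x * indicator {x. 0 < u x} x) + lam * measure lborel Z" using iQ fZ by simp
  finally have e3: "(LBINT x. indicator D x * G (norm (U x))) \<le> (LBINT x. indicator D x * G (norm (U x + \<Psi> x))) + lam * measure lborel Z"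
    using e1 by linarith
  have uZ: "AE x\<in>Z in lborel. U x = 0"
    using wgrad_zero_level[OF open_\<Omega> bounded_\<Omega> u(1)] by eventually_elim (auto simp: Z_def)
  have mp: "(\<lambda>x. U x + \<Psi> x) \<in> Borel" by measurable
  note ec = energy_comparison[OF mp wgradD(7)[OF u(1)] D Z ZD fZ integrable_ind_G[OF mp fU D] integrable_ind_G[OF wgradD(7)[OF u(1)] u(3) D] uZ h e3]
  show "(LBINT x. indicator Z x * G (norm (U x + \<Psi> x))) \<le> 2 * lam * measure lborel Z" by (rule ec(1))
  assume "measure lborel Z = 0"
  from ec(2)[OF this] wgrad_zero_level[OF open_\<Omega> bounded_\<Omega> w]
  have "AE x in lborel. \<Psi> x = 0" by eventually_elim (auto simp: D_def)
  then show "AE x in lborel. \<psi> x = 0" by (rule W0_zero_gradient[OF w0 _ nn])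
qed

lemma minimal_sub:
  assumes w0: "W0 G \<Omega> \<psi> \<Psi>" and fin: "mdl G \<psi> < \<infinity>" "mdl G \<Psi> < \<infinity>" and nn: "\<And>x. 0 \<le> u x + \<psi> x"
    and z: "\<And>x. 0 < u x + \<psi> x \<Longrightarrow> 0 < u x"
  shows "(LBINT x. indicator {x. \<psi> x \<noteq> 0} x * G (norm (U x))) \<le> (LBINT x. indicator {x. \<psi> x \<noteq> 0} x * G (norm (U x + \<Psi> x)))"
proof -
  note m = minimal_split[OF w0 fin nn]
  have "(LBINT x. Q x * indicator {x. 0 < u x + \<psi> x} x) \<le> (LBINT x. Q x * indicator {x. 0 < u x} x)"
    by (rule integral_mono[OF m(3,2)]) (use z Q(2) in \<open>auto simp: indicator_def\<close>)
  with m(1) show ?thesis by linarith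
qed

lemma W0_minus:
  assumes "W0 G \<Omega> f F"
  shows "W0 G \<Omega> (\<lambda>x. - f x) (\<lambda>x. - F x)"
  using W0_add_scale[OF assms assms, of "-2"] by (simp add: algebra_simps scaleR_2)

lemma mdl_minus: "mdl G (\<lambda>x. - f x) = mdl G f"
  by (simp add: mdl_def)

text \<open>Subtracting \<psi> creates no positive points, so this is the energy comparison with
  empty contact set.\<close>

lemma compare_min:
  assumes w0: "W0 G \<Omega> \<psi> \<Psi>" and fin: "mdl G \<psi> < \<infinity>" "mdl G \<Psi> < \<infinity>" and nn: "\<And>x. 0 \<le> \<psi> x" "\<And>x. \<psi> x \<le> u x"
  defines "D \<equiv> {x. \<psi> x \<noteq> 0}"
  assumes h: "(LBINT x. indicator D x * G (norm (U x - \<Psi> x))) \<le> (LBINT x. indicator D x * G (norm ((1 / 2) *R ((U x - \<Psi> x) + U x))))"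
  shows "AE x in lborel. \<psi> x = 0"
proof -
  have w: "wgrad \<Omega> \<psi> \<Psi>" using w0 by (simp add: W0_def)
  note [measurable] = wgradD(6,7)[OF w] wgradD(6,7)[OF u(1)]
  have D[measurable]: "D \<in> sets borel" unfolding D_def by measurable
  have "(LBINT x. indicator {x. - \<psi> x \<noteq> 0} x * G (norm (U x))) \<le> (LBINT x. indicator {x. - \<psi> x \<noteq> 0} x * G (norm (U x + - \<Psi> x)))"
  proof (rule minimal_sub[OF W0_minus[OF w0]])
    fix x
    show "0 \<le> u x + - \<psi> x" using nn(2)[of x] by simp
    show "0 < u x" if "0 < u x + - \<psi> x" using that nn(1)[of x] by simp
  qed (use fin in \<open>auto simp: mdl_minus\<close>)
  then have e: "(LBINT x. indicator D x * G (norm (U x))) \<le> (LBINT x. indicator D x * G (norm (U x - \<Psi> x))) + lam * measure lborel ({} :: (real ^ 'n) set)"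
    by (simp add: D_def)
  have fU: "mdl G (\<lambda>x. U x - \<Psi> x) < \<infinity>" by (rule mdl_diff_finite[OF _ u(3) _ fin(2)]) measurable
  have mp: "(\<lambda>x. U x - \<Psi> x) \<in> Borel" by measurable
  have "AE x\<in>D in lborel. U x - \<Psi> x = U x"
    by (rule energy_comparison(2)[OF mp wgradD(7)[OF u(1)] D _ _ _ integrable_ind_G[OF mp fU D] integrable_ind_G[OF wgradD(7)[OF u(1)] u(3) D] _ h e]) auto
  then have "AE x in lborel. \<Psi> x = 0"
    using wgrad_zero_level[OF open_\<Omega> bounded_\<Omega> w] by eventually_elim (auto simp: D_def)
  then show "AE x in lborel. \<psi> x = 0" by (rule W0_zero_gradient[OF w0 _ nn(1)])
qed

lemma wf: "wgrad \<Omega> (\<lambda>x. u x - \<phi> x) (\<lambda>x. U x - P x)" using bc(1) by (simp add: W0_def)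

lemma mUP: "mdl G (\<lambda>x. U x - P x) < \<infinity>"
  by (rule mdl_diff_finite[OF wgradD(7)[OF u(1)] u(3) _ bc(2)]) measurable

lemma wgrad_const: "wgrad \<Omega> (\<lambda>x. indicator \<Omega> x * c) (\<lambda>x. 0)"
proof -
  have "wgrad \<Omega> (\<lambda>x. indicator \<Omega> x * c) (\<lambda>x. indicator \<Omega> x *R 0)"
    by (rule C1_bounded_wgrad[OF open_\<Omega> bounded_\<Omega>, where B="\<bar>c\<bar>"]) (auto simp: GDERIV_const)
  then show ?thesis by simp
qed

text \<open>The excess over \<open>M\<close> is dominated by the positive part of
  \<open>u - \<phi>\<close>, hence has zero boundary values. Truncated at \<open>M\<close>, the
  gradient is zero on the excess set, so the half-step inequality is trivial there.\<close>

lemma le_M: "AE x in lborel. u x \<le> M"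
proof -
  define \<psi> where "\<psi> x = max 0 (u x - indicator \<Omega> x * M)" for x
  define \<Psi> where "\<Psi> x = indicator {x. u x - indicator \<Omega> x * M > 0} x *R (U x - 0)" for x
  have w: "wgrad \<Omega> \<psi> \<Psi>" unfolding \<psi>_def \<Psi>_def
    by (rule wgrad_pos[OF open_\<Omega> wgrad_diff[OF u(1) wgrad_const]])
  have b: "0 \<le> \<psi> x" "\<psi> x \<le> u x" for x using u(4)[of x] M by (auto simp: \<psi>_def indicator_def)
  have f1: "mdl G \<psi> < \<infinity>"
    by (rule order_le_less_trans[OF mdl_mono[OF yG] u(2)]) (use b u(4) in auto)
  have f2: "mdl G \<Psi> < \<infinity>"
    by (rule order_le_less_trans[OF mdl_mono[OF yG] u(3)]) (auto simp: \<Psi>_def indicator_def)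
  have w0: "W0 G \<Omega> \<psi> \<Psi>"
  proof (rule W0_of_dominated[OF bc(1) mUP w f1 f2 b(1)])
    show "AE x in lborel. \<psi> x \<le> max 0 (u x - \<phi> x)"
    proof (rule AE_I2)
      fix x show "\<psi> x \<le> max 0 (u x - \<phi> x)"
        using bc(4)[of x] wgradD(3)[OF wf, of x] wgradD(3)[OF u(1), of x] by (cases "x \<in> \<Omega>") (auto simp: \<psi>_def)
    qed
  qed
  have "AE x in lborel. \<psi> x = 0"
  proof (rule compare_min[OF w0 f1 f2 b])
    have z: "indicator {x. \<psi> x \<noteq> 0} x * G (norm (U x - \<Psi> x)) = 0" for x
      using G0 by (auto simp: \<psi>_def \<Psi>_def indicator_def max_def)
    have "(LBINT x. indicator {x. \<psi> x \<noteq> 0} x * G (norm (U x - \<Psi> x))) = 0" unfolding z by simp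
    also have "0 \<le> (LBINT x. indicator {x. \<psi> x \<noteq> 0} x * G (norm ((1 / 2) *R ((U x - \<Psi> x) + U x))))"
      by (intro integral_nonneg_AE AE_I2 mult_nonneg_nonneg G_nonneg) simp
    finally show "(LBINT x. indicator {x. \<psi> x \<noteq> 0} x * G (norm (U x - \<Psi> x))) \<le> (LBINT x. indicator {x. \<psi> x \<noteq> 0} x * G (norm ((1 / 2) *R ((U x - \<Psi> x) + U x))))" .
  qed
  then show ?thesis
  proof eventually_elim
    case (elim x)
    then show ?case using M wgradD(3)[OF u(1), of x] by (cases "x \<in> \<Omega>") (auto simp: \<psi>_def max_def split: if_splits)
  qed
qed

end

section \<open>Comparison with barriers\<close>

lemma wgrad_test_local_integrable:
  assumes w: "wgrad \<Omega> f F" and U: "open U" "U \<subseteq> \<Omega>" and K: "compact K" "K \<subseteq> U"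
    and z: "\<And>x. x \<notin> K \<Longrightarrow> f x = 0 \<and> F x = 0"
    and a: "\<And>x. x \<in> U \<Longrightarrow> GDERIV a x :> a' x" "continuous_on U a'"
  shows "L1 (\<lambda>x. f x *R a' x)" "L1 (\<lambda>x. a x *R F x)"
proof -
  obtain \<zeta> \<zeta>' where \<zeta>: "C1c U \<zeta> \<zeta>'" "\<And>x. x \<in> K \<Longrightarrow> \<zeta> x = 1" "\<And>x. x \<in> K \<Longrightarrow> \<zeta>' x = 0"
    using cutoff[OF K U(1)] by blast
  have "C1c \<Omega> (\<lambda>x. \<zeta> x * a x) (\<lambda>x. \<zeta> x *R a' x + a x *R \<zeta>' x)"
    using C1c_mono[OF C1c_mult_local[OF U(1) \<zeta>(1) a] U(2)] .
  note i = C1c_test_integrable[OF this wgradD(1,2)[OF w]]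
  have "(\<lambda>x. f x *R (\<zeta> x *R a' x + a x *R \<zeta>' x)) = (\<lambda>x. f x *R a' x)"
    using \<zeta> z by force
  with i(1) show "L1 (\<lambda>x. f x *R a' x)" by simp
  have "(\<lambda>x. (\<zeta> x * a x) *R F x) = (\<lambda>x. a x *R F x)"
    using \<zeta> z by force
  with i(2) show "L1 (\<lambda>x. a x *R F x)" by simp
qed

lemma wgrad_divergence:
  fixes V :: "real ^ 'n \<Rightarrow> real ^ 'n"
  assumes w: "wgrad \<Omega> f F" and U: "open U" "U \<subseteq> \<Omega>" and K: "compact K" "K \<subseteq> U"
    and z: "\<And>x. x \<notin> K \<Longrightarrow> f x = 0 \<and> F x = 0"
    and V: "\<And>x i. x \<in> U \<Longrightarrow> GDERIV (\<lambda>x. V x $ i) x :> V' i x" "\<And>i. continuous_on U (V' i)"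
  shows "(LBINT x. V x \<bullet> F x) = - (LBINT x. f x * (\<Sum>i\<in>UNIV. V' i x $ i))"
proof -
  have i1: "L1 (\<lambda>x. f x *R V' i x)" for i
    by (rule wgrad_test_local_integrable(1)[OF w U K z V(1) V(2)])
  have i2: "L1 (\<lambda>x. V x $ i *R F x)" for i
    by (rule wgrad_test_local_integrable(2)[OF w U K z V(1) V(2)])
  have n1: "L1 (\<lambda>x. f x * V' i x $ i)" for i
    using integrable_bounded_linear[OF bounded_linear_vec_nth i1, of i i] by simp
  have n2: "L1 (\<lambda>x. V x $ i * F x $ i)" for i
    using integrable_bounded_linear[OF bounded_linear_vec_nth i2, of i i] by simp
  have e: "(LBINT x. f x * V' i x $ i) = - (LBINT x. V x $ i * F x $ i)" for i
  proof -
    have "(LBINT x. f x *R V' i x) = - (LBINT x. V x $ i *R F x)"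
      by (rule wgrad_test_local[OF w U K z V(1) V(2)])
    then have "(LBINT x. f x *R V' i x) $ i = - (LBINT x. V x $ i *R F x) $ i" by simp
    then show ?thesis unfolding integral_vec_nth[OF i1] integral_vec_nth[OF i2] by simp
  qed
  have "(LBINT x. V x \<bullet> F x) = (\<Sum>i\<in>UNIV. LBINT x. V x $ i * F x $ i)"
    unfolding inner_vec_def using n2 by simp
  also have "\<dots> = - (\<Sum>i\<in>UNIV. LBINT x. f x * V' i x $ i)"
    by (simp add: e sum_negf)
  also have "(\<Sum>i\<in>UNIV. LBINT x. f x * V' i x $ i) = (LBINT x. f x * (\<Sum>i\<in>UNIV. V' i x $ i))"
    unfolding sum_distrib_left using n1 by simp
  finally show ?thesis .
qed

context orlicz_domain
begin

text \<open>The weak form of div V \<le> 0 against a nonnegative \<psi> that may reach the frontier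
  of \<Omega>. It is applied to the minima from \<open>W0_dominated\<close>, whose supports are
  compact in \<open>\<Omega> \<inter> B\<close>, and passed to the limit since \<open>V\<close> is
  bounded and the gradients converge in L1.\<close>

lemma barrier_sign:
  fixes V :: "real ^ 'n \<Rightarrow> real ^ 'n"
  assumes f: "W0 G \<Omega> f F" "mdl G F < \<infinity>" and w: "wgrad \<Omega> \<psi> \<Psi>" and fin: "mdl G \<psi> < \<infinity>" "mdl G \<Psi> < \<infinity>"
    and nn: "\<And>x. 0 \<le> \<psi> x" and le: "AE x in lborel. \<psi> x \<le> max 0 (f x)"
    and B: "open B" "compact K" "K \<subseteq> B" and z: "\<And>x. x \<notin> K \<Longrightarrow> \<psi> x = 0"
    and V: "\<And>x i. x \<in> \<Omega> \<inter> B \<Longrightarrow> GDERIV (\<lambda>x. V x $ i) x :> V' i x" "\<And>i. continuous_on (\<Omega> \<inter> B) (V' i)"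
      "\<And>x. x \<in> \<Omega> \<inter> B \<Longrightarrow> (\<Sum>i\<in>UNIV. V' i x $ i) \<le> 0" "\<And>x. x \<in> \<Omega> \<inter> B \<Longrightarrow> norm (V x) \<le> b"
  shows "0 \<le> (LBINT x. (indicator (\<Omega> \<inter> B) x *R V x) \<bullet> \<Psi> x)"
    "L1 (\<lambda>x. (indicator (\<Omega> \<inter> B) x *R V x) \<bullet> \<Psi> x)"
proof -
  obtain \<eta> H where h: "\<And>n::nat. wgrad \<Omega> (\<eta> n) (H n)" "\<And>n. \<exists>K. compact K \<and> K \<subseteq> \<Omega> \<and> (\<forall>x. x \<notin> K \<longrightarrow> \<eta> n x = 0)"
    "\<And>n x. 0 \<le> \<eta> n x \<and> \<eta> n x \<le> \<psi> x" "\<And>n x. \<eta> n x = 0 \<Longrightarrow> H n x = 0" "\<And>n. mdl G (\<eta> n) < \<infinity>" "\<And>n. mdl G (H n) < \<infinity>"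
    "(\<lambda>n. mdl G (\<lambda>x. \<psi> x - \<eta> n x)) \<longlonglongrightarrow> 0" "(\<lambda>n. mdl G (\<lambda>x. \<Psi> x - H n x)) \<longlonglongrightarrow> 0"
    by (rule W0_dominated[OF f w fin nn le], rule that)
  define W where "W x = indicator (\<Omega> \<inter> B) x *R V x" for x
  have oB: "open (\<Omega> \<inter> B)" using open_\<Omega> B(1) by blast
  have cV: "continuous_on (\<Omega> \<inter> B) V"
  proof -
    have "continuous_on (\<Omega> \<inter> B) (\<lambda>x. \<chi> i. V x $ i)"
      by (intro continuous_on_vec_lambda GDERIV_continuous_on[OF V(1)])
    then show ?thesis by simp
  qed
  have [measurable]: "W \<in> Borel"
    unfolding W_def using borel_measurable_continuous_on_indicator[OF _ cV] oB by simp
  note [measurable] = wgradD(6,7)[OF w] wgradD(6,7)[OF h(1)]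
  have Wb: "norm (W x) \<le> max b 0" for x using V(4)[of x] by (auto simp: W_def indicator_def)
  have Wm: "W \<in> borel_measurable lborel" by measurable
  show "L1 (\<lambda>x. (indicator (\<Omega> \<inter> B) x *R V x) \<bullet> \<Psi> x)"
    using integrable_bilinear_bounded[OF bounded_bilinear_inner wgradD(2)[OF w] Wm Wb] by (simp only: W_def)
  have pos: "0 \<le> (LBINT x. W x \<bullet> H n x)" for n
  proof -
    obtain L where L: "compact L" "L \<subseteq> \<Omega>" "\<forall>x. x \<notin> L \<longrightarrow> \<eta> n x = 0" using h(2) by blast
    have zn: "\<eta> n x = 0 \<and> H n x = 0" if "x \<notin> L \<inter> K" for x
    proof -
      have "\<eta> n x = 0" using that L(3) z[of x] h(3)[of n x] by fastforce
      then show ?thesis using h(4) by blast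
    qed
    have cLK: "compact (L \<inter> K)" using L(1) B(2) by (simp add: compact_Int)
    have sLK: "L \<inter> K \<subseteq> \<Omega> \<inter> B" using L(2) B(3) by blast
    have "(LBINT x. V x \<bullet> H n x) = - (LBINT x. \<eta> n x * (\<Sum>i\<in>UNIV. V' i x $ i))"
      by (rule wgrad_divergence[OF h(1) oB _ cLK sLK zn V(1,2)]) auto
    moreover have "(LBINT x. V x \<bullet> H n x) = (LBINT x. W x \<bullet> H n x)"
    proof (rule Bochner_Integration.integral_cong[OF refl])
      fix x show "V x \<bullet> H n x = W x \<bullet> H n x"
        using zn[of x] sLK by (cases "x \<in> L \<inter> K") (auto simp: W_def indicator_def)
    qed
    moreover have "0 \<le> (LBINT x. - (\<eta> n x * (\<Sum>i\<in>UNIV. V' i x $ i)))"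
    proof (intro integral_nonneg_AE AE_I2)
      fix x show "0 \<le> - (\<eta> n x * (\<Sum>i\<in>UNIV. V' i x $ i))"
      proof (cases "x \<in> L \<inter> K")
        case True
        then have "(\<Sum>i\<in>UNIV. V' i x $ i) \<le> 0" using sLK V(3) by blast
        then show ?thesis using h(3)[of n x] by (simp add: mult_nonneg_nonpos)
      next
        case False then show ?thesis using zn by simp
      qed
    qed
    ultimately show ?thesis by simp
  qed
  have "(\<lambda>n. LBINT x. norm (\<Psi> x - H n x)) \<longlonglongrightarrow> 0"
    by (rule mdl_tendsto_L1[OF _ _ h(8)]) (use wgradD[OF w] wgradD[OF h(1)] in auto)
  then have "(\<lambda>n. LBINT x. norm (H n x - \<Psi> x)) \<longlonglongrightarrow> 0" by (simp add: norm_minus_commute)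
  from L1_bilinear_tendsto[OF bounded_bilinear_inner wgradD(2)[OF h(1)] wgradD(2)[OF w] this Wm Wb AE_I2[OF tendsto_const] Wm]
  have "(\<lambda>n. LBINT x. W x \<bullet> H n x) \<longlonglongrightarrow> (LBINT x. W x \<bullet> \<Psi> x)" .
  then show "0 \<le> (LBINT x. (indicator (\<Omega> \<inter> B) x *R V x) \<bullet> \<Psi> x)"
    using LIMSEQ_le_const pos unfolding W_def by blast
qed

text \<open>Only the frontier of \<open>B\<close> is crossed, and \<open>f\<close> is zero near it;
  at the frontier of \<Omega> nothing changes.\<close>

lemma wgrad_extend_zero:
  assumes w: "wgrad (\<Omega> \<inter> B) f F" and B: "open B" "compact K" "K \<subseteq> B"
    and z: "\<And>x. x \<notin> K \<Longrightarrow> f x = 0 \<and> F x = 0"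
  shows "wgrad \<Omega> f F"
proof -
  obtain \<zeta> \<zeta>' where \<zeta>: "C1c B \<zeta> \<zeta>'" "\<And>x. x \<in> K \<Longrightarrow> \<zeta> x = 1" "\<And>x. x \<in> K \<Longrightarrow> \<zeta>' x = 0"
    using cutoff[OF B(2,3,1)] by blast
  obtain L where L: "compact L" "L \<subseteq> B" "\<And>x. x \<notin> L \<Longrightarrow> \<zeta> x = 0 \<and> \<zeta>' x = 0"
    using \<zeta>(1) unfolding C1c_def by blast
  show ?thesis
  proof (rule wgrad_extend[OF w])
    show "GDERIV \<zeta> x :> \<zeta>' x" for x using \<zeta>(1) by (simp add: C1c_def)
    show "continuous_on UNIV \<zeta>'" using \<zeta>(1) by (simp add: C1c_def)
    show "closed L" using L(1) by (rule compact_imp_closed)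
    show "\<zeta> x = 1 \<and> \<zeta>' x = 0" if "f x \<noteq> 0 \<or> F x \<noteq> 0" for x using that z[of x] \<zeta>(2,3) by blast
  qed (use open_\<Omega> B L in auto)
qed

end

context scalar_min
begin

text \<open>In the applications the function vanishes off \<open>K\<close> only almost everywhere.
  Multiplying by the indicator of \<open>K\<close> and resetting the gradient on the zero set alters
  both on null sets and yields pointwise support in \<open>K\<close>.\<close>

lemma clip_to_\<Omega>:
  assumes B: "open B" "compact K" "K \<subseteq> B" and w: "wgrad (\<Omega> \<inter> B) f F"
    and z: "AE x in lborel. x \<notin> K \<longrightarrow> f x = 0"
  defines "\<psi> \<equiv> \<lambda>x. indicator K x * f x"
  defines "\<Psi> \<equiv> \<lambda>x. indicator {x. \<psi> x \<noteq> 0} x *R F x"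
  shows "wgrad \<Omega> \<psi> \<Psi>" "AE x in lborel. \<psi> x = f x"
proof -
  have oB: "open (\<Omega> \<inter> B)" "bounded (\<Omega> \<inter> B)" using open_\<Omega> B(1) bounded_\<Omega> by (auto simp: bounded_Int)
  note [measurable] = wgradD(6,7)[OF w]
  have [measurable]: "K \<in> sets borel" using B(2) by (simp add: borel_compact)
  have [measurable]: "\<psi> \<in> Borel" unfolding \<psi>_def by measurable
  have [measurable]: "\<Psi> \<in> Borel" unfolding \<Psi>_def by measurable
  show e: "AE x in lborel. \<psi> x = f x" using z by eventually_elim (auto simp: \<psi>_def indicator_def)
  have e2: "AE x in lborel. F x = \<Psi> x"
    using e wgrad_zero_level[OF oB w] by eventually_elim (auto simp: \<Psi>_def indicator_def)
  have "wgrad (\<Omega> \<inter> B) \<psi> \<Psi>"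
  proof (rule wgrad_cong_AE[OF w _ e2])
    show "AE x in lborel. f x = \<psi> x" using e by eventually_elim simp
    show "\<psi> x = 0 \<and> \<Psi> x = 0" if "x \<notin> \<Omega> \<inter> B" for x using wgradD(3)[OF w that] by (simp add: \<psi>_def \<Psi>_def)
  qed measurable
  then show "wgrad \<Omega> \<psi> \<Psi>"
    by (rule wgrad_extend_zero[OF _ B]) (auto simp: \<psi>_def \<Psi>_def)
qed

text \<open>For \<open>s = 1\<close> the competitor is the minimum of \<open>u\<close> and
  \<open>w\<close>, for \<open>s = - 1\<close> the maximum. The condition on values in [0, M] off
  \<open>K\<close>, together with \<open>le_M\<close>, makes the excess vanish there. Convexity at
  \<open>w'\<close> reduces the half-step inequality to the sign of the divergence of
  \<open>A (w' x)\<close>.\<close>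

lemma barrier_compare:
  fixes s :: real
  assumes s: "s = 1 \<or> s = - 1" and B: "open B" "compact K" "K \<subseteq> B"
    and w: "\<And>x. x \<in> \<Omega> \<inter> B \<Longrightarrow> GDERIV w x :> w' x" "continuous_on (\<Omega> \<inter> B) w'"
      "\<And>x. x \<in> \<Omega> \<inter> B \<Longrightarrow> \<bar>w x\<bar> \<le> b" "\<And>x. x \<in> \<Omega> \<inter> B \<Longrightarrow> norm (w' x) \<le> b"
    and V: "\<And>x i. x \<in> \<Omega> \<inter> B \<Longrightarrow> GDERIV (\<lambda>x. A (w' x) $ i) x :> V' i x" "\<And>i. continuous_on (\<Omega> \<inter> B) (V' i)"
      "\<And>x. x \<in> \<Omega> \<inter> B \<Longrightarrow> s * (\<Sum>i\<in>UNIV. V' i x $ i) \<le> 0"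
    and le: "\<And>x. x \<in> \<Omega> \<inter> B \<Longrightarrow> s * \<phi> x \<le> s * w x"
      "\<And>x t. x \<in> \<Omega> \<inter> B \<Longrightarrow> x \<notin> K \<Longrightarrow> 0 \<le> t \<Longrightarrow> t \<le> M \<Longrightarrow> s * t \<le> s * w x"
    and big: "\<And>x. x \<in> \<Omega> \<inter> B \<Longrightarrow> 2 * lam < G (norm (w' x))"
  shows "AE x in lborel. x \<in> \<Omega> \<inter> B \<longrightarrow> s * u x \<le> s * w x"
proof -
  define O' where "O' = \<Omega> \<inter> B"
  have ss: "s * s = 1" "\<bar>s\<bar> = 1" using s by auto
  have oB: "open O'" "bounded O'" "O' \<subseteq> \<Omega>" using open_\<Omega> B(1) bounded_\<Omega> by (auto simp: O'_def bounded_Int)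
  have [measurable]: "O' \<in> sets borel" using oB by simp
  have ww: "wgrad O' (\<lambda>x. indicator O' x * w x) (\<lambda>x. indicator O' x *R w' x)"
    by (rule C1_bounded_wgrad[OF oB(1,2)]) (use w in \<open>auto simp: O'_def\<close>)
  have wu: "wgrad O' (\<lambda>x. indicator O' x * u x) (\<lambda>x. indicator O' x *R U x)"
    by (rule wgrad_restrict[OF u(1) oB(1,3)])
  define f where "f x = max 0 (s * (indicator O' x * u x - indicator O' x * w x))" for x
  define F where "F x = indicator {x. s * (indicator O' x * u x - indicator O' x * w x) > 0} x *R (s *R (indicator O' x *R U x - indicator O' x *R w' x))" for x
  have wfF: "wgrad O' f F" unfolding f_def F_def by (rule wgrad_pos[OF oB(1) wgrad_scale[OF wgrad_diff[OF wu ww]]])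
  have fz: "AE x in lborel. x \<notin> K \<longrightarrow> f x = 0"
    using le_M
  proof eventually_elim
    case (elim x)
    then show ?case using u(4)[of x] le(2)[of x "u x"] by (cases "x \<in> O'") (auto simp: f_def O'_def algebra_simps)
  qed
  define \<psi> where "\<psi> x = indicator K x * f x" for x
  define \<Psi> where "\<Psi> x = indicator {x. \<psi> x \<noteq> 0} x *R F x" for x
  have w\<psi>: "wgrad \<Omega> \<psi> \<Psi>" and \<psi>f: "AE x in lborel. \<psi> x = f x"
    using clip_to_\<Omega>[OF B wfF[unfolded O'_def] fz] unfolding \<psi>_def[abs_def] \<Psi>_def[abs_def] by auto
  note [measurable] = wgradD(6,7)[OF w\<psi>] wgradD(6,7)[OF u(1)] wgradD(6,7)[OF ww]
  have b1: "0 \<le> \<psi> x" for x by (simp add: \<psi>_def f_def)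
  have bd: "norm (indicator O' x * w x) \<le> max b 0" "norm (indicator O' x *R w' x) \<le> max b 0" for x
    using w(3,4)[of x] by (auto simp: indicator_def O'_def le_max_iff_disj)
  have fw: "mdl G (\<lambda>x. indicator O' x * w x) < \<infinity>" "mdl G (\<lambda>x. indicator O' x *R w' x) < \<infinity>"
    by (rule bounded_mdl_finite[OF wgradD(6)[OF ww] bd(1)], use oB(3) in force)
      (rule bounded_mdl_finite[OF wgradD(7)[OF ww] bd(2)], use oB(3) in force)
  have f1: "mdl G \<psi> < \<infinity>"
    by (rule order_le_less_trans[OF mdl_mono[OF yG] mdl_diff_finite[OF wgradD(6)[OF u(1)] u(2) wgradD(6)[OF ww] fw(1)]])
      (use s in \<open>auto simp: \<psi>_def f_def indicator_def\<close>)
  have f2: "mdl G \<Psi> < \<infinity>"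
    by (rule order_le_less_trans[OF mdl_mono[OF yG] mdl_diff_finite[OF wgradD(7)[OF u(1)] u(3) wgradD(7)[OF ww] fw(2)]])
      (use ss(2) in \<open>auto simp: \<Psi>_def F_def \<psi>_def f_def indicator_def\<close>)
  have dom: "AE x in lborel. \<psi> x \<le> max 0 (s * (u x - \<phi> x))"
  proof (rule AE_I2)
    fix x show "\<psi> x \<le> max 0 (s * (u x - \<phi> x))"
      using le(1)[of x] by (auto simp: \<psi>_def f_def O'_def indicator_def right_diff_distrib)
  qed
  have W0s: "W0 G \<Omega> (\<lambda>x. s * (u x - \<phi> x)) (\<lambda>x. s *R (U x - P x))"
    using bc(1) W0_minus[OF bc(1)] s by auto
  have mUPs: "mdl G (\<lambda>x. s *R (U x - P x)) < \<infinity>"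
    by (rule mdl_scaleR_finite[OF yG _ mUP]) measurable
  have w0\<psi>: "W0 G \<Omega> \<psi> \<Psi>" by (rule W0_of_dominated[OF W0s mUPs w\<psi> f1 f2 b1 dom])
  define D where "D = {x. \<psi> x \<noteq> 0}"
  have [measurable]: "D \<in> sets borel" unfolding D_def by measurable
  have onD: "x \<in> O'" "U x - s *R \<Psi> x = w' x" if "x \<in> D" for x
    using that ss(1) by (auto simp: D_def \<Psi>_def F_def \<psi>_def f_def indicator_def max_def split: if_splits)
  have offD: "\<Psi> x = 0" if "x \<notin> D" for x using that by (simp add: D_def \<Psi>_def)
  define X where "X x = s *R A (w' x)" for x
  have Ab: "norm (X x) \<le> g (max b 0)" if "x \<in> \<Omega> \<inter> B" for x
  proof -
    have "norm (X x) \<le> g (norm (w' x))" using ss(2) by (simp add: X_def A_def g_nonneg abs_mult)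
    also have "\<dots> \<le> g (max b 0)" by (rule g_mono) (use w(4)[OF that] in auto)
    finally show ?thesis .
  qed
  have V1: "GDERIV (\<lambda>x. X x $ i) x :> s *R V' i x" if "x \<in> \<Omega> \<inter> B" for x i
    using GDERIV_mult[OF GDERIV_const[of s] V(1)[OF that]] by (simp add: X_def)
  have V2: "continuous_on (\<Omega> \<inter> B) (\<lambda>x. s *R V' i x)" for i by (intro continuous_intros V(2))
  have V3: "(\<Sum>i\<in>UNIV. (s *R V' i x) $ i) \<le> 0" if "x \<in> \<Omega> \<inter> B" for x
    using V(3)[OF that] by (simp add: sum_distrib_left)
  have z\<psi>: "\<psi> x = 0" if "x \<notin> K" for x using that by (simp add: \<psi>_def)
  define S where "S x = (indicator O' x *R X x) \<bullet> \<Psi> x" for x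
  have sgn: "0 \<le> (LBINT x. S x)" "L1 S"
    using barrier_sign[OF W0s mUPs w\<psi> f1 f2 b1 dom B z\<psi> V1 V2 V3 Ab] unfolding O'_def S_def[abs_def] by auto
  have fp: "mdl G (\<lambda>x. U x - s *R \<Psi> x) < \<infinity>"
    by (intro mdl_diff_finite[OF _ u(3)] mdl_scaleR_finite[OF yG _ f2]) measurable
  have h: "(LBINT x. indicator D x * G (norm (U x - s *R \<Psi> x))) \<le> (LBINT x. indicator D x * G (norm ((1 / 2) *R ((U x - s *R \<Psi> x) + U x))))"
  proof -
    have fm: "mdl G (\<lambda>x. (1 / 2) *R ((U x - s *R \<Psi> x) + U x)) < \<infinity>"
      by (intro mdl_scaleR_finite[OF yG] mdl_add_finite[OF yG _ fp _ u(3)]) measurable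
    have i1: "L1 (\<lambda>x. indicator D x * G (norm (U x - s *R \<Psi> x)))"
      by (rule integrable_ind_G[OF _ fp]) measurable
    have i2: "L1 (\<lambda>x. indicator D x * G (norm ((1 / 2) *R ((U x - s *R \<Psi> x) + U x))))"
      by (rule integrable_ind_G[OF _ fm]) measurable
    have "(LBINT x. indicator D x * G (norm (U x - s *R \<Psi> x)) + 1 / 2 * S x) \<le>
        (LBINT x. indicator D x * G (norm ((1 / 2) *R ((U x - s *R \<Psi> x) + U x))))"
    proof (rule integral_mono[OF _ i2])
      show "L1 (\<lambda>x. indicator D x * G (norm (U x - s *R \<Psi> x)) + 1 / 2 * S x)" using i1 sgn(2) by simp
      fix x
      show "indicator D x * G (norm (U x - s *R \<Psi> x)) + 1 / 2 * S x \<le> indicator D x * G (norm ((1 / 2) *R ((U x - s *R \<Psi> x) + U x)))"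
      proof (cases "x \<in> D")
        case True
        have "U x $ i = w' x $ i + s * \<Psi> x $ i" for i unfolding onD(2)[OF True, symmetric] by simp
        \<comment> \<open>The midpoint differs from \<open>w'\<close> by half the signed gradient of
          \<psi>, so the linear term of the supporting hyperplane is exactly half of
          \<open>S\<close>.\<close>
        then have e2: "(1 / 2) *R (w' x + U x) - w' x = (s / 2) *R \<Psi> x" by (simp add: vec_eq_iff field_simps)
        have "G (norm (w' x)) + A (w' x) \<bullet> ((1 / 2) *R (w' x + U x) - w' x) \<le> G (norm ((1 / 2) *R (w' x + U x)))"
          by (rule G_gradient)
        then show ?thesis unfolding onD(2)[OF True] e2 using True onD(1)[OF True] by (simp add: S_def X_def)
      qed (simp add: offD S_def)
    qed
    then show ?thesis using i1 sgn by simp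
  qed
  have "AE x in lborel. \<psi> x = 0"
  proof (cases "s = 1")
    case True
    have b2: "\<psi> x \<le> u x" for x
      using u(4)[of x] le(1)[of x] bc(3)[of x] True by (auto simp: \<psi>_def f_def indicator_def O'_def)
    show ?thesis by (rule compare_min[OF w0\<psi> f1 f2 b1 b2], fold D_def) (use h True in simp)
  next
    case False
    then have s1: "s = - 1" using s by simp
    define Z where "Z = {x. \<psi> x \<noteq> 0 \<and> u x = 0}"
    have Z[measurable]: "Z \<in> sets borel" unfolding Z_def by measurable
    have ZD: "Z \<subseteq> D" "D \<subseteq> \<Omega>" using onD(1) oB(3) by (auto simp: Z_def D_def)
    note cm = compare_max[OF w0\<psi> f1 f2 b1, folded D_def Z_def, OF h[unfolded s1 scaleR_minus1_left diff_minus_eq_add]]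
    have fZ: "emeasure lborel Z < \<infinity>" using emeasure_subset_\<Omega>[OF Z] ZD by blast
    \<comment> \<open>On the contact set the competitor has gradient \<open>w'\<close>, so
      \<open>k\<close> is positive there by \<open>big\<close>. Its integral is at most zero by the
      first part of \<open>compare_max\<close>, and therefore the contact set is null.\<close>
    define k where "k x = indicator Z x * G (norm (U x + \<Psi> x)) - 2 * lam * indicator Z x" for x
    have iZ: "L1 (\<lambda>x. indicator Z x * G (norm (U x + \<Psi> x)))"
      by (rule integrable_ind_G[OF _ fp[unfolded s1 scaleR_minus1_left diff_minus_eq_add]]) measurable
    have ik: "L1 k" unfolding k_def using iZ fZ by simp
    have kp: "0 < k x" if "x \<in> Z" for x
    proof -
      have "x \<in> \<Omega> \<inter> B" "U x + \<Psi> x = w' x" using onD[of x] that ZD s1 by (auto simp: O'_def)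
      then show ?thesis using big[of x] that by (simp add: k_def)
    qed
    have kn: "0 \<le> k x" for x using kp[of x] by (cases "x \<in> Z") (auto simp: k_def)
    have "(LBINT x. k x) \<le> 0" unfolding k_def using iZ fZ cm(1) by simp
    then have "(LBINT x. k x) = 0" using kn by (simp add: antisym integral_nonneg_AE)
    then have "AE x in lborel. k x = 0" using integral_nonneg_eq_0_iff_AE[OF ik] kn by simp
    then have "AE x in lborel. x \<notin> Z" by eventually_elim (use kp in force)
    then have "Z \<in> null_sets lborel" by (subst AE_iff_null_sets) auto
    then have "measure lborel Z = 0" by (simp add: null_sets_def measure_def)
    then show ?thesis by (rule cm(2))
  qed
  with \<psi>f show ?thesis
  proof eventually_elim
    case (elim x)
    then show ?case by (auto simp: f_def O'_def max_def algebra_simps split: if_splits)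
  qed
qed

end

section \<open>Comparison with translates\<close>

text \<open>The increment is the integral of the gradient along the segment from \<open>y\<close>
  back to \<open>y - s *R \<tau>\<close>. After Fubini each gradient on the segment is exchanged for
  the one at its end \<open>y\<close>, at the price \<omega>. The room around the segments makes the
  identity exact for mollifications of radius at most \<open>r\<close>.\<close>

lemma wgrad_difference_quotient:
  fixes \<tau> :: "real ^ 'n"
  assumes w: "wgrad \<Omega> u U" and \<tau>: "norm \<tau> = 1" and s: "0 \<le> s" and E: "E \<in> sets borel" and r: "0 < r"
    and room: "\<And>y t. y \<in> E \<Longrightarrow> 0 \<le> t \<Longrightarrow> t \<le> s \<Longrightarrow> cball (y - t *R \<tau>) r \<subseteq> \<Omega>"
    and om: "\<And>t. 0 \<le> t \<Longrightarrow> t \<le> s \<Longrightarrow> (LBINT x. norm (U (x - t *R \<tau>) - U x)) \<le> \<omega>"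
  shows "(LBINT y. indicator E y * (u y - u (y - s *R \<tau>))) \<le> s * ((LBINT y. indicator E y * (U y \<bullet> \<tau>)) + \<omega>)"
proof -
  note iu = wgradD(1)[OF w] and iU = wgradD(2)[OF w]
  note [measurable] = E wgradD(6,7)[OF w]
  obtain \<rho> k where \<rho>: "\<And>n. \<rho> n > 0" "\<rho> \<longlonglongrightarrow> 0" "\<And>n. kernel (\<rho> n) (k n)"
     "AE x in lborel. (\<lambda>n. conv (k n) u x) \<longlonglongrightarrow> u x"
    using mollify_seq[OF iu] by (elim exE conjE) (rule that, (rule spec, assumption | assumption)+)
  define f where "f n = conv (k n) u" for n
  define V where "V n = conv (k n) U" for n
  have ifn: "L1 (f n)" "L1 (V n)" for n
    unfolding f_def V_def using conv_integrable_lborel[OF \<rho>(3)] iu iU by auto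
  note [measurable] = borel_measurable_integrable[OF ifn(1)] borel_measurable_integrable[OF ifn(2)]
  have sh: "L1 (\<lambda>y. g (y - a))" if "L1 g" for g :: "real ^ 'n \<Rightarrow> 'c::{banach, second_countable_topology}" and a
    using lborel_integrable_translation[OF that, of "- a"] by simp
  have iE: "L1 (\<lambda>y. indicator E y * g y)" if "L1 g" for g :: "real ^ 'n \<Rightarrow> real"
    using integrable_mult_indicator[OF _ that, of E] E by simp
  have iEV: "L1 (\<lambda>y. indicator E y * (g (y - a) \<bullet> \<tau>))" if "L1 g" for g :: "real ^ 'n \<Rightarrow> real ^ 'n" and a
    by (rule iE) (use sh[OF that, of a] in auto)
  define J where "J = (LBINT y. indicator E y * (U y \<bullet> \<tau>))"
  define e where "e n = (LBINT x. norm (V n x - U x))" for n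
  have e0: "e \<longlonglongrightarrow> 0" unfolding e_def V_def by (rule conv_L1_tendsto[OF \<rho>(3,2) iU])
  have inner: "(LBINT y. indicator E y * (V n (y - t *R \<tau>) \<bullet> \<tau>)) \<le> J + (e n + \<omega>)" if t: "0 \<le> t" "t \<le> s" for n t
  proof -
    have "(LBINT y. indicator E y * (V n (y - t *R \<tau>) \<bullet> \<tau>)) \<le>
        (LBINT y. indicator E y * (U y \<bullet> \<tau>) + (norm (V n (y - t *R \<tau>) - U (y - t *R \<tau>)) + norm (U (y - t *R \<tau>) - U y)))"
    proof (rule integral_mono)
      show "L1 (\<lambda>y. indicator E y * (V n (y - t *R \<tau>) \<bullet> \<tau>))" by (rule iEV[OF ifn(2)])
      show "L1 (\<lambda>y. indicator E y * (U y \<bullet> \<tau>) + (norm (V n (y - t *R \<tau>) - U (y - t *R \<tau>)) + norm (U (y - t *R \<tau>) - U y)))"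
        using iEV[OF iU, of 0] sh[OF ifn(2)] sh[OF iU] iU by auto
      fix y
      have "V n (y - t *R \<tau>) \<bullet> \<tau> - U y \<bullet> \<tau> \<le> norm (V n (y - t *R \<tau>) - U y)"
        using norm_cauchy_schwarz[of "V n (y - t *R \<tau>) - U y" \<tau>] \<tau> by (simp add: inner_diff_left)
      also have "\<dots> \<le> norm (V n (y - t *R \<tau>) - U (y - t *R \<tau>)) + norm (U (y - t *R \<tau>) - U y)" by norm
      finally show "indicator E y * (V n (y - t *R \<tau>) \<bullet> \<tau>) \<le>
          indicator E y * (U y \<bullet> \<tau>) + (norm (V n (y - t *R \<tau>) - U (y - t *R \<tau>)) + norm (U (y - t *R \<tau>) - U y))"
        by (simp add: indicator_def)
    qed
    also have "\<dots> = J + ((LBINT y. norm (V n (y - t *R \<tau>) - U (y - t *R \<tau>))) + (LBINT y. norm (U (y - t *R \<tau>) - U y)))"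
      using iEV[OF iU, of 0] sh[OF ifn(2)] sh[OF iU] iU by (simp add: J_def)
    also have "(LBINT y. norm (V n (y - t *R \<tau>) - U (y - t *R \<tau>))) = e n"
      using lborel_integral_translation[of "\<lambda>y. norm (V n y - U y)" "- t *R \<tau>"] by (simp add: e_def)
    finally show ?thesis using om[OF t] by linarith
  qed
  have bound: "(LBINT y. indicator E y * (f n y - f n (y - s *R \<tau>))) \<le> s * (J + (e n + \<omega>))" if n: "\<rho> n \<le> r" for n
  proof -
    define h where "h t y = indicator {0..s} t *R (indicator E y * (V n (y - t *R \<tau>) \<bullet> \<tau>))" for t y
    have g: "GDERIV (f n) x :> gradient (f n) x" "continuous_on UNIV (gradient (f n))" for x
      using Ck1_GDERIV[OF conv_Ck[OF \<rho>(3) iu]] unfolding f_def by auto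
    have ftc: "(LBINT t. h t y) = indicator E y * (f n y - f n (y - s *R \<tau>))" for y
    proof (cases "y \<in> E")
      case True
      have gV: "gradient (f n) (y - t *R \<tau>) = V n (y - t *R \<tau>)" if "t \<in> {0..s}" for t
      proof -
        have "cball (y - t *R \<tau>) (\<rho> n) \<subseteq> \<Omega>" using room[OF True, of t] that n subset_cball[of "\<rho> n" r] by fastforce
        then show ?thesis unfolding f_def V_def by (rule GDERIV_gradient_eq[OF conv_wgrad[OF w \<rho>(3)]])
      qed
      have "has_bochner_integral lborel (\<lambda>t. indicator {0..s} t *R (gradient (f n) (y - t *R \<tau>) \<bullet> \<tau>)) (- f n (y - s *R \<tau>) - - f n (y - 0 *R \<tau>))"
      proof (rule has_bochner_integral_FTC_Icc[OF s])
        fix t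
        have "((\<lambda>t. f n (y - t *R \<tau>)) has_derivative (\<lambda>r. (- r *R \<tau>) \<bullet> gradient (f n) (y - t *R \<tau>))) (at t within {0..s})"
          by (rule has_derivative_compose[of "\<lambda>t. y - t *R \<tau>" _ t _ "f n"])
            (use g(1) in \<open>auto simp: gderiv_def intro!: derivative_eq_intros\<close>)
        from has_derivative_minus[OF this]
        show "((\<lambda>t. - f n (y - t *R \<tau>)) has_vector_derivative gradient (f n) (y - t *R \<tau>) \<bullet> \<tau>) (at t within {0..s})"
          by (simp add: has_vector_derivative_def inner_commute)
      next
        show "continuous_on {0..s} (\<lambda>t. gradient (f n) (y - t *R \<tau>) \<bullet> \<tau>)"
          by (intro continuous_intros continuous_on_compose2[OF g(2)]) auto
      qed
      then have "(LBINT t. indicator {0..s} t *R (gradient (f n) (y - t *R \<tau>) \<bullet> \<tau>)) = f n y - f n (y - s *R \<tau>)"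
        by (simp add: has_bochner_integral_integral_eq)
      moreover have "indicator {0..s} t *R (gradient (f n) (y - t *R \<tau>) \<bullet> \<tau>) = h t y" for t
        using True gV[of t] by (simp add: h_def indicator_def)
      ultimately show ?thesis using True by simp
    qed (simp add: h_def)
    have iI: "L1 (indicat_real {0..s})" using s by (intro integrable_real_indicator) (simp_all add: emeasure_lborel_Icc_eq)
    have ih: "integrable (lborel \<Otimes>\<^sub>M lborel) (\<lambda>(t, y). h t y)"
    proof (rule lborel_pair.Fubini_integrable)
      show m: "(\<lambda>(t, y). h t y) \<in> borel_measurable (lborel \<Otimes>\<^sub>M lborel)" unfolding h_def by measurable
      show "AE t in lborel. L1 (\<lambda>y. case (t, y) of (t, y) \<Rightarrow> h t y)"
        using iEV[OF ifn(2)] by (auto simp: h_def)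
      show "L1 (\<lambda>t. LBINT y. norm (case (t, y) of (t, y) \<Rightarrow> h t y))"
      proof (rule Bochner_Integration.integrable_bound[where f="\<lambda>t. indicator {0..s} t *R (LBINT y. norm (V n y))"])
        show "(\<lambda>t. LBINT y. norm (case (t, y) of (t, y) \<Rightarrow> h t y)) \<in> borel_measurable lborel" using m by measurable
        show "AE t in lborel. norm (LBINT y. norm (case (t, y) of (t, y) \<Rightarrow> h t y)) \<le> norm (indicator {0..s} t *R (LBINT y. norm (V n y)))"
        proof (rule AE_I2)
          fix t
          have "(LBINT y. norm (h t y)) \<le> (LBINT y. indicator {0..s} t *R norm (V n (y - t *R \<tau>)))"
          proof (rule integral_mono)
            show "norm (h t y) \<le> indicator {0..s} t *R norm (V n (y - t *R \<tau>))" for y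
              using Cauchy_Schwarz_ineq2[of "V n (y - t *R \<tau>)" \<tau>] \<tau> by (simp add: h_def indicator_def)
          qed (use iEV[OF ifn(2)] sh[OF ifn(2)] in \<open>auto simp: h_def\<close>)
          also have "\<dots> = indicator {0..s} t *R (LBINT y. norm (V n y))"
            using lborel_integral_translation[of "\<lambda>y. norm (V n y)" "- t *R \<tau>"] by simp
          finally show "norm (LBINT y. norm (case (t, y) of (t, y) \<Rightarrow> h t y)) \<le> norm (indicator {0..s} t *R (LBINT y. norm (V n y)))" by simp
        qed
      qed (simp add: iI)
    qed
    have "(LBINT y. indicator E y * (f n y - f n (y - s *R \<tau>))) = (LBINT y. (LBINT t. h t y))" by (simp only: ftc)
    also have "\<dots> = (LBINT t. (LBINT y. h t y))" by (rule lborel_pair.Fubini_integral[OF ih])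
    also have "\<dots> \<le> (LBINT t. indicator {0..s} t *R (J + (e n + \<omega>)))"
    proof (rule integral_mono)
      show "L1 (\<lambda>t. (LBINT y. h t y))" using lborel_pair.integrable_fst[OF ih] .
      show "(LBINT y. h t y) \<le> indicator {0..s} t *R (J + (e n + \<omega>))" for t
        using inner[of t n] by (auto simp: h_def indicator_def)
    qed (simp add: iI)
    also have "\<dots> = s * (J + (e n + \<omega>))" using s by simp
    finally show ?thesis .
  qed
  have l: "(\<lambda>n. LBINT y. indicator E y * (f n y - f n (y - s *R \<tau>))) \<longlonglongrightarrow> (LBINT y. indicator E y * (u y - u (y - s *R \<tau>)))"
  proof -
    have c: "(\<lambda>n. LBINT y. b y *R f n y) \<longlonglongrightarrow> (LBINT y. b y *R u y)" if "b \<in> borel_measurable lborel" "\<And>y. \<bar>b y\<bar> \<le> 1" for b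
      by (rule L1_bilinear_tendsto[OF bounded_bilinear_scaleR ifn(1) iu _ that(1) _ _ that(1), where B=1])
        (use that(2) conv_L1_tendsto[OF \<rho>(3,2) iu] in \<open>auto simp: f_def\<close>)
    have tr: "(LBINT y. indicator E y * (g y - g (y - s *R \<tau>))) = (LBINT y. indicator E y *R g y) - (LBINT y. indicator E (y + s *R \<tau>) *R g y)"
      if "L1 g" for g :: "real ^ 'n \<Rightarrow> real"
      using iE[OF that] iE[OF sh[OF that]] lborel_integral_translation[of "\<lambda>y. indicator E y * g (y - s *R \<tau>)" "s *R \<tau>"]
      by (simp add: right_diff_distrib)
    show ?thesis unfolding tr[OF ifn(1)] tr[OF iu] by (intro tendsto_diff c) (auto simp: indicator_def)
  qed
  have "(\<lambda>n. s * (J + (e n + \<omega>))) \<longlonglongrightarrow> s * (J + (0 + \<omega>))" by (intro tendsto_intros e0)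
  moreover have "\<forall>\<^sub>F n in sequentially. \<rho> n \<le> r" using order_tendstoD(2)[OF \<rho>(2) r] by eventually_elim simp
  then have "\<forall>\<^sub>F n in sequentially. (LBINT y. indicator E y * (f n y - f n (y - s *R \<tau>))) \<le> s * (J + (e n + \<omega>))"
    by eventually_elim (rule bound)
  ultimately show ?thesis using tendsto_le[OF trivial_limit_sequentially _ l] by (simp add: J_def)
qed

lemma close_to_frontier:
  fixes \<Omega> :: "'a::euclidean_space set"
  assumes "open \<Omega>" "bounded \<Omega>" "x \<in> \<Omega>" "infdist x (- \<Omega>) < d"
  shows "\<exists>z\<in>frontier \<Omega>. dist x z < d"
proof -
  have ne: "- \<Omega> \<noteq> {}" using assms(2) not_bounded_UNIV by (metis Compl_empty_eq double_complement)
  have "closed (- \<Omega>)" using assms(1) by (simp add: closed_Compl)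
  then obtain y where y: "y \<in> - \<Omega>" "infdist x (- \<Omega>) = dist x y"
    using infdist_attains_inf[of "- \<Omega>" x] ne by (metis)
  have "closed_segment x y \<inter> frontier \<Omega> \<noteq> {}"
    by (rule connected_Int_frontier) (use y assms(3) in auto)
  then obtain z where z: "z \<in> closed_segment x y" "z \<in> frontier \<Omega>" by blast
  have "dist x z \<le> dist x y" using z(1) segment_bound1[of z x y] by (simp add: dist_norm norm_minus_commute)
  then have "dist x z < d" using y(2) assms(4) by linarith
  with z(2) show ?thesis by blast
qed

lemma AE_lborel_translation:
  fixes a :: "'a::euclidean_space"
  assumes "AE x in lborel. R x"
  shows "AE x in lborel. R (x + a)"
proof -
  have "AE x in lborel. R (a + x)"
    by (rule AE_distrD[of "(+) a" lborel borel R]) (simp, subst lborel_distr_plus, rule assms)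
  then show ?thesis by (simp add: add.commute)
qed

context scalar_min
begin

text \<open>If \<open>x\<close> were within \<open>4 * norm \<sigma>\<close> of the complement,
  \<open>x\<close> and \<open>x + \<sigma>\<close> would lie within 4 and 5 lengths of \<sigma> of
  one boundary point; comparing both values with its \<open>b\<close> bounds the increment by
  \<open>9 * L0 * norm \<sigma>\<close>.\<close>

lemma translation_room:
  assumes BE: "\<And>x0. x0 \<in> frontier \<Omega> \<Longrightarrow> \<exists>b. AE x\<in>\<Omega> in lborel. \<bar>u x - b\<bar> \<le> L0 * norm (x - x0)"
    and L0: "0 \<le> L0" "9 * L0 \<le> L"
  shows "AE x\<in>\<Omega> in lborel. x + \<sigma> \<in> \<Omega> \<longrightarrow> L * norm \<sigma> < u (x + \<sigma>) - u x \<longrightarrow> 4 * norm \<sigma> \<le> infdist x (- \<Omega>)"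
proof -
  obtain T where T: "countable T" "T \<subseteq> frontier \<Omega>" "frontier \<Omega> \<subseteq> closure T"
    using separable[of "frontier \<Omega>"] by metis
  obtain b where b: "\<And>x0. x0 \<in> frontier \<Omega> \<Longrightarrow> AE x\<in>\<Omega> in lborel. \<bar>u x - b x0\<bar> \<le> L0 * norm (x - x0)"
  proof -
    have "\<forall>x0\<in>frontier \<Omega>. \<exists>b. AE x\<in>\<Omega> in lborel. \<bar>u x - b\<bar> \<le> L0 * norm (x - x0)"
      by (intro ballI BE)
    from bchoice[OF this] show thesis by (elim exE) (rule that, erule bspec)
  qed
  have "AE x in lborel. \<forall>x0\<in>T. x \<in> \<Omega> \<longrightarrow> \<bar>u x - b x0\<bar> \<le> L0 * norm (x - x0)"
    by (subst AE_ball_countable[OF T(1)]) (use b T(2) in auto)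
  moreover have "AE x in lborel. \<forall>x0\<in>T. x + \<sigma> \<in> \<Omega> \<longrightarrow> \<bar>u (x + \<sigma>) - b x0\<bar> \<le> L0 * norm (x + \<sigma> - x0)"
    by (rule AE_lborel_translation) (rule calculation)
  ultimately show ?thesis
  proof eventually_elim
    case (elim x)
    show ?case
    proof (intro impI, rule ccontr)
      assume a: "x \<in> \<Omega>" "x + \<sigma> \<in> \<Omega>" "L * norm \<sigma> < u (x + \<sigma>) - u x" "\<not> 4 * norm \<sigma> \<le> infdist x (- \<Omega>)"
      then obtain z where z: "z \<in> frontier \<Omega>" "dist x z < 4 * norm \<sigma>"
        using close_to_frontier[OF open_\<Omega> bounded_\<Omega> a(1)] by (metis not_le)
      obtain x0 where x0: "x0 \<in> T" "dist x0 z < 4 * norm \<sigma> - dist x z"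
        using z T(3) closure_approachable[of z T] by (meson diff_gt_0_iff_gt subsetD)
      have d: "norm (x - x0) \<le> 4 * norm \<sigma>" using x0(2) dist_triangle[of x x0 z] by (simp add: dist_norm norm_minus_commute)
      have d2: "norm (x + \<sigma> - x0) \<le> 5 * norm \<sigma>" using d norm_triangle_ineq[of "x - x0" \<sigma>] by (simp add: algebra_simps)
      have "u (x + \<sigma>) - u x \<le> L0 * norm (x + \<sigma> - x0) + L0 * norm (x - x0)"
        using elim(1)[rule_format, OF x0(1) a(1)] elim(2)[rule_format, OF x0(1) a(2)] by linarith
      also have "\<dots> \<le> L0 * (5 * norm \<sigma>) + L0 * (4 * norm \<sigma>)"
        by (intro add_mono mult_left_mono d d2 L0)
      also have "\<dots> = (9 * L0) * norm \<sigma>" by simp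
      also have "\<dots> \<le> L * norm \<sigma>" by (intro mult_right_mono L0) simp
      finally show False using a(3) by simp
    qed
  qed
qed

text \<open>The half-step inequality comes from minimality itself, applied at the translated points.
  The margin \<open>4 * norm \<sigma>\<close> keeps the supports of \<psi> and of its shift by
  \<sigma> compact in \<Omega>, so both perturbations have zero boundary values.\<close>

lemma translation_contact:
  assumes \<sigma>: "\<sigma> \<noteq> 0" and L: "0 \<le> L"
    and room: "AE x\<in>\<Omega> in lborel. x + \<sigma> \<in> \<Omega> \<longrightarrow> L * norm \<sigma> < u (x + \<sigma>) - u x \<longrightarrow> 4 * norm \<sigma> \<le> infdist x (- \<Omega>)"
  defines "Z \<equiv> {x. 4 * norm \<sigma> \<le> infdist x (- \<Omega>) \<and> u x = 0 \<and> L * norm \<sigma> < u (x + \<sigma>)}"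
  shows "(LBINT x. indicator Z x * G (norm (U (x + \<sigma>)))) \<le> 2 * lam * measure lborel Z"
    and "measure lborel Z = 0 \<Longrightarrow> AE x\<in>\<Omega> in lborel. x + \<sigma> \<in> \<Omega> \<longrightarrow> u (x + \<sigma>) - u x \<le> L * norm \<sigma>"
proof -
  define c where "c = L * norm \<sigma>"
  have c0: "0 \<le> c" using L by (simp add: c_def)
  define K where "K = {x. 4 * norm \<sigma> \<le> infdist x (- \<Omega>)}"
  have K\<Omega>: "K \<subseteq> \<Omega>"
  proof
    fix x assume "x \<in> K"
    then show "x \<in> \<Omega>" using infdist_zero[of x "- \<Omega>"] \<sigma> unfolding K_def by (cases "x \<in> - \<Omega>") auto
  qed
  have "closed K" unfolding K_def by (intro closed_Collect_le continuous_intros)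
  then have K: "compact K" using bounded_subset[OF bounded_\<Omega> K\<Omega>] by (simp add: compact_eq_bounded_closed)
  define B where "B = (\<lambda>x. x - \<sigma>) ` \<Omega>"
  have B: "x \<in> B \<longleftrightarrow> x + \<sigma> \<in> \<Omega>" for x unfolding B_def by (metis (no_types, lifting) add_diff_cancel diff_add_cancel image_iff)
  have oB: "open B" unfolding B_def using open_translation[OF open_\<Omega>, of "- \<sigma>"] by simp
  have KB: "K \<subseteq> B"
  proof
    fix x assume "x \<in> K"
    then have "cball x (norm \<sigma>) \<subseteq> \<Omega>" using zero_less_norm_iff[THEN iffD2, OF \<sigma>]
      unfolding K_def
      by - (erule CollectE, rule cball_subset_infdist, linarith)
    then show "x \<in> B" by (auto simp: B dist_norm)
  qed
  define O' where "O' = \<Omega> \<inter> B"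
  have oO: "open O'" unfolding O'_def by (intro open_Int open_\<Omega> oB)
  have [measurable]: "O' \<in> sets borel" "K \<in> sets borel" using oO K by (auto simp: borel_compact)
  have w1: "wgrad O' (\<lambda>x. indicator O' x * u (x + \<sigma>)) (\<lambda>x. indicator O' x *R U (x + \<sigma>))"
    by (rule wgrad_restrict[OF wgrad_translate[OF u(1), of \<sigma>] oO]) (auto simp: O'_def B_def)
  have w2: "wgrad O' (\<lambda>x. indicator O' x * u x) (\<lambda>x. indicator O' x *R U x)"
    by (rule wgrad_restrict[OF u(1) oO]) (simp add: O'_def)
  have w3: "wgrad O' (\<lambda>x. indicator O' x * (indicator \<Omega> x * c)) (\<lambda>x. indicator O' x *R 0)"
    by (rule wgrad_restrict[OF wgrad_const oO]) (simp add: O'_def)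
  define f where "f x = max 0 (indicator O' x * u (x + \<sigma>) - indicator O' x * u x - indicator O' x * (indicator \<Omega> x * c))" for x
  define F where "F x = indicator {x. indicator O' x * u (x + \<sigma>) - indicator O' x * u x - indicator O' x * (indicator \<Omega> x * c) > 0} x *R
    (indicator O' x *R U (x + \<sigma>) - indicator O' x *R U x - indicator O' x *R 0)" for x
  have wf: "wgrad O' f F" unfolding f_def F_def by (rule wgrad_pos[OF oO wgrad_diff[OF wgrad_diff[OF w1 w2] w3]])
  have fO: "f x = (if x \<in> O' then max 0 (u (x + \<sigma>) - u x - c) else 0)" for x
    by (auto simp: f_def O'_def)
  have fz: "AE x in lborel. x \<notin> K \<longrightarrow> f x = 0"
    using room by eventually_elim (auto simp: fO O'_def B K_def c_def max_def)
  define \<psi> where "\<psi> x = indicator K x * f x" for x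
  define \<Psi> where "\<Psi> x = indicator {x. \<psi> x \<noteq> 0} x *R F x" for x
  have w\<psi>: "wgrad \<Omega> \<psi> \<Psi>" and \<psi>f: "AE x in lborel. \<psi> x = f x"
    using clip_to_\<Omega>[OF oB K KB wf[unfolded O'_def] fz] unfolding \<psi>_def[abs_def] \<Psi>_def[abs_def] by auto
  have KO: "x \<in> O'" if "x \<in> K" for x using that K\<Omega> KB by (auto simp: O'_def)
  have \<psi>K: "\<psi> x = (if x \<in> K then max 0 (u (x + \<sigma>) - u x - c) else 0)" for x
    using KO by (auto simp: \<psi>_def fO)
  define D where "D = {x. \<psi> x \<noteq> 0}"
  have Deq: "x \<in> D \<longleftrightarrow> x \<in> K \<and> u x + c < u (x + \<sigma>)" for x by (auto simp: D_def \<psi>K max_def)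
  have \<Psi>D: "\<Psi> x = indicator D x *R (U (x + \<sigma>) - U x)" for x
    using KO[of x] K\<Omega> by (auto simp: \<Psi>_def D_def[symmetric] Deq F_def indicator_def)
  note [measurable] = wgradD(6,7)[OF w\<psi>] wgradD(6,7)[OF u(1)]
  have D[measurable]: "D \<in> sets borel" unfolding D_def by measurable
  have \<psi>0: "0 \<le> \<psi> x" for x by (simp add: \<psi>K)
  have us[measurable]: "(\<lambda>x. u (x + \<sigma>)) \<in> Borel" "(\<lambda>x. U (x + \<sigma>)) \<in> Borel" by measurable
  have Us: "mdl G (\<lambda>x. U (x + \<sigma>)) < \<infinity>" using mdl_translation[OF yG wgradD(7)[OF u(1)]] u(3) by simp
  have f1: "mdl G \<psi> < \<infinity>"
  proof (rule order_le_less_trans[OF mdl_mono[OF yG]])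
    show "AE x in lborel. norm (\<psi> x) \<le> norm (u (x + \<sigma>))"
    proof (rule AE_I2)
      fix x show "norm (\<psi> x) \<le> norm (u (x + \<sigma>))" using u(4)[of x] u(4)[of "x + \<sigma>"] c0 by (auto simp: \<psi>K)
    qed
    show "mdl G (\<lambda>x. u (x + \<sigma>)) < \<infinity>" using mdl_translation[OF yG wgradD(6)[OF u(1)]] u(2) by simp
  qed
  have f2: "mdl G \<Psi> < \<infinity>"
    by (rule order_le_less_trans[OF mdl_mono[OF yG] mdl_diff_finite[OF us(2) Us wgradD(7)[OF u(1)] u(3)]])
      (auto simp: \<Psi>D indicator_def)
  have zK: "\<psi> x = 0 \<and> \<Psi> x = 0" if "x \<notin> K" for x using that by (simp add: \<psi>K \<Psi>D Deq)
  have w0: "W0 G \<Omega> \<psi> \<Psi>" by (rule compact_support_W0[OF w\<psi> K K\<Omega> zK f1 f2])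
  have h: "(LBINT x. indicator D x * G (norm (U x + \<Psi> x))) \<le> (LBINT x. indicator D x * G (norm ((1 / 2) *R ((U x + \<Psi> x) + U x))))"
  proof -
    \<comment> \<open>Half of \<psi>, shifted by \<sigma> and subtracted. Before halving, the
      shifted \<psi> is at most \<open>u\<close>, so the competitor stays nonnegative. Pulled back
      by \<sigma>, its gradient on \<open>D\<close> is the mean of \<open>U (x + \<sigma>)\<close>
      and \<open>U x\<close>.\<close>
    define \<psi>' where "\<psi>' x = - (1 / 2) * \<psi> (x + - \<sigma>)" for x
    define \<Psi>' where "\<Psi>' x = (- (1 / 2)) *R \<Psi> (x + - \<sigma>)" for x
    define K' where "K' = (\<lambda>x. \<sigma> + x) ` K"
    have K': "compact K'" unfolding K'_def by (rule compact_translation[OF K])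
    have inK': "x \<in> K' \<longleftrightarrow> x + - \<sigma> \<in> K" for x by (auto simp: K'_def intro!: image_eqI[of x _ "x + - \<sigma>"])
    have K'\<Omega>: "K' \<subseteq> \<Omega>" using KB by (auto simp: inK' B dest: subsetD)
    have z': "\<psi>' x = 0 \<and> \<Psi>' x = 0" if "x \<notin> K'" for x using zK[of "x + - \<sigma>"] that by (simp add: \<psi>'_def \<Psi>'_def inK')
    have "wgrad UNIV \<psi>' \<Psi>'"
      using wgrad_scale[OF wgrad_translate[OF wgrad_compact_UNIV[OF w\<psi> K K\<Omega> zK], of "- \<sigma>"], of "- (1 / 2)"]
      by (simp add: \<psi>'_def[abs_def] \<Psi>'_def[abs_def] surj_plus_right)
    from wgrad_restrict[OF this open_\<Omega>]
    have "wgrad \<Omega> (\<lambda>x. indicator \<Omega> x * \<psi>' x) (\<lambda>x. indicator \<Omega> x *R \<Psi>' x)" by simp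
    moreover have "indicator \<Omega> x * \<psi>' x = \<psi>' x" "indicator \<Omega> x *R \<Psi>' x = \<Psi>' x" for x
      using z'[of x] K'\<Omega> by (cases "x \<in> \<Omega>"; force)+
    ultimately have w': "wgrad \<Omega> \<psi>' \<Psi>'" by simp
    have e1: "mdl G \<psi>' < \<infinity>"
      using mdl_scaleR_finite[OF yG _ f1[folded mdl_translation[OF yG wgradD(6)[OF w\<psi>], of "- \<sigma>"]], of "- (1 / 2)"]
      by (simp add: \<psi>'_def[abs_def])
    have e2: "mdl G \<Psi>' < \<infinity>"
      using mdl_scaleR_finite[OF yG _ f2[folded mdl_translation[OF yG wgradD(7)[OF w\<psi>], of "- \<sigma>"]], of "- (1 / 2)"]
      by (simp add: \<Psi>'_def[abs_def])
    have n': "0 \<le> u x + \<psi>' x" for x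
      using u(4)[of x] u(4)[of "x - \<sigma>"] c0 by (auto simp: \<psi>'_def \<psi>K)
    have p': "0 < u x" if "0 < u x + \<psi>' x" for x using that \<psi>0[of "x + - \<sigma>"] by (simp add: \<psi>'_def)
    have "(LBINT x. indicator {x. \<psi>' x \<noteq> 0} x * G (norm (U x))) \<le> (LBINT x. indicator {x. \<psi>' x \<noteq> 0} x * G (norm (U x + \<Psi>' x)))"
      by (rule minimal_sub[OF compact_support_W0[OF w' K' K'\<Omega> z' e1 e2] e1 e2 n' p'])
    moreover have "(LBINT x. indicator {x. \<psi>' x \<noteq> 0} (x + \<sigma>) * G (norm (U (x + \<sigma>)))) = (LBINT x. indicator {x. \<psi>' x \<noteq> 0} x * G (norm (U x)))"
      by (rule lborel_integral_translation)
    moreover have "(LBINT x. indicator {x. \<psi>' x \<noteq> 0} (x + \<sigma>) * G (norm (U (x + \<sigma>) + \<Psi>' (x + \<sigma>)))) = (LBINT x. indicator {x. \<psi>' x \<noteq> 0} x * G (norm (U x + \<Psi>' x)))"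
      by (rule lborel_integral_translation)
    moreover have "indicator {x. \<psi>' x \<noteq> 0} (x + \<sigma>) = (indicator D x :: real)" for x by (simp add: \<psi>'_def D_def indicator_def)
    ultimately have "(LBINT x. indicator D x * G (norm (U (x + \<sigma>)))) \<le> (LBINT x. indicator D x * G (norm (U (x + \<sigma>) + \<Psi>' (x + \<sigma>))))"
      by simp
    moreover have "indicator D x * G (norm (U (x + \<sigma>))) = indicator D x * G (norm (U x + \<Psi> x))" for x
      by (simp add: \<Psi>D indicator_def)
    moreover have "indicator D x * G (norm (U (x + \<sigma>) + \<Psi>' (x + \<sigma>))) = indicator D x * G (norm ((1 / 2) *R ((U x + \<Psi> x) + U x)))" for x
    proof (cases "x \<in> D")
      case True
      have "U (x + \<sigma>) + \<Psi>' (x + \<sigma>) = (1 / 2) *R ((U x + \<Psi> x) + U x)"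
        using True by (simp add: \<Psi>'_def \<Psi>D vec_eq_iff field_simps)
      then show ?thesis by (simp only:)
    qed simp
    ultimately show ?thesis by (simp only:)
  qed
  have ZD: "Z = {x. \<psi> x \<noteq> 0 \<and> u x = 0}"
    unfolding Z_def by (auto simp: \<psi>K K_def c_def max_def)
  note cm = compare_max[OF w0 f1 f2 \<psi>0, folded D_def ZD, OF h]
  have "indicator Z x * G (norm (U (x + \<sigma>))) = indicator Z x * G (norm (U x + \<Psi> x))" for x
    by (auto simp: \<Psi>D ZD D_def indicator_def)
  then show "(LBINT x. indicator Z x * G (norm (U (x + \<sigma>)))) \<le> 2 * lam * measure lborel Z"
    using cm(1) by (simp only:)
  assume "measure lborel Z = 0"
  from cm(2)[OF this] \<psi>f
  show "AE x\<in>\<Omega> in lborel. x + \<sigma> \<in> \<Omega> \<longrightarrow> u (x + \<sigma>) - u x \<le> L * norm \<sigma>"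
    by eventually_elim (auto simp: fO O'_def B c_def max_def split: if_splits)
qed

end

context scalar_min
begin

text \<open>The weak gradient gives no pointwise derivative of \<open>I\<close>, so its monotonicity
  is proved in steps of length \<open>s\<close> with an error \<open>s * \<omega>\<close>, where
  \<omega> bounds the L1 shift error of the gradient over lengths up to \<open>s\<close>. Summing
  the steps up to \<open>T\<close> gives at most \<open>T * \<omega>\<close>, and \<omega> can be
  made arbitrarily small.\<close>

lemma translation_le:
  assumes room: "\<And>\<sigma>. AE x\<in>\<Omega> in lborel. x + \<sigma> \<in> \<Omega> \<longrightarrow> L * norm \<sigma> < u (x + \<sigma>) - u x \<longrightarrow> 4 * norm \<sigma> \<le> infdist x (- \<Omega>)"
    and L: "0 < L" "2 * lam < G L" and \<tau>: "norm \<tau> = 1" and T: "0 < T"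
  shows "AE x\<in>\<Omega> in lborel. x + T *R \<tau> \<in> \<Omega> \<longrightarrow> u (x + T *R \<tau>) - u x \<le> L * T"
proof -
  note [measurable] = wgradD(6,7)[OF u(1)]
  note iu = wgradD(1)[OF u(1)] and iU = wgradD(2)[OF u(1)]
  have \<Omega>m[measurable]: "\<Omega> \<in> sets borel" using open_\<Omega> by simp
  define S where "S = {x \<in> \<Omega>. u x = 0}"
  have Am[measurable]: "S \<in> sets borel" unfolding S_def by measurable
  define Z where "Z t = {x. 4 * norm (t *R \<tau>) \<le> infdist x (- \<Omega>) \<and> u x = 0 \<and> L * norm (t *R \<tau>) < u (x + t *R \<tau>)}" for t
  have Zm[measurable]: "Z t \<in> sets borel" for t
  proof -
    have "continuous_on UNIV (\<lambda>x. infdist x (- \<Omega>))" by (intro continuous_intros)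
    then have [measurable]: "(\<lambda>x. infdist x (- \<Omega>)) \<in> Borel" by (rule borel_measurable_continuous_onI)
    have "{x \<in> space borel. 4 * norm (t *R \<tau>) \<le> infdist x (- \<Omega>) \<and> u x = 0 \<and> L * norm (t *R \<tau>) < u (x + t *R \<tau>)} \<in> sets borel"
      by measurable
    then show ?thesis by (simp add: Z_def)
  qed
  have Z: "x \<in> Z t \<longleftrightarrow> 4 * t \<le> infdist x (- \<Omega>) \<and> u x = 0 \<and> L * t < u (x + t *R \<tau>)" if "0 < t" for x t
    using that \<tau> by (simp add: Z_def)
  have ZA: "Z t \<subseteq> S" if "0 < t" for t
  proof
    fix x assume x: "x \<in> Z t"
    then have "0 < infdist x (- \<Omega>)" using that by (simp add: Z)
    then have "x \<in> \<Omega>" using infdist_zero[of x "- \<Omega>"] by (cases "x \<in> - \<Omega>") auto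
    then show "x \<in> S" using x by (simp add: S_def Z_def)
  qed
  have iind: "L1 (indicat_real B)" if "B \<in> sets borel" "B \<subseteq> S" for B
    using emeasure_subset_\<Omega>[OF that(1)] that by (intro integrable_real_indicator) (auto simp: S_def)
  have iB: "L1 (\<lambda>x. indicator B x * h (x + a))" if "B \<in> sets borel" "L1 h" for B a and h :: "real ^ 'n \<Rightarrow> real"
    using integrable_mult_indicator[OF _ lborel_integrable_translation[OF that(2)], of B] that(1) by simp
  define I where "I t = (LBINT x. indicator S x * max 0 (u (x + t *R \<tau>) - t * L))" for t
  have iI: "L1 (\<lambda>x. indicator S x * max 0 (u (x + t *R \<tau>) - t * L))" if "0 \<le> t" for t
  proof (rule Bochner_Integration.integrable_bound[OF iB[OF Am iu, of "t *R \<tau>"]])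
    have "0 \<le> t * L" using that L by simp
    then show "AE x in lborel. norm (indicator S x * max 0 (u (x + t *R \<tau>) - t * L)) \<le> norm (indicator S x * u (x + t *R \<tau>))"
      by (intro AE_I2) (auto simp: indicator_def max_def)
  qed simp
  \<comment> \<open>On the zero set of \<open>u\<close> the integrand is positive only if
    \<open>u\<close> grows by more than \<open>t * L\<close> under the translation; the hypothesis
    \<open>room\<close> then places the point in \<open>Z t\<close>, up to a null set.\<close>
  have IZ: "I t = (LBINT x. indicator (Z t) x * (u (x + t *R \<tau>) - t * L))" if "0 < t" for t
    unfolding I_def
  proof (rule integral_cong_AE)
    show "AE x in lborel. indicator S x * max 0 (u (x + t *R \<tau>) - t * L) = indicator (Z t) x * (u (x + t *R \<tau>) - t * L)"
      using room[of "t *R \<tau>"]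
    proof eventually_elim
      case (elim x)
      show ?case
      proof (cases "x \<in> S \<and> t * L < u (x + t *R \<tau>)")
        case True
        have "0 < t * L" using that L by simp
        then have "x + t *R \<tau> \<in> \<Omega>" using True wgradD(3)[OF u(1), of "x + t *R \<tau>"] by (cases "x + t *R \<tau> \<in> \<Omega>") auto
        then have "x \<in> Z t" using elim True that \<tau> by (simp add: Z S_def mult.commute)
        then show ?thesis using True by simp
      next
        case False
        then have "x \<notin> Z t" using ZA[OF that] Z[OF that, of x] by (auto simp: mult.commute)
        then show ?thesis using False by (auto simp: indicator_def)
      qed
    qed
  qed measurable
  \<comment> \<open>The supporting line of \<open>G\<close> at \<open>L\<close> bounds the energy on
    \<open>Z t\<close> from below. Were the mean slope above \<open>L\<close>, the mean energy would
    exceed \<open>G L > 2 * lam\<close>, against \<open>translation_contact\<close>.\<close>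
  have slope: "(LBINT x. indicator (Z t) x * (U (x + t *R \<tau>) \<bullet> \<tau>)) \<le> L * measure lborel (Z t)" if t: "0 < t" for t
  proof -
    have i: "L1 (\<lambda>x. indicator (Z t) x * (U (x + t *R \<tau>) \<bullet> \<tau>))" by (rule iB[OF Zm]) (use iU in simp)
    have iZ: "L1 (\<lambda>x. indicat_real (Z t) x)" by (rule iind[OF Zm ZA[OF t]])
    have "mdl G (\<lambda>x. U (x + t *R \<tau>)) < \<infinity>" using mdl_translation[OF yG wgradD(7)[OF u(1)]] u(3) by simp
    then have iG: "L1 (\<lambda>x. indicator (Z t) x * G (norm (U (x + t *R \<tau>))))"
      by (intro integrable_ind_G Zm) measurable
    have "G L * measure lborel (Z t) + g L * ((LBINT x. indicator (Z t) x * (U (x + t *R \<tau>) \<bullet> \<tau>)) - L * measure lborel (Z t))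
        = (LBINT x. G L * indicator (Z t) x + g L * (indicator (Z t) x * (U (x + t *R \<tau>) \<bullet> \<tau>) - L * indicator (Z t) x))"
      using i iZ by simp
    also have "\<dots> \<le> (LBINT x. indicator (Z t) x * G (norm (U (x + t *R \<tau>))))"
    proof (rule integral_mono[OF _ iG])
      fix x
      have "G (norm L) + A L \<bullet> (norm (U (x + t *R \<tau>)) - L) \<le> G (norm (norm (U (x + t *R \<tau>))))" by (rule G_gradient)
      moreover have "g L * (U (x + t *R \<tau>) \<bullet> \<tau> - L) \<le> g L * (norm (U (x + t *R \<tau>)) - L)"
        using norm_cauchy_schwarz[of "U (x + t *R \<tau>)" \<tau>] \<tau> g_pos[OF L(1)] by (intro mult_left_mono) auto
      ultimately show "G L * indicator (Z t) x + g L * (indicator (Z t) x * (U (x + t *R \<tau>) \<bullet> \<tau>) - L * indicator (Z t) x) \<le> indicator (Z t) x * G (norm (U (x + t *R \<tau>)))"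
        using L by (simp add: indicator_def A_def)
    qed (use i iZ in simp)
    also have "\<dots> \<le> 2 * lam * measure lborel (Z t)"
      unfolding Z_def by (rule translation_contact(1)[OF _ less_imp_le[OF L(1)] room]) (use t \<tau> in auto)
    also have "\<dots> \<le> G L * measure lborel (Z t)" using L by (intro mult_right_mono) auto
    finally show ?thesis using g_pos[OF L(1)] by (simp add: mult_le_0_iff)
  qed
  \<comment> \<open>On \<open>Z\<close> at time \<open>t + s\<close> the increment over the last
    step has mean slope at most \<open>L\<close>, up to \<omega>, while the threshold rises by
    exactly \<open>s * L\<close>. Enlarging the set from \<open>Z\<close> to \<open>S\<close> only
    increases the positive part at time \<open>t\<close>.\<close>
  have step: "I (t + s) \<le> I t + s * \<omega>"
    if s: "0 < s" "0 \<le> t" and om: "\<And>r. 0 \<le> r \<Longrightarrow> r \<le> s \<Longrightarrow> (LBINT x. norm (U (x - r *R \<tau>) - U x)) \<le> \<omega>" for s t \<omega>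
  proof -
    define t' where "t' = t + s"
    have t': "0 < t'" using s by (simp add: t'_def)
    define E where "E = {y. y - t' *R \<tau> \<in> Z t'}"
    have Em: "E \<in> sets borel"
    proof -
      have "{y \<in> space borel. y - t' *R \<tau> \<in> Z t'} \<in> sets borel" by measurable
      then show ?thesis by (simp add: E_def)
    qed
    have EZ: "indicator E (x + t' *R \<tau>) = (indicator (Z t') x :: real)" for x by (simp add: E_def indicator_def)
    have sh: "(LBINT y. indicator E y * h y) = (LBINT x. indicator (Z t') x * h (x + t' *R \<tau>))" for h :: "real ^ 'n \<Rightarrow> real"
      using lborel_integral_translation[of "\<lambda>y. indicator E y * h y" "t' *R \<tau>"] by (simp add: EZ)
    \<comment> \<open>Points of \<open>Z t'\<close> have distance at least \<open>4 * t'\<close>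
      from the complement, so balls of radius \<open>t'\<close> around all points of the segment
      fit.\<close>
    have cb: "cball (y - r *R \<tau>) t' \<subseteq> \<Omega>" if "y \<in> E" "0 \<le> r" "r \<le> s" for y r
    proof -
      have "cball (y - t' *R \<tau>) (2 * t') \<subseteq> \<Omega>" using that(1) t' by (intro cball_subset_infdist) (auto simp: E_def Z)
      moreover have "dist (y - t' *R \<tau>) (y - r *R \<tau>) = t' - r"
        using that s \<tau> by (simp add: dist_norm scaleR_diff_left[symmetric] t'_def)
      then have "cball (y - r *R \<tau>) t' \<subseteq> cball (y - t' *R \<tau>) (2 * t')"
        using that(2) by (simp add: cball_subset_cball_iff dist_commute)
      ultimately show ?thesis by blast
    qed
    have "(LBINT x. indicator (Z t') x * (u (x + t' *R \<tau>) - u (x + t *R \<tau>))) \<le> s * ((LBINT x. indicator (Z t') x * (U (x + t' *R \<tau>) \<bullet> \<tau>)) + \<omega>)"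
      using wgrad_difference_quotient[OF u(1) \<tau> less_imp_le[OF s(1)] Em t' cb om]
      unfolding sh by (simp add: t'_def algebra_simps)
    also have "\<dots> \<le> s * (L * measure lborel (Z t') + \<omega>)" using slope[OF t'] s by simp
    finally have q: "(LBINT x. indicator (Z t') x * (u (x + t' *R \<tau>) - u (x + t *R \<tau>))) \<le> s * (L * measure lborel (Z t') + \<omega>)" .
    have i: "L1 (\<lambda>x. indicator (Z t') x * u (x + a))" for a by (rule iB[OF Zm iu])
    have iZ: "L1 (\<lambda>x. indicat_real (Z t') x)" by (rule iind[OF Zm ZA[OF t']])
    have c: "(LBINT x. indicator (Z t') x * (u (x + a) - b)) = (LBINT x. indicator (Z t') x * u (x + a)) - b * measure lborel (Z t')" for a b
      using i[of a] iZ by (simp add: right_diff_distrib)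
    have d: "(LBINT x. indicator (Z t') x * (u (x + a) - u (x + b))) = (LBINT x. indicator (Z t') x * u (x + a)) - (LBINT x. indicator (Z t') x * u (x + b))" for a b
      using i by (simp add: right_diff_distrib)
    have "(LBINT x. indicator (Z t') x * (u (x + t *R \<tau>) - t * L)) \<le> I t"
      unfolding I_def
    proof (rule integral_mono[OF _ iI[OF s(2)]])
      show "L1 (\<lambda>x. indicator (Z t') x * (u (x + t *R \<tau>) - t * L))"
        using i iZ by (simp add: right_diff_distrib)
      show "indicator (Z t') x * (u (x + t *R \<tau>) - t * L) \<le> indicator S x * max 0 (u (x + t *R \<tau>) - t * L)" for x
        using ZA[OF t'] by (auto simp: indicator_def)
    qed
    moreover have "I t' = (LBINT x. indicator (Z t') x * (u (x + t *R \<tau>) - t * L))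
        + (LBINT x. indicator (Z t') x * (u (x + t' *R \<tau>) - u (x + t *R \<tau>))) - s * (L * measure lborel (Z t'))"
      unfolding IZ[OF t'] c d by (simp add: t'_def distrib_left distrib_right)
    ultimately show ?thesis using q unfolding t'_def[symmetric] by (simp add: distrib_left)
  qed
  have I0: "I 0 = 0"
  proof -
    have "indicator S x * max 0 (u (x + 0 *R \<tau>) - 0 * L) = 0" for x by (simp add: S_def indicator_def)
    then show ?thesis unfolding I_def by (simp only: Bochner_Integration.integral_zero)
  qed
  have "I T \<le> 0 + e" if "0 < e" for e
  proof -
    have "0 < e / T" using that T by simp
    from L1_translation_continuous[OF iU this] obtain d where d: "0 < d" "\<forall>h. norm h < d \<longrightarrow> (LBINT x. norm (U (x - h) - U x)) < e / T"
      by (elim exE conjE) (rule that)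
    obtain N where N: "T / d < real N" using reals_Archimedean2 by metis
    have "0 < T / d" using T d by simp
    then have N0: "0 < real N" using N by linarith
    \<comment> \<open>The step is below \<open>d\<close>, so the L1 shift error of \<open>U\<close>
      is at most \<open>e / T\<close> and \<open>N\<close> steps cost at most
      \<open>e\<close>.\<close>
    define s where "s = T / N"
    have s: "0 < s" "s < d" using N N0 T d(1) by (auto simp: s_def field_simps)
    have it: "I (real n * s) \<le> real n * s * (e / T)" for n
    proof (induction n)
      case (Suc n)
      have "I (real n * s + s) \<le> I (real n * s) + s * (e / T)"
      proof (rule step[OF s(1)])
        fix r assume "0 \<le> r" "r \<le> s"
        then have "norm (r *R \<tau>) < d" using s \<tau> by simp
        then show "(LBINT x. norm (U (x - r *R \<tau>) - U x)) \<le> e / T" using d(2) by (intro less_imp_le) simp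
      qed (use s in simp)
      then show ?case using Suc by (simp add: algebra_simps)
    qed (simp add: I0)
    have "real N * s = T" using N0 by (simp add: s_def)
    then show ?thesis using it[of N] T by simp
  qed
  then have "I T \<le> 0" by (rule field_le_epsilon)
  moreover have "0 \<le> I T" unfolding I_def by (rule integral_nonneg_AE) simp
  ultimately have "(LBINT x. indicator S x * max 0 (u (x + T *R \<tau>) - T * L)) = 0" unfolding I_def[symmetric] by (rule antisym)
  then have "AE x in lborel. indicator S x * max 0 (u (x + T *R \<tau>) - T * L) = 0"
    using integral_nonneg_eq_0_iff_AE[OF iI[of T]] T by simp
  then have "AE x in lborel. x \<notin> Z T"
    by eventually_elim (use ZA[OF T] Z[OF T] in \<open>force simp: indicator_def max_def mult.commute split: if_splits\<close>)
  then have "Z T \<in> null_sets lborel" using Zm[of T] by (subst AE_iff_null_sets) auto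
  then have "measure lborel (Z T) = 0" by (simp add: null_sets_def measure_def)
  from translation_contact(2)[OF _ less_imp_le[OF L(1)] room this[unfolded Z_def]]
  show ?thesis using T \<tau> by (cases "\<tau> = 0") auto
qed

end

section \<open>From translation estimates to Lipschitz representatives\<close>

lemma conv_translation_le:
  fixes u :: "real ^ 'n \<Rightarrow> real"
  assumes k: "kernel r k" and u: "L1 u" and "cball x r \<subseteq> \<Omega>" "cball (x + \<sigma>) r \<subseteq> \<Omega>"
    and ae: "AE x\<in>\<Omega> in lborel. x + \<sigma> \<in> \<Omega> \<longrightarrow> u (x + \<sigma>) - u x \<le> c"
  shows "conv k u (x + \<sigma>) - conv k u x \<le> c"
proof -
  note kc = kernel_C1c[OF k]
  have i1: "L1 (\<lambda>y. k (x - y) *R u y)" by (rule conv_integrable[OF kc u])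
  have us: "L1 (\<lambda>y. u (y + \<sigma>))" by (rule lborel_integrable_translation[OF u])
  have i2: "L1 (\<lambda>y. k (x - y) *R u (y + \<sigma>))" by (rule conv_integrable[OF kc us])
  have ik: "L1 (\<lambda>y. k (x - y))" and k1: "(LBINT y. k (x - y)) = 1"
    using lborel_integrable_reflection[OF C1c_integrable(1)[OF kc], of x] lborel_integral_reflection[OF C1c_measurable(1)[OF kc], of x] k
    by (auto simp: kernel_def)
  have "conv k u (x + \<sigma>) = (LBINT y. k (x - y) *R u (y + \<sigma>))"
    using lborel_integral_translation[of "\<lambda>y. k (x + \<sigma> - y) *R u y" \<sigma>] by (simp add: conv_def)
  then have "conv k u (x + \<sigma>) - conv k u x = (LBINT y. k (x - y) * (u (y + \<sigma>) - u y))"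
    using i1 i2 by (simp add: conv_def right_diff_distrib)
  also have "\<dots> \<le> (LBINT y. k (x - y) * c)"
  proof (rule integral_mono_AE)
    show "L1 (\<lambda>y. k (x - y) * (u (y + \<sigma>) - u y))" using Bochner_Integration.integrable_diff[OF i2 i1] by (simp add: right_diff_distrib)
    show "L1 (\<lambda>y. k (x - y) * c)" using ik by simp
    show "AE y in lborel. k (x - y) * (u (y + \<sigma>) - u y) \<le> k (x - y) * c"
      using ae
    proof eventually_elim
      case (elim y)
      show ?case
      proof (cases "y \<in> cball x r")
        case True
        then have "y \<in> \<Omega>" "y + \<sigma> \<in> \<Omega>" using assms(3,4) by (auto simp: dist_norm subset_iff)
        then show ?thesis using elim k by (intro mult_left_mono) (auto simp: kernel_def)
      next
        case False
        then have "k (x - y) = 0" using k by (simp add: kernel_def dist_norm)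
        then show ?thesis by simp
      qed
    qed
  qed
  also have "\<dots> = c" using k1 by simp
  finally show ?thesis .
qed

text \<open>The exceptional null set depends on \<sigma>; mollification turns the estimate into one
  valid at every pair of points well inside \<Omega>. It passes to the set \<open>E\<close> of
  convergence, which is dense in \<Omega>, and extends to its closure. Two points are compared by
  the single translation joining them, so the constant holds on all of \<Omega>.\<close>

lemma lipschitz_of_translation:
  fixes u :: "real ^ 'n \<Rightarrow> real"
  assumes \<Omega>: "open \<Omega>" "bounded \<Omega>" and u: "L1 u" and L: "0 \<le> L"
    and tr: "\<And>\<sigma>. AE x\<in>\<Omega> in lborel. x + \<sigma> \<in> \<Omega> \<longrightarrow> u (x + \<sigma>) - u x \<le> L * norm \<sigma>"
  shows "\<exists>w. L-lipschitz_on \<Omega> w \<and> (AE x\<in>\<Omega> in lborel. u x = w x)"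
proof -
  obtain \<rho> k where \<rho>: "\<And>n. \<rho> n > 0" "\<rho> \<longlonglongrightarrow> 0" "\<And>n. kernel (\<rho> n) (k n)"
     "AE x in lborel. (\<lambda>n. conv (k n) u x) \<longlonglongrightarrow> u x"
    using mollify_seq[OF u] by (elim exE conjE) (rule that, (rule spec, assumption | assumption)+)
  define f where "f n = conv (k n) u" for n
  have lip: "f n y - f n x \<le> L * norm (y - x)" if "\<rho> n < infdist x (- \<Omega>)" "\<rho> n < infdist y (- \<Omega>)" for n x y
    using conv_translation_le[OF \<rho>(3) u cball_subset_infdist[OF that(1)] _ tr[of "y - x"]] cball_subset_infdist[OF that(2)]
    unfolding f_def by simp
  define E where "E = {x \<in> \<Omega>. (\<lambda>n. f n x) \<longlonglongrightarrow> u x}"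
  have E1: "u y - u x \<le> L * norm (y - x)" if xy: "x \<in> E" "y \<in> E" for x y
  proof (rule LIMSEQ_le_const2)
    show "(\<lambda>n. f n y - f n x) \<longlonglongrightarrow> u y - u x" using xy by (intro tendsto_diff) (auto simp: E_def)
    have "0 < infdist x (- \<Omega>)" "0 < infdist y (- \<Omega>)" using xy \<Omega> by (auto simp: E_def intro!: infdist_compl_pos)
    then have "\<forall>\<^sub>F n in sequentially. \<rho> n < infdist x (- \<Omega>) \<and> \<rho> n < infdist y (- \<Omega>)"
      by (intro eventually_conj order_tendstoD(2)[OF \<rho>(2)])
    then obtain N where "\<forall>n\<ge>N. \<rho> n < infdist x (- \<Omega>) \<and> \<rho> n < infdist y (- \<Omega>)"
      unfolding eventually_sequentially by (elim exE) (rule that)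
    then show "\<exists>N. \<forall>n\<ge>N. f n y - f n x \<le> L * norm (y - x)" using lip by (intro exI[of _ N]) auto
  qed
  have "L-lipschitz_on E u"
  proof (rule lipschitz_onI[OF _ L])
    fix x y assume "x \<in> E" "y \<in> E"
    then show "dist (u x) (u y) \<le> L * dist x y"
      using E1[of x y] E1[of y x] by (auto simp: dist_norm norm_minus_commute abs_le_iff)
  qed
  from lipschitz_extend_closure[OF this]
  obtain w where w: "L-lipschitz_on (closure E) w" "\<forall>x\<in>E. w x = u x"
    by (elim exE conjE) (rule that)
  have ae: "AE x\<in>\<Omega> in lborel. x \<in> E" using \<rho>(4) by eventually_elim (simp add: E_def f_def)
  have "\<Omega> \<subseteq> closure E"
  proof
    fix x assume "x \<in> \<Omega>"
    have "AE x\<in>\<Omega> in lebesgue. x \<in> closure E"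
      by (rule AE_completion) (use ae in eventually_elim, use closure_subset in blast)
    then show "x \<in> closure E" by (rule mem_closed_if_AE_lebesgue_open[OF \<Omega>(1) closed_closure _ \<open>x \<in> \<Omega>\<close>])
  qed
  with w(1) have "L-lipschitz_on \<Omega> w" by (rule lipschitz_on_subset)
  moreover have "AE x\<in>\<Omega> in lborel. u x = w x" using ae by eventually_elim (use w(2) in auto)
  ultimately show ?thesis by blast
qed

lemma (in scalar_min) boundary_lipschitz_imp_lipschitz:
  assumes BE: "\<And>x0. x0 \<in> frontier \<Omega> \<Longrightarrow> \<exists>b. AE x\<in>\<Omega> in lborel. \<bar>u x - b\<bar> \<le> L0 * norm (x - x0)"
    and L0: "0 \<le> L0"
  shows "\<exists>L w. L-lipschitz_on \<Omega> w \<and> (AE x\<in>\<Omega> in lborel. u x = w x)"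
proof -
  obtain \<Lambda> where \<Lambda>: "\<Lambda> > 0" "\<forall>t\<ge>\<Lambda>. 2 * lam < G t" using G_unbounded[of "2 * lam"] by (elim exE conjE) (rule that)
  define L where "L = max \<Lambda> (9 * L0)"
  have L: "0 < L" "2 * lam < G L" "9 * L0 \<le> L" using \<Lambda> by (auto simp: L_def)
  have room: "AE x\<in>\<Omega> in lborel. x + \<sigma> \<in> \<Omega> \<longrightarrow> L * norm \<sigma> < u (x + \<sigma>) - u x \<longrightarrow> 4 * norm \<sigma> \<le> infdist x (- \<Omega>)" for \<sigma>
    by (rule translation_room[OF BE L0 L(3)])
  have "AE x\<in>\<Omega> in lborel. x + \<sigma> \<in> \<Omega> \<longrightarrow> u (x + \<sigma>) - u x \<le> L * norm \<sigma>" for \<sigma>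
    using translation_le[OF room L(1,2), of "(1 / norm \<sigma>) *R \<sigma>" "norm \<sigma>"] by (cases "\<sigma> = 0") auto
  from lipschitz_of_translation[OF open_\<Omega> bounded_\<Omega> wgradD(1)[OF u(1)] less_imp_le[OF L(1)] this]
  show ?thesis by (rule exI[of _ L])
qed

section \<open>Barriers near a boundary point\<close>

lemma GDERIV_scaleR_field:
  assumes "GDERIV f x :> df" "(V has_derivative H) (at x)"
  shows "((\<lambda>x. f x *R V x) has_derivative (\<lambda>h. f x *R H h + (h \<bullet> df) *R V x)) (at x)"
  using has_derivative_scaleR[OF assms(1)[unfolded gderiv_def] assms(2)] .

lemma GDERIV_component:
  fixes V :: "real ^ 'n \<Rightarrow> real ^ 'm"
  assumes V: "(V has_derivative H) (at x)"
  shows "GDERIV (\<lambda>x. V x $ i) x :> (\<chi> j. H (axis j 1) $ i)"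
proof -
  have e: "H h $ i = h \<bullet> (\<chi> j. H (axis j 1) $ i)" for h
    using linear_axis_expansion[OF has_derivative_linear[OF V], of h] by (simp add: inner_vec_def)
  have "((\<lambda>x. V x $ i) has_derivative (\<lambda>h. H h $ i)) (at x)"
    by (rule bounded_linear.has_derivative[OF bounded_linear_vec_nth V])
  then show ?thesis unfolding gderiv_def by (rule has_derivative_eq_rhs) (rule ext, rule e)
qed

lemma GDERIV_inner_powr:
  assumes "x \<noteq> x0"
  shows "GDERIV (\<lambda>x. ((x - x0) \<bullet> (x - x0)) powr c) x :> (2 * c * ((x - x0) \<bullet> (x - x0)) powr (c - 1)) *R (x - x0)"
proof -
  have "GDERIV (\<lambda>x. (x - x0) \<bullet> (x - x0)) x :> 2 *R (x - x0)"
    unfolding gderiv_def by (auto intro!: derivative_eq_intros simp: inner_commute)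
  moreover have "((\<lambda>z. z powr c) has_real_derivative c * ((x - x0) \<bullet> (x - x0)) powr (c - 1)) (at ((x - x0) \<bullet> (x - x0)))"
    by (rule has_real_derivative_powr) (use assms in simp)
  ultimately have "GDERIV (\<lambda>x. ((x - x0) \<bullet> (x - x0)) powr c) x :> (c * ((x - x0) \<bullet> (x - x0)) powr (c - 1)) *R (2 *R (x - x0))"
    by (rule GDERIV_DERIV_compose)
  then show ?thesis by (simp add: mult_ac)
qed

text \<open>The trace of the rank-one map sending \<open>h\<close> to
  \<open>(h \<bullet> a) *R b\<close>.\<close>

lemma trace_outer:
  fixes a b :: "real ^ 'n"
  shows "(\<Sum>i\<in>UNIV. (axis i 1 \<bullet> a) * b $ i) = a \<bullet> b"
proof -
  have "axis i 1 \<bullet> a = a $ i" for i by (simp add: inner_axis')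
  then show ?thesis by (simp only: inner_vec_def[of a b] inner_real_def)
qed

text \<open>With \<open>x0\<close> a boundary point, \<open>\<nu>\<close> the inner normal and \<open>C1\<close> large, \<open>barrier_dist\<close> is comparable
  from below with the distance to a paraboloid-like hypersurface touching the domain from outside at \<open>x0\<close>.
  The power \<open>1 + \<alpha>\<close> in \<open>barrier\<close> makes its second derivative dominate that of \<open>barrier_dist\<close>.\<close>

definition barrier_dist :: "real \<Rightarrow> real \<Rightarrow> 'a::euclidean_space \<Rightarrow> 'a \<Rightarrow> 'a \<Rightarrow> real" where
  "barrier_dist \<alpha> C1 x0 \<nu> x = (x - x0) \<bullet> \<nu> + C1 * ((x - x0) \<bullet> (x - x0)) powr ((1 + \<alpha>) / 2)"

text \<open>The gradient of \<open>barrier_dist\<close>, of length near 1 close to \<open>x0\<close>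
  but not normalized.\<close>

definition barrier_normal :: "real \<Rightarrow> real \<Rightarrow> 'a::euclidean_space \<Rightarrow> 'a \<Rightarrow> 'a \<Rightarrow> 'a" where
  "barrier_normal \<alpha> C1 x0 \<nu> x = \<nu> + (2 * ((1 + \<alpha>) / 2) * C1 * ((x - x0) \<bullet> (x - x0)) powr ((1 + \<alpha>) / 2 - 1)) *R (x - x0)"

text \<open>The derivative of the profile z - \<kappa> z^(1 + \<alpha>) at the value of
  \<open>barrier_dist\<close>; its decrease provides the concavity.\<close>

definition barrier_slope :: "real \<Rightarrow> real \<Rightarrow> real \<Rightarrow> 'a::euclidean_space \<Rightarrow> 'a \<Rightarrow> 'a \<Rightarrow> real" where
  "barrier_slope \<alpha> \<kappa> C1 x0 \<nu> x = 1 - \<kappa> * (1 + \<alpha>) * barrier_dist \<alpha> C1 x0 \<nu> x powr \<alpha>"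

definition barrier :: "real \<Rightarrow> real \<Rightarrow> real \<Rightarrow> 'a::euclidean_space \<Rightarrow> 'a \<Rightarrow> real \<Rightarrow> 'a \<Rightarrow> real \<Rightarrow> 'a \<Rightarrow> real" where
  "barrier \<alpha> \<kappa> C1 x0 \<nu> b q s x = b + q \<bullet> (x - x0) +
     s * (barrier_dist \<alpha> C1 x0 \<nu> x - \<kappa> * barrier_dist \<alpha> C1 x0 \<nu> x powr (1 + \<alpha>))"

definition barrier_gradient :: "real \<Rightarrow> real \<Rightarrow> real \<Rightarrow> 'a::euclidean_space \<Rightarrow> 'a \<Rightarrow> 'a \<Rightarrow> real \<Rightarrow> 'a \<Rightarrow> 'a" where
  "barrier_gradient \<alpha> \<kappa> C1 x0 \<nu> q s x = q + (s * barrier_slope \<alpha> \<kappa> C1 x0 \<nu> x) *R barrier_normal \<alpha> C1 x0 \<nu> x"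

context nfun
begin

text \<open>The Jacobian of \<open>A\<close>: it multiplies directions orthogonal to
  \<open>p\<close> by \<open>g (norm p) / norm p\<close> and \<open>p\<close> itself by
  \<open>deriv g (norm p)\<close>.\<close>

definition dA :: "'a::real_inner \<Rightarrow> 'a \<Rightarrow> 'a" where
  "dA p h = (g (norm p) / norm p) *R h +
     ((deriv g (norm p) * norm p - g (norm p)) / norm p ^ 3 * (p \<bullet> h)) *R p"

lemma A_has_derivative:
  fixes p :: "'a::euclidean_space"
  assumes "p \<noteq> 0"
  shows "(A has_derivative dA p) (at p)"
proof -
  have n: "norm p > 0" using assms by simp
  have "DERIV (\<lambda>t. g t / t) (norm p) :> (deriv g (norm p) * norm p - g (norm p)) / (norm p * norm p)"
    using DERIV_divide[OF DERIV_g[OF n] DERIV_ident] n by simp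
  from GDERIV_scaleR_field[OF GDERIV_DERIV_compose[OF GDERIV_norm[OF assms] this] has_derivative_ident]
  have "((\<lambda>x. (g (norm x) / norm x) *R x) has_derivative dA p) (at p)"
    by (rule has_derivative_eq_rhs) (auto simp: dA_def fun_eq_iff sgn_div_norm inner_commute power3_eq_cube field_simps)
  then show ?thesis unfolding A_def[abs_def] .
qed

lemma GDERIV_A_component:
  fixes V :: "real ^ 'n \<Rightarrow> real ^ 'n"
  assumes "(V has_derivative H) (at x)" "V x \<noteq> 0"
  shows "GDERIV (\<lambda>x. A (V x) $ i) x :> (\<chi> j. dA (V x) (H (axis j 1)) $ i)"
  by (rule GDERIV_component[OF has_derivative_compose[OF assms(1) A_has_derivative[OF assms(2)]]])

lemma dA_trace:
  fixes p :: "real ^ 'n"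
  assumes H: "linear H"
  shows "(\<Sum>i\<in>UNIV. dA p (H (axis i 1)) $ i) = g (norm p) / norm p * (\<Sum>i\<in>UNIV. H (axis i 1) $ i) +
    (deriv g (norm p) * norm p - g (norm p)) / norm p ^ 3 * (p \<bullet> H p)"
proof -
  have "p \<bullet> H p = (\<Sum>j\<in>UNIV. p $ j * (p \<bullet> H (axis j 1)))"
    unfolding linear_axis_expansion[OF H, of p] by (simp add: inner_sum_right)
  then show ?thesis
    by (simp add: dA_def sum.distrib sum_distrib_left sum_divide_distrib mult_ac)
qed

lemma dA_continuous_on:
  fixes p :: "real ^ 'n \<Rightarrow> real ^ 'n"
  assumes p: "continuous_on S p" "\<And>x. x \<in> S \<Longrightarrow> p x \<noteq> 0" and h: "continuous_on S h"
  shows "continuous_on S (\<lambda>x. dA (p x) (h x))"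
proof -
  have "continuous_on S (\<lambda>x. g (norm (p x)))"
    by (rule continuous_on_compose2[OF cont_g]) (auto intro!: continuous_intros p)
  moreover have "continuous_on S (\<lambda>x. deriv g (norm (p x)))"
    by (rule continuous_on_compose2[OF cont_dg]) (auto intro!: continuous_intros p)
  ultimately show ?thesis unfolding dA_def by (intro continuous_intros p h) (use p(2) in auto)
qed

text \<open>The Hessian of \<open>w\<close> is \<open>s\<close> times a concave rank-one part
  \<open>F'' v v^T\<close> plus \<open>F'\<close> times the Hessian of \<open>barrier_dist\<close>.
  In the nondivergence form \<mu> tr H + \<gamma> (p \<bullet> H p) the bad part enters with weight
  at most \<open>CARD('n)\<close> in the trace and \<open>g\<^sub>0\<close> in the direction
  \<open>p\<close>, which explains the last hypothesis. The final product carries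
  \<open>s * s\<close>, so upper and lower barriers are treated together.\<close>

lemma barrier_calculus:
  fixes x0 \<nu> q :: "real ^ 'n" and \<alpha> \<kappa> C1 b s :: real and S :: "(real ^ 'n) set"
  defines "c \<equiv> (1 + \<alpha>) / 2"
  defines "Y \<equiv> \<lambda>x. (x - x0) \<bullet> (x - x0)"
  defines "\<rho> \<equiv> barrier_dist \<alpha> C1 x0 \<nu>"
  defines "v \<equiv> barrier_normal \<alpha> C1 x0 \<nu>"
  defines "F' \<equiv> barrier_slope \<alpha> \<kappa> C1 x0 \<nu>"
  defines "w \<equiv> barrier \<alpha> \<kappa> C1 x0 \<nu> b q s"
  defines "w' \<equiv> barrier_gradient \<alpha> \<kappa> C1 x0 \<nu> q s"
  assumes \<alpha>: "0 < \<alpha>" "\<alpha> \<le> 1" and C1: "0 \<le> C1" and \<kappa>: "0 \<le> \<kappa>"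
    and S: "\<And>x. x \<in> S \<Longrightarrow> x \<noteq> x0" "\<And>x. x \<in> S \<Longrightarrow> 0 < \<rho> x" "\<And>x. x \<in> S \<Longrightarrow> w' x \<noteq> 0"
      "\<And>x. x \<in> S \<Longrightarrow> 0 \<le> F' x" "\<And>x. x \<in> S \<Longrightarrow> F' x \<le> 1"
      "\<And>x. x \<in> S \<Longrightarrow> 2 * C1 * (CARD('n) + g\<^sub>0) * Y x powr (c - 1) \<le> \<kappa> * (1 + \<alpha>) * \<alpha> * \<rho> x powr (\<alpha> - 1) * (norm (v x))\<^sup>2"
  shows "\<exists>V'. (\<forall>x\<in>S. GDERIV w x :> w' x) \<and> continuous_on S w' \<and>
    (\<forall>x\<in>S. \<forall>i. GDERIV (\<lambda>x. A (w' x) $ i) x :> V' i x) \<and> (\<forall>i. continuous_on S (V' i)) \<and>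
    (\<forall>x\<in>S. s * (\<Sum>i\<in>UNIV. V' i x $ i) \<le> 0)"
proof -
  have \<rho>_def: "\<rho> = (\<lambda>x. (x - x0) \<bullet> \<nu> + C1 * Y x powr c)"
    by (simp add: \<rho>_def barrier_dist_def Y_def c_def fun_eq_iff)
  have v_def: "v = (\<lambda>x. \<nu> + (2 * c * C1 * Y x powr (c - 1)) *R (x - x0))"
    by (simp add: v_def barrier_normal_def Y_def c_def fun_eq_iff)
  have F'_def: "F' = (\<lambda>x. 1 - \<kappa> * (1 + \<alpha>) * \<rho> x powr \<alpha>)"
    by (simp add: F'_def barrier_slope_def assms(3) fun_eq_iff)
  have w_def: "w = (\<lambda>x. b + q \<bullet> (x - x0) + s * (\<rho> x - \<kappa> * \<rho> x powr (1 + \<alpha>)))"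
    by (simp add: w_def barrier_def assms(3) fun_eq_iff)
  have w'_def: "w' = (\<lambda>x. q + (s * F' x) *R v x)"
    by (simp add: w'_def barrier_gradient_def assms(4,5) fun_eq_iff)
  have c: "0 < c" "c \<le> 1" "2 * c = 1 + \<alpha>" using \<alpha> by (auto simp: c_def)
  define F'' where "F'' x = - (\<kappa> * (1 + \<alpha>) * \<alpha> * \<rho> x powr (\<alpha> - 1))" for x
  \<comment> \<open>The Hessian of \<open>barrier_dist\<close>. Its second term is nonpositive as a
    quadratic form, because \<open>c \<le> 1\<close>, and is dropped in the upper bounds.\<close>
  define B where "B x h = (2 * c * C1) *R (Y x powr (c - 1) *R h + (2 * (c - 1) * Y x powr (c - 2) * (h \<bullet> (x - x0))) *R (x - x0))" for x h
  define H0 where "H0 x h = (F'' x * (h \<bullet> v x)) *R v x + F' x *R B x h" for x h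
  define H where "H x h = s *R H0 x h" for x h
  define V' where "V' i x = (\<chi> j. dA (w' x) (H x (axis j 1)) $ i)" for i x
  have Yp: "Y x > 0" if "x \<in> S" for x using S(1)[OF that] by (simp add: Y_def)
  have d\<rho>: "GDERIV \<rho> x :> v x" if "x \<in> S" for x
  proof -
    have 1: "GDERIV (\<lambda>x. (x - x0) \<bullet> \<nu>) x :> \<nu>"
      unfolding gderiv_def by (auto intro!: derivative_eq_intros)
    have 2: "GDERIV (\<lambda>x. C1 * Y x powr c) x :> C1 *R ((2 * c * Y x powr (c - 1)) *R (x - x0)) + (Y x powr c) *R 0"
      unfolding Y_def by (rule GDERIV_mult[OF GDERIV_const GDERIV_inner_powr[OF S(1)[OF that]]])
    show ?thesis using GDERIV_add[OF 1 2] unfolding \<rho>_def v_def by (simp add: mult_ac)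
  qed
  have dw: "GDERIV w x :> w' x" if x: "x \<in> S" for x
  proof -
    have 1: "GDERIV (\<lambda>x. b + q \<bullet> (x - x0)) x :> q"
      unfolding gderiv_def by (auto intro!: derivative_eq_intros simp: inner_commute)
    have "((\<lambda>z. z - \<kappa> * z powr (1 + \<alpha>)) has_real_derivative F' x) (at (\<rho> x))"
      using has_real_derivative_powr[OF S(2)[OF x], of "1 + \<alpha>"] S(2)[OF x] unfolding F'_def
      by (auto intro!: derivative_eq_intros)
    then have "GDERIV (\<lambda>x. \<rho> x - \<kappa> * \<rho> x powr (1 + \<alpha>)) x :> F' x *R v x"
      by (rule GDERIV_DERIV_compose[OF d\<rho>[OF x]])
    from GDERIV_add[OF 1 GDERIV_mult[OF GDERIV_const[of s] this]]
    show ?thesis unfolding w_def w'_def by simp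
  qed
  have dF': "GDERIV F' x :> F'' x *R v x" if x: "x \<in> S" for x
  proof -
    have "((\<lambda>z. 1 - \<kappa> * (1 + \<alpha>) * z powr \<alpha>) has_real_derivative F'' x) (at (\<rho> x))"
      using has_real_derivative_powr[OF S(2)[OF x], of \<alpha>] S(2)[OF x] unfolding F''_def
      by (auto intro!: derivative_eq_intros)
    then show ?thesis unfolding F'_def by (rule GDERIV_DERIV_compose[OF d\<rho>[OF x]])
  qed
  have dv: "(v has_derivative B x) (at x)" if x: "x \<in> S" for x
  proof -
    have "((\<lambda>x. Y x powr (c - 1) *R (x - x0)) has_derivative (\<lambda>h. Y x powr (c - 1) *R h + (h \<bullet> ((2 * (c - 1) * Y x powr (c - 1 - 1)) *R (x - x0))) *R (x - x0))) (at x)"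
      unfolding Y_def by (rule GDERIV_scaleR_field[OF GDERIV_inner_powr[OF S(1)[OF x]]]) (auto intro!: derivative_eq_intros)
    from has_derivative_add[OF has_derivative_const[of \<nu>] has_derivative_scaleR_right[OF this, of "2 * c * C1"]]
    have "((\<lambda>x. \<nu> + (2 * c * C1) *R (Y x powr (c - 1) *R (x - x0))) has_derivative B x) (at x)"
      by (rule has_derivative_eq_rhs) (simp add: B_def fun_eq_iff)
    then show ?thesis unfolding v_def by simp
  qed
  have dw': "(w' has_derivative H x) (at x)" if x: "x \<in> S" for x
  proof -
    from has_derivative_add[OF has_derivative_const[of q] has_derivative_scaleR_right[OF GDERIV_scaleR_field[OF dF'[OF x] dv[OF x]], of s]]
    have "((\<lambda>x. q + s *R (F' x *R v x)) has_derivative H x) (at x)"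
      by (rule has_derivative_eq_rhs) (simp add: H_def H0_def fun_eq_iff add.commute)
    then show ?thesis unfolding w'_def by simp
  qed
  have cw': "continuous_on S w'" using dw' by (meson continuous_at_imp_continuous_on has_derivative_continuous)
  have cY: "continuous_on S Y" unfolding Y_def by (intro continuous_intros)
  have c\<rho>: "continuous_on S \<rho>" using d\<rho> by (rule GDERIV_continuous_on)
  have cF': "continuous_on S F'" using dF' by (rule GDERIV_continuous_on)
  have cv: "continuous_on S v" using dv by (meson continuous_at_imp_continuous_on has_derivative_continuous)
  have cF'': "continuous_on S F''" unfolding F''_def by (intro continuous_intros c\<rho>) (use S(2) in force)
  have cB: "continuous_on S (\<lambda>x. B x h)" for h unfolding B_def by (intro continuous_intros cY) (use Yp in force)+
  have cH: "continuous_on S (\<lambda>x. H x h)" for h unfolding H_def H0_def by (intro continuous_intros cF' cF'' cv cB)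
  have cV: "continuous_on S (V' i)" for i unfolding V'_def
    by (intro continuous_on_vec_lambda continuous_on_component dA_continuous_on cw' S(3) cH)
  have sgn: "s * (\<Sum>i\<in>UNIV. V' i x $ i) \<le> 0" if x: "x \<in> S" for x
  proof -
    define p where "p = w' x"
    have p: "norm p > 0" using S(3)[OF x] by (simp add: p_def)
    \<comment> \<open>The difference of the two eigenvalues of \<open>dA p\<close> divided by the
      squared norm of \<open>p\<close>: nonnegative since \<delta> exceeds 1, and
      \<open>\<gamma> * (norm p)\<^sup>2\<close> is at most
      \<open>g\<^sub>0 * \<mu>\<close>.\<close>
    define \<gamma> where "\<gamma> = (deriv g (norm p) * norm p - g (norm p)) / norm p ^ 3"
    define \<mu> where "\<mu> = g (norm p) / norm p"
    have \<mu>: "0 < \<mu>" using g_pos[OF p] p by (simp add: \<mu>_def)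
    have gp: "0 < g (norm p)" by (rule g_pos[OF p])
    have "g (norm p) \<le> \<delta> * g (norm p)" using \<delta> gp by simp
    then have \<gamma>0: "0 \<le> \<gamma>" using dg_pos(2)[OF p] p by (simp add: \<gamma>_def)
    have \<gamma>1: "\<gamma> * (norm p)\<^sup>2 \<le> g\<^sub>0 * \<mu>"
    proof -
      have "\<gamma> * (norm p)\<^sup>2 = (deriv g (norm p) * norm p - g (norm p)) / norm p"
        using p by (simp add: \<gamma>_def power3_eq_cube power2_eq_square)
      also have "\<dots> \<le> (g\<^sub>0 * g (norm p)) / norm p" using dg_pos(3)[OF p] gp p by (intro divide_right_mono) auto
      finally show ?thesis by (simp add: \<mu>_def)
    qed
    have lH: "linear (H x)" using dw'[OF x] by (rule has_derivative_linear)
    have t1: "(\<Sum>i\<in>UNIV. V' i x $ i) = \<mu> * (\<Sum>i\<in>UNIV. H x (axis i 1) $ i) + \<gamma> * (p \<bullet> H x p)"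
      using dA_trace[OF lH, of p] by (simp add: V'_def p_def \<mu>_def \<gamma>_def)
    define yy where "yy = Y x powr (c - 1)"
    have yy: "0 < yy" using Yp[OF x] by (simp add: yy_def)
    have trB: "(\<Sum>i\<in>UNIV. B x (axis i 1) $ i) \<le> 2 * C1 * CARD('n) * yy"
    proof -
      have e: "(\<Sum>i\<in>UNIV. B x (axis i 1) $ i) = 2 * c * C1 * (yy * CARD('n) + 2 * (c - 1) * Y x powr (c - 2) * ((x - x0) \<bullet> (x - x0)))"
      proof -
        have "B x (axis i 1) $ i = 2 * c * C1 * (yy * 1 + 2 * (c - 1) * Y x powr (c - 2) * ((axis i 1 \<bullet> (x - x0)) * (x - x0) $ i))" for i
          by (simp add: B_def yy_def)
        then show ?thesis
          by (simp only: sum.distrib sum_distrib_left[symmetric] trace_outer) simp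
      qed
      have "2 * (c - 1) * Y x powr (c - 2) * ((x - x0) \<bullet> (x - x0)) \<le> 0"
        by (rule mult_nonpos_nonneg[OF mult_nonpos_nonneg]) (use c in auto)
      then have "(\<Sum>i\<in>UNIV. B x (axis i 1) $ i) \<le> 2 * c * C1 * (yy * CARD('n))"
        unfolding e using c C1 by (intro mult_left_mono) auto
      also have "\<dots> = c * (2 * C1 * (yy * CARD('n)))" by simp
      also have "\<dots> \<le> 1 * (2 * C1 * (yy * CARD('n)))" using c C1 yy by (intro mult_right_mono) auto
      finally show ?thesis by (simp add: mult_ac)
    qed
    have pBp: "p \<bullet> B x p \<le> 2 * C1 * yy * (norm p)\<^sup>2"
    proof -
      have e: "p \<bullet> B x p = 2 * c * C1 * (yy * (norm p)\<^sup>2 + 2 * (c - 1) * Y x powr (c - 2) * (p \<bullet> (x - x0))\<^sup>2)"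
        by (simp add: B_def yy_def inner_add_right dot_square_norm power2_eq_square)
      have "2 * (c - 1) * Y x powr (c - 2) * (p \<bullet> (x - x0))\<^sup>2 \<le> 0"
        by (rule mult_nonpos_nonneg[OF mult_nonpos_nonneg]) (use c in auto)
      then have "p \<bullet> B x p \<le> 2 * c * C1 * (yy * (norm p)\<^sup>2)"
        unfolding e using c C1 by (intro mult_left_mono) auto
      also have "\<dots> = c * (2 * C1 * (yy * (norm p)\<^sup>2))" by simp
      also have "\<dots> \<le> 1 * (2 * C1 * (yy * (norm p)\<^sup>2))" using c C1 yy by (intro mult_right_mono) auto
      finally show ?thesis by (simp add: mult_ac)
    qed
    \<comment> \<open>The concavity gained from the profile. It must outweigh the second derivatives
      of \<open>barrier_dist\<close>, which grow like the distance to the power \<alpha> -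
      1.\<close>
    define Q where "Q = \<kappa> * (1 + \<alpha>) * \<alpha> * \<rho> x powr (\<alpha> - 1) * (norm (v x))\<^sup>2"
    have Q: "2 * C1 * (CARD('n) + g\<^sub>0) * yy \<le> Q" using S(6)[OF x] by (simp add: Q_def yy_def)
    have trH: "(\<Sum>i\<in>UNIV. H0 x (axis i 1) $ i) \<le> - Q + 2 * C1 * CARD('n) * yy"
    proof -
      have "(\<Sum>i\<in>UNIV. H0 x (axis i 1) $ i) = - Q + F' x * (\<Sum>i\<in>UNIV. B x (axis i 1) $ i)"
      proof -
        have "H0 x (axis i 1) $ i = F'' x * ((axis i 1 \<bullet> v x) * v x $ i) + F' x * B x (axis i 1) $ i" for i
          by (simp add: H0_def)
        then have "(\<Sum>i\<in>UNIV. H0 x (axis i 1) $ i) = F'' x * (v x \<bullet> v x) + F' x * (\<Sum>i\<in>UNIV. B x (axis i 1) $ i)"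
          by (simp only: sum.distrib sum_distrib_left[symmetric] trace_outer)
        then show ?thesis by (simp add: Q_def F''_def power2_norm_eq_inner)
      qed
      also have "\<dots> \<le> - Q + F' x * (2 * C1 * CARD('n) * yy)" using trB S(4)[OF x] by (intro add_left_mono mult_left_mono) auto
      also have "\<dots> \<le> - Q + 1 * (2 * C1 * CARD('n) * yy)" using S(5)[OF x] C1 yy by (intro add_left_mono mult_right_mono) auto
      finally show ?thesis by simp
    qed
    have pHp: "p \<bullet> H0 x p \<le> 2 * C1 * yy * (norm p)\<^sup>2"
    proof -
      have F2: "F'' x \<le> 0" using \<kappa> \<alpha> by (simp add: F''_def)
      have "p \<bullet> H0 x p = F'' x * (p \<bullet> v x)\<^sup>2 + F' x * (p \<bullet> B x p)"
        by (simp add: H0_def inner_add_right power2_eq_square)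
      also have "\<dots> \<le> 0 + F' x * (2 * C1 * yy * (norm p)\<^sup>2)"
        using pBp S(4)[OF x] F2 by (intro add_mono mult_left_mono) (auto simp: mult_nonpos_nonneg)
      also have "\<dots> \<le> 0 + 1 * (2 * C1 * yy * (norm p)\<^sup>2)" using S(5)[OF x] C1 yy by (intro add_left_mono mult_right_mono) auto
      finally show ?thesis by simp
    qed
    have "\<mu> * (\<Sum>i\<in>UNIV. H0 x (axis i 1) $ i) + \<gamma> * (p \<bullet> H0 x p) \<le> \<mu> * (- Q + 2 * C1 * CARD('n) * yy) + \<gamma> * (2 * C1 * yy * (norm p)\<^sup>2)"
      using trH pHp \<mu> \<gamma>0 by (intro add_mono mult_left_mono) auto
    also have "\<dots> = \<mu> * (- Q + 2 * C1 * CARD('n) * yy) + (\<gamma> * (norm p)\<^sup>2) * (2 * C1 * yy)" by simp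
    also have "\<dots> \<le> \<mu> * (- Q + 2 * C1 * CARD('n) * yy) + (g\<^sub>0 * \<mu>) * (2 * C1 * yy)"
      using \<gamma>1 C1 yy by (intro add_left_mono mult_right_mono) auto
    also have "\<dots> = \<mu> * (2 * C1 * (CARD('n) + g\<^sub>0) * yy - Q)" by (simp add: algebra_simps)
    also have "\<dots> \<le> 0" using Q \<mu> by (intro mult_nonneg_nonpos) auto
    finally have fin: "\<mu> * (\<Sum>i\<in>UNIV. H0 x (axis i 1) $ i) + \<gamma> * (p \<bullet> H0 x p) \<le> 0" .
    have "(\<Sum>i\<in>UNIV. V' i x $ i) = s * (\<mu> * (\<Sum>i\<in>UNIV. H0 x (axis i 1) $ i) + \<gamma> * (p \<bullet> H0 x p))"
      unfolding t1 by (simp add: H_def sum_distrib_left[symmetric] algebra_simps)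
    then have "s * (\<Sum>i\<in>UNIV. V' i x $ i) = (s * s) * (\<mu> * (\<Sum>i\<in>UNIV. H0 x (axis i 1) $ i) + \<gamma> * (p \<bullet> H0 x p))"
      by (simp add: mult.assoc)
    also have "\<dots> \<le> 0" using fin by (intro mult_nonneg_nonpos) auto
    finally show ?thesis .
  qed
  have dV: "GDERIV (\<lambda>x. A (w' x) $ i) x :> V' i x" if "x \<in> S" for x i
    unfolding V'_def by (rule GDERIV_A_component[OF dw'[OF that] S(3)[OF that]])
  show ?thesis
    by (intro exI[of _ V'] conjI ballI allI cw' cV; (rule dw dV sgn, assumption)?)
qed

end

text \<open>For small \<open>d powr \<alpha>\<close> the picture is close to a half-space:
  \<open>\<rho>\<close> is at most \<open>2 * d\<close>, and \<open>v\<close> is within 1/2 of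
  \<nu>. The coefficient \<open>C + 1\<close> exceeds the geometric constant \<open>C\<close> by
  one, which keeps \<open>\<rho>\<close> above \<open>d powr (1 + \<alpha>)\<close> inside the
  domain.\<close>

lemma barrier_bounds:
  fixes x x0 \<nu> :: "'a::euclidean_space" and \<alpha> \<kappa> C :: real
  defines "d \<equiv> norm (x - x0)"
  defines "\<rho> \<equiv> barrier_dist \<alpha> (C + 1) x0 \<nu> x"
  defines "v \<equiv> barrier_normal \<alpha> (C + 1) x0 \<nu> x"
  assumes \<alpha>: "0 < \<alpha>" "\<alpha> \<le> 1" and C: "0 \<le> C" and \<kappa>: "0 \<le> \<kappa>" and \<nu>: "norm \<nu> = 1"
    and d: "0 < d" "(C + 1) * d powr \<alpha> \<le> 1 / 4" "\<kappa> * d powr \<alpha> \<le> 1 / 8"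
    and side: "- C * d powr (1 + \<alpha>) \<le> (x - x0) \<bullet> \<nu>"
  shows "0 < \<rho>" "1 / 2 \<le> barrier_slope \<alpha> \<kappa> (C + 1) x0 \<nu> x" "barrier_slope \<alpha> \<kappa> (C + 1) x0 \<nu> x \<le> 1"
    "1 / 2 \<le> norm v" "norm v \<le> 3 / 2"
    "d powr (1 + \<alpha>) / 2 \<le> \<rho> - \<kappa> * \<rho> powr (1 + \<alpha>)" "\<rho> - \<kappa> * \<rho> powr (1 + \<alpha>) \<le> 2 * d"
    "\<kappa> * \<alpha> = 16 * (C + 1) * k \<Longrightarrow> 0 \<le> k \<Longrightarrow> 2 * (C + 1) * k * ((x - x0) \<bullet> (x - x0)) powr ((1 + \<alpha>) / 2 - 1)
      \<le> \<kappa> * (1 + \<alpha>) * \<alpha> * \<rho> powr (\<alpha> - 1) * (norm v)\<^sup>2"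
proof -
  have Y: "((x - x0) \<bullet> (x - x0)) powr a = d powr (2 * a)" for a
  proof -
    have "(x - x0) \<bullet> (x - x0) = d powr 2" using d(1) by (simp add: d_def dot_square_norm)
    then show ?thesis by (simp add: powr_powr)
  qed
  have d1: "d powr (1 + \<alpha>) = d * d powr \<alpha>" using d(1) by (simp add: powr_add)
  have Y1: "((x - x0) \<bullet> (x - x0)) powr ((1 + \<alpha>) / 2) = d powr (1 + \<alpha>)" unfolding Y by (rule arg_cong[where f="(powr) d"]) simp
  have Y2: "((x - x0) \<bullet> (x - x0)) powr ((1 + \<alpha>) / 2 - 1) = d powr (\<alpha> - 1)" unfolding Y by (rule arg_cong[where f="(powr) d"]) (simp add: field_simps)
  have \<rho>: "\<rho> = (x - x0) \<bullet> \<nu> + (C + 1) * d powr (1 + \<alpha>)" unfolding \<rho>_def barrier_dist_def Y1 ..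
  have \<rho>1: "d powr (1 + \<alpha>) \<le> \<rho>" using side unfolding \<rho> by (simp add: algebra_simps)
  have dp: "0 < d powr (1 + \<alpha>)" using d(1) by simp
  show \<rho>0: "0 < \<rho>" using \<rho>1 dp by linarith
  have "(x - x0) \<bullet> \<nu> \<le> d" using norm_cauchy_schwarz[of "x - x0" \<nu>] \<nu> by (simp add: d_def)
  moreover have "(C + 1) * d powr (1 + \<alpha>) \<le> d"
    using mult_left_mono[OF d(2), of d] d(1) by (simp add: d1 mult_ac)
  ultimately have \<rho>2: "\<rho> \<le> 2 * d" unfolding \<rho> by linarith
  have two: "2 powr \<alpha> \<le> (2 :: real)" using powr_mono[of \<alpha> 1 2] \<alpha> by simp
  have "\<rho> powr \<alpha> \<le> (2 * d) powr \<alpha>" using \<rho>2 \<rho>0 \<alpha> by (intro powr_mono2) auto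
  also have "\<dots> = 2 powr \<alpha> * d powr \<alpha>" using d(1) by (simp add: powr_mult)
  also have "\<dots> \<le> 2 * d powr \<alpha>" using two by (intro mult_right_mono) auto
  finally have \<kappa>\<rho>: "\<kappa> * \<rho> powr \<alpha> \<le> 1 / 4" using mult_left_mono[of "\<rho> powr \<alpha>" "2 * d powr \<alpha>" \<kappa>] \<kappa> d(3) by linarith
  have "(1 + \<alpha>) * (\<kappa> * \<rho> powr \<alpha>) \<le> 2 * (1 / 4)" using \<kappa>\<rho> \<alpha> \<kappa> by (intro mult_mono) auto
  then show "1 / 2 \<le> barrier_slope \<alpha> \<kappa> (C + 1) x0 \<nu> x"
    unfolding barrier_slope_def \<rho>_def[symmetric] by (simp add: mult_ac)
  show "barrier_slope \<alpha> \<kappa> (C + 1) x0 \<nu> x \<le> 1" unfolding barrier_slope_def using \<kappa> \<alpha> by simp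
  have v: "v = \<nu> + ((1 + \<alpha>) * (C + 1) * d powr (\<alpha> - 1)) *R (x - x0)" unfolding v_def barrier_normal_def Y2 by simp
  have "norm (((1 + \<alpha>) * (C + 1) * d powr (\<alpha> - 1)) *R (x - x0)) = (1 + \<alpha>) * ((C + 1) * (d powr (\<alpha> - 1) * d))"
    using \<alpha> C by (simp add: d_def[symmetric] abs_mult)
  also have "d powr (\<alpha> - 1) * d = d powr \<alpha>" using d(1) powr_add[of d "\<alpha> - 1" 1] by simp
  also have "(1 + \<alpha>) * ((C + 1) * d powr \<alpha>) \<le> 2 * (1 / 4)" using d(2) \<alpha> C by (intro mult_mono) auto
  finally have e: "norm (((1 + \<alpha>) * (C + 1) * d powr (\<alpha> - 1)) *R (x - x0)) \<le> 1 / 2" by simp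
  show v1: "1 / 2 \<le> norm v" using norm_diff_ineq[of \<nu> "((1 + \<alpha>) * (C + 1) * d powr (\<alpha> - 1)) *R (x - x0)"] e \<nu> unfolding v by linarith
  show "norm v \<le> 3 / 2" using norm_triangle_ineq[of \<nu> "((1 + \<alpha>) * (C + 1) * d powr (\<alpha> - 1)) *R (x - x0)"] e \<nu> unfolding v by linarith
  have P: "\<rho> - \<kappa> * \<rho> powr (1 + \<alpha>) = \<rho> * (1 - \<kappa> * \<rho> powr \<alpha>)" using \<rho>0 by (simp add: powr_add algebra_simps)
  have "\<rho> * (1 / 2) \<le> \<rho> * (1 - \<kappa> * \<rho> powr \<alpha>)" using \<kappa>\<rho> \<rho>0 by (intro mult_left_mono) auto
  then show "d powr (1 + \<alpha>) / 2 \<le> \<rho> - \<kappa> * \<rho> powr (1 + \<alpha>)" unfolding P using \<rho>1 by linarith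
  have "0 \<le> \<kappa> * \<rho> powr (1 + \<alpha>)" using \<kappa> by simp
  then show "\<rho> - \<kappa> * \<rho> powr (1 + \<alpha>) \<le> 2 * d" using \<rho>2 by linarith
  assume k: "\<kappa> * \<alpha> = 16 * (C + 1) * k" "0 \<le> k"
  have "(1 / 2) * d powr (\<alpha> - 1) \<le> 2 powr (\<alpha> - 1) * d powr (\<alpha> - 1)"
    using powr_mono[of "- 1" "\<alpha> - 1" 2] \<alpha> by (intro mult_right_mono) (auto simp: powr_minus)
  also have "\<dots> = (2 * d) powr (\<alpha> - 1)" using d(1) by (simp add: powr_mult)
  also have "\<dots> \<le> \<rho> powr (\<alpha> - 1)" using \<rho>2 \<rho>0 \<alpha> by (intro powr_mono2') auto
  finally have \<rho>3: "(1 / 2) * d powr (\<alpha> - 1) \<le> \<rho> powr (\<alpha> - 1)" .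
  have v2: "1 / 4 \<le> (norm v)\<^sup>2" using power_mono[OF v1, of 2] by (simp add: power2_eq_square)
  \<comment> \<open>The constant 16 is 2 * 2 * 4: a factor 2 is required, and the lower bounds for
    \<open>\<rho> powr (\<alpha> - 1)\<close> and for the squared norm of \<open>v\<close> lose the
    factors 2 and 4.\<close>
  have "2 * (C + 1) * k * d powr (\<alpha> - 1) = (16 * (C + 1) * k) * 1 * ((1 / 2) * d powr (\<alpha> - 1)) * (1 / 4)" by simp
  also have "\<dots> \<le> (16 * (C + 1) * k) * (1 + \<alpha>) * \<rho> powr (\<alpha> - 1) * (norm v)\<^sup>2"
    by (intro mult_mono \<rho>3 v2) (use C k(2) \<alpha> in auto)
  also have "\<dots> = \<kappa> * (1 + \<alpha>) * \<alpha> * \<rho> powr (\<alpha> - 1) * (norm v)\<^sup>2" unfolding k(1)[symmetric] by simp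
  finally show "2 * (C + 1) * k * ((x - x0) \<bullet> (x - x0)) powr ((1 + \<alpha>) / 2 - 1) \<le> \<kappa> * (1 + \<alpha>) * \<alpha> * \<rho> powr (\<alpha> - 1) * (norm v)\<^sup>2"
    unfolding Y2 .
qed

text \<open>Both the domain and the datum are flat up to order 1 + \<alpha> at \<open>x0\<close>.
  The numbers \<open>b\<close> and \<open>q\<close> stand for boundary value and gradient seen from
  inside; only values of \<open>f\<close> in \<Omega> enter.\<close>

definition boundary_expansion :: "real \<Rightarrow> 'a::euclidean_space set \<Rightarrow> ('a \<Rightarrow> real) \<Rightarrow> real \<Rightarrow> real \<Rightarrow> 'a \<Rightarrow> 'a \<Rightarrow> 'a \<Rightarrow> real \<Rightarrow> bool" where
  "boundary_expansion \<alpha> \<Omega> f C r x0 \<nu> q b \<longleftrightarrow> norm \<nu> = 1 \<and> norm q \<le> C \<and> \<bar>b\<bar> \<le> C \<and>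
    (\<forall>x\<in>\<Omega> \<inter> ball x0 r. - C * norm (x - x0) powr (1 + \<alpha>) \<le> (x - x0) \<bullet> \<nu> \<and>
       \<bar>f x - b - q \<bullet> (x - x0)\<bar> \<le> C * norm (x - x0) powr (1 + \<alpha>))"

section \<open>The Lipschitz estimate at the boundary\<close>

context scalar_min
begin

text \<open>The barriers are \<open>b + q \<bullet> (x - x0)\<close> plus and minus
  \<open>N * P x\<close>, where \<open>P\<close> lies between half of d^(1 + \<alpha>) and 2d for
  the distance d to \<open>x0\<close>. The lower bound on \<open>P\<close> absorbs the expansion
  error of the datum, the upper one gives the Lipschitz estimate. All constants are independent of
  \<open>x0\<close>.\<close>

lemma boundary_estimate:
  fixes C r0 \<alpha> :: real
  assumes \<alpha>: "0 < \<alpha>" "\<alpha> \<le> 1" and C: "0 \<le> C" and r0: "0 < r0"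
  shows "\<exists>L0\<ge>0. \<forall>x0 \<nu> q b. x0 \<in> frontier \<Omega> \<and> boundary_expansion \<alpha> \<Omega> \<phi> C r0 x0 \<nu> q b \<longrightarrow> (AE x\<in>\<Omega> in lborel. \<bar>u x - b\<bar> \<le> L0 * norm (x - x0))"
proof -
  obtain \<Lambda> where \<Lambda>: "\<Lambda> > 0" "\<forall>t\<ge>\<Lambda>. 2 * lam < G t" using G_unbounded[of "2 * lam"] by (elim exE conjE) (rule that)
  have g0p: "0 \<le> g\<^sub>0" using ell[of 1] \<delta> by simp
  define k where "k = CARD('n) + g\<^sub>0"
  have k: "0 \<le> k" using g0p by (simp add: k_def)
  define \<kappa> where "\<kappa> = 16 * (C + 1) * k / \<alpha>"
  have \<kappa>: "0 \<le> \<kappa>" "\<kappa> * \<alpha> = 16 * (C + 1) * k" using C k \<alpha> by (auto simp: \<kappa>_def)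
  \<comment> \<open>Chosen so that a distance whose power \<alpha> is at most \<open>1 / T\<close>
    satisfies both smallness conditions of \<open>barrier_bounds\<close>.\<close>
  define T where "T = 4 * (C + 1) + 8 * \<kappa>"
  have T: "T > 0" using C \<kappa> by (simp add: T_def add_pos_nonneg)
  define r where "r = min r0 (min 1 ((1 / T) powr (1 / \<alpha>)))"
  have r: "0 < r" "r \<le> r0" "r \<le> 1" using r0 T by (auto simp: r_def)
  have rT: "r powr \<alpha> \<le> 1 / T"
  proof -
    have "r powr \<alpha> \<le> ((1 / T) powr (1 / \<alpha>)) powr \<alpha>" by (rule powr_mono2) (use r \<alpha> in \<open>auto simp: r_def\<close>)
    also have "\<dots> = 1 / T" using T \<alpha> by (simp add: powr_powr)
    finally show ?thesis .
  qed
  \<comment> \<open>Three demands: \<open>N \<ge> 2 * C\<close> dominates the expansion error;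
    \<open>N / 4 - C \<ge> \<Lambda>\<close> keeps the gradient above the threshold, slope and
    normal each being at least 1/2; the last summand lifts \<open>N * P x\<close> above
    \<open>M + 2 * C\<close> in the outer half of the ball.\<close>
  define N where "N = 4 * C + 4 * \<Lambda> + 2 * (M + 2 * C) / (r / 2) powr (1 + \<alpha>)"
  have rp: "0 < (r / 2) powr (1 + \<alpha>)" using r by simp
  have Nt: "0 \<le> 2 * (M + 2 * C) / (r / 2) powr (1 + \<alpha>)" using M C by simp
  have N: "4 * C + 4 * \<Lambda> \<le> N" using Nt unfolding N_def by linarith
  then have N: "4 * C + 4 * \<Lambda> \<le> N" "0 < N" using \<Lambda>(1) C by linarith+
  have Nr: "M + 2 * C \<le> N * ((r / 2) powr (1 + \<alpha>) / 2)"
  proof -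
    have "M + 2 * C = 2 * (M + 2 * C) / (r / 2) powr (1 + \<alpha>) * ((r / 2) powr (1 + \<alpha>) / 2)" using rp by (simp add: field_simps)
    also have "\<dots> \<le> N * ((r / 2) powr (1 + \<alpha>) / 2)" using \<Lambda> C rp by (intro mult_right_mono) (auto simp: N_def)
    finally show ?thesis .
  qed
  \<comment> \<open>The first two summands come from the barriers within distance \<open>r\<close>;
    the last covers the remaining points, where \<open>\<bar>u x - b\<bar> \<le> M + C\<close> and
    the distance is at least \<open>r\<close>.\<close>
  define L0 where "L0 = C + 2 * N + (M + C) / r"
  have L0: "0 \<le> L0" using C N M r by (simp add: L0_def)
  have main: "AE x\<in>\<Omega> in lborel. \<bar>u x - b\<bar> \<le> L0 * norm (x - x0)"
    if x0: "x0 \<in> frontier \<Omega>" and \<nu>: "norm \<nu> = 1" and q: "norm q \<le> C" and b: "\<bar>b\<bar> \<le> C"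
      and geo: "\<forall>x\<in>\<Omega> \<inter> ball x0 r0. - C * norm (x - x0) powr (1 + \<alpha>) \<le> (x - x0) \<bullet> \<nu> \<and>
       \<bar>\<phi> x - b - q \<bullet> (x - x0)\<bar> \<le> C * norm (x - x0) powr (1 + \<alpha>)" for x0 \<nu> q b
  proof -
    have x0\<Omega>: "x0 \<notin> \<Omega>" using x0 open_\<Omega> by (simp add: frontier_def interior_open)
    define S where "S = \<Omega> \<inter> ball x0 r"
    define P where "P x = barrier_dist \<alpha> (C + 1) x0 \<nu> x - \<kappa> * barrier_dist \<alpha> (C + 1) x0 \<nu> x powr (1 + \<alpha>)" for x
    define w where "w = barrier \<alpha> \<kappa> (C + 1) x0 \<nu> b q"
    define w' where "w' = barrier_gradient \<alpha> \<kappa> (C + 1) x0 \<nu> q"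
    have pre: "0 < norm (x - x0)" "norm (x - x0) < r" "(C + 1) * norm (x - x0) powr \<alpha> \<le> 1 / 4" "\<kappa> * norm (x - x0) powr \<alpha> \<le> 1 / 8"
      "- C * norm (x - x0) powr (1 + \<alpha>) \<le> (x - x0) \<bullet> \<nu>" "\<bar>\<phi> x - b - q \<bullet> (x - x0)\<bar> \<le> C * norm (x - x0) powr (1 + \<alpha>)"
      if x: "x \<in> S" for x
    proof -
      show 0: "0 < norm (x - x0)" using x x0\<Omega> by (auto simp: S_def)
      show 1: "norm (x - x0) < r" using x by (simp add: S_def dist_norm norm_minus_commute)
      have "norm (x - x0) powr \<alpha> \<le> r powr \<alpha>" using 1 \<alpha> by (intro powr_mono2) auto
      then have d: "norm (x - x0) powr \<alpha> \<le> 1 / T" using rT by linarith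
      then have e: "norm (x - x0) powr \<alpha> * T \<le> 1" using T by (simp add: field_simps)
      have p: "0 \<le> (C + 1) * norm (x - x0) powr \<alpha>" "0 \<le> \<kappa> * norm (x - x0) powr \<alpha>" using C \<kappa> by auto
      have "norm (x - x0) powr \<alpha> * T = 4 * ((C + 1) * norm (x - x0) powr \<alpha>) + 8 * (\<kappa> * norm (x - x0) powr \<alpha>)"
        by (simp add: T_def algebra_simps)
      then show "(C + 1) * norm (x - x0) powr \<alpha> \<le> 1 / 4" "\<kappa> * norm (x - x0) powr \<alpha> \<le> 1 / 8" using e p by linarith+
      have "x \<in> \<Omega> \<inter> ball x0 r0" using x r by (auto simp: S_def)
      then show "- C * norm (x - x0) powr (1 + \<alpha>) \<le> (x - x0) \<bullet> \<nu>" "\<bar>\<phi> x - b - q \<bullet> (x - x0)\<bar> \<le> C * norm (x - x0) powr (1 + \<alpha>)"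
        using geo by auto
    qed
    note bb = barrier_bounds[OF \<alpha> C \<kappa>(1) \<nu> pre(1,3,4,5)]
    have wP: "w s x = b + q \<bullet> (x - x0) + s * P x" for s x by (simp add: w_def barrier_def P_def)
    have qx: "\<bar>q \<bullet> (x - x0)\<bar> \<le> C * norm (x - x0)" for x
      using Cauchy_Schwarz_ineq2[of q "x - x0"] mult_right_mono[OF q, of "norm (x - x0)"] by simp
    have P1: "norm (x - x0) powr (1 + \<alpha>) / 2 \<le> P x" "P x \<le> 2 * norm (x - x0)" "0 \<le> P x" if "x \<in> S" for x
    proof -
      show 1: "norm (x - x0) powr (1 + \<alpha>) / 2 \<le> P x" "P x \<le> 2 * norm (x - x0)" using bb(6,7)[OF that that that that] unfolding P_def by auto
      have "0 \<le> norm (x - x0) powr (1 + \<alpha>)" by simp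
      then show "0 \<le> P x" using 1 by linarith
    qed
    have NP: "N * P x \<le> 2 * N * norm (x - x0)" "C * norm (x - x0) powr (1 + \<alpha>) \<le> N * P x" if x: "x \<in> S" for x
    proof -
      show "N * P x \<le> 2 * N * norm (x - x0)" using mult_left_mono[OF P1(2)[OF x], of N] N by simp
      have "(2 * C) * (norm (x - x0) powr (1 + \<alpha>) / 2) \<le> N * P x"
        by (rule mult_mono) (use N \<Lambda> C P1[OF x] in auto)
      then show "C * norm (x - x0) powr (1 + \<alpha>) \<le> N * P x" by simp
    qed
    have NPK: "M + 2 * C \<le> N * P x" if x: "x \<in> S" "r / 2 \<le> norm (x - x0)" for x
    proof -
      have "(r / 2) powr (1 + \<alpha>) \<le> norm (x - x0) powr (1 + \<alpha>)" using x r \<alpha> by (intro powr_mono2) auto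
      then have "(r / 2) powr (1 + \<alpha>) / 2 \<le> P x" using P1(1)[OF x(1)] by linarith
      then have "N * ((r / 2) powr (1 + \<alpha>) / 2) \<le> N * P x" using N by (intro mult_left_mono) auto
      then show ?thesis using Nr by linarith
    qed
    have gr: "\<Lambda> \<le> norm (w' s x)" "norm (w' s x) \<le> C + 2 * N" if x: "x \<in> S" and s: "\<bar>s\<bar> = N" for s x
    proof -
      define m where "m = norm ((s * barrier_slope \<alpha> \<kappa> (C + 1) x0 \<nu> x) *R barrier_normal \<alpha> (C + 1) x0 \<nu> x)"
      define F where "F = barrier_slope \<alpha> \<kappa> (C + 1) x0 \<nu> x"
      define n where "n = norm (barrier_normal \<alpha> (C + 1) x0 \<nu> x)"
      have F: "1 / 2 \<le> F" "F \<le> 1" "1 / 2 \<le> n" "n \<le> 3 / 2" unfolding F_def n_def using bb(2-5)[OF x x x x] by auto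
      have m: "m = N * F * n" unfolding m_def F_def[symmetric] using F(1) s by (simp add: n_def abs_mult)
      have "N * (1 / 2) * (1 / 2) \<le> m" unfolding m using F N by (intro mult_mono) auto
      moreover have "m \<le> N * 1 * (3 / 2)" unfolding m using F N by (intro mult_mono) auto
      moreover have "m - norm q \<le> norm (w' s x)" "norm (w' s x) \<le> norm q + m"
        unfolding w'_def barrier_gradient_def m_def
        using norm_diff_ineq[of "(s * barrier_slope \<alpha> \<kappa> (C + 1) x0 \<nu> x) *R barrier_normal \<alpha> (C + 1) x0 \<nu> x" q]
        by (simp add: add.commute, intro norm_triangle_ineq)
      ultimately show "\<Lambda> \<le> norm (w' s x)" "norm (w' s x) \<le> C + 2 * N" using q N by linarith+
    qed
    have wb: "\<bar>w s x\<bar> \<le> 2 * C + 2 * N" if x: "x \<in> S" and s: "\<bar>s\<bar> = N" for s x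
    proof -
      have n1: "norm (x - x0) \<le> 1" using pre(2)[OF x] r by linarith
      have "C * norm (x - x0) \<le> C * 1" using n1 C by (rule mult_left_mono)
      moreover have "2 * N * norm (x - x0) \<le> 2 * N * 1" using n1 N by (intro mult_left_mono) auto
      moreover have "\<bar>s * P x\<bar> = N * P x" using s P1(3)[OF x] by (simp add: abs_mult)
      ultimately show ?thesis using NP(1)[OF x] qx[of x] b unfolding wP by linarith
    qed
    have bc': "\<exists>V'. (\<forall>x\<in>S. GDERIV (w s) x :> w' s x) \<and> continuous_on S (w' s) \<and>
      (\<forall>x\<in>S. \<forall>i. GDERIV (\<lambda>x. A (w' s x) $ i) x :> V' i x) \<and> (\<forall>i. continuous_on S (V' i)) \<and>
      (\<forall>x\<in>S. s * (\<Sum>i\<in>UNIV. V' i x $ i) \<le> 0)" if s: "\<bar>s\<bar> = N" for s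
      unfolding w_def w'_def
    proof (rule barrier_calculus[OF \<alpha> _ \<kappa>(1)])
      show "0 \<le> C + 1" using C by simp
      fix x assume x: "x \<in> S"
      show "x \<noteq> x0" using pre(1)[OF x] by auto
      show "0 < barrier_dist \<alpha> (C + 1) x0 \<nu> x" by (rule bb(1)[OF x x x x])
      show "barrier_gradient \<alpha> \<kappa> (C + 1) x0 \<nu> q s x \<noteq> 0" using gr(1)[OF x s] \<Lambda> unfolding w'_def by auto
      show "0 \<le> barrier_slope \<alpha> \<kappa> (C + 1) x0 \<nu> x" "barrier_slope \<alpha> \<kappa> (C + 1) x0 \<nu> x \<le> 1" using bb(2,3)[OF x x x x] by auto
      show "2 * (C + 1) * (real CARD('n) + g\<^sub>0) * ((x - x0) \<bullet> (x - x0)) powr ((1 + \<alpha>) / 2 - 1)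
        \<le> \<kappa> * (1 + \<alpha>) * \<alpha> * barrier_dist \<alpha> (C + 1) x0 \<nu> x powr (\<alpha> - 1) * (norm (barrier_normal \<alpha> (C + 1) x0 \<nu> x))\<^sup>2"
        using bb(8)[OF x x x x \<kappa>(2) k] unfolding k_def .
    qed
    have K: "compact (cball x0 (r / 2))" "cball x0 (r / 2) \<subseteq> ball x0 r" using r by auto
    have wb2: "\<bar>w s x\<bar> \<le> 2 * C + 2 * N" "norm (w' s x) \<le> 2 * C + 2 * N" if "x \<in> S" "\<bar>s\<bar> = N" for s x
      using wb[OF that] gr(2)[OF that] C by auto
    have far: "r / 2 \<le> norm (x - x0)" if "x \<notin> cball x0 (r / 2)" for x
      using that by (simp add: dist_norm norm_minus_commute)
    have qC: "\<bar>q \<bullet> (x - x0)\<bar> \<le> C" if "x \<in> S" for x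
    proof -
      have "C * norm (x - x0) \<le> C * 1" using pre(2)[OF that] r C by (intro mult_left_mono) auto
      then show ?thesis using qx[of x] by linarith
    qed
    have cmp: "AE x\<in>S in lborel. s * u x \<le> s * w (s * N) x" if s: "s = 1 \<or> s = - 1" for s
    proof -
      have sN: "\<bar>s * N\<bar> = N" using s N by auto
      obtain V' where V: "\<forall>x\<in>S. GDERIV (w (s * N)) x :> w' (s * N) x" "continuous_on S (w' (s * N))"
        "\<forall>x\<in>S. \<forall>i. GDERIV (\<lambda>x. A (w' (s * N) x) $ i) x :> V' i x" "\<forall>i. continuous_on S (V' i)"
        "\<forall>x\<in>S. s * N * (\<Sum>i\<in>UNIV. V' i x $ i) \<le> 0" using bc'[OF sN] by (elim exE conjE) (rule that)
      show ?thesis unfolding S_def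
      proof (rule barrier_compare[OF s open_ball K, where b="2 * C + 2 * N" and w'="w' (s * N)" and V'=V'], fold S_def)
        fix x assume x: "x \<in> S"
        show "GDERIV (w (s * N)) x :> w' (s * N) x" using V(1) x by blast
        show "\<bar>w (s * N) x\<bar> \<le> 2 * C + 2 * N" "norm (w' (s * N) x) \<le> 2 * C + 2 * N" using wb2[OF x sN] by auto
        show "GDERIV (\<lambda>x. A (w' (s * N) x) $ i) x :> V' i x" for i using V(3) x by blast
        show "s * (\<Sum>i\<in>UNIV. V' i x $ i) \<le> 0" using V(5)[rule_format, OF x] N by (simp add: mult.assoc mult.left_commute[of s N] mult_le_0_iff)
        show "2 * lam < G (norm (w' (s * N) x))" using \<Lambda>(2) gr(1)[OF x sN] by blast
        show "s * \<phi> x \<le> s * w (s * N) x" using pre(6)[OF x] NP(2)[OF x] s unfolding wP by (auto simp: abs_le_iff)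
        show "s * t \<le> s * w (s * N) x" if "x \<notin> cball x0 (r / 2)" "0 \<le> t" "t \<le> M" for t
          using NPK[OF x far[OF that(1)]] qC[OF x] b s that(2,3) unfolding wP by (auto simp: abs_le_iff)
      qed (use V in auto)
    qed
    show ?thesis
      using cmp[OF disjI1[OF refl]] cmp[OF disjI2[OF refl]] le_M
    proof eventually_elim
      case (elim x)
      show ?case
      proof
        assume x\<Omega>: "x \<in> \<Omega>"
        show "\<bar>u x - b\<bar> \<le> L0 * norm (x - x0)"
        proof (cases "x \<in> S")
          case True
          have "\<bar>u x - b\<bar> \<le> C * norm (x - x0) + 2 * N * norm (x - x0)"
            using elim(1,2) True NP(1)[OF True] qx[of x] unfolding wP by (simp add: abs_le_iff)
          also have "\<dots> = (C + 2 * N) * norm (x - x0)" by (simp add: algebra_simps)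
          also have "\<dots> \<le> L0 * norm (x - x0)" using M C r by (intro mult_right_mono) (auto simp: L0_def)
          finally show ?thesis .
        next
          case False
          then have d: "r \<le> norm (x - x0)" using x\<Omega> by (simp add: S_def dist_norm norm_minus_commute)
          have "\<bar>u x - b\<bar> \<le> (M + C) / r * r" using elim(3) u(4)[of x] b M r by (simp add: abs_le_iff)
          also have "\<dots> \<le> L0 * norm (x - x0)" by (rule mult_mono) (use d M C N r L0 in \<open>auto simp: L0_def\<close>)
          finally show ?thesis .
        qed
      qed
    qed
  qed
  show ?thesis
    unfolding boundary_expansion_def by (intro exI[of _ L0] conjI L0 allI impI, elim conjE, rule main)
qed

end

section \<open>Boundary expansions from charts of class C1,alpha\<close>

text \<open>Translates operator-norm bounds into bounds on gradient vectors by evaluating the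
  derivative at the gradient itself. With \<open>e = 1\<close> it also covers real-valued
  functions.\<close>

lemma C1_holder_gradient:
  fixes f :: "real ^ 'n \<Rightarrow> 'b::euclidean_space"
  assumes f: "C1_holder \<alpha> S f" and e: "norm e = 1"
  shows "\<exists>C\<ge>0. \<exists>F. \<forall>x\<in>S. GDERIV (\<lambda>x. f x \<bullet> e) x :> F x \<and> \<bar>f x \<bullet> e\<bar> \<le> C \<and> norm (F x) \<le> C \<and>
    (\<forall>y\<in>S. norm (F x - F y) \<le> C * dist x y powr \<alpha>)"
proof -
  define f' where "f' x = frechet_derivative f (at x)" for x
  obtain C where C: "\<forall>x\<in>S. norm (f x) \<le> C" "\<forall>x\<in>S. onorm (f' x) \<le> C"
    "\<forall>x\<in>S. \<forall>y\<in>S. onorm (\<lambda>h. f' x h - f' y h) \<le> C * dist x y powr \<alpha>" and df: "\<forall>x\<in>S. f differentiable (at x)"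
    using f unfolding C1_holder_def f'_def[symmetric] by (elim exE conjE) (rule that)
  define F where "F x = gradient (\<lambda>x. f x \<bullet> e) x" for x
  have D: "(f has_derivative f' x) (at x)" if "x \<in> S" for x
    using df that unfolding f'_def by (simp add: frechet_derivative_works)
  have De: "((\<lambda>x. f x \<bullet> e) has_derivative (\<lambda>h. f' x h \<bullet> e)) (at x)" if "x \<in> S" for x
    by (rule has_derivative_inner_left[OF D[OF that]])
  have G: "GDERIV (\<lambda>x. f x \<bullet> e) x :> F x" if "x \<in> S" for x
    unfolding F_def by (rule differentiable_GDERIV) (rule differentiableI[OF De[OF that]])
  have FF: "f' x h \<bullet> e = h \<bullet> F x" if "x \<in> S" for x h
    using has_derivative_unique[OF De[OF that] G[OF that, unfolded gderiv_def]] by (rule fun_cong)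
  have key: "norm v \<le> B" if "bounded_linear T" "onorm T \<le> B" "\<And>h. T h \<bullet> e = h \<bullet> v" for v :: "real ^ 'n" and T :: "real ^ 'n \<Rightarrow> 'b" and B
  proof -
    have "norm v * norm v = T v \<bullet> e" by (simp add: that(3) dot_square_norm power2_eq_square)
    also have "\<dots> \<le> norm (T v)" using norm_cauchy_schwarz[of "T v" e] e by simp
    also have "\<dots> \<le> onorm T * norm v" by (rule onorm[OF that(1)])
    also have "\<dots> \<le> B * norm v" using that(2) by (intro mult_right_mono) auto
    finally have "norm v * norm v \<le> B * norm v" .
    moreover have "0 \<le> B" using onorm_pos_le[OF that(1)] that(2) by linarith
    ultimately show ?thesis by (cases "norm v = 0") (auto simp: mult_le_cancel_right)
  qed
  have bl: "bounded_linear (f' x)" if "x \<in> S" for x using D[OF that] by (rule has_derivative_bounded_linear)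
  show ?thesis
  proof (intro exI[of _ "\<bar>C\<bar>"] exI[of _ F] conjI ballI)
    fix x assume x: "x \<in> S"
    show "GDERIV (\<lambda>x. f x \<bullet> e) x :> F x" by (rule G[OF x])
    show "\<bar>f x \<bullet> e\<bar> \<le> \<bar>C\<bar>" using Cauchy_Schwarz_ineq2[of "f x" e] e C(1) x by fastforce
    show "norm (F x) \<le> \<bar>C\<bar>" by (rule key[OF bl[OF x]]) (use C(2) x FF[OF x] in force)+
    fix y assume y: "y \<in> S"
    show "norm (F x - F y) \<le> \<bar>C\<bar> * dist x y powr \<alpha>"
    proof (rule key[OF bounded_linear_sub[OF bl[OF x] bl[OF y]]])
      have "onorm (\<lambda>h. f' x h - f' y h) \<le> C * dist x y powr \<alpha>" using C(3) x y by blast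
      also have "\<dots> \<le> \<bar>C\<bar> * dist x y powr \<alpha>" by (intro mult_right_mono) auto
      finally show "onorm (\<lambda>h. f' x h - f' y h) \<le> \<bar>C\<bar> * dist x y powr \<alpha>" .
    qed (simp add: inner_diff_left inner_diff_right FF[OF x] FF[OF y])
  qed simp
qed

lemma segment_growth:
  fixes f :: "'a::euclidean_space \<Rightarrow> real"
  assumes "\<And>y. y \<in> closed_segment a b \<Longrightarrow> GDERIV f y :> F y"
    and "\<And>y. y \<in> closed_segment a b \<Longrightarrow> norm (F y - q) \<le> B"
  shows "\<bar>(f b - q \<bullet> b) - (f a - q \<bullet> a)\<bar> \<le> B * norm (b - a)"
proof -
  have "norm ((f b - q \<bullet> b) - (f a - q \<bullet> a)) \<le> B * norm (b - a)"
  proof (rule differentiable_bound[OF convex_closed_segment[of a b]])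
    fix y assume y: "y \<in> closed_segment a b"
    have "(f has_derivative (\<lambda>h. h \<bullet> F y)) (at y)" using assms(1)[OF y] by (simp add: gderiv_def)
    from has_derivative_diff[OF this has_derivative_inner_right[OF has_derivative_ident, of q]]
    have d: "((\<lambda>y. f y - q \<bullet> y) has_derivative (\<lambda>h. h \<bullet> (F y - q))) (at y)"
      by (rule has_derivative_eq_rhs) (simp add: fun_eq_iff inner_diff_right inner_commute)
    then show "((\<lambda>y. f y - q \<bullet> y) has_derivative (\<lambda>h. h \<bullet> (F y - q))) (at y within closed_segment a b)"
      by (rule has_derivative_at_withinI)
    have "onorm (\<lambda>h. h \<bullet> (F y - q)) \<le> norm (F y - q)"
      by (rule onorm_le) (metis Cauchy_Schwarz_ineq2 mult.commute real_norm_def)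
    then show "onorm (\<lambda>h. h \<bullet> (F y - q)) \<le> B" using assms(2)[OF y] by linarith
  qed auto
  then show ?thesis by simp
qed

text \<open>Differentiability is given only inside \<Omega>, so \<open>b\<close> and
  \<open>q\<close> are limits of \<open>f\<close> and its gradient along the vertical ray above
  \<open>x0\<close>. The straight segment from \<open>x\<close> to \<open>x0\<close> may leave
  \<Omega>; instead the expansion is integrated along a path that goes up from \<open>x\<close> by
  \<open>T\<close>, across, and down towards \<open>x0\<close>.\<close>

lemma chart_estimate:
  fixes \<Omega> :: "(real ^ 'n) set" and f \<gamma> :: "real ^ 'n \<Rightarrow> real"
  assumes \<alpha>: "0 < \<alpha>" and \<Omega>: "open \<Omega>"
    and C: "0 \<le> C" and F: "\<And>x. x \<in> \<Omega> \<Longrightarrow> GDERIV f x :> F x" "\<And>x. x \<in> \<Omega> \<Longrightarrow> \<bar>f x\<bar> \<le> C" "\<And>x. x \<in> \<Omega> \<Longrightarrow> norm (F x) \<le> C"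
      "\<And>x y. x \<in> \<Omega> \<Longrightarrow> y \<in> \<Omega> \<Longrightarrow> norm (F x - F y) \<le> C * dist x y powr \<alpha>"
    and D: "0 \<le> D" and \<Gamma>: "\<And>x. GDERIV \<gamma> x :> \<Gamma> x" "\<And>x. norm (\<Gamma> x) \<le> D" "\<And>x y. norm (\<Gamma> x - \<Gamma> y) \<le> D * dist x y powr \<alpha>"
    and e: "norm e = 1" "\<And>x t. \<gamma> (x + t *R e) = \<gamma> x"
    and R: "0 < R" "\<Omega> \<inter> ball z R = {x \<in> ball z R. x \<bullet> e > \<gamma> x}"
    and x0: "x0 \<in> frontier \<Omega>" "x0 \<in> ball z (R / 2)"
  shows "\<exists>\<nu> q b. norm \<nu> = 1 \<and> norm q \<le> C \<and> \<bar>b\<bar> \<le> C \<and>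
    (\<forall>x\<in>\<Omega> \<inter> ball x0 (R / (2 * (D + 3))). - D * norm (x - x0) powr (1 + \<alpha>) \<le> (x - x0) \<bullet> \<nu> \<and>
       \<bar>f x - b - q \<bullet> (x - x0)\<bar> \<le> C * (D + 3) powr \<alpha> * (2 * D + 5) * norm (x - x0) powr (1 + \<alpha>))"
proof -
  \<comment> \<open>\<open>(D + 3) * r\<close> is \<open>R / 2\<close>, so the detour used for the
    expansion stays inside the chart.\<close>
  define r where "r = R / (2 * (D + 3))"
  have r: "0 < r" "(D + 3) * r = R / 2" using D R(1) by (auto simp: r_def field_simps)
  have near: "y \<in> ball z R" if "norm (y - x0) < R / 2" for y
    using that x0(2) dist_triangle[of z y x0] by (simp add: dist_norm norm_minus_commute)
  have in\<Omega>: "y \<in> \<Omega> \<longleftrightarrow> \<gamma> y < y \<bullet> e" if "norm (y - x0) < R / 2" for y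
    using R(2) near[OF that] by blast
  have ee: "e \<bullet> e = 1" using e(1) by (simp add: dot_square_norm)
  have c\<gamma>: "continuous_on UNIV \<gamma>" using \<Gamma>(1) by (rule GDERIV_continuous_on)
  have x0n: "x0 \<notin> \<Omega>" using x0(1) \<Omega> by (simp add: frontier_def interior_open)
  \<comment> \<open>A frontier point lies on the graph: not above it, as it is outside \<Omega>, and
    not below it, as a neighbourhood would then miss \<Omega>.\<close>
  have \<gamma>x0: "\<gamma> x0 = x0 \<bullet> e"
  proof (rule antisym)
    show "x0 \<bullet> e \<le> \<gamma> x0" using in\<Omega>[of x0] x0n R(1) by simp
    show "\<gamma> x0 \<le> x0 \<bullet> e"
    proof (rule ccontr)
      assume a: "\<not> \<gamma> x0 \<le> x0 \<bullet> e"
      define O' where "O' = {y. y \<bullet> e < \<gamma> y} \<inter> ball x0 (R / 2)"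
      have "open O'" unfolding O'_def by (intro open_Int open_Collect_less open_ball continuous_intros c\<gamma>)
      moreover have "x0 \<in> O'" using a R(1) by (simp add: O'_def)
      moreover have "x0 \<in> closure \<Omega>" using x0(1) by (simp add: frontier_def)
      ultimately have "O' \<inter> \<Omega> \<noteq> {}" using open_Int_closure_eq_empty[of O' \<Omega>] by blast
      then show False using in\<Omega> by (auto simp: O'_def dist_norm norm_minus_commute)
    qed
  qed
  define a where "a = \<Gamma> x0"
  have ae: "e \<bullet> a = 0"
  proof -
    have "((\<lambda>t. \<gamma> (x0 + t *R e)) has_derivative (\<lambda>t. (t *R e) \<bullet> a)) (at 0)"
      by (rule has_derivative_compose[of "\<lambda>t. x0 + t *R e" "\<lambda>t. t *R e" 0 UNIV \<gamma>])
        (use \<Gamma>(1)[of x0] in \<open>auto simp: gderiv_def a_def intro!: derivative_eq_intros\<close>)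
    then have "((\<lambda>t :: real. \<gamma> x0) has_derivative (\<lambda>t. (t *R e) \<bullet> a)) (at 0)" by (simp only: e(2))
    from has_derivative_unique[OF this has_derivative_const] have "(1 *R e) \<bullet> a = 0" by (rule fun_cong)
    then show ?thesis by simp
  qed
  define m where "m = norm (e - a)"
  have m: "1 \<le> m"
  proof -
    have "1 = (e - a) \<bullet> e" using ae ee by (simp add: inner_diff_left inner_commute[of a e])
    also have "\<dots> \<le> m" using norm_cauchy_schwarz[of "e - a" e] e(1) by (simp add: m_def)
    finally show ?thesis .
  qed
  \<comment> \<open>The normalized gradient of \<open>x \<bullet> e - \<gamma> x\<close> at
    \<open>x0\<close>. The length \<open>m\<close> is at least 1 because \<open>a\<close> is
    orthogonal to \<open>e\<close>, so dividing by it does not enlarge the error constant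
    \<open>D\<close>.\<close>
  define \<nu> where "\<nu> = (1 / m) *R (e - a)"
  have \<nu>: "norm \<nu> = 1"
  proof -
    have "norm \<nu> = 1 / m * m" using m by (simp add: \<nu>_def m_def[symmetric])
    then show ?thesis using m by simp
  qed
  have \<gamma>taylor: "\<bar>(\<gamma> x - a \<bullet> x) - (\<gamma> x0 - a \<bullet> x0)\<bar> \<le> D * norm (x - x0) powr \<alpha> * norm (x - x0)" for x
  proof (rule segment_growth[OF \<Gamma>(1)])
    fix y assume "y \<in> closed_segment x0 x"
    then have "dist y x0 \<le> norm (x - x0)" using segment_bound1[of y x0 x] by (simp add: dist_norm)
    then have "D * dist y x0 powr \<alpha> \<le> D * norm (x - x0) powr \<alpha>"
      using D \<alpha> by (intro mult_left_mono powr_mono2) auto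
    then show "norm (\<Gamma> y - a) \<le> D * norm (x - x0) powr \<alpha>" using \<Gamma>(3)[of y x0] unfolding a_def by linarith
  qed
  have pw: "t powr \<alpha> * t = t powr (1 + \<alpha>)" if "0 \<le> t" for t :: real
    using that by (cases "t = 0") (auto simp: powr_add)
  have side: "- D * norm (x - x0) powr (1 + \<alpha>) \<le> (x - x0) \<bullet> \<nu>" if x: "x \<in> \<Omega> \<inter> ball x0 r" for x
  proof -
    have "(D + 3) * norm (x - x0) < (D + 3) * r" using x D by (simp add: dist_norm norm_minus_commute)
    moreover have "norm (x - x0) \<le> (D + 3) * norm (x - x0)" using D by (simp add: mult_le_cancel_right1)
    ultimately have "\<gamma> x < x \<bullet> e" using in\<Omega>[of x] x r by simp
    moreover have "(x - x0) \<bullet> (e - a) = x \<bullet> e - x0 \<bullet> e - (a \<bullet> x - a \<bullet> x0)"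
      by (simp add: inner_diff_left inner_diff_right inner_commute)
    ultimately have l: "- (D * norm (x - x0) powr (1 + \<alpha>)) \<le> (x - x0) \<bullet> (e - a)"
      using \<gamma>taylor[of x] \<gamma>x0 pw[OF norm_ge_zero, of "x - x0"] by (simp add: mult.assoc)
    have "D * norm (x - x0) powr (1 + \<alpha>) / m \<le> D * norm (x - x0) powr (1 + \<alpha>) / 1"
      using m D by (intro divide_left_mono) auto
    moreover have "- (D * norm (x - x0) powr (1 + \<alpha>)) / m \<le> ((x - x0) \<bullet> (e - a)) / m"
      using l m by (intro divide_right_mono) auto
    ultimately show ?thesis by (simp add: \<nu>_def)
  qed
  define t where "t n = r / 2 * inverse (real (Suc n))" for n
  have t0: "t \<longlonglongrightarrow> 0" unfolding t_def by (intro tendsto_mult_right_zero LIMSEQ_inverse_real_of_nat)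
  have tp: "0 < t n" "t n < r" for n
  proof -
    show "0 < t n" using r by (simp add: t_def)
    have "t n \<le> r / 2 * 1" unfolding t_def using r by (intro mult_left_mono) (auto simp: inverse_le_1_iff)
    then show "t n < r" using r by linarith
  qed
  have "1 * r < (D + 3) * r" using r(1) D by (intro mult_strict_right_mono) auto
  then have rR: "r < R / 2" using r(2) by linarith
  have up: "x0 + s *R e \<in> \<Omega>" if "0 < s" "s < R / 2" for s
    using in\<Omega>[of "x0 + s *R e"] that e \<gamma>x0 ee by (simp add: inner_add_left)
  define y where "y n = x0 + t n *R e" for n
  have y\<Omega>: "y n \<in> \<Omega>" for n unfolding y_def using up tp[of n] rR by simp
  have yl: "y \<longlonglongrightarrow> x0"
  proof -
    have "y \<longlonglongrightarrow> x0 + 0 *R e" unfolding y_def by (intro tendsto_intros t0)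
    then show ?thesis by simp
  qed
  \<comment> \<open>The limits \<open>b\<close> and \<open>q\<close> are taken along a subsequence
    given by compactness; the Hoelder bound for \<open>F\<close> then compares every gradient in
    \<Omega> with \<open>q\<close>.\<close>
  have "bounded (range (\<lambda>n. (f (y n), F (y n))))"
  proof (rule boundedI)
    fix p assume "p \<in> range (\<lambda>n. (f (y n), F (y n)))"
    then obtain n where "p = (f (y n), F (y n))" by blast
    then show "norm p \<le> C + C"
      using norm_Pair_le[of "f (y n)" "F (y n)"] F(2,3)[OF y\<Omega>[of n]] by simp
  qed
  then obtain p \<sigma> where \<sigma>: "strict_mono \<sigma>" "((\<lambda>n. (f (y n), F (y n))) \<circ> \<sigma>) \<longlonglongrightarrow> p"
    using bounded_imp_convergent_subsequence by blast
  define b where "b = fst p"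
  define q where "q = snd p"
  have fl: "(\<lambda>n. f (y (\<sigma> n))) \<longlonglongrightarrow> b" using tendsto_fst[OF \<sigma>(2)] by (simp add: b_def o_def)
  have Fl: "(\<lambda>n. F (y (\<sigma> n))) \<longlonglongrightarrow> q" using tendsto_snd[OF \<sigma>(2)] by (simp add: q_def o_def)
  have y\<sigma>: "(\<lambda>n. y (\<sigma> n)) \<longlonglongrightarrow> x0" using LIMSEQ_subseq_LIMSEQ[OF yl \<sigma>(1)] by (simp add: o_def)
  have b: "\<bar>b\<bar> \<le> C" by (rule LIMSEQ_le_const2[OF tendsto_rabs[OF fl]]) (use F(2)[OF y\<Omega>] in auto)
  have q: "norm q \<le> C" by (rule LIMSEQ_le_const2[OF tendsto_norm[OF Fl]]) (use F(3)[OF y\<Omega>] in auto)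
  have Fq: "norm (F x - q) \<le> C * norm (x - x0) powr \<alpha>" if x: "x \<in> \<Omega>" for x
  proof (rule LIMSEQ_le)
    show "(\<lambda>n. norm (F x - F (y (\<sigma> n)))) \<longlonglongrightarrow> norm (F x - q)" by (intro tendsto_intros Fl)
    show "(\<lambda>n. C * dist x (y (\<sigma> n)) powr \<alpha>) \<longlonglongrightarrow> C * norm (x - x0) powr \<alpha>"
      unfolding dist_norm by (intro tendsto_intros y\<sigma>) (use x x0n in auto)
    show "\<exists>N. \<forall>n\<ge>N. norm (F x - F (y (\<sigma> n))) \<le> C * dist x (y (\<sigma> n)) powr \<alpha>" using F(4)[OF x y\<Omega>] by blast
  qed
  have taylor: "\<bar>f x - b - q \<bullet> (x - x0)\<bar> \<le> C * (D + 3) powr \<alpha> * (2 * D + 5) * norm (x - x0) powr (1 + \<alpha>)"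
    if x: "x \<in> \<Omega> \<inter> ball x0 r" for x
  proof -
    define d where "d = norm (x - x0)"
    have d: "0 < d" "d < r" using x x0n by (auto simp: d_def dist_norm norm_minus_commute)
    have Dd: "(D + 3) * d < R / 2" using mult_strict_left_mono[OF d(2), of "D + 3"] D unfolding r(2) by simp
    \<comment> \<open>The height exceeds the possible rise \<open>D * d\<close> of the graph over
      the horizontal part plus the drop \<open>d\<close> of the height along it. Every point of the
      path is within \<open>(D + 3) * d\<close> of \<open>x0\<close>, and its length is at most
      \<open>2 * T + d = (2 * D + 5) * d\<close>.\<close>
    define T where "T = (D + 2) * d"
    have T: "0 < T" "T + d = (D + 3) * d" using mult_pos_pos[of "D + 2" d] D d(1) by (auto simp: T_def algebra_simps)
    define B where "B = C * ((D + 3) * d) powr \<alpha>"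
    have B0: "0 \<le> B" using C by (simp add: B_def)
    have FB: "norm (F w - q) \<le> B" if "w \<in> \<Omega>" "norm (w - x0) \<le> (D + 3) * d" for w
    proof -
      have "C * norm (w - x0) powr \<alpha> \<le> B" unfolding B_def using C that(2) \<alpha> by (intro mult_left_mono powr_mono2) auto
      then show ?thesis using Fq[OF that(1)] by linarith
    qed
    define H where "H w = f w - q \<bullet> w" for w
    have seg: "\<bar>H w' - H w\<bar> \<le> B * norm (w' - w)"
      if "\<And>v. v \<in> closed_segment w w' \<Longrightarrow> v \<in> \<Omega> \<and> norm (v - x0) \<le> (D + 3) * d" for w w'
      unfolding H_def by (rule segment_growth[of w w' f F q B]) (use that F(1) FB in blast)+
    have s1: "\<bar>H (x + T *R e) - H x\<bar> \<le> B * norm (x + T *R e - x)"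
    proof (rule seg)
      fix v assume "v \<in> closed_segment x (x + T *R e)"
      then obtain s where s: "0 \<le> s" "s \<le> 1" "v = (1 - s) *R x + s *R (x + T *R e)"
        unfolding closed_segment_def by blast
      have v: "v = x + (s * T) *R e" unfolding s(3) by (simp add: algebra_simps)
      have sT: "0 \<le> s * T" "s * T \<le> T" using s T mult_right_mono[of s 1 T] by auto
      have "norm (v - x0) \<le> d + s * T"
        using norm_triangle_ineq[of "x - x0" "(s * T) *R e"] e(1) sT unfolding v d_def by (simp add: algebra_simps)
      then have n: "norm (v - x0) \<le> (D + 3) * d" using sT T by linarith
      have "\<gamma> x < x \<bullet> e" using in\<Omega>[of x] x rR d by (simp add: d_def)
      then have "\<gamma> v < v \<bullet> e" unfolding v e(2) using sT ee by (simp add: inner_add_left)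
      then show "v \<in> \<Omega> \<and> norm (v - x0) \<le> (D + 3) * d" using in\<Omega>[of v] n Dd by auto
    qed
    have s2: "\<bar>H (x + T *R e) - H (x0 + T *R e)\<bar> \<le> B * norm (x + T *R e - (x0 + T *R e))"
    proof (rule seg)
      fix v assume "v \<in> closed_segment (x0 + T *R e) (x + T *R e)"
      then obtain s where s: "0 \<le> s" "s \<le> 1" "v = (1 - s) *R (x0 + T *R e) + s *R (x + T *R e)"
        unfolding closed_segment_def by blast
      have v: "v = (x0 + s *R (x - x0)) + T *R e" unfolding s(3) by (simp add: algebra_simps)
      have sd: "norm (s *R (x - x0)) \<le> d" using s mult_right_mono[of s 1 d] d by (simp add: d_def)
      have "norm (v - x0) \<le> norm (s *R (x - x0)) + T"
        using norm_triangle_ineq[of "s *R (x - x0)" "T *R e"] e(1) T unfolding v by (simp add: algebra_simps)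
      then have n: "norm (v - x0) \<le> (D + 3) * d" using sd T by linarith
      have "\<bar>\<gamma> (x0 + s *R (x - x0)) - \<gamma> x0\<bar> \<le> D * norm (x0 + s *R (x - x0) - x0)"
        using segment_growth[of x0 "x0 + s *R (x - x0)" \<gamma> \<Gamma> 0 D] \<Gamma> by simp
      also have "\<dots> \<le> D * d" using sd D by (intro mult_left_mono) auto
      finally have "\<gamma> (x0 + s *R (x - x0)) \<le> x0 \<bullet> e + D * d" using \<gamma>x0 by linarith
      moreover have "- d \<le> (s *R (x - x0)) \<bullet> e" using Cauchy_Schwarz_ineq2[of "s *R (x - x0)" e] sd unfolding e(1) by linarith
      moreover have "v \<bullet> e = x0 \<bullet> e + (s *R (x - x0)) \<bullet> e + T" unfolding v using ee by (simp add: inner_add_left)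
      moreover have "\<gamma> v = \<gamma> (x0 + s *R (x - x0))" unfolding v by (rule e(2))
      moreover have "D * d + d < T" using d unfolding T_def by (simp add: algebra_simps)
      ultimately have "\<gamma> v < v \<bullet> e" by linarith
      then show "v \<in> \<Omega> \<and> norm (v - x0) \<le> (D + 3) * d" using in\<Omega>[of v] n Dd by auto
    qed
    have s3: "\<bar>H (x0 + T *R e) - H (x0 + s *R e)\<bar> \<le> B * T" if s0: "0 < s" "s < T" for s
    proof -
      have "\<bar>H (x0 + T *R e) - H (x0 + s *R e)\<bar> \<le> B * norm (x0 + T *R e - (x0 + s *R e))"
      proof (rule seg)
        fix v assume "v \<in> closed_segment (x0 + s *R e) (x0 + T *R e)"
        then obtain k where k: "0 \<le> k" "k \<le> 1" "v = (1 - k) *R (x0 + s *R e) + k *R (x0 + T *R e)"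
          unfolding closed_segment_def by blast
        define \<tau> where "\<tau> = (1 - k) * s + k * T"
        have v: "v = x0 + \<tau> *R e" unfolding k(3) \<tau>_def by (simp add: algebra_simps)
        have "s \<le> \<tau>" "\<tau> \<le> T" unfolding \<tau>_def using convex_bound_le[of "- s" "- s" "- T" "1 - k" k] convex_bound_le[of s T T "1 - k" k] k s0 by (auto simp: algebra_simps)
        then have "0 < \<tau>" "\<tau> \<le> (D + 3) * d" using s0 T d by auto
        then show "v \<in> \<Omega> \<and> norm (v - x0) \<le> (D + 3) * d" unfolding v using up[of \<tau>] Dd e(1) by auto
      qed
      also have "norm (x0 + T *R e - (x0 + s *R e)) = T - s"
      proof -
        have "x0 + T *R e - (x0 + s *R e) = (T - s) *R e" by (simp add: algebra_simps)
        then show ?thesis using s0 e(1) by simp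
      qed
      also have "B * (T - s) \<le> B * T" using B0 s0 by (intro mult_left_mono) auto
      finally show ?thesis .
    qed
    have tl: "(\<lambda>n. t (\<sigma> n)) \<longlonglongrightarrow> 0" using LIMSEQ_subseq_LIMSEQ[OF t0 \<sigma>(1)] by (simp add: o_def)
    have "\<bar>H (x0 + T *R e) - (b - q \<bullet> x0)\<bar> \<le> B * T"
    proof (rule LIMSEQ_le_const2)
      show "(\<lambda>n. \<bar>H (x0 + T *R e) - (f (y (\<sigma> n)) - q \<bullet> y (\<sigma> n))\<bar>) \<longlonglongrightarrow> \<bar>H (x0 + T *R e) - (b - q \<bullet> x0)\<bar>"
        by (intro tendsto_intros fl y\<sigma>)
      obtain N where "\<forall>n\<ge>N. t (\<sigma> n) < T" using order_tendstoD(2)[OF tl T(1)] unfolding eventually_sequentially by blast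
      then show "\<exists>N. \<forall>n\<ge>N. \<bar>H (x0 + T *R e) - (f (y (\<sigma> n)) - q \<bullet> y (\<sigma> n))\<bar> \<le> B * T"
        using s3 tp(1) unfolding H_def y_def by blast
    qed
    then have "\<bar>H x - (b - q \<bullet> x0)\<bar> \<le> B * T + B * d + B * T"
      using s1 s2 T(1) e(1) unfolding d_def[symmetric] by (simp add: d_def[symmetric])
    also have "\<dots> = B * ((2 * D + 5) * d)" by (simp add: T_def algebra_simps)
    also have "\<dots> = C * (D + 3) powr \<alpha> * (2 * D + 5) * (d powr \<alpha> * d)"
      unfolding B_def using D d by (simp add: powr_mult)
    also have "\<dots> = C * (D + 3) powr \<alpha> * (2 * D + 5) * d powr (1 + \<alpha>)" using d by (simp add: pw)
    also have "\<bar>H x - (b - q \<bullet> x0)\<bar> = \<bar>f x - b - q \<bullet> (x - x0)\<bar>" by (simp add: H_def inner_diff_right algebra_simps)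
    finally show ?thesis by (simp add: d_def)
  qed
  show ?thesis
    by (intro exI[of _ \<nu>] exI[of _ q] exI[of _ b] conjI ballI \<nu> q b) (use side taylor in \<open>auto simp: r_def\<close>)
qed

text \<open>A chart at \<open>z\<close> serves all frontier points in a smaller ball with the same
  constants. The property is preserved when \<open>C\<close> grows and \<open>r\<close> shrinks, so
  a finite cover of the compact frontier gives uniform constants.\<close>

lemma uniform_boundary_chart:
  fixes \<Omega> :: "(real ^ 'n) set" and \<Phi> :: "real ^ 'n \<Rightarrow> real ^ 'm"
  assumes \<alpha>: "0 < \<alpha>" and b: "bounded \<Omega>" and d: "C1_holder_domain \<alpha> \<Omega>" and \<Phi>: "C1_holder \<alpha> \<Omega> \<Phi>"
  shows "\<exists>C\<ge>0. \<exists>r>0. \<forall>x0\<in>frontier \<Omega>. \<exists>\<nu> q b. boundary_expansion \<alpha> \<Omega> (\<lambda>x. \<Phi> x $ i) C r x0 \<nu> q b"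
proof -
  define good where "good C r x0 \<longleftrightarrow> (\<exists>\<nu> q b. boundary_expansion \<alpha> \<Omega> (\<lambda>x. \<Phi> x $ i) C r x0 \<nu> q b)" for C r and x0 :: "real ^ 'n"
  have mono: "good C' r' x0" if g: "good C r x0" and le: "C \<le> C'" "r' \<le> r" for C C' r r' x0
  proof -
    obtain \<nu> q b where 1: "norm \<nu> = 1" "norm q \<le> C" "\<bar>b\<bar> \<le> C"
      "\<forall>x\<in>\<Omega> \<inter> ball x0 r. - C * norm (x - x0) powr (1 + \<alpha>) \<le> (x - x0) \<bullet> \<nu> \<and>
       \<bar>\<Phi> x $ i - b - q \<bullet> (x - x0)\<bar> \<le> C * norm (x - x0) powr (1 + \<alpha>)"
      using g unfolding good_def boundary_expansion_def by (elim exE conjE) (rule that)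
    have "- C' * norm (x - x0) powr (1 + \<alpha>) \<le> (x - x0) \<bullet> \<nu> \<and>
       \<bar>\<Phi> x $ i - b - q \<bullet> (x - x0)\<bar> \<le> C' * norm (x - x0) powr (1 + \<alpha>)" if x: "x \<in> \<Omega> \<inter> ball x0 r'" for x
    proof -
      have "C * norm (x - x0) powr (1 + \<alpha>) \<le> C' * norm (x - x0) powr (1 + \<alpha>)" using le(1) by (intro mult_right_mono) auto
      moreover have "x \<in> \<Omega> \<inter> ball x0 r" using x le(2) by auto
      ultimately show ?thesis using 1(4)[rule_format, of x] by (auto simp: mult_minus_left)
    qed
    then show ?thesis unfolding good_def boundary_expansion_def using 1(1-3) le(1)
      by - (rule exI[of _ \<nu>], rule exI[of _ q], rule exI[of _ b], auto)
  qed
  have o: "open \<Omega>" using d by (simp add: C1_holder_domain_def)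
  have "norm (axis i 1 :: real ^ 'm) = 1" by simp
  from C1_holder_gradient[OF \<Phi> this] obtain C F where C: "0 \<le> C"
    "\<forall>x\<in>\<Omega>. GDERIV (\<lambda>x. \<Phi> x \<bullet> axis i 1) x :> F x \<and> \<bar>\<Phi> x \<bullet> axis i 1\<bar> \<le> C \<and> norm (F x) \<le> C \<and>
    (\<forall>y\<in>\<Omega>. norm (F x - F y) \<le> C * dist x y powr \<alpha>)" by (elim exE conjE) (rule that)
  have C2: "\<forall>x\<in>\<Omega>. GDERIV (\<lambda>x. \<Phi> x $ i) x :> F x \<and> \<bar>\<Phi> x $ i\<bar> \<le> C \<and> norm (F x) \<le> C \<and>
    (\<forall>y\<in>\<Omega>. norm (F x - F y) \<le> C * dist x y powr \<alpha>)" using C(2) by (simp add: inner_axis)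
  have loc: "\<exists>C r. 0 < r \<and> (\<forall>x0\<in>frontier \<Omega> \<inter> ball z r. good C r x0)" if z: "z \<in> frontier \<Omega>" for z
  proof -
    obtain R e and \<gamma> :: "real ^ 'n \<Rightarrow> real" where R: "R > 0" and e: "norm e = 1" and \<gamma>: "C1_holder \<alpha> UNIV \<gamma>" "\<forall>x t. \<gamma> (x + t *R e) = \<gamma> x"
      "\<Omega> \<inter> ball z R = {x \<in> ball z R. x \<bullet> e > \<gamma> x}"
      using bspec[OF d[unfolded C1_holder_domain_def, THEN conjunct2, THEN conjunct2, THEN conjunct2] z] by (elim exE conjE) (rule that)
    from C1_holder_gradient[OF \<gamma>(1) norm_one] obtain D \<Gamma> where D: "0 \<le> D"
      "\<forall>x\<in>UNIV. GDERIV (\<lambda>x. \<gamma> x \<bullet> 1) x :> \<Gamma> x \<and> \<bar>\<gamma> x \<bullet> 1\<bar> \<le> D \<and> norm (\<Gamma> x) \<le> D \<and>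
        (\<forall>y\<in>UNIV. norm (\<Gamma> x - \<Gamma> y) \<le> D * dist x y powr \<alpha>)" by (elim exE conjE) (rule that)
    define K where "K = C * (D + 3) powr \<alpha> * (2 * D + 5)"
    define r where "r = R / (2 * (D + 3))"
    have r: "0 < r" "r \<le> R / 2" using R D by (auto simp: r_def field_simps)
    define E where "E = C + D + K"
    have E: "C \<le> E" "D \<le> E" "K \<le> E" using C(1) D(1) by (auto simp: E_def K_def)
    have "good E r x0" if x0: "x0 \<in> frontier \<Omega> \<inter> ball z r" for x0
    proof -
      have x0': "x0 \<in> frontier \<Omega>" "x0 \<in> ball z (R / 2)" using x0 r by auto
      have "\<exists>\<nu> q b. norm \<nu> = 1 \<and> norm q \<le> C \<and> \<bar>b\<bar> \<le> C \<and>
        (\<forall>x\<in>\<Omega> \<inter> ball x0 (R / (2 * (D + 3))). - D * norm (x - x0) powr (1 + \<alpha>) \<le> (x - x0) \<bullet> \<nu> \<and>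
         \<bar>\<Phi> x $ i - b - q \<bullet> (x - x0)\<bar> \<le> C * (D + 3) powr \<alpha> * (2 * D + 5) * norm (x - x0) powr (1 + \<alpha>))"
        by (rule chart_estimate[OF \<alpha> o C(1) _ _ _ _ D(1) _ _ _ e _ R \<gamma>(3) x0', where F=F and \<Gamma>=\<Gamma>])
          (use C2 D(2) \<gamma>(2) in \<open>simp_all\<close>)
      then obtain \<nu> q b where 1: "norm \<nu> = 1" "norm q \<le> C" "\<bar>b\<bar> \<le> C"
        "\<forall>x\<in>\<Omega> \<inter> ball x0 r. - D * norm (x - x0) powr (1 + \<alpha>) \<le> (x - x0) \<bullet> \<nu> \<and>
         \<bar>\<Phi> x $ i - b - q \<bullet> (x - x0)\<bar> \<le> K * norm (x - x0) powr (1 + \<alpha>)"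
        unfolding r_def[symmetric] K_def[symmetric] by (elim exE conjE) (rule that)
      show ?thesis unfolding good_def boundary_expansion_def
      proof (rule exI[of _ \<nu>], rule exI[of _ q], rule exI[of _ b], intro conjI ballI)
        fix x assume x: "x \<in> \<Omega> \<inter> ball x0 r"
        have "D * norm (x - x0) powr (1 + \<alpha>) \<le> E * norm (x - x0) powr (1 + \<alpha>)"
          "K * norm (x - x0) powr (1 + \<alpha>) \<le> E * norm (x - x0) powr (1 + \<alpha>)"
          using E by (auto intro!: mult_right_mono)
        then show "- E * norm (x - x0) powr (1 + \<alpha>) \<le> (x - x0) \<bullet> \<nu>"
          "\<bar>\<Phi> x $ i - b - q \<bullet> (x - x0)\<bar> \<le> E * norm (x - x0) powr (1 + \<alpha>)"
          using 1(4)[rule_format, OF x] by (auto simp: mult_minus_left)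
      qed (use 1 E in auto)
    qed
    with r(1) show ?thesis by blast
  qed
  then obtain Cf rf where f: "\<And>z. z \<in> frontier \<Omega> \<Longrightarrow> 0 < rf z \<and> (\<forall>x0\<in>frontier \<Omega> \<inter> ball z (rf z). good (Cf z) (rf z) x0)"
  proof -
    have "\<forall>z\<in>frontier \<Omega>. \<exists>C r. 0 < r \<and> (\<forall>x0\<in>frontier \<Omega> \<inter> ball z r. good C r x0)" using loc by blast
    from bchoice[OF this] obtain Cf where "\<forall>z\<in>frontier \<Omega>. \<exists>r. 0 < r \<and> (\<forall>x0\<in>frontier \<Omega> \<inter> ball z r. good (Cf z) r x0)" ..
    from bchoice[OF this] obtain rf where "\<forall>z\<in>frontier \<Omega>. 0 < rf z \<and> (\<forall>x0\<in>frontier \<Omega> \<inter> ball z (rf z). good (Cf z) (rf z) x0)" ..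
    then show thesis by (intro that[of rf Cf]) (erule bspec)
  qed
  have "compact (frontier \<Omega>)" using b by (rule compact_frontier_bounded)
  moreover have "\<And>T. T \<in> frontier \<Omega> \<Longrightarrow> open (ball T (rf T))" by simp
  moreover have "frontier \<Omega> \<subseteq> (\<Union>z\<in>frontier \<Omega>. ball z (rf z))" using f by force
  ultimately obtain Z where Z: "Z \<subseteq> frontier \<Omega>" "finite Z" "frontier \<Omega> \<subseteq> (\<Union>z\<in>Z. ball z (rf z))"
    by (rule compactE_image)
  define C0 where "C0 = Max (insert 0 (Cf ` Z))"
  define r0 where "r0 = Min (insert 1 (rf ` Z))"
  have 1: "0 \<le> C0" "\<And>z. z \<in> Z \<Longrightarrow> Cf z \<le> C0" "\<And>z. z \<in> Z \<Longrightarrow> r0 \<le> rf z"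
    using Z(2) by (auto simp: C0_def r0_def)
  have 2: "0 < r0" unfolding r0_def using Z f by (subst Min_gr_iff) auto
  have "good C0 r0 x0" if "x0 \<in> frontier \<Omega>" for x0
  proof -
    obtain z where z: "z \<in> Z" "x0 \<in> ball z (rf z)" using Z(3) \<open>x0 \<in> frontier \<Omega>\<close> by blast
    then have "good (Cf z) (rf z) x0" using f[of z] Z(1) \<open>x0 \<in> frontier \<Omega>\<close> by blast
    then show ?thesis by (rule mono) (use 1 z in auto)
  qed
  then show ?thesis using 1(1) 2 unfolding good_def by blast
qed

section \<open>From the vector problem to its components\<close>

locale vector_min = nfun G g \<delta> g\<^sub>0 + orlicz_domain G \<Omega> C\<^sub>G
  for G g :: "real \<Rightarrow> real" and \<delta> g\<^sub>0 C\<^sub>G :: real and \<Omega> :: "(real ^ 'n) set" +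
  fixes \<Phi> u :: "real ^ 'n \<Rightarrow> real ^ 'm" and lam M :: real
  assumes lam: "0 < lam" and M: "0 < M"
    and \<Phi>: "\<And>i. continuous_on \<Omega> (\<lambda>x. \<Phi> x $ i)" "\<And>i. (\<lambda>x. \<Phi> x $ i) \<in> sobolev_orlicz G \<Omega>"
      "\<And>x i. x \<in> \<Omega> \<Longrightarrow> 0 \<le> \<Phi> x $ i" "\<And>x i. x \<in> \<Omega> \<Longrightarrow> \<Phi> x $ i \<le> M"
    and min: "is_minimizer G lam \<Omega> \<Phi> u"
begin

definition rep :: "(real ^ 'n \<Rightarrow> real ^ 'm) \<Rightarrow> ('m \<Rightarrow> real ^ 'n \<Rightarrow> real) \<Rightarrow> ('m \<Rightarrow> real ^ 'n \<Rightarrow> real ^ 'n) \<Rightarrow> bool" where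
  "rep v a A' \<longleftrightarrow> (\<forall>j. wgrad \<Omega> (a j) (A' j) \<and> (AE x\<in>\<Omega> in lborel. v x $ j = a j x) \<and>
     mdl G (a j) < \<infinity> \<and> mdl G (A' j) < \<infinity>)"

lemma indicator_integrable:
  assumes "{x \<in> \<Omega>. R x} \<in> sets borel"
  shows "L1 (\<lambda>x. lam * indicator {x \<in> \<Omega>. R x} x)"
  using emeasure_subset_\<Omega>[OF assms] assms by auto

text \<open>The energy density in Borel representatives. Positivity of the norm is expressed by the
  components, so that the set can be split when all but one are frozen.\<close>

definition dens :: "('m \<Rightarrow> real ^ 'n \<Rightarrow> real) \<Rightarrow> ('m \<Rightarrow> real ^ 'n \<Rightarrow> real ^ 'n) \<Rightarrow> real ^ 'n \<Rightarrow> real" where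
  "dens a A' x = (\<Sum>j\<in>UNIV. G (norm (A' j x))) + lam * indicator {x \<in> \<Omega>. \<exists>j. a j x \<noteq> 0} x"

lemma J_rep:
  assumes r: "rep v a A'"
  shows "L1 (dens a A')"
    and "J_functional G lam \<Omega> v = ennreal (LBINT x. dens a A' x)"
proof -
  have w: "wgrad \<Omega> (a j) (A' j)" and e: "AE x\<in>\<Omega> in lborel. v x $ j = a j x" and f: "mdl G (a j) < \<infinity>" "mdl G (A' j) < \<infinity>" for j
    using r unfolding rep_def by auto
  note [measurable] = wgradD(6)[OF w]
  have m: "{x \<in> \<Omega>. \<exists>j. a j x \<noteq> 0} \<in> sets borel"
  proof -
    have "{x \<in> space borel. x \<in> \<Omega> \<and> (\<exists>j. a j x \<noteq> 0)} \<in> sets borel" by measurable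
    then show ?thesis by simp
  qed
  show i: "L1 (dens a A')"
    unfolding dens_def by (intro Bochner_Integration.integrable_add Bochner_Integration.integrable_sum integrable_G[OF wgradD(7)[OF w] f(2)] indicator_integrable[OF m])
  have nn: "0 \<le> dens a A' x" for x
    unfolding dens_def using lam by (intro add_nonneg_nonneg sum_nonneg young_nonneg[OF yG norm_ge_zero]) auto
  have "J_functional G lam \<Omega> v = (\<integral>\<^sup>+x. ennreal (dens a A' x) \<partial>lborel)"
    unfolding J_functional_def
  proof (rule lebesgue_on_nn_integral_rep[OF borel_\<Omega>])
    have "AE x in lborel. \<forall>j\<in>UNIV. x \<in> \<Omega> \<longrightarrow> weak_gradient \<Omega> (\<lambda>y. v y $ j) x = A' j x"
      by (rule AE_finite_allI) (auto intro: sobolev_orliczI(2)[OF w e f])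
    moreover have "AE x in lborel. \<forall>j\<in>UNIV. x \<in> \<Omega> \<longrightarrow> v x $ j = a j x"
      by (rule AE_finite_allI) (auto intro: e)
    ultimately show "AE x\<in>\<Omega> in lborel. ennreal ((\<Sum>j\<in>UNIV. G (norm (weak_gradient \<Omega> (\<lambda>y. v y $ j) x))) + lam * indicator {y. 0 < norm (v y)} x) =
      ennreal (dens a A' x)"
    proof eventually_elim
      case (elim x)
      show ?case
      proof
        assume x: "x \<in> \<Omega>"
        have "0 < norm (v x) \<longleftrightarrow> (\<exists>j. a j x \<noteq> 0)" using elim(2) x by (auto simp: vec_eq_iff)
        then show "ennreal ((\<Sum>j\<in>UNIV. G (norm (weak_gradient \<Omega> (\<lambda>y. v y $ j) x))) + lam * indicator {y. 0 < norm (v y)} x) =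
          ennreal (dens a A' x)"
          using elim(1) x by (simp add: dens_def indicator_def)
      qed
    qed
    show "ennreal (dens a A' x) = 0" if "x \<notin> \<Omega>" for x
      using that wgradD(4)[OF w] G0 by (simp add: dens_def)
  qed
  also have "\<dots> = ennreal (LBINT x. dens a A' x)"
    by (rule nn_integral_eq_integral[OF i]) (use nn in simp)
  finally show "J_functional G lam \<Omega> v = ennreal (LBINT x. dens a A' x)" .
qed

text \<open>Varying one component leaves the energy of the others unchanged, and where some other
  component is nonzero the penalty is already paid. Both are collected in the integrable function
  \<open>Rr\<close>, which cancels; the penalty remains only where all others vanish.\<close>

lemma component_scalar_min:
  fixes i :: 'm
  shows "\<exists>Q v V P. scalar_min G g \<delta> g\<^sub>0 C\<^sub>G \<Omega> Q v V (\<lambda>x. indicator \<Omega> x * \<Phi> x $ i) P lam M \<and>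
    (AE x\<in>\<Omega> in lborel. u x $ i = v x)"
proof -
  have adm: "\<forall>j. (\<lambda>x. u x $ j) \<in> sobolev_orlicz G \<Omega> \<and> (\<lambda>x. u x $ j - \<Phi> x $ j) \<in> sobolev_orlicz_0 G \<Omega> \<and>
     (AE x in lebesgue_on \<Omega>. 0 \<le> u x $ j)"
    and less: "\<forall>v\<in>admissible G \<Omega> \<Phi>. J_functional G lam \<Omega> u \<le> J_functional G lam \<Omega> v"
    using min by (auto simp: is_minimizer_def admissible_def)
  have "\<forall>j. \<exists>aA. wgrad \<Omega> (fst aA) (snd aA) \<and> (AE x\<in>\<Omega> in lborel. u x $ j = fst aA x) \<and>
     mdl G (fst aA) < \<infinity> \<and> mdl G (snd aA) < \<infinity> \<and> (\<forall>x. 0 \<le> fst aA x)"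
  proof
    fix j
    have s: "(\<lambda>x. u x $ j) \<in> sobolev_orlicz G \<Omega>" and nn: "AE x\<in>\<Omega> in lborel. 0 \<le> u x $ j"
      using adm AE_lebesgue_on_iff[OF borel_\<Omega>] by auto
    from sobolev_orlicz_rep[OF s] obtain a F where a: "wgrad \<Omega> a F" "AE x\<in>\<Omega> in lborel. u x $ j = a x"
      "mdl G a < \<infinity>" "mdl G F < \<infinity>" by (elim exE conjE) (rule that)
    note [measurable] = wgradD(6,7)[OF a(1)]
    \<comment> \<open>Almost-everywhere nonnegativity becomes nonnegativity at every point by taking
      the positive part, which changes the representative on a null set and so keeps its weak
      gradient.\<close>
    have e: "AE x in lborel. a x = max 0 (a x)"
      using a(2) nn by eventually_elim (use wgradD(3)[OF a(1)] in force)
    have w: "wgrad \<Omega> (\<lambda>x. max 0 (a x)) F"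
      by (rule wgrad_cong_AE[OF a(1) e]) (use wgradD(3,4)[OF a(1)] in auto)
    have "mdl G (\<lambda>x. max 0 (a x)) < \<infinity>"
      by (rule order_le_less_trans[OF mdl_mono[OF yG] a(3)]) auto
    moreover have "AE x\<in>\<Omega> in lborel. u x $ j = max 0 (a x)" using a(2) e by eventually_elim simp
    ultimately show "\<exists>aA. wgrad \<Omega> (fst aA) (snd aA) \<and> (AE x\<in>\<Omega> in lborel. u x $ j = fst aA x) \<and>
     mdl G (fst aA) < \<infinity> \<and> mdl G (snd aA) < \<infinity> \<and> (\<forall>x. 0 \<le> fst aA x)"
      using w a(4) by (intro exI[of _ "(\<lambda>x. max 0 (a x), F)"]) simp
  qed
  from choice[OF this] obtain aA where aA: "\<forall>j. wgrad \<Omega> (fst (aA j)) (snd (aA j)) \<and> (AE x\<in>\<Omega> in lborel. u x $ j = fst (aA j) x) \<and>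
     mdl G (fst (aA j)) < \<infinity> \<and> mdl G (snd (aA j)) < \<infinity> \<and> (\<forall>x. 0 \<le> fst (aA j) x)" ..
  define a where "a j = fst (aA j)" for j
  define F where "F j = snd (aA j)" for j
  have w: "wgrad \<Omega> (a j) (F j)" and e: "AE x\<in>\<Omega> in lborel. u x $ j = a j x" and f: "mdl G (a j) < \<infinity>" "mdl G (F j) < \<infinity>"
    and nn: "0 \<le> a j x" for j x using aA by (auto simp: a_def F_def)
  have ru: "rep u a F" unfolding rep_def using w e f by blast
  note [measurable] = wgradD(6,7)[OF w]
  define O' where "O' = {x \<in> \<Omega>. \<exists>j. j \<noteq> i \<and> a j x \<noteq> 0}"
  define Q where "Q x = lam * indicator {x \<in> \<Omega>. \<forall>j. j \<noteq> i \<longrightarrow> a j x = 0} x" for x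
  have mO: "O' \<in> sets borel"
  proof -
    have "{x \<in> space borel. x \<in> \<Omega> \<and> (\<exists>j. j \<noteq> i \<and> a j x \<noteq> 0)} \<in> sets borel" by measurable
    then show ?thesis by (simp add: O'_def)
  qed
  have mQ: "{x \<in> \<Omega>. \<forall>j. j \<noteq> i \<longrightarrow> a j x = 0} \<in> sets borel"
  proof -
    have "{x \<in> space borel. x \<in> \<Omega> \<and> (\<forall>j. j \<noteq> i \<longrightarrow> a j x = 0)} \<in> sets borel" by measurable
    then show ?thesis by simp
  qed
  define \<phi> where "\<phi> x = indicator \<Omega> x * \<Phi> x $ i" for x
  have m\<phi>: "\<phi> \<in> Borel"
    using borel_measurable_continuous_on_indicator[OF borel_\<Omega> \<Phi>(1), of i] by (simp add: \<phi>_def[abs_def])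
  from sobolev_orlicz_rep[OF \<Phi>(2)[of i]] obtain p P where p: "wgrad \<Omega> p P" "AE x\<in>\<Omega> in lborel. \<Phi> x $ i = p x"
      "mdl G p < \<infinity>" "mdl G P < \<infinity>" by (elim exE conjE) (rule that)
  have p\<phi>: "AE x in lborel. p x = \<phi> x" using p(2) by eventually_elim (use wgradD(3)[OF p(1)] in \<open>auto simp: \<phi>_def indicator_def\<close>)
  have w\<phi>: "wgrad \<Omega> \<phi> P"
    by (rule wgrad_cong_AE[OF p(1) p\<phi>]) (use wgradD(4,7)[OF p(1)] m\<phi> in simp_all, simp add: \<phi>_def)
  have "mdl G \<phi> = mdl G p" by (rule mdl_cong) (use p\<phi> in auto)
  then have f\<phi>: "mdl G \<phi> < \<infinity>" using p(3) by simp
  have wd: "wgrad \<Omega> (\<lambda>x. a i x - \<phi> x) (\<lambda>x. F i x - P x)" by (rule wgrad_diff[OF w w\<phi>])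
  have fd: "mdl G (\<lambda>x. a i x - \<phi> x) < \<infinity>" "mdl G (\<lambda>x. F i x - P x) < \<infinity>"
    using mdl_diff_finite[OF wgradD(6)[OF w] f(1) m\<phi> f\<phi>] mdl_diff_finite[OF wgradD(7)[OF w] f(2) wgradD(7)[OF p(1)] p(4)] by auto
  have ed: "AE x\<in>\<Omega> in lborel. u x $ i - \<Phi> x $ i = a i x - \<phi> x" using e[of i] by eventually_elim (simp add: \<phi>_def)
  have bc: "W0 G \<Omega> (\<lambda>x. a i x - \<phi> x) (\<lambda>x. F i x - P x)"
    by (rule iffD1[OF sobolev_orlicz_0_iff_W0[OF wd ed fd]]) (use adm in blast)
  have minimal: "(LBINT x. G (norm (F i x)) + Q x * indicator {x. 0 < a i x} x) \<le>
      (LBINT x. G (norm (F i x + \<Psi> x)) + Q x * indicator {x. 0 < a i x + \<psi> x} x)"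
    if w0: "W0 G \<Omega> \<psi> \<Psi>" and fin: "mdl G \<psi> < \<infinity>" "mdl G \<Psi> < \<infinity>" and n\<psi>: "\<And>x. 0 \<le> a i x + \<psi> x" for \<psi> \<Psi>
  proof -
    have w\<psi>: "wgrad \<Omega> \<psi> \<Psi>" using w0 by (simp add: W0_def)
    note [measurable] = wgradD(6,7)[OF w\<psi>]
    define v where "v x = (\<chi> j. if j = i then a i x + \<psi> x else u x $ j)" for x
    define a' where "a' j x = (if j = i then a i x + \<psi> x else a j x)" for j x
    define F' where "F' j x = (if j = i then F i x + \<Psi> x else F j x)" for j x
    have wi: "wgrad \<Omega> (\<lambda>x. a i x + \<psi> x) (\<lambda>x. F i x + \<Psi> x)" by (rule wgrad_add[OF w w\<psi>])
    have fi: "mdl G (\<lambda>x. a i x + \<psi> x) < \<infinity>" "mdl G (\<lambda>x. F i x + \<Psi> x) < \<infinity>"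
      using mdl_add_finite[OF yG wgradD(6)[OF w] f(1) wgradD(6)[OF w\<psi>] fin(1)]
        mdl_add_finite[OF yG wgradD(7)[OF w] f(2) wgradD(7)[OF w\<psi>] fin(2)] by auto
    have rv: "rep v a' F'" unfolding rep_def
    proof
      fix j
      show "wgrad \<Omega> (a' j) (F' j) \<and> (AE x\<in>\<Omega> in lborel. v x $ j = a' j x) \<and> mdl G (a' j) < \<infinity> \<and> mdl G (F' j) < \<infinity>"
      proof (cases "j = i")
        case True
        then show ?thesis using wi fi by (simp add: a'_def[abs_def] F'_def[abs_def] v_def)
      next
        case False
        then show ?thesis using w[of j] f[of j] e[of j] by (simp add: a'_def[abs_def] F'_def[abs_def] v_def)
      qed
    qed
    have "v \<in> admissible G \<Omega> \<Phi>" unfolding admissible_def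
    proof (rule CollectI, rule allI)
      fix j
      show "(\<lambda>x. v x $ j) \<in> sobolev_orlicz G \<Omega> \<and> (\<lambda>x. v x $ j - \<Phi> x $ j) \<in> sobolev_orlicz_0 G \<Omega> \<and> (AE x in lebesgue_on \<Omega>. 0 \<le> v x $ j)"
      proof (cases "j = i")
        case True
        have 1: "(\<lambda>x. a i x + \<psi> x) \<in> sobolev_orlicz G \<Omega>" by (rule sobolev_orliczI(1)[OF wi _ fi]) simp
        have 2: "W0 G \<Omega> (\<lambda>x. (a i x - \<phi> x) + 1 * \<psi> x) (\<lambda>x. (F i x - P x) + 1 *R \<Psi> x)" by (rule W0_add_scale[OF bc w0])
        have 3: "(\<lambda>x. a i x + \<psi> x - \<Phi> x $ i) \<in> sobolev_orlicz_0 G \<Omega>"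
        proof (rule iffD2[OF sobolev_orlicz_0_iff_W0 2])
          show "wgrad \<Omega> (\<lambda>x. (a i x - \<phi> x) + 1 * \<psi> x) (\<lambda>x. (F i x - P x) + 1 *R \<Psi> x)" using 2 unfolding W0_def by blast
          show "AE x\<in>\<Omega> in lborel. a i x + \<psi> x - \<Phi> x $ i = (a i x - \<phi> x) + 1 * \<psi> x" by (rule AE_I2) (simp add: \<phi>_def)
          show "mdl G (\<lambda>x. (a i x - \<phi> x) + 1 * \<psi> x) < \<infinity>"
            using mdl_add_finite[OF yG wgradD(6)[OF wd] fd(1) wgradD(6)[OF w\<psi>] fin(1)] by simp
          show "mdl G (\<lambda>x. (F i x - P x) + 1 *R \<Psi> x) < \<infinity>"
            using mdl_add_finite[OF yG wgradD(7)[OF wd] fd(2) wgradD(7)[OF w\<psi>] fin(2)] by simp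
        qed
        show ?thesis using True 1 3 n\<psi> by (simp add: v_def)
      next
        case False
        then show ?thesis using adm by (simp add: v_def)
      qed
    qed
    then have J: "J_functional G lam \<Omega> u \<le> J_functional G lam \<Omega> v" using less by blast
    define Rr where "Rr x = (\<Sum>j\<in>UNIV - {i}. G (norm (F j x))) + lam * indicator O' x" for x
    have iR: "L1 Rr" unfolding Rr_def
      using indicator_integrable[of "\<lambda>x. \<exists>j. j \<noteq> i \<and> a j x \<noteq> 0"] mO
      by (intro Bochner_Integration.integrable_add Bochner_Integration.integrable_sum integrable_G[OF wgradD(7)[OF w] f(2)]) (simp add: O'_def)
    have split: "dens b B x = Rr x + (G (norm (B i x)) + Q x * indicator {x. 0 < b i x} x)"
      if h: "\<And>j. j \<noteq> i \<Longrightarrow> b j = a j \<and> B j = F j" "\<And>x. 0 \<le> b i x" for b :: "'m \<Rightarrow> real ^ 'n \<Rightarrow> real" and B :: "'m \<Rightarrow> real ^ 'n \<Rightarrow> real ^ 'n" and x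
    proof -
      have "(\<Sum>j\<in>UNIV. G (norm (B j x))) = G (norm (B i x)) + (\<Sum>j\<in>UNIV - {i}. G (norm (B j x)))"
        by (rule sum.remove) auto
      also have "(\<Sum>j\<in>UNIV - {i}. G (norm (B j x))) = (\<Sum>j\<in>UNIV - {i}. G (norm (F j x)))"
        using h(1) by (intro sum.cong) auto
      finally have 1: "(\<Sum>j\<in>UNIV. G (norm (B j x))) = G (norm (B i x)) + (\<Sum>j\<in>UNIV - {i}. G (norm (F j x)))" .
      have "(\<exists>j. b j x \<noteq> 0) \<longleftrightarrow> (\<exists>j. j \<noteq> i \<and> a j x \<noteq> 0) \<or> 0 < b i x"
      proof -
        have "(\<exists>j. R j) \<longleftrightarrow> (\<exists>j. j \<noteq> i \<and> R j) \<or> R i" for R by metis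
        then have "(\<exists>j. b j x \<noteq> 0) \<longleftrightarrow> (\<exists>j. j \<noteq> i \<and> b j x \<noteq> 0) \<or> b i x \<noteq> 0" .
        also have "(\<exists>j. j \<noteq> i \<and> b j x \<noteq> 0) \<longleftrightarrow> (\<exists>j. j \<noteq> i \<and> a j x \<noteq> 0)" using h(1) by (simp cong: conj_cong)
        also have "b i x \<noteq> 0 \<longleftrightarrow> 0 < b i x" using h(2)[of x] by linarith
        finally show ?thesis .
      qed
      then have "lam * indicator {x \<in> \<Omega>. \<exists>j. b j x \<noteq> 0} x = lam * indicator O' x + Q x * indicator {x. 0 < b i x} x"
        by (auto simp: O'_def Q_def indicator_def)
      with 1 show ?thesis by (simp add: dens_def Rr_def)
    qed
    have su: "dens a F x = Rr x + (G (norm (F i x)) + Q x * indicator {x. 0 < a i x} x)" for x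
      by (rule split) (use nn in auto)
    have sv: "dens a' F' x = Rr x + (G (norm (F' i x)) + Q x * indicator {x. 0 < a' i x} x)" for x
      by (rule split) (use n\<psi> in \<open>auto simp: a'_def[abs_def] F'_def[abs_def]\<close>)
    have i1: "L1 (\<lambda>x. G (norm (F i x)) + Q x * indicator {x. 0 < a i x} x)"
      using Bochner_Integration.integrable_diff[OF J_rep(1)[OF ru] iR] unfolding su by simp
    have i2: "L1 (\<lambda>x. G (norm (F' i x)) + Q x * indicator {x. 0 < a' i x} x)"
      using Bochner_Integration.integrable_diff[OF J_rep(1)[OF rv] iR] unfolding sv by simp
    \<comment> \<open>Nonnegativity of the larger integral allows the comparison of extended values
      to be read as one of reals.\<close>
    have "0 \<le> (LBINT x. Rr x + (G (norm (F' i x)) + Q x * indicator {x. 0 < a' i x} x))"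
      using lam by (intro integral_nonneg_AE AE_I2 add_nonneg_nonneg) (auto simp: Rr_def Q_def intro!: add_nonneg_nonneg sum_nonneg young_nonneg[OF yG])
    then have "(LBINT x. Rr x + (G (norm (F i x)) + Q x * indicator {x. 0 < a i x} x)) \<le> (LBINT x. Rr x + (G (norm (F' i x)) + Q x * indicator {x. 0 < a' i x} x))"
      using J unfolding J_rep(2)[OF ru] J_rep(2)[OF rv] su sv by (simp add: ennreal_le_iff)
    then have "(LBINT x. G (norm (F i x)) + Q x * indicator {x. 0 < a i x} x) \<le> (LBINT x. G (norm (F' i x)) + Q x * indicator {x. 0 < a' i x} x)"
      unfolding Bochner_Integration.integral_add[OF iR i1] Bochner_Integration.integral_add[OF iR i2] by simp
    then show ?thesis by (simp add: a'_def F'_def)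
  qed
  have "scalar_min G g \<delta> g\<^sub>0 C\<^sub>G \<Omega> Q (a i) (F i) \<phi> P lam M"
  proof
    show "Q \<in> Borel" unfolding Q_def using mQ by measurable
    show "0 \<le> Q x" "Q x \<le> lam" for x using lam by (auto simp: Q_def indicator_def)
    show "0 \<le> \<phi> x" "\<phi> x \<le> M" if "x \<in> \<Omega>" for x using \<Phi>(3,4) that by (auto simp: \<phi>_def)
  qed (use w f nn bc p(4) M minimal in auto)
  then show ?thesis using e[of i] unfolding \<phi>_def[abs_def] by blast
qed

end

section \<open>Assembling the Lipschitz representatives of all components\<close>

theorem corollary1p1:
  fixes G :: "real \<Rightarrow> real" and \<delta> g\<^sub>0 \<alpha> lam :: real
    and \<Omega> :: "(real ^ 'n) set" and \<Phi> u :: "real ^ 'n \<Rightarrow> real ^ 'm"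
  assumes "CARD('n) \<ge> 2"
    and "lam > 0"
    and "0 < \<alpha>" and "\<alpha> \<le> 1"
    and "bounded \<Omega>" and "C1_holder_domain \<alpha> \<Omega>"
    and "1 < \<delta>" and "\<delta> \<le> g\<^sub>0" and "G \<in> N_class \<delta> g\<^sub>0"
    and "C1_holder \<alpha> \<Omega> \<Phi>"
    and "\<And>i. (\<lambda>x. \<Phi> x $ i) \<in> sobolev_orlicz G \<Omega>"
    and "\<And>x i. x \<in> \<Omega> \<Longrightarrow> 0 \<le> \<Phi> x $ i"
    and "is_minimizer G lam \<Omega> \<Phi> u"
  shows "\<exists>w. (AE x in lebesgue_on \<Omega>. u x = w x) \<and> locally_lipschitz_on \<Omega> w"
proof -
  obtain g where g: "nfun G g \<delta> g\<^sub>0" using N_class_nfun[OF assms(9,7)] ..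
  obtain C\<^sub>G where CG: "\<forall>t\<ge>0. t \<le> G t + C\<^sub>G" using nfun.superlinear[OF g] ..
  have o: "open \<Omega>" using assms(6) by (simp add: C1_holder_domain_def)
  have od: "orlicz_domain G \<Omega> C\<^sub>G"
    using nfun.young[OF g] CG o assms(5) nfun.G_pos[OF g] by unfold_locales auto
  obtain K where K: "\<forall>x\<in>\<Omega>. norm (\<Phi> x) \<le> K" and df: "\<forall>x\<in>\<Omega>. \<Phi> differentiable (at x)"
    using assms(10) unfolding C1_holder_def by blast
  \<comment> \<open>The added 1 makes the common bound for the boundary data strictly
    positive.\<close>
  define M where "M = \<bar>K\<bar> + 1"
  have \<Phi>M: "\<Phi> x $ i \<le> M" if "x \<in> \<Omega>" for x i
    using K that component_le_norm_cart[of "\<Phi> x" i] by (force simp: M_def)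
  have c\<Phi>: "continuous_on \<Omega> (\<lambda>x. \<Phi> x $ i)" for i
    using df by (intro continuous_on_component continuous_at_imp_continuous_on) (auto intro: differentiable_imp_continuous_within)
  have vm: "vector_min G g \<delta> g\<^sub>0 C\<^sub>G \<Omega> \<Phi> u lam M"
    using g od assms(2,11-13) \<Phi>M c\<Phi> by (intro vector_min.intro vector_min_axioms.intro) (auto simp: M_def)
  have comp: "\<exists>Lw. (fst Lw)-lipschitz_on \<Omega> (snd Lw) \<and> (AE x\<in>\<Omega> in lborel. u x $ i = snd Lw x)" for i
  proof -
    from vector_min.component_scalar_min[OF vm, of i] obtain Q v V P
      where s: "scalar_min G g \<delta> g\<^sub>0 C\<^sub>G \<Omega> Q v V (\<lambda>x. indicator \<Omega> x * \<Phi> x $ i) P lam M"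
        and e: "AE x\<in>\<Omega> in lborel. u x $ i = v x" by (elim exE conjE) (rule that)
    interpret scalar_min G g \<delta> g\<^sub>0 C\<^sub>G \<Omega> Q v V "\<lambda>x. indicator \<Omega> x * \<Phi> x $ i" P lam M by (rule s)
    from uniform_boundary_chart[OF assms(3,5,6,10), of i] obtain C r where C: "0 \<le> C" "0 < r"
      and ch: "\<forall>x0\<in>frontier \<Omega>. \<exists>\<nu> q b. boundary_expansion \<alpha> \<Omega> (\<lambda>x. \<Phi> x $ i) C r x0 \<nu> q b" by (elim exE conjE) (rule that)
    from boundary_estimate[OF assms(3,4) C] obtain L0 where L0: "0 \<le> L0"
      and be: "\<forall>x0 \<nu> q b. x0 \<in> frontier \<Omega> \<and> boundary_expansion \<alpha> \<Omega> (\<lambda>x. indicator \<Omega> x * \<Phi> x $ i) C r x0 \<nu> q b \<longrightarrow>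
        (AE x\<in>\<Omega> in lborel. \<bar>v x - b\<bar> \<le> L0 * norm (x - x0))" by (elim exE conjE) (rule that)
    have BE: "\<exists>b. AE x\<in>\<Omega> in lborel. \<bar>v x - b\<bar> \<le> L0 * norm (x - x0)" if x0: "x0 \<in> frontier \<Omega>" for x0
    proof -
      from bspec[OF ch x0] obtain \<nu> q b where "boundary_expansion \<alpha> \<Omega> (\<lambda>x. \<Phi> x $ i) C r x0 \<nu> q b" by (elim exE) (rule that)
      then have "boundary_expansion \<alpha> \<Omega> (\<lambda>x. indicator \<Omega> x * \<Phi> x $ i) C r x0 \<nu> q b" by (simp add: boundary_expansion_def)
      then show ?thesis using x0 by (intro exI[of _ b] be[rule_format, of x0 \<nu> q b]) simp
    qed
    have "\<exists>L w. L-lipschitz_on \<Omega> w \<and> (AE x\<in>\<Omega> in lborel. v x = w x)"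
      by (rule boundary_lipschitz_imp_lipschitz[OF _ L0]) (rule BE)
    then obtain L w where "L-lipschitz_on \<Omega> w" "AE x\<in>\<Omega> in lborel. v x = w x"
      by (elim exE conjE) (rule that)
    moreover from this(2) e have "AE x\<in>\<Omega> in lborel. u x $ i = w x" by eventually_elim simp
    ultimately show ?thesis by (intro exI[of _ "(L, w)"]) simp
  qed
  then obtain Lw where Lw: "\<And>i. (fst (Lw i))-lipschitz_on \<Omega> (snd (Lw i))" "\<And>i. AE x\<in>\<Omega> in lborel. u x $ i = snd (Lw i) x"
    using choice[of "\<lambda>i Lw. (fst Lw)-lipschitz_on \<Omega> (snd Lw) \<and> (AE x\<in>\<Omega> in lborel. u x $ i = snd Lw x)"] by auto
  define w where "w x = (\<chi> i. snd (Lw i) x)" for x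
  have "AE x in lborel. \<forall>i\<in>UNIV. x \<in> \<Omega> \<longrightarrow> u x $ i = snd (Lw i) x"
    by (rule AE_finite_allI) (auto intro: Lw(2))
  then have "AE x\<in>\<Omega> in lborel. u x = w x" by eventually_elim (simp add: w_def vec_eq_iff)
  then have "AE x in lebesgue_on \<Omega>. u x = w x" using o by (simp add: AE_lebesgue_on_iff)
  \<comment> \<open>The norm of a vector is at most the sum of the absolute values of its
    components, so the component constants add up. The bound holds on all of \<Omega>, hence on each
    compact subset.\<close>
  moreover have "(\<Sum>i\<in>UNIV. fst (Lw i))-lipschitz_on \<Omega> w"
  proof (rule lipschitz_onI)
    show "0 \<le> (\<Sum>i\<in>UNIV. fst (Lw i))" by (intro sum_nonneg lipschitz_on_nonneg[OF Lw(1)])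
    fix x y assume xy: "x \<in> \<Omega>" "y \<in> \<Omega>"
    have "dist (w x) (w y) \<le> (\<Sum>i\<in>UNIV. \<bar>(w x - w y) $ i\<bar>)" unfolding dist_norm by (rule norm_le_l1_cart)
    also have "\<dots> \<le> (\<Sum>i\<in>UNIV. fst (Lw i) * dist x y)"
      using lipschitz_onD[OF Lw(1) xy] by (intro sum_mono) (simp add: w_def dist_norm)
    finally show "dist (w x) (w y) \<le> (\<Sum>i\<in>UNIV. fst (Lw i)) * dist x y" by (simp add: sum_distrib_right)
  qed
  ultimately show ?thesis
    unfolding locally_lipschitz_on_def by (meson lipschitz_on_subset)
qed

end
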